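(* Assume $\tau_H=\tau_G<\tau_F\le\infty$ and that there exists $\epsilon>0$ with $\sup_{|\beta-\beta_0|\le\epsilon}\mathbb{E}\big[|Z|^2e^{2\beta'Z}\big]<\infty$. Fix $x\in(0,\tau_H)$ and $\tau^*\in(x,\tau_H)$. Let $m\ge2$ and assume that $\lambda_0$ is $m$ times continuously differentiable, with $\lambda_0'$ uniformly bounded from below by a strictly positive constant, that $t\mapsto\Phi(t;\beta_0)$ is continuous in a neighborhood of $x$, and that $k$ is an $m$-orthogonal kernel satisfying (i) $k$ has bounded support $[-1,1]$ and $\int_{-1}^1k(y)\,dy=1$; (ii) $k$ is twice differentiable with a bounded derivative. Let $\tilde\lambda_n^{GS}$ be the left derivative of the greatest convex minorant on $[0,\tau^*]$ of the smoothed Breslow estimator $\Lambda_n^s$, and suppose $n^{1/(2m+1)}b\to c>0$. Then, for all $0<\ell<M<\tau^*$, $$\sup_{y\in[\ell,M]}\big|\tilde\lambda_n^{GS}(y)-\lambda_0(y)\big|=O(b^m)+O_p(b^{-1}n^{-1/2}),$$ and $$n^{m/(2m+1)}\big(\tilde\lambda_n^{GS}(x)-\lambda_0(x)\big)\xrightarrow{d}N(\mu,\sigma^2),$$ where $$\mu=\frac{(-c)^m}{m!}\lambda_0^{(m)}(x)\int_{-1}^1k(y)y^m\,dy,\qquad\sigma^2=\frac{\lambda_0(x)}{c\,\Phi(x;\beta_0)}\int_{-1}^1k(y)^2\,dy.$$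
   Context: Cox model. $(T_i,\Delta_i,Z_i)$, $i=1,\dots,n$, are i.i.d. copies of $(T,\Delta,Z)$, which has distribution $\mathbb{P}$; $\mathbb{P}_n$ is the empirical measure. Here $T=\min(X,C)$, $\Delta=\mathbf{1}_{\{X\le C\}}$, $X\ge0$ is an event time, $C\ge0$ a censoring time, $Z\in\mathbb{R}^p$ a covariate vector. Given $Z$, $X$ and $C$ are independent; given $Z=z$, they have absolutely continuous distribution functions $F(x|z)$, $G(x|z)$ with densities, sharing no parameters. The conditional hazard rate of $X$ given $Z=z$ is $\lambda(x|z)=\lambda_0(x)e^{\beta_0'z}$, with $\beta_0\in\mathbb{R}^p$ and a nondecreasing baseline hazard $\lambda_0$. $F,G,H$ are the distribution functions of $X,C,T$ and $\tau_F,\tau_G,\tau_H$ the right end points of their supports. $\Phi(x;\beta)=\int\mathbf{1}_{\{t\ge x\}}e^{\beta'z}\,d\mathbb{P}(t,\delta,z)$ and $\Phi_n(x;\beta)=\int\mathbf{1}_{\{t\ge x\}}e^{\beta'z}\,d\mathbb{P}_n(t,\delta,z)$. $\hat\beta_n$ is the maximum partial likelihood estimator, i.e. the maximizer of $\prod_{i:\Delta_i=1}e^{\beta'Z_i}/\sum_{j=1}^n\mathbf{1}_{\{T_j\ge T_i\}}e^{\beta'Z_j}$. Smoothness conditions and the lower bound on $\lambda_0'$ are understood on $[0,\tau_H]$. Kernel. $k$ is $m$-orthogonal if $\int|k(u)||u|^m\,du<\infty$ and $\int k(u)u^j\,du=0$ for $j=1,\dots,m-1$. The bandwidth $b=b_n>0$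 satisfies $b\to0$, $nb\to\infty$, and $k_b(u)=b^{-1}k(u/b)$. Estimators. The Breslow estimator is $\Lambda_n(x)=\int\frac{\delta\mathbf{1}_{\{t\le x\}}}{\Phi_n(t;\hat\beta_n)}\,d\mathbb{P}_n(t,\delta,z)$ and the smoothed Breslow estimator is $\Lambda_n^s(x)=\int k_b(x-u)\Lambda_n(u)\,du$. $\tilde\lambda_n^{GS}$ is called the isotonized smoothed Breslow estimator. *)

theory Defs
  imports "HOL-Probability.Probability" "HOL-Library.Landau_Symbols"
begin

definition measure_support :: "real measure \<Rightarrow> real set" where
  "measure_support \<mu> = {x. \<forall>e>0. measure \<mu> (ball x e) > 0}"

definition right_endpoint :: "real measure \<Rightarrow> ereal" where
  "right_endpoint \<mu> = (SUP x\<in>measure_support \<mu>. ereal x)"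

(* f z and g z are the conditional densities of the event time X and of the censoring time C
   given Z = z. The assumption joint_law says both that these are the conditional laws and that
   X and C are conditionally independent given Z. As densities are only determined up to null
   sets, so is the identity  f(x|z) / (1 - F(x|z)) = lam0(x) exp(beta0'z)  for the conditional
   hazard. The baseline hazard is required to be nondecreasing only to the left of the right
   endpoint of X: when that endpoint is finite, lam0 has to be unbounded there. *)
locale cox_model = prob_space N for N :: "'a measure" +
  fixes X C :: "'a \<Rightarrow> real"
    and Z :: "'a \<Rightarrow> real ^ 'p"
    and f g :: "real ^ 'p \<Rightarrow> real \<Rightarrow> real"
    and lam0 :: "real \<Rightarrow> real"
    and beta0 :: "real ^ 'p"
  assumes X_rv: "X \<in> borel_measurable N"
    and C_rv: "C \<in> borel_measurable N"
    and Z_rv: "Z \<in> borel_measurable N"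
    and X_nonneg: "AE w in N. 0 \<le> X w"
    and C_nonneg: "AE w in N. 0 \<le> C w"
    and f_measurable: "case_prod f \<in> borel_measurable borel"
    and g_measurable: "case_prod g \<in> borel_measurable borel"
    and f_nonneg: "\<And>z x. 0 \<le> f z x"
    and g_nonneg: "\<And>z x. 0 \<le> g z x"
    and f_density: "\<And>z. (\<integral>\<^sup>+ x. ennreal (f z x) \<partial>lborel) = 1"
    and g_density: "\<And>z. (\<integral>\<^sup>+ x. ennreal (g z x) \<partial>lborel) = 1"
    and joint_law: "\<And>A B D. A \<in> sets borel \<Longrightarrow> B \<in> sets borel \<Longrightarrow> D \<in> sets borel \<Longrightarrow>
      prob {w \<in> space N. X w \<in> A \<and> C w \<in> B \<and> Z w \<in> D} =
      (\<integral>z\<in>D. measure (density lborel (f z)) A * measure (density lborel (g z)) B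
         \<partial>distr N borel Z)"
    and hazard: "AE z in distr N borel Z. AE x in lborel.
      0 \<le> x \<and> cdf (density lborel (f z)) x < 1 \<longrightarrow>
      f z x / (1 - cdf (density lborel (f z)) x) = lam0 x * exp (beta0 \<bullet> z)"
    and lam0_mono: "mono_on {x. 0 \<le> x \<and> ereal x < right_endpoint (distr N borel X)} lam0"

type_synonym 'p obs = "real \<times> real \<times> (real ^ 'p)"

(* The law of the observation (T, Delta, Z). *)
definition obs_law ::
    "'a measure \<Rightarrow> ('a \<Rightarrow> real) \<Rightarrow> ('a \<Rightarrow> real) \<Rightarrow> ('a \<Rightarrow> real ^ 'p) \<Rightarrow> ('p::finite) obs measure" where
  "obs_law N X C Z =
     distr N borel (\<lambda>w. (min (X w) (C w), of_bool (X w \<le> C w), Z w))"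

(* Sample points are numbered from 0, so that the sample of size n is y 0, ..., y (n - 1). *)
definition empirical :: "nat \<Rightarrow> (nat \<Rightarrow> ('p::finite) obs) \<Rightarrow> ('p::finite) obs measure" where
  "empirical n y = distr (uniform_count_measure {..<n}) borel y"

(* Phi(x; beta) for P the law of the observations, Phi_n(x; beta) for P the empirical measure. *)
definition Phi :: "('p::finite) obs measure \<Rightarrow> real \<Rightarrow> real ^ 'p \<Rightarrow> real" where
  "Phi P x \<beta> = (\<integral>(t, \<delta>, z). of_bool (t \<ge> x) * exp (\<beta> \<bullet> z) \<partial>P)"

definition partial_lik :: "nat \<Rightarrow> (nat \<Rightarrow> ('p::finite) obs) \<Rightarrow> real ^ 'p \<Rightarrow> real" where
  "partial_lik n y \<beta> =
     (let T = (\<lambda>i. fst (y i)); \<Delta> = (\<lambda>i. fst (snd (y i))); Z = (\<lambda>i. snd (snd (y i)))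
      in \<Prod>i\<in>{i. i < n \<and> \<Delta> i = 1}.
           exp (\<beta> \<bullet> Z i) / (\<Sum>j<n. of_bool (T j \<ge> T i) * exp (\<beta> \<bullet> Z j)))"

(* "The" maximizer, i.e. uniqueness is included. For a fixed n the partial likelihood has no
   unique maximizer with positive probability (for n = 1 it is constantly 1), so this should be
   asked for on events of probability tending to one only. *)
definition is_mple :: "nat \<Rightarrow> (nat \<Rightarrow> ('p::finite) obs) \<Rightarrow> real ^ 'p \<Rightarrow> bool" where
  "is_mple n y \<beta> \<longleftrightarrow> (\<forall>\<beta>'. \<beta>' \<noteq> \<beta> \<longrightarrow> partial_lik n y \<beta>' < partial_lik n y \<beta>)"

definition breslow :: "('p::finite) obs measure \<Rightarrow> real ^ 'p \<Rightarrow> real \<Rightarrow> real" where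
  "breslow Pn \<beta> x = (\<integral>(t, \<delta>, z). \<delta> * of_bool (t \<le> x) / Phi Pn t \<beta> \<partial>Pn)"

definition kernel_smooth :: "(real \<Rightarrow> real) \<Rightarrow> real \<Rightarrow> (real \<Rightarrow> real) \<Rightarrow> real \<Rightarrow> real" where
  "kernel_smooth k b L x = (\<integral>u. k ((x - u) / b) / b * L u \<partial>lborel)"

(* Greatest convex minorant of h on [0,tau]: the pointwise supremum of all convex minorants. *)
definition gcm :: "real \<Rightarrow> (real \<Rightarrow> real) \<Rightarrow> real \<Rightarrow> real" where
  "gcm \<tau> h x = (SUP c \<in> {c. convex_on {0..\<tau>} c \<and> (\<forall>u\<in>{0..\<tau>}. c u \<le> h u)}. c x)"

definition left_deriv :: "(real \<Rightarrow> real) \<Rightarrow> real \<Rightarrow> real" where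
  "left_deriv h x = (THE D. (h has_real_derivative D) (at_left x))"

definition iso_smoothed_breslow ::
    "(real \<Rightarrow> real) \<Rightarrow> real \<Rightarrow> real \<Rightarrow> ('p::finite) obs measure \<Rightarrow> real ^ 'p \<Rightarrow> real \<Rightarrow> real" where
  "iso_smoothed_breslow k b \<tau> Pn \<beta> = left_deriv (gcm \<tau> (kernel_smooth k b (breslow Pn \<beta>)))"

definition orthogonal_kernel :: "nat \<Rightarrow> (real \<Rightarrow> real) \<Rightarrow> bool" where
  "orthogonal_kernel m k \<longleftrightarrow>
     integrable lborel (\<lambda>u. \<bar>k u\<bar> * \<bar>u\<bar> ^ m) \<and>
     (\<forall>j\<in>{1..<m}. has_bochner_integral lborel (\<lambda>u. k u * u ^ j) 0)"

(* m times continuously differentiable on S; one-sided derivatives at endpoints of S. *)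
definition cont_diff_on :: "nat \<Rightarrow> real set \<Rightarrow> (real \<Rightarrow> real) \<Rightarrow> bool" where
  "cont_diff_on m S h \<longleftrightarrow>
     (\<exists>D. D 0 = h \<and>
       (\<forall>j<m. \<forall>t\<in>S. (D j has_real_derivative D (Suc j) t) (at t within S)) \<and>
       continuous_on S (D m))"

(* The event is only required to contain a measurable event of probability tending to one. *)
definition with_prob_to_one :: "'w measure \<Rightarrow> (nat \<Rightarrow> 'w \<Rightarrow> bool) \<Rightarrow> bool" where
  "with_prob_to_one M Q \<longleftrightarrow>
     (\<exists>A. (\<forall>n. A n \<in> sets M \<and> (\<forall>w\<in>A n. Q n w)) \<and> (\<lambda>n. measure M (A n)) \<longlonglongrightarrow> 1)"

(* R n = O_p(a n). Measurability is part of the definition since measure gives the junk value 0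
   to non-measurable sets. *)
definition big_Op :: "'w measure \<Rightarrow> (nat \<Rightarrow> 'w \<Rightarrow> real) \<Rightarrow> (nat \<Rightarrow> real) \<Rightarrow> bool" where
  "big_Op M R a \<longleftrightarrow>
     (\<forall>n. R n \<in> borel_measurable M) \<and>
     (\<forall>\<epsilon>>0. \<exists>K. \<forall>\<^sub>F n in sequentially.
        measure M {w \<in> space M. \<bar>R n w\<bar> > K * \<bar>a n\<bar>} < \<epsilon>)"

definition conv_in_distribution ::
    "'w measure \<Rightarrow> (nat \<Rightarrow> 'w \<Rightarrow> real) \<Rightarrow> real measure \<Rightarrow> bool" where
  "conv_in_distribution M V L \<longleftrightarrow>
     (\<forall>n. V n \<in> borel_measurable M) \<and> weak_conv_m (\<lambda>n. distr M borel (V n)) L"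

end

(* Elementary route: the kernel-smoothed Breslow estimator is differentiable, with derivative a
kernel sum. Compensating the events shows that the partial score has mean zero and variance O(n), so
strict concavity of the partial likelihood gives the root-n rate of the estimator beta_n. It then
suffices to replace the empirical risk process by its mean: the derivative of the smoothed
estimator is lam0 plus a bias of order b^m plus a centred sum of size O_p(1 / (b sqrt n)), uniformly
and, on a window of size n^(-1/4) around x, up to increments of smaller order than n^(-m/(2m+1)).
As lam0 increases with slope at least a > 0, the derivative is increasing up to these errors, so the
slope of the greatest convex minorant differs from it by no more than a multiple of them. *)
theory Submission
  imports Defs
begin

text \<open>Three obstacles shape the argument. The minorant at \<open>x\<close> depends on all of
  \<open>{0..taustar}\<close>, yet near 0 the kernel window leaves the half-line and the derivative
  is out of control; there only a crude bound on the smoothed estimator itself is available, and the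
  convexity gained further right has to outweigh it. No information matrix is assumed to be regular:
  that a unique maximizer exists with probability tending to one already prevents the covariate from
  lying almost surely in a hyperplane, and compactness makes this quantitative. Uniform laws for the
  risk process are avoided: compensating a sum over events turns random event times into fixed ones,
  where a variance suffices, and keeps the length of the time window as a factor, which locally
  cancels the 1/b of the kernel. The window n^(-1/4) balances two ratios, the uniform error 1/(b
  sqrt n) against the window, and the increment of the centred sum over the window against
  n^(-m/(2m+1)); both are of order (n b^4)^(-1/4), which vanishes because \<open>m\<close> is at
  least 2.\<close>

abbreviation large :: "(nat => bool) => bool" (binder "LARGE " 10)
 where "large P \<equiv> eventually P sequentially"

section \<open>Left derivatives of greatest convex minorants\<close>

lemma continuous_on_interval_bounded:
 fixes h :: "real => real"
 assumes "continuous_on {a..b} h"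
 shows "\<exists>B. \<forall>u\<in>{a..b}. \<bar>h u\<bar> <= B"
proof -
 have "bounded (h ` {a..b})"
  by (intro compact_imp_bounded compact_continuous_image assms) auto
 then show ?thesis by (auto simp: bounded_iff)
qed

text \<open>Over the reals \<open>SUP\<close> carries information only for a nonempty set that is
  bounded above. The constant \<open>B\<close> is a convex minorant and provides nonemptiness;
  boundedness, needed for the opposite inequality, comes from \<open>h v\<close> itself.\<close>

lemma gcm_upper:
 assumes "\<forall>u\<in>{0..\<tau>}. B <= h u" "v \<in> {0..\<tau>}"
 shows "gcm \<tau> h v <= h v"
 unfolding gcm_def
proof (rule cSUP_least)
 show "{c. convex_on {0..\<tau>} c \<and> (\<forall>u\<in>{0..\<tau>}. c u <= h u)} \<noteq> {}"
  using assms(1) by (auto intro!: exI[of _ "%_. B"] simp: convex_on_def simp flip: distrib_right)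
qed (use assms in auto)

lemma gcm_lower:
 assumes "convex_on {0..\<tau>} c" "\<forall>u\<in>{0..\<tau>}. c u <= h u" "v \<in> {0..\<tau>}"
 shows "c v <= gcm \<tau> h v"
 unfolding gcm_def
 by (rule cSUP_upper) (use assms in \<open>auto intro!: bdd_aboveI[of _ "h v"]\<close>)

lemma gcm_convex:
 assumes "\<forall>u\<in>{0..\<tau>}. B <= h u"
 shows "convex_on {0..\<tau>} (gcm \<tau> h)"
proof (rule convex_onI)
 fix t u v :: real assume t: "0 < t" "t < 1" and uv: "u \<in> {0..\<tau>}" "v \<in> {0..\<tau>}"
 have "gcm \<tau> h ((1 - t) *\<^sub>R u + t *\<^sub>R v) =
   (SUP c \<in> {c. convex_on {0..\<tau>} c \<and> (\<forall>u\<in>{0..\<tau>}. c u <= h u)}. c ((1 - t) *\<^sub>R u + t *\<^sub>R v))"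
  by (simp add: gcm_def)
 also have "... <= (1 - t) * gcm \<tau> h u + t * gcm \<tau> h v"
 proof (rule cSUP_least)
  show "{c. convex_on {0..\<tau>} c \<and> (\<forall>u\<in>{0..\<tau>}. c u <= h u)} \<noteq> {}"
   using assms by (auto intro!: exI[of _ "%_. B"] simp: convex_on_def simp flip: distrib_right)
  fix c assume c: "c \<in> {c. convex_on {0..\<tau>} c \<and> (\<forall>u\<in>{0..\<tau>}. c u <= h u)}"
  then have "c ((1 - t) *\<^sub>R u + t *\<^sub>R v) <= (1 - t) * c u + t * c v"
   using t uv by (intro convex_onD) auto
  also have "... <= (1 - t) * gcm \<tau> h u + t * gcm \<tau> h v"
   using c t uv by (intro add_mono mult_left_mono gcm_lower) auto
  finally show "c ((1 - t) *\<^sub>R u + t *\<^sub>R v) <= (1 - t) * gcm \<tau> h u + t * gcm \<tau> h v" .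
 qed
 finally show "gcm \<tau> h ((1 - t) *\<^sub>R u + t *\<^sub>R v) <= (1 - t) * gcm \<tau> h u + t * gcm \<tau> h v" .
qed simp

text \<open>Writing \<open>y\<close> as the convex combination of \<open>s\<close> and
  \<open>t\<close> with weight \<open>p\<close> turns convexity into the two comparisons with the
  chord over the whole interval; the first claim then follows by transitivity.\<close>

lemma convex_on_slopes:
 fixes G :: "real => real"
 assumes "convex_on S G" "s \<in> S" "t \<in> S" "s < y" "y < t"
 shows "(G y - G s) / (y - s) <= (G t - G y) / (t - y)" (is ?A)
  and "(G y - G s) / (y - s) <= (G t - G s) / (t - s)" (is ?B)
  and "(G t - G s) / (t - s) <= (G t - G y) / (t - y)" (is ?C)
proof -
 define p where "p = (y - s) / (t - s)"
 have p: "0 < p" "p < 1" using assms by (auto simp: p_def field_simps)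
 have y: "y - s = p * (t - s)" "t - y = (1 - p) * (t - s)"
  using assms by (auto simp: p_def field_simps)
 have "G ((1 - p) *\<^sub>R s + p *\<^sub>R t) <= (1 - p) * G s + p * G t"
  using assms p by (intro convex_onD) auto
 moreover have "(1 - p) *\<^sub>R s + p *\<^sub>R t = y" using y by (simp add: algebra_simps)
 ultimately have le: "G y <= (1 - p) * G s + p * G t" by simp
 have ts: "t - s > 0" using assms by simp
 have B: "(G y - G s) / (y - s) <= (G t - G s) / (t - s)"
 proof -
  have "(G y - G s) / (y - s) <= (p * (G t - G s)) / (y - s)"
   using le assms by (intro divide_right_mono) (auto simp: algebra_simps)
  then show ?thesis using p ts by (simp add: y)
 qed
 have C: "(G t - G s) / (t - s) <= (G t - G y) / (t - y)"
 proof -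
  have "((1-p) * (G t - G s)) / (t - y) <= (G t - G y) / (t - y)"
   using le assms by (intro divide_right_mono) (auto simp: algebra_simps)
  then show ?thesis using p ts by (simp add: y)
 qed
 show ?A ?B ?C using B C by auto
qed

text \<open>The left difference quotients increase towards \<open>y\<close> and are bounded by every
  right quotient, so their supremum \<open>D\<close> is also their limit.\<close>

lemma convex_left_derivative:
 fixes G :: "real => real"
 assumes G: "convex_on {\<alpha>..\<tau>} G" and y: "\<alpha> < y" "y < \<tau>"
 shows "(G has_real_derivative left_deriv G y) (at_left y)"
  and "\<And>s. \<alpha> <= s ==> s < y ==> (G y - G s) / (y - s) <= left_deriv G y"
  and "\<And>t. y < t ==> t <= \<tau> ==> left_deriv G y <= (G t - G y) / (t - y)"
proof -
 define q where "q = (%s. (G y - G s) / (y - s))"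
 define D where "D = (SUP s\<in>{\<alpha>..<y}. q s)"
 have ub: "q s <= (G t - G y) / (t - y)" if "\<alpha> <= s" "s < y" "y < t" "t <= \<tau>" for s t
  unfolding q_def using that by (intro convex_on_slopes[OF G]) auto
 have bdd: "bdd_above (q ` {\<alpha>..<y})"
  using ub[of _ \<tau>] y by (intro bdd_aboveI[of _ "(G \<tau> - G y) / (\<tau> - y)"]) auto
 have mono: "q s <= q s'" if "\<alpha> <= s" "s < s'" "s' < y" for s s'
  unfolding q_def using convex_on_slopes(3)[OF G, of s y s'] that y by auto
 have lo: "q s <= D" if "\<alpha> <= s" "s < y" for s
  unfolding D_def using that bdd by (intro cSUP_upper) auto
 have hi: "D <= (G t - G y) / (t - y)" if "y < t" "t <= \<tau>" for t
  unfolding D_def using that y ub by (intro cSUP_least) auto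
 have "(q \<longlongrightarrow> D) (at_left y)"
 proof (rule order_tendstoI)
  fix a assume "a < D"
  then obtain s where s: "s \<in> {\<alpha>..<y}" "a < q s"
   unfolding D_def using less_cSUP_iff[OF _ bdd] y by auto
  show "\<forall>\<^sub>F x in at_left y. a < q x"
   unfolding eventually_at_left_field
   using s mono[of s] by (intro exI[of _ s]) fastforce
 next
  fix a assume "D < a"
  then show "\<forall>\<^sub>F x in at_left y. q x < a"
   unfolding eventually_at_left_field using y
   by (intro exI[of _ \<alpha>]) (auto intro: le_less_trans[OF lo])
 qed
 moreover have "q = (%s. (G s - G y) / (s - y))"
 proof
  show "q s = (G s - G y) / (s - y)" for s
   using minus_divide_divide[of "G y - G s" "y - s"] by (simp add: q_def)
 qed
 ultimately have der: "(G has_real_derivative D) (at_left y)"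
  unfolding has_field_derivative_iff by simp
 \<comment> \<open>\<open>left_deriv\<close> is a definite description, hence uniqueness of limits
   along the nontrivial filter \<open>at_left y\<close> is required.\<close>
 have "left_deriv G y = D" unfolding left_deriv_def
 proof (rule the_equality)
  show "E = D" if "(G has_real_derivative E) (at_left y)" for E
   using that der tendsto_unique[OF trivial_limit_at_left_real]
   unfolding has_field_derivative_iff by blast
 qed (rule der)
 then show "(G has_real_derivative left_deriv G y) (at_left y)"
  and "\<And>s. \<alpha> <= s ==> s < y ==> (G y - G s) / (y - s) <= left_deriv G y"
  and "\<And>t. y < t ==> t <= \<tau> ==> left_deriv G y <= (G t - G y) / (t - y)"
  using der lo hi by (auto simp: q_def)
qed

lemma convex_supporting_line:
 fixes G :: "real => real"
 assumes G: "convex_on {\<alpha>..\<tau>} G" and y: "\<alpha> < y" "y < \<tau>" and u: "u \<in> {\<alpha>..\<tau>}"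
 shows "G y + left_deriv G y * (u - y) <= G u"
proof (cases u y rule: linorder_cases)
 case less
 with convex_left_derivative(2)[OF G y, of u] u show ?thesis by (auto simp: field_simps)
next
 case greater
 with convex_left_derivative(3)[OF G y, of u] u show ?thesis by (auto simp: field_simps)
qed simp

lemma left_deriv_mono:
 fixes G :: "real => real"
 assumes G: "convex_on {\<alpha>..\<tau>} G" and y: "\<alpha> < y" "y <= z" "z < \<tau>"
 shows "left_deriv G y <= left_deriv G z"
proof (cases "y = z")
 case False
 then have "left_deriv G y <= (G z - G y) / (z - y)" 
  using convex_left_derivative(3)[OF G, of y z] y by auto
 also have "... <= left_deriv G z"
  using convex_left_derivative(2)[OF G, of z y] y False by auto
 finally show ?thesis .
qed auto

text \<open>The left derivative at a point dominates the chord slope from any fixed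
  \<open>s\<close>, and that slope is continuous in the point; choosing \<open>s\<close> with slope
  above \<open>a\<close> at \<open>y\<close> keeps the derivative above \<open>a\<close> just left
  of \<open>y\<close>. The upper half is monotonicity.\<close>

lemma left_deriv_left_continuous:
 fixes G :: "real => real"
 assumes G: "convex_on {\<alpha>..\<tau>} G" and y: "\<alpha> < y" "y < \<tau>"
 shows "(left_deriv G \<longlongrightarrow> left_deriv G y) (at_left y)"
proof (rule order_tendstoI)
 fix a assume "left_deriv G y < a"
 then show "\<forall>\<^sub>F x in at_left y. left_deriv G x < a"
  unfolding eventually_at_left_field using left_deriv_mono[OF G, of _ y] y
  by (intro exI[of _ \<alpha>]) fastforce
next
 fix a assume a: "a < left_deriv G y"
 have lim: "((%s. (G s - G y) / (s - y)) \<longlongrightarrow> left_deriv G y) (at_left y)"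
  using convex_left_derivative(1)[OF G y] unfolding has_field_derivative_iff .
 have "\<forall>\<^sub>F s in at_left y. a < (G s - G y) / (s - y) \<and> \<alpha> < s \<and> s < y"
  using order_tendstoD(1)[OF lim a] eventually_at_left_field y by (auto simp: eventually_conj_iff)
 then obtain s where s: "a < (G s - G y) / (s - y)" "\<alpha> < s" "s < y"
  using eventually_happens[of _ "at_left y"] trivial_limit_at_left_real by blast
 have cont: "(G \<longlongrightarrow> G y) (at_left y)"
  using DERIV_continuous[OF convex_left_derivative(1)[OF G y]] unfolding continuous_within by simp
 have "((%x. (G x - G s) / (x - s)) \<longlongrightarrow> (G y - G s) / (y - s)) (at_left y)"
  using s by (intro tendsto_intros cont) auto
 moreover have "a < (G y - G s) / (y - s)"
  using s(1) by (metis minus_diff_eq minus_divide_divide)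
 ultimately have "\<forall>\<^sub>F x in at_left y. a < (G x - G s) / (x - s) \<and> s < x"
  using order_tendstoD(1) s eventually_at_left_field[of "%x. s < x" y] by (auto simp: eventually_conj_iff)
 moreover have "\<forall>\<^sub>F x in at_left y. x < y" by (simp add: eventually_at_filter)
 ultimately show "\<forall>\<^sub>F x in at_left y. a < left_deriv G x"
 proof eventually_elim
  case (elim x)
  then show ?case using convex_left_derivative(2)[OF G, of x s] s y by auto
 qed
qed

text \<open>If the line through \<open>(y, h y)\<close> with slope \<open>p\<close>, lowered by \<open>e\<close>, stays below \<open>h\<close>, then
  comparing increments of the minorant over steps of length \<open>\<rho>\<close> pins its derivative down to
  \<open>e / \<rho>\<close> plus the variation of \<open>h\<close> over the step.\<close>

lemma gcm_left_deriv_near: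
 assumes "\<forall>u\<in>{0..\<tau>}. B <= h u"
  and y: "0 <= y - \<rho>" "y + \<rho> <= \<tau>" and \<rho>: "\<rho> > 0" and e: "e >= 0"
  and below: "\<And>v. v \<in> {0..\<tau>} ==> h y + p * (v - y) - e <= h v"
  and up: "h (y + \<rho>) - h y <= (p + \<theta>) * \<rho>"
  and lo: "h y - h (y - \<rho>) >= (p - \<theta>) * \<rho>"
 shows "\<bar>left_deriv (gcm \<tau> h) y - p\<bar> <= \<theta> + e / \<rho>"
proof -
 let ?c = "%v. h y + p * (v - y) - e"
 note G = gcm_convex[OF assms(1)]
 have conv: "convex_on {0..\<tau>} ?c"
 proof (rule convex_onI)
  fix t u v :: real
  have "h y + p * ((1 - t) *\<^sub>R u + t *\<^sub>R v - y) - e = (1 - t) * (h y + p * (u - y) - e) + t * (h y + p * (v - y) - e)"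
   by (simp add: algebra_simps)
  then show "h y + p * ((1 - t) *\<^sub>R u + t *\<^sub>R v - y) - e <= (1 - t) * (h y + p * (u - y) - e) + t * (h y + p * (v - y) - e)"
   by simp
 qed simp
 have y': "0 < y" "y < \<tau>" using y \<rho> by auto
 have Gy: "h y - e <= gcm \<tau> h y" using gcm_lower[OF conv, of h y] below y' by auto
 have "left_deriv (gcm \<tau> h) y <= (gcm \<tau> h (y+\<rho>) - gcm \<tau> h y) / \<rho>"
  using convex_left_derivative(3)[OF G y', of "y + \<rho>"] \<rho> y by simp
 also have "... <= (h (y + \<rho>) - (h y - e)) / \<rho>"
  using gcm_upper[OF assms(1), of "y+\<rho>"] y \<rho> Gy by (intro divide_right_mono) auto
 also have "... <= ((p + \<theta>) * \<rho> + e) / \<rho>"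
  using up \<rho> by (intro divide_right_mono) auto
 also have "... = p + \<theta> + e / \<rho>" using \<rho> by (simp add: field_simps)
 finally have 1: "left_deriv (gcm \<tau> h) y <= p + \<theta> + e / \<rho>" .
 have "p - \<theta> - e / \<rho> = ((p - \<theta>) * \<rho> - e) / \<rho>" using \<rho> by (simp add: field_simps)
 also have "... <= ((h y - e) - h (y - \<rho>)) / \<rho>"
  using lo \<rho> by (intro divide_right_mono) auto
 also have "... <= (gcm \<tau> h y - gcm \<tau> h (y-\<rho>)) / \<rho>"
  using gcm_upper[OF assms(1), of "y-\<rho>"] y \<rho> Gy by (intro divide_right_mono) auto
 also have "... <= left_deriv (gcm \<tau> h) y"
  using convex_left_derivative(2)[OF G y', of "y - \<rho>"] \<rho> y by simp
 finally show ?thesis using 1 by (simp add: abs_le_iff)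
qed

text \<open>Integrating \<open>h' v - p \<ge> \<alpha> (v - y) - \<omega>\<close> loses at most \<open>\<omega>\<^sup>2 / (2 \<alpha>)\<close>; a step of
  length \<open>\<omega>\<close> then gives an error of order \<open>\<omega>\<close>.\<close>

lemma gcm_left_deriv_approx:
 assumes bdd: "\<forall>u\<in>{0..\<tau>}. B <= h u"
  and y: "0 <= y - \<delta>" "y + \<omega> <= \<tau>" and \<omega>: "0 < \<omega>" "\<omega> <= \<delta>" and \<alpha>: "\<alpha> > 0"
  and deriv: "\<And>v. v \<in> {y-\<delta>..\<tau>} ==> (h has_real_derivative h' v) (at v)"
  and right: "\<And>v. y <= v ==> v <= \<tau> ==> \<alpha> * (v - y) - \<omega> <= h' v - p"
  and left: "\<And>v. y - \<delta> <= v ==> v <= y ==> \<alpha> * (y - v) - \<omega> <= p - h' v"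
  and near: "\<And>v. \<bar>v - y\<bar> <= \<omega> ==> \<bar>h' v - p\<bar> <= L * \<omega>"
  and far: "\<And>v. 0 <= v ==> v <= y - \<delta> ==> h y + p * (v - y) <= h v"
 shows "\<bar>left_deriv (gcm \<tau> h) y - p\<bar> <= (L + 1 / (2 * \<alpha>)) * \<omega>"
proof -
 define e where "e = \<omega>\<^sup>2 / (2 * \<alpha>)"
 \<comment> \<open>Completing the square: \<open>e\<close> is the largest amount by which the
   parabola on the left falls below 0.\<close>
 have quad: "\<alpha> / 2 * r\<^sup>2 - \<omega> * r >= - e" for r
 proof -
  have "0 <= (\<alpha> * r - \<omega>)\<^sup>2 / (2 * \<alpha>)" using \<alpha> by simp
  also have "... = \<alpha> / 2 * r\<^sup>2 - \<omega> * r + e"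
   using \<alpha> by (simp add: e_def power2_eq_square field_simps)
  finally show ?thesis by simp
 qed
 have R: "h v - h y >= p * (v - y) - e" if v: "y <= v" "v <= \<tau>" for v
 proof -
  \<comment> \<open>Subtracting the integrated lower bound for the derivative leaves a function
    whose derivative is nonnegative by \<open>right\<close>.\<close>
  have "h y - p * y - (\<alpha> / 2 * (y - y)\<^sup>2 - \<omega> * (y - y)) <= h v - p * v - (\<alpha> / 2 * (v - y)\<^sup>2 - \<omega> * (v - y))"
  proof (rule DERIV_nonneg_imp_nondecreasing[OF v(1)])
   fix u assume u: "y <= u" "u <= v"
   have "((%v. h v - p * v - (\<alpha> / 2 * (v - y)\<^sup>2 - \<omega> * (v - y))) has_real_derivative
     (h' u - p - (\<alpha> * (u - y) - \<omega>))) (at u)"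
    using u v y \<omega> by (auto intro!: derivative_eq_intros deriv simp: field_simps)
   then show "\<exists>z. ((%v. h v - p * v - (\<alpha> / 2 * (v - y)\<^sup>2 - \<omega> * (v - y))) has_real_derivative z) (at u) \<and> 0 <= z"
    using right[of u] u v by auto
  qed
  then show ?thesis using quad[of "v - y"] by (simp add: algebra_simps)
 qed
 have Lf: "h v - h y >= p * (v - y) - e" if v: "y - \<delta> <= v" "v <= y" for v
 proof -
  have "h v - p * v - (\<alpha> / 2 * (y - v)\<^sup>2 - \<omega> * (y - v)) >= h y - p * y - (\<alpha> / 2 * (y - y)\<^sup>2 - \<omega> * (y - y))"
  proof (rule DERIV_nonpos_imp_nonincreasing[OF v(2)])
   fix u assume u: "v <= u" "u <= y"
   have "((%v. h v - p * v - (\<alpha> / 2 * (y - v)\<^sup>2 - \<omega> * (y - v))) has_real_derivative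
     (h' u - p + (\<alpha> * (y - u) - \<omega>))) (at u)"
    using u v y \<omega> by (auto intro!: derivative_eq_intros deriv simp: field_simps)
   then show "\<exists>z. ((%v. h v - p * v - (\<alpha> / 2 * (y - v)\<^sup>2 - \<omega> * (y - v))) has_real_derivative z) (at u) \<and> z <= 0"
    using left[of u] u v by (intro exI[of _ "(h' u - p + (\<alpha> * (y - u) - \<omega>))"]) auto
  qed
  then show ?thesis using quad[of "y - v"] by (simp add: algebra_simps)
 qed
 have e: "e >= 0" using \<alpha> by (simp add: e_def)
 have "\<bar>left_deriv (gcm \<tau> h) y - p\<bar> <= L * \<omega> + e / \<omega>"
 proof (rule gcm_left_deriv_near[OF bdd _ _ \<omega>(1) e])
  show "0 <= y - \<omega>" "y + \<omega> <= \<tau>" using y \<omega> by auto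
  show "h y + p * (v - y) - e <= h v" if "v \<in> {0..\<tau>}" for v
   using R[of v] Lf[of v] far[of v] e that by (cases "v >= y"; cases "v >= y - \<delta>") auto
  \<comment> \<open>By the mean value theorem an increment over a step of length
    \<open>\<omega>\<close> is \<open>\<omega>\<close> times a derivative within
    \<open>L * \<omega>\<close> of \<open>p\<close>.\<close>
  obtain z where z: "y < z" "z < y + \<omega>" "h (y + \<omega>) - h y = (y + \<omega> - y) * h' z"
   using MVT2[of y "y+\<omega>" h h'] deriv \<omega> y by auto
  then show "h (y + \<omega>) - h y <= (p + L * \<omega>) * \<omega>" 
   using near[of z] \<omega> by (auto simp: mult.commute intro!: mult_right_mono)
  obtain z where z: "y - \<omega> < z" "z < y" "h y - h (y - \<omega>) = (y - (y - \<omega>)) * h' z"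
   using MVT2[of "y-\<omega>" y h h'] deriv \<omega> y by auto
  then show "h y - h (y - \<omega>) >= (p - L * \<omega>) * \<omega>"
   using near[of z] \<omega> by (auto simp: mult.commute intro!: mult_right_mono)
 qed
 also have "... = (L + 1 / (2 * \<alpha>)) * \<omega>"
  using \<omega> by (simp add: e_def power2_eq_square field_simps)
 finally show ?thesis .
qed

section \<open>Measurability of the minorant and of its left derivative\<close>

lemma Rats_between_dense:
 fixes \<tau> :: real
 assumes "0 < \<tau>" "u \<in> {0..\<tau>}"
 shows "u \<in> closure (\<rat> \<inter> {0..\<tau>})"
proof (cases "u < \<tau>")
 case True
 show ?thesis unfolding closure_approachable
 proof (intro allI impI)
  fix e :: real assume "0 < e"
  then obtain r where "r \<in> \<rat>" "u < r" "r < min \<tau> (u + e)"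
   using Rats_dense_in_real[of u "min \<tau> (u+e)"] True by auto
  then show "\<exists>y\<in>\<rat> \<inter> {0..\<tau>}. dist y u < e"
   using assms by (intro bexI[of _ r]) (auto simp: dist_real_def)
 qed
next
 case False
 show ?thesis unfolding closure_approachable
 proof (intro allI impI)
  fix e :: real assume "0 < e"
  then obtain r where "r \<in> \<rat>" "max 0 (u - e) < r" "r < u"
   using Rats_dense_in_real[of "max 0 (u-e)" u] assms False by auto
  then show "\<exists>y\<in>\<rat> \<inter> {0..\<tau>}. dist y u < e"
   using assms by (intro bexI[of _ r]) (auto simp: dist_real_def)
 qed
qed

text \<open>A supporting line at \<open>x\<close> lies strictly above \<open>c\<close> there, and
  this slack allows its slope and height to be made rational; continuity lets the minorant condition
  be tested at rational points only. The inequality thus becomes a countable condition, which is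
  what measurability in the sample needs.\<close>

lemma gcm_gt_iff:
 assumes cont: "continuous_on {0..\<tau>} h" and x: "0 < x" "x < \<tau>"
 shows "c < gcm \<tau> h x \<longleftrightarrow>
  (\<exists>q\<in>\<rat>. \<exists>e\<in>\<rat>. e > 0 \<and> (\<forall>u\<in>\<rat> \<inter> {0..\<tau>}. c + e + q * (u - x) <= h u))"
proof -
 obtain B where B: "\<forall>u\<in>{0..\<tau>}. \<bar>h u\<bar> <= B"
  using continuous_on_interval_bounded[OF cont] by blast
 then have B: "\<forall>u\<in>{0..\<tau>}. - B <= h u" by (auto simp: abs_le_iff)
 show ?thesis
 proof
  assume c: "c < gcm \<tau> h x"
  define d where "d = gcm \<tau> h x - c"
  obtain e where e: "e \<in> \<rat>" "0 < e" "e < d / 2"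
   using Rats_dense_in_real[of 0 "d / 2"] c by (auto simp: d_def)
  let ?D = "left_deriv (gcm \<tau> h) x"
  \<comment> \<open>Half of the gap \<open>d\<close> pays for tilting the line: over an interval of
    length \<open>\<tau>\<close> the slope may change by \<open>d / (2 * \<tau>)\<close>. The other
    half pays for \<open>e\<close>.\<close>
  obtain q where q: "q \<in> \<rat>" "?D - d / (2 * \<tau>) < q" "q < ?D + d / (2 * \<tau>)"
   using Rats_dense_in_real[of "?D - d / (2 * \<tau>)" "?D + d / (2 * \<tau>)"] c x by (auto simp: d_def)
  have "c + e + q * (u - x) <= h u" if u: "u \<in> {0..\<tau>}" for u
  proof -
   have "(q - ?D) * (u - x) <= \<bar>q - ?D\<bar> * \<bar>u - x\<bar>" by (simp flip: abs_mult)
   also have "... <= d / (2 * \<tau>) * \<tau>" using q u x by (intro mult_mono) auto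
   also have "... = d / 2" using x by simp
   finally have "q * (u - x) <= ?D * (u - x) + d / 2" by (simp add: algebra_simps)
   moreover have "gcm \<tau> h x + ?D * (u - x) <= gcm \<tau> h u"
    by (rule convex_supporting_line[OF gcm_convex[OF B] x u])
   moreover have "gcm \<tau> h u <= h u" by (rule gcm_upper[OF B u])
   ultimately show ?thesis using e unfolding d_def by argo
  qed
  with q e show "\<exists>q\<in>\<rat>. \<exists>e\<in>\<rat>. e > 0 \<and> (\<forall>u\<in>\<rat> \<inter> {0..\<tau>}. c + e + q * (u - x) <= h u)" by blast
 next
  assume "\<exists>q\<in>\<rat>. \<exists>e\<in>\<rat>. e > 0 \<and> (\<forall>u\<in>\<rat> \<inter> {0..\<tau>}. c + e + q * (u - x) <= h u)"
  then obtain q e where qe: "e > 0" "\<And>u. u \<in> \<rat> \<inter> {0..\<tau>} ==> c + e + q * (u - x) <= h u" by blast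
  have sub: "closure (\<rat> \<inter> {0..\<tau>}) \<subseteq> {0..\<tau>}" by (intro closure_minimal) auto
  have "c + e + q * (u - x) <= h u" if u: "u \<in> {0..\<tau>}" for u
  proof -
   have "0 <= h u - (c + e + q * (u - x))"
    by (rule continuous_ge_on_closure[of "\<rat> \<inter> {0..\<tau>}"])
      (use qe u x sub in \<open>auto intro!: continuous_intros continuous_on_subset[OF cont] Rats_between_dense\<close>)
   then show ?thesis by simp
  qed
  moreover have "convex_on {0..\<tau>} (%u. c + e + q * (u - x))"
  proof (rule convex_onI)
   fix t u v :: real
   have "c + e + q * ((1 - t) *\<^sub>R u + t *\<^sub>R v - x) = (1 - t) * (c + e + q * (u - x)) + t * (c + e + q * (v - x))"
    by (simp add: algebra_simps)
   then show "c + e + q * ((1 - t) *\<^sub>R u + t *\<^sub>R v - x) <= (1 - t) * (c + e + q * (u - x)) + t * (c + e + q * (v - x))"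
    by simp
  qed simp
  ultimately have "c + e + q * (x - x) <= gcm \<tau> h x"
   using x by (intro gcm_lower[where c = "%u. c + e + q * (u - x)"]) auto
  then show "c < gcm \<tau> h x" using qe by simp
 qed
qed

lemma borel_measurable_gcm:
 assumes meas: "\<And>u. (%w. h w u) \<in> borel_measurable M"
  and cont: "\<And>w. w \<in> space M ==> continuous_on {0..\<tau>} (h w)" and x: "0 < x" "x < \<tau>"
 shows "(%w. gcm \<tau> (h w) x) \<in> borel_measurable M"
proof (rule borel_measurableI_greater)
 fix c
 have "{w \<in> space M. c < gcm \<tau> (h w) x} =
  {w \<in> space M. \<exists>q\<in>\<rat>. \<exists>e\<in>\<rat>. e > 0 \<and> (\<forall>u\<in>\<rat> \<inter> {0..\<tau>}. c + e + q * (u - x) <= h w u)}"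
  using gcm_gt_iff[OF cont x] by blast
 also have "... \<in> sets M"
 proof (intro sets.sets_Collect_countable_Ex' sets.sets_Collect_conj sets.sets_Collect_const countable_rat)
  fix q e :: real
  show "{w \<in> space M. \<forall>u\<in>\<rat> \<inter> {0..\<tau>}. c + e + q * (u - x) <= h w u} \<in> sets M"
   by (intro sets.sets_Collect_countable_All' borel_measurable_le borel_measurable_const meas)
     (auto intro: countable_rat countable_subset)
 qed
 finally show "{w \<in> space M. c < gcm \<tau> (h w) x} \<in> sets M" .
qed

lemma gcm_convex_of_continuous:
 assumes "continuous_on {0..\<tau>} h"
 shows "convex_on {0..\<tau>} (gcm \<tau> h)"
proof -
 obtain B where B: "\<forall>u\<in>{0..\<tau>}. \<bar>h u\<bar> <= B"
  using continuous_on_interval_bounded[OF assms] by blast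
 then have "\<forall>u\<in>{0..\<tau>}. - B <= h u" by (auto simp: abs_le_iff)
 then show ?thesis by (rule gcm_convex)
qed

lemma borel_measurable_left_deriv_gcm:
 assumes meas: "\<And>u. (%w. h w u) \<in> borel_measurable M"
  and cont: "\<And>w. w \<in> space M ==> continuous_on {0..\<tau>} (h w)" and x: "0 < x" "x < \<tau>"
 shows "(%w. left_deriv (gcm \<tau> (h w)) x) \<in> borel_measurable M"
proof -
 \<comment> \<open>The shift by 2 keeps every \<open>s n\<close>, including \<open>s 0\<close>,
   strictly between 0 and \<open>x\<close>.\<close>
 define s where "s = (%n. x - x / real (n + 2))"
 have s: "0 < s n" "s n < x" for n using x by (auto simp: s_def field_simps intro: add_pos_nonneg)
 have "(%n. x - x / real (n + 2)) \<longlonglongrightarrow> x - 0"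
  by (intro tendsto_intros LIMSEQ_ignore_initial_segment[OF lim_const_over_n])
 then have lim: "filterlim s (at_left x) sequentially"
  unfolding filterlim_at using s by (auto simp: s_def less_imp_neq)
 show ?thesis
 proof (rule borel_measurable_LIMSEQ_real)
  fix w assume w: "w \<in> space M"
  have "((%y. (gcm \<tau> (h w) y - gcm \<tau> (h w) x) / (y - x)) \<longlongrightarrow> left_deriv (gcm \<tau> (h w)) x) (at_left x)"
   using convex_left_derivative(1)[OF gcm_convex_of_continuous[OF cont[OF w]] x]
   unfolding has_field_derivative_iff .
  then show "(%n. (gcm \<tau> (h w) (s n) - gcm \<tau> (h w) x) / (s n - x)) \<longlonglongrightarrow> left_deriv (gcm \<tau> (h w)) x"
   using lim by (rule filterlim_compose)
 next
  fix n
  show "(%w. (gcm \<tau> (h w) (s n) - gcm \<tau> (h w) x) / (s n - x)) \<in> borel_measurable M"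
   using s[of n] x by (intro borel_measurable_divide borel_measurable_diff borel_measurable_const
    borel_measurable_gcm[OF meas cont]) auto
 qed
qed

text \<open>Left continuity of the left derivative and of \<open>f\<close> reduces the supremum to
  rational points; \<open>l\<close> has to be added because no point of the interval lies to its
  left. Monotonicity of the left derivative bounds it by its values at the endpoints.\<close>

lemma borel_measurable_SUP_left_deriv_gcm:
 assumes meas: "\<And>u. (%w. h w u) \<in> borel_measurable M"
  and cont: "\<And>w. w \<in> space M ==> continuous_on {0..\<tau>} (h w)"
  and lu: "0 < l" "l < u" "u < \<tau>" and f: "continuous_on {l..u} f"
 shows "(%w. SUP y\<in>{l..u}. \<bar>left_deriv (gcm \<tau> (h w)) y - f y\<bar>) \<in> borel_measurable M"
  and "\<And>w. w \<in> space M ==> bdd_above ((%y. \<bar>left_deriv (gcm \<tau> (h w)) y - f y\<bar>) ` {l..u})"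
proof -
 let ?D = "%w. left_deriv (gcm \<tau> (h w))"
 have bdd: "bdd_above ((%y. \<bar>?D w y - f y\<bar>) ` {l..u})" if w: "w \<in> space M" for w
 proof -
  obtain B where B: "\<forall>y\<in>{l..u}. \<bar>f y\<bar> <= B"
   using continuous_on_interval_bounded[OF f] by blast
  have "\<bar>?D w y - f y\<bar> <= \<bar>?D w l\<bar> + \<bar>?D w u\<bar> + B" if "y \<in> {l..u}" for y
   using left_deriv_mono[OF gcm_convex_of_continuous[OF cont[OF w]], of l y]
    left_deriv_mono[OF gcm_convex_of_continuous[OF cont[OF w]], of y u] B[rule_format, OF that] that lu by auto
  then show ?thesis by (rule bdd_aboveI2)
 qed
 show "bdd_above ((%y. \<bar>?D w y - f y\<bar>) ` {l..u})" if "w \<in> space M" for w using that by (rule bdd)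
 show "(%w. SUP y\<in>{l..u}. \<bar>?D w y - f y\<bar>) \<in> borel_measurable M"
 proof (rule borel_measurableI_le)
  fix c
  let ?S = "insert l (\<rat> \<inter> {l..u})"
  have "(SUP y\<in>{l..u}. \<bar>?D w y - f y\<bar>) <= c \<longleftrightarrow> (\<forall>y\<in>?S. \<bar>?D w y - f y\<bar> <= c)" if w: "w \<in> space M" for w
  proof -
   have 1: "\<bar>?D w y - f y\<bar> <= c" if S: "\<forall>y\<in>?S. \<bar>?D w y - f y\<bar> <= c" and y: "y \<in> {l..u}" for y
   proof (cases "y = l")
    case False
    then have y': "l < y" "y <= u" using y by auto
    have fl: "(f \<longlongrightarrow> f y) (at_left y)"
     using y' by (intro continuous_on_Icc_at_leftD[of l] continuous_on_subset[OF f]) auto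
    have lim: "((%y. \<bar>?D w y - f y\<bar>) \<longlongrightarrow> \<bar>?D w y - f y\<bar>) (at_left y)"
     using y' lu by (intro tendsto_intros fl left_deriv_left_continuous[OF gcm_convex_of_continuous[OF cont[OF w]]]) auto
    show ?thesis
    proof (rule ccontr)
     assume "\<not> \<bar>?D w y - f y\<bar> <= c"
     then have "\<forall>\<^sub>F z in at_left y. c < \<bar>?D w z - f z\<bar>"
      using order_tendstoD(1)[OF lim] by simp
     then obtain a where a: "a < y" "\<And>z. a < z ==> z < y ==> c < \<bar>?D w z - f z\<bar>"
      unfolding eventually_at_left_field by blast
     obtain r where "r \<in> \<rat>" "max a l < r" "r < y"
      using Rats_dense_in_real[of "max a l" y] a y' by auto
     then have "r \<in> ?S" "c < \<bar>?D w r - f r\<bar>" using a y' by auto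
     then show False using S by force
    qed
   qed (use S in auto)
   have 2: "(SUP y\<in>{l..u}. \<bar>?D w y - f y\<bar>) <= c \<longleftrightarrow> (\<forall>y\<in>{l..u}. \<bar>?D w y - f y\<bar> <= c)"
    using lu by (intro cSUP_le_iff bdd w) auto
   have "?S \<subseteq> {l..u}" using lu by auto
   with 1 show ?thesis unfolding 2 by blast
  qed
  then have "{w \<in> space M. (SUP y\<in>{l..u}. \<bar>?D w y - f y\<bar>) <= c} =
    {w \<in> space M. \<forall>y\<in>?S. \<bar>?D w y - f y\<bar> <= c}" by blast
  also have "... \<in> sets M"
  proof (rule sets.sets_Collect_countable_All')
   show "countable ?S" by (auto intro: countable_rat countable_subset)
   fix y assume "y \<in> ?S"
   then have "(%w. ?D w y) \<in> borel_measurable M"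
    using lu by (intro borel_measurable_left_deriv_gcm[OF meas cont]) auto
   then show "{w \<in> space M. \<bar>?D w y - f y\<bar> <= c} \<in> sets M" by measurable
  qed
  finally show "{w \<in> space M. (SUP y\<in>{l..u}. \<bar>?D w y - f y\<bar>) <= c} \<in> sets M" .
 qed
qed

section \<open>Boundedness in probability and a triangular central limit theorem\<close>

text \<open>A one-sided form of stochastic boundedness, phrased with measurable events contained in
  the event of interest. In this form \<open>\<phi>\<close> may be non-measurable, and the notion is
  stable under arbitrary pointwise implications.\<close>

definition bdd_in_prob :: "'w measure => (nat => 'w => real) => (nat => real) => bool" where
 "bdd_in_prob M \<phi> a \<longleftrightarrow> (\<forall>\<eta>>0. \<exists>K. LARGE n.
   \<exists>A\<in>sets M. measure M A >= 1 - \<eta> \<and> (\<forall>w\<in>A. \<phi> n w <= K * a n))"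

context prob_space
begin

abbreviation Op :: "(nat => 'a => real) => (nat => real) => bool" where "Op \<equiv> bdd_in_prob M"

abbreviation wpo :: "(nat => 'a => bool) => bool" where "wpo \<equiv> with_prob_to_one M"

abbreviation likely :: "real => ('a => bool) => bool" where
 "likely \<eta> Q \<equiv> \<exists>A\<in>sets M. prob A >= 1 - \<eta> \<and> (\<forall>w\<in>A. Q w)"

lemma likely_conj:
 assumes "likely (\<eta> / 2) P" "likely (\<eta> / 2) Q" "\<And>w. P w ==> Q w ==> R w"
 shows "likely \<eta> R"
proof -
 obtain A B where AB: "A \<in> events" "B \<in> events" "prob A >= 1 - \<eta> / 2" "prob B >= 1 - \<eta> / 2"
  "\<forall>w\<in>A. P w" "\<forall>w\<in>B. Q w" using assms(1,2) by blast
 have "prob (A \<union> B) = prob A + prob B - prob (A \<inter> B)"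
  using finite_measure_Union'[of A B] finite_measure_Diff'[of B A] AB by (simp add: Int_commute Un_Diff)
 then have "prob (A \<inter> B) >= 1 - \<eta>" using AB prob_le_1[of "A \<union> B"] by linarith
 then show ?thesis using AB assms(3) by (intro bexI[of _ "A \<inter> B"]) auto
qed

text \<open>The definition asks for one sequence of events, the form with \<open>\<eta>\<close>
  allows a different one for each \<open>\<eta>\<close>. To return to a single sequence, choose for
  each \<open>n\<close> a measurable subset of the event whose probability is within
  \<open>1 / Suc n\<close> of the supremum \<open>p n\<close>.\<close>

lemma with_prob_to_one_iff:
 "wpo Q \<longleftrightarrow> (\<forall>\<eta>>0. LARGE n. likely \<eta> (Q n))"
proof
 assume "wpo Q"
 then obtain A where A: "\<And>n. A n \<in> events" "\<And>n w. w \<in> A n ==> Q n w" "(%n. prob (A n)) \<longlonglongrightarrow> 1"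
  unfolding with_prob_to_one_def by blast
 show "\<forall>\<eta>>0. LARGE n. likely \<eta> (Q n)"
 proof (intro allI impI)
  fix \<eta> :: real assume "0 < \<eta>"
  then have "LARGE n. prob (A n) > 1 - \<eta>" using order_tendstoD(1)[OF A(3)] by simp
  then show "LARGE n. likely \<eta> (Q n)"
   by eventually_elim (use A in \<open>auto intro!: bexI[of _ "A _"]\<close>)
 qed
next
 assume *: "\<forall>\<eta>>0. LARGE n. likely \<eta> (Q n)"
 define S where "S = (%n. {A\<in>events. \<forall>w\<in>A. Q n w})"
 define p where "p = (%n. SUP A\<in>S n. prob A)"
 have ne: "S n \<noteq> {}" for n by (auto simp: S_def intro!: exI[of _ "{}"])
 have bdd: "bdd_above (prob ` S n)" for n by (auto intro!: bdd_aboveI[of _ 1])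
 have "\<exists>A\<in>S n. p n - 1 / Suc n < prob A" for n
  using less_cSUP_iff[OF ne bdd, of "p n - 1 / Suc n" n] unfolding p_def by auto
 then obtain A where A: "\<And>n. A n \<in> S n" "\<And>n. p n - 1 / Suc n < prob (A n)" by metis
 have "p \<longlonglongrightarrow> 1"
 proof (rule order_tendstoI)
  fix a :: real assume "a < 1"
  then have "LARGE n. likely ((1 - a) / 2) (Q n)"
   using * by (auto elim!: allE[of _ "(1 - a) / 2"])
  then show "LARGE n. a < p n"
  proof eventually_elim
   case (elim n)
   then obtain A where A: "A \<in> S n" "prob A >= 1 - (1 - a) / 2" by (auto simp: S_def)
   have "prob A <= p n" unfolding p_def using A bdd by (intro cSUP_upper) auto
   then show ?case using A \<open>a < 1\<close> by (auto simp: field_simps)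
  qed
 next
  fix a :: real assume "1 < a"
  moreover have "p n <= 1" for n unfolding p_def using ne by (intro cSUP_least) auto
  ultimately show "LARGE n. p n < a" by (auto intro!: always_eventually intro: le_less_trans)
 qed
 then have lim: "(%n. p n - 1 / Suc n) \<longlonglongrightarrow> 1 - 0" by (intro tendsto_intros LIMSEQ_Suc lim_const_over_n)
 have "(%n. prob (A n)) \<longlonglongrightarrow> 1"
  by (rule tendsto_sandwich[OF _ _ _ tendsto_const[of 1]])
    (use A lim in \<open>auto intro!: always_eventually less_imp_le\<close>)
 then show "wpo Q"
  unfolding with_prob_to_one_def using A(1) by (intro exI[of _ A]) (auto simp: S_def)
qed

lemma wpo_mono:
 assumes "wpo P" "\<And>n w. w \<in> space M ==> P n w ==> Q n w"
 shows "wpo Q"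
 using assms sets.sets_into_space unfolding with_prob_to_one_def by (metis subsetD)

lemma wpo_conj:
 assumes "wpo P" "wpo Q"
 shows "wpo (%n w. P n w \<and> Q n w)"
 unfolding with_prob_to_one_iff
proof (intro allI impI)
 fix \<eta> :: real assume "0 < \<eta>"
 then have "LARGE n. likely (\<eta> / 2) (P n)" "LARGE n. likely (\<eta> / 2) (Q n)"
  using assms unfolding with_prob_to_one_iff by (auto elim!: allE[of _ "\<eta> / 2"])
 then show "LARGE n. likely \<eta> (%w. P n w \<and> Q n w)"
  by eventually_elim (rule likely_conj, assumption+, rule conjI)
qed

lemma wpo_AE:
 assumes "\<And>n. AE w in M. Q n w"
 shows "wpo Q"
 unfolding with_prob_to_one_iff
proof (intro allI impI always_eventually)
 fix \<eta> :: real and n assume "0 < \<eta>"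
 from assms[of n] obtain N where N: "N \<in> null_sets M" "{w\<in>space M. \<not> Q n w} \<subseteq> N"
  by (auto elim!: AE_E simp: null_sets_def)
 have "prob (space M - N) = 1" using N by (subst prob_compl) (auto simp: measure_eq_0_null_sets)
 then show "likely \<eta> (Q n)"
  using N \<open>0 < \<eta>\<close> by (intro bexI[of _ "space M - N"]) auto
qed

text \<open>The form in which most probabilistic arguments below end: finitely many likely events
  are intersected, and what remains is a deterministic implication at a fixed sample point for large
  \<open>n\<close>.\<close>

lemma wpo_eventually_mp:
 assumes "wpo P" "LARGE n. \<forall>w\<in>space M. P n w --> Q n w"
 shows "wpo Q"
 unfolding with_prob_to_one_iff
proof (intro allI impI)
 fix \<eta> :: real assume "0 < \<eta>"
 then have "LARGE n. likely \<eta> (P n)" using assms(1) unfolding with_prob_to_one_iff by simp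
 with assms(2) show "LARGE n. likely \<eta> (Q n)"
  by eventually_elim (use sets.sets_into_space in blast)
qed

lemma wpo_of_bdd_in_prob:
 assumes "Op \<phi> a" "\<And>K. LARGE n. K * a n <= c n"
 shows "wpo (%n w. \<phi> n w <= c n)"
 unfolding with_prob_to_one_iff
proof (intro allI impI)
 fix \<eta> :: real assume "0 < \<eta>"
 then obtain K where "LARGE n. likely \<eta> (%w. \<phi> n w <= K * a n)"
  using assms(1) unfolding bdd_in_prob_def by blast
 then show "LARGE n. likely \<eta> (%w. \<phi> n w <= c n)"
  using assms(2)[of K] by eventually_elim (meson order_trans)
qed

text \<open>Splitting \<open>\<eta>\<close> into halves once here reduces the calculus of stochastic
  orders to deterministic implications between bounds.\<close>

lemma bdd_in_prob_combine:
 assumes "Op \<phi> a" "Op \<psi> b"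
  and comb: "\<And>K L. \<exists>J. LARGE n. \<forall>w. \<phi> n w <= K * a n --> \<psi> n w <= L * b n --> \<theta> n w <= J * d n"
 shows "Op \<theta> d"
 unfolding bdd_in_prob_def
proof (intro allI impI)
 fix \<eta> :: real assume "0 < \<eta>"
 then have "\<eta> / 2 > 0" by simp
 then obtain K L where KL: "LARGE n. likely (\<eta> / 2) (%w. \<phi> n w <= K * a n)"
  "LARGE n. likely (\<eta> / 2) (%w. \<psi> n w <= L * b n)"
  using assms(1,2) unfolding bdd_in_prob_def by blast
 obtain J where "LARGE n. \<forall>w. \<phi> n w <= K * a n --> \<psi> n w <= L * b n --> \<theta> n w <= J * d n"
  using comb by blast
 with KL have "LARGE n. likely \<eta> (%w. \<theta> n w <= J * d n)"
 proof eventually_elim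
  case (elim n)
  show ?case by (rule likely_conj[OF elim(1,2)]) (use elim(3) in blast)
 qed
 then show "\<exists>K. LARGE n. likely \<eta> (%w. \<theta> n w <= K * d n)" ..
qed

lemma bdd_in_prob_transform:
 assumes "Op \<phi> a"
  and "\<And>K. \<exists>J. LARGE n. \<forall>w. \<phi> n w <= K * a n --> \<theta> n w <= J * d n"
 shows "Op \<theta> d"
proof (rule bdd_in_prob_combine[OF assms(1,1)])
 fix K L :: real
 from assms(2)[of K] obtain J where "LARGE n. \<forall>w. \<phi> n w <= K * a n --> \<theta> n w <= J * d n" ..
 then have "LARGE n. \<forall>w. \<phi> n w <= K * a n --> \<phi> n w <= L * a n --> \<theta> n w <= J * d n"
  by eventually_elim blast
 then show "\<exists>J. LARGE n. \<forall>w. \<phi> n w <= K * a n --> \<phi> n w <= L * a n --> \<theta> n w <= J * d n" ..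
qed

lemma bdd_in_prob_mono:
 assumes "Op \<psi> a" "wpo (%n w. \<phi> n w <= \<psi> n w)"
 shows "Op \<phi> a"
proof (rule bdd_in_prob_combine[OF assms(1), of "%n w. of_bool (\<psi> n w < \<phi> n w)" "%_. 0"])
 \<comment> \<open>An event of probability tending to one is read as boundedness, at rate 0, of the
   indicator of its failure, so that the general combination rule applies.\<close>
 show "Op (%n w. of_bool (\<psi> n w < \<phi> n w)) (%_. 0)"
  using assms(2) unfolding bdd_in_prob_def with_prob_to_one_iff by (simp add: of_bool_def not_less if_distrib cong: if_cong)
 show "\<exists>J. LARGE n. \<forall>w. \<psi> n w <= K * a n --> of_bool (\<psi> n w < \<phi> n w) <= L * 0 --> \<phi> n w <= J * a n" for K L :: real
  by (rule exI[of _ K]) (auto simp: of_bool_def split: if_splits)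
qed

lemma bdd_in_prob_add:
 assumes "Op \<phi> a" "Op \<psi> a"
 shows "Op (%n w. \<phi> n w + \<psi> n w) a"
 by (rule bdd_in_prob_combine[OF assms])
   (rule exI[of _ "_ + _"], auto simp: distrib_right intro!: always_eventually add_mono)

lemma bdd_in_prob_mult:
 assumes "Op \<phi> a" "Op \<psi> b" and nonneg: "\<And>n w. 0 <= \<phi> n w" "\<And>n w. 0 <= \<psi> n w"
 shows "Op (%n w. \<phi> n w * \<psi> n w) (%n. a n * b n)"
proof (rule bdd_in_prob_combine[OF assms(1,2)], intro exI always_eventually allI impI)
 fix K L n w assume le: "\<phi> n w <= K * a n" "\<psi> n w <= L * b n"
 have "\<phi> n w * \<psi> n w <= (K * a n) * (L * b n)"
  using le nonneg[of n w] by (intro mult_mono) auto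
 then show "\<phi> n w * \<psi> n w <= K * L * (a n * b n)" by (simp add: mult_ac)
qed

lemma bdd_in_prob_const: "(\<And>n. 0 <= c n) ==> Op (%n w. c n) c"
 unfolding bdd_in_prob_def by (auto intro!: exI[of _ 1] bexI[of _ "space M"] simp: prob_space)

lemma bdd_in_prob_cmult:
 assumes "Op \<phi> a" "0 <= c"
 shows "Op (%n w. c * \<phi> n w) a"
 by (rule bdd_in_prob_transform[OF assms(1)])
   (rule exI[of _ "c * _"], auto simp: mult.assoc assms(2) intro!: always_eventually mult_left_mono)

lemma bdd_in_prob_sqrt:
 assumes "Op \<phi> a" "\<And>n. 0 <= a n"
 shows "Op (%n w. sqrt (\<phi> n w)) (%n. sqrt (a n))"
 by (rule bdd_in_prob_transform[OF assms(1)])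
   (rule exI[of _ "sqrt _"], auto intro!: always_eventually simp flip: real_sqrt_mult)

lemma bdd_in_prob_rate:
 assumes "Op \<phi> a" "\<And>n. 0 <= a n" "LARGE n. a n <= C * b n"
 shows "Op \<phi> b"
proof (rule bdd_in_prob_transform[OF assms(1)], rule exI)
 fix K
 show "LARGE n. \<forall>w. \<phi> n w <= K * a n --> \<phi> n w <= \<bar>K\<bar> * C * b n"
  using assms(3)
 proof eventually_elim
  case (elim n)
  have "K * a n <= \<bar>K\<bar> * a n" using assms(2)[of n] by (intro mult_right_mono) auto
  also have "... <= \<bar>K\<bar> * (C * b n)" using elim by (intro mult_left_mono) auto
  finally show ?case by (auto simp: mult.assoc)
 qed
qed

text \<open>\<open>X\<close> may take negative values: its truncation by \<open>ennreal\<close> is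
  enough for a bound from above, and with \<open>nn_integral\<close> no integrability has to be
  carried along.\<close>

lemma bdd_in_prob_Markov:
 assumes meas: "\<And>n. X n \<in> borel_measurable M"
  and le: "LARGE n. (\<integral>\<^sup>+w. ennreal (X n w) \<partial>M) <= ennreal (C * a n)"
  and a: "LARGE n. a n > 0"
 shows "Op X a"
 unfolding bdd_in_prob_def
proof (intro allI impI)
 fix \<eta> :: real assume \<eta>: "0 < \<eta>"
 \<comment> \<open>Adding 1 keeps \<open>K\<close> positive when \<open>C\<close> is 0, and
   \<open>\<bar>C\<bar> / K\<close> is still at most \<open>\<eta>\<close>.\<close>
 define K where "K = (\<bar>C\<bar> + 1) / \<eta>"
 have K: "K > 0" "\<bar>C\<bar> / K <= \<eta>" using \<eta> by (auto simp: K_def field_simps)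
 from le a have "LARGE n. \<exists>A\<in>sets M. prob A >= 1 - \<eta> \<and> (\<forall>w\<in>A. X n w <= K * a n)"
 proof eventually_elim
  case (elim n)
  let ?B = "{w\<in>space M. 1 <= ennreal (1 / (K * a n)) * ennreal (X n w)}"
  have B: "?B \<in> sets M" using meas[of n] by measurable
  have "emeasure M ?B <= ennreal (1 / (K * a n)) * (\<integral>\<^sup>+w. ennreal (X n w) * indicator (space M) w \<partial>M)"
   using meas[of n] by (intro nn_integral_Markov_inequality) auto
  also have "(\<integral>\<^sup>+w. ennreal (X n w) * indicator (space M) w \<partial>M) = (\<integral>\<^sup>+w. ennreal (X n w) \<partial>M)"
   by (intro nn_integral_cong) auto
  also have "ennreal (1 / (K * a n)) * ... <= ennreal (1 / (K * a n)) * ennreal (C * a n)"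
   using elim by (intro mult_left_mono) auto
  also have "... <= ennreal (1 / (K * a n)) * ennreal (\<bar>C\<bar> * a n)"
   using elim by (intro mult_left_mono ennreal_leI mult_right_mono) auto
  also have "... = ennreal (\<bar>C\<bar> / K)"
   using elim K by (subst ennreal_mult[symmetric]) auto
  finally have "prob ?B <= \<eta>" using K \<eta> by (auto simp: emeasure_eq_measure ennreal_le_iff)
  then have "prob (space M - ?B) >= 1 - \<eta>" using prob_compl[OF B] by simp
  moreover have "X n w <= K * a n" if "w \<in> space M - ?B" for w
  proof (rule ccontr)
   assume "\<not> X n w <= K * a n"
   then have "1 <= 1 / (K * a n) * X n w" using K elim by (auto simp: field_simps)
   then have "ennreal 1 <= ennreal (1 / (K * a n) * X n w)" by (rule ennreal_leI)
   also have "... = ennreal (1 / (K * a n)) * ennreal (X n w)" using K elim by (intro ennreal_mult') auto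
   finally show False using that by auto
  qed
  ultimately show ?case using B by (intro bexI[of _ "space M - ?B"]) auto
 qed
 then show "\<exists>K. LARGE n. \<exists>A\<in>sets M. prob A >= 1 - \<eta> \<and> (\<forall>w\<in>A. X n w <= K * a n)" ..
qed

lemma bdd_in_prob_Markov_sq:
 assumes "\<And>n. X n \<in> borel_measurable M"
  and "LARGE n. (\<integral>\<^sup>+w. ennreal ((X n w)\<^sup>2) \<partial>M) <= ennreal (C * (a n)\<^sup>2)"
  and a: "\<And>n. 0 <= a n" "LARGE n. a n > 0"
 shows "Op (%n w. \<bar>X n w\<bar>) a"
proof -
 have "Op (%n w. (X n w)\<^sup>2) (%n. (a n)\<^sup>2)"
  using assms by (intro bdd_in_prob_Markov) (auto elim: eventually_mono)
 from bdd_in_prob_sqrt[OF this] show ?thesis by (simp add: a)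
qed

end

section \<open>Characteristic functions and empirical means\<close>

lemma exp_neg_quadratic_bound:
 fixes x :: real assumes "0 <= x" shows "\<bar>exp (- x) - (1 - x)\<bar> <= x\<^sup>2 / 2"
proof -
 have "1 + (- x) <= exp (- x)" by (rule exp_ge_add_one_self)
 moreover have "exp (- x) <= 1 - x + x\<^sup>2 / 2"
 proof -
  \<comment> \<open>The quadratic Taylor polynomials at \<open>- x\<close> and at \<open>x\<close>
    multiply to \<open>1 + x ^ 4 / 4\<close>; replacing the second by the larger
    \<open>exp x\<close> and dividing gives the bound.\<close>
  have "1 <= 1 + x ^ 4 / 4" by simp
  also have "... = (1 - x + x\<^sup>2 / 2) * (1 + x + x\<^sup>2 / 2)" by (simp add: algebra_simps power2_eq_square power4_eq_xxxx)
  also have "... <= (1 - x + x\<^sup>2 / 2) * exp x"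
  proof (rule mult_left_mono[OF exp_lower_Taylor_quadratic[OF assms]])
   have "0 <= ((1 - x)\<^sup>2 + 1) / 2" by simp
   also have "... = 1 - x + x\<^sup>2 / 2" by (simp add: power2_eq_square field_simps)
   finally show "0 <= 1 - x + x\<^sup>2 / 2" .
  qed
  finally show ?thesis by (simp add: exp_minus field_simps)
 qed
 ultimately show ?thesis by auto
qed

lemma iexp_diff_le: "cmod (iexp x - iexp y) <= \<bar>x - y\<bar>"
proof -
 have "iexp x - iexp y = iexp y * (iexp (x - y) - 1)"
  by (simp add: right_diff_distrib flip: exp_add)
 then have "cmod (iexp x - iexp y) = cmod (iexp (x - y) - 1)" by (simp add: norm_mult)
 also have "... <= \<bar>x - y\<bar>" using iexp_approx1[of "x - y" 0] by simp
 finally show ?thesis .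
qed

text \<open>The law is an affine image of the standard normal one, whose characteristic function is
  known.\<close>

lemma char_normal_distribution:
 assumes "\<sigma> > 0"
 shows "char (density lborel (normal_density \<mu> \<sigma>)) t = iexp (t * \<mu>) * exp (- (t * \<sigma>)\<^sup>2 / 2)"
proof -
 interpret S: prob_space std_normal_distribution by (rule prob_space_normal_density) simp
 have "distributed std_normal_distribution lborel (%x. x) std_normal_density"
  by (auto simp: distributed_def distr_id2 measurable_ident_sets)
 from S.normal_density_affine[OF this, of \<sigma> \<mu>] assms
 have D: "distr std_normal_distribution lborel (%x. \<mu> + \<sigma> * x) = density lborel (normal_density \<mu> \<sigma>)"
  by (simp add: distributed_def)
 have "char (density lborel (normal_density \<mu> \<sigma>)) t = (CLINT x|std_normal_distribution. iexp (t * (\<mu> + \<sigma> * x)))"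
  unfolding char_def D[symmetric] by (subst integral_distr) auto
 also have "... = (CLINT x|std_normal_distribution. iexp (t * \<mu>) * iexp ((t * \<sigma>) * x))"
  by (simp add: algebra_simps flip: exp_add)
 also have "... = iexp (t * \<mu>) * char std_normal_distribution (t * \<sigma>)"
  unfolding char_def by (rule integral_mult_right_zero)
 finally show ?thesis by (simp add: char_std_normal_distribution)
qed

definition emp :: "nat => ('b => real) => (nat => 'b) => real" where
 "emp n \<phi> y = (\<Sum>i<n. \<phi> (y i)) / real n"

locale iid_sample = prob_space M for M :: "'w measure" +
 fixes Y :: "nat => 'w => 'b::topological_space" and P :: "'b measure"
 assumes indep: "indep_vars (%_. borel) Y UNIV"
  and law: "\<And>i. distr M borel (Y i) = P"
begin

abbreviation ys :: "'w => nat => 'b" where "ys w \<equiv> (%i. Y i w)"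

lemma Y_meas [measurable]: "Y i \<in> measurable M borel"
 using indep unfolding indep_vars_def by auto

lemma sets_P: "sets P = sets borel" using law[of 0] by (metis sets_distr)

lemma measurable_P: "measurable P N = measurable borel N"
 by (rule measurable_cong_sets[OF sets_P refl])

lemma prob_space_P: "prob_space P"
 using law[of 0] prob_space_distr[OF Y_meas[of 0]] by simp

lemma nn_integral_Y:
 "\<phi> \<in> borel_measurable borel ==> (\<integral>\<^sup>+w. \<phi> (Y i w) \<partial>M) = (\<integral>\<^sup>+y. \<phi> y \<partial>P)"
 by (subst law[of i, symmetric], subst nn_integral_distr) auto

lemma integral_Y:
 fixes \<phi> :: "'b => real" shows
 "\<phi> \<in> borel_measurable borel ==> (\<integral>w. \<phi> (Y i w) \<partial>M) = (\<integral>y. \<phi> y \<partial>P)"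
 by (subst law[of i, symmetric], subst integral_distr) auto

lemma integrable_Y:
 fixes \<phi> :: "'b => real" shows
 "\<phi> \<in> borel_measurable borel ==> integrable M (%w. \<phi> (Y i w)) \<longleftrightarrow> integrable P \<phi>"
 by (subst law[of i, symmetric], subst integrable_distr_eq) auto

lemma AE_Y: "Measurable.pred borel Q ==> (AE w in M. Q (Y i w)) \<longleftrightarrow> (AE y in P. Q y)"
 by (subst law[of i, symmetric], subst AE_distr_iff) auto

lemma emp_meas [measurable]: "\<phi> \<in> borel_measurable borel ==> (%w. emp n \<phi> (ys w)) \<in> borel_measurable M"
 unfolding emp_def
 by (intro borel_measurable_divide borel_measurable_sum measurable_compose[OF Y_meas]) auto

text \<open>Expanding the square of the centred sum, products of different independent centred terms
  integrate to 0, so only the diagonal remains; centring can only lower a second moment.\<close>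

lemma emp_second_moment:
 assumes [measurable]: "\<phi> \<in> borel_measurable borel" and sq: "integrable P (%y. (\<phi> y)\<^sup>2)"
 shows "integrable M (%w. (emp n \<phi> (ys w) - (\<integral>y. \<phi> y \<partial>P))\<^sup>2)"
  and "0 < n ==> (\<integral>w. (emp n \<phi> (ys w) - (\<integral>y. \<phi> y \<partial>P))\<^sup>2 \<partial>M) <= (\<integral>y. (\<phi> y)\<^sup>2 \<partial>P) / n"
proof -
 interpret P: prob_space P by (rule prob_space_P)
 define m where "m = (\<integral>y. \<phi> y \<partial>P)"
 have \<phi>P [measurable]: "\<phi> \<in> borel_measurable P" by (simp add: measurable_P)
 have int: "integrable P \<phi>" by (rule P.square_integrable_imp_integrable[OF \<phi>P sq])
 define X where "X = (%i w. \<phi> (Y i w) - m)"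
 have [measurable]: "X i \<in> borel_measurable M" for i unfolding X_def by measurable
 have sqc: "integrable P (%y. (\<phi> y - m)\<^sup>2)"
  unfolding power2_diff using sq int by auto
 have X1: "integrable M (X i)" for i unfolding X_def using integrable_Y[of \<phi> i] int by auto
 have X0: "(\<integral>w. X i w \<partial>M) = 0" for i
  unfolding X_def using integral_Y[of \<phi> i] integrable_Y[of \<phi> i] int by (simp add: m_def prob_space)
 have X2: "integrable M (%w. X i w * X i w)" for i
  unfolding X_def using integrable_Y[of "%y. (\<phi> y - m)\<^sup>2" i] sqc by (simp add: power2_eq_square)
 have ivX: "indep_vars (%_. borel) X UNIV"
  unfolding X_def by (rule indep_vars_compose2[OF indep]) measurable
 have ind: "indep_vars (%_. borel) X {i, j}" for i j
  by (rule indep_vars_subset[OF ivX]) auto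
 have Xij: "integrable M (%w. X i w * X j w)" for i j
  using X2[of i] indep_vars_integrable[OF _ ind[of i j]] X1 by (cases "i = j") auto
 have Xij0: "(\<integral>w. X i w * X j w \<partial>M) = 0" if "i \<noteq> j" for i j
  using indep_vars_lebesgue_integral[OF _ ind[of i j]] X1 X0 that by auto
 have Xii: "(\<integral>w. X i w * X i w \<partial>M) = (\<integral>y. (\<phi> y - m)\<^sup>2 \<partial>P)" for i
  unfolding X_def using integral_Y[of "%y. (\<phi> y - m)\<^sup>2" i] by (simp add: power2_eq_square)
 have eq: "(emp n \<phi> (ys w) - m)\<^sup>2 = (\<Sum>i<n. \<Sum>j<n. X i w * X j w) / n\<^sup>2" if "0 < n" for w
 proof -
  have "emp n \<phi> (ys w) - m = (\<Sum>i<n. X i w) / n"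
   using that by (simp add: emp_def X_def sum_subtractf field_simps)
  then show ?thesis by (simp add: power_divide power2_eq_square sum_product)
 qed
 show "integrable M (%w. (emp n \<phi> (ys w) - (\<integral>y. \<phi> y \<partial>P))\<^sup>2)"
  unfolding m_def[symmetric]
  by (cases "n = 0") (auto simp: emp_def[of 0] eq intro!: integrable_divide Bochner_Integration.integrable_sum Xij)
 assume n: "0 < n"
 have "(\<integral>w. (emp n \<phi> (ys w) - m)\<^sup>2 \<partial>M) = (\<Sum>i<n. \<Sum>j<n. (\<integral>w. X i w * X j w \<partial>M)) / n\<^sup>2"
  by (simp add: eq[OF n] Bochner_Integration.integral_sum Xij Bochner_Integration.integrable_sum)
 also have "(\<Sum>i<n. \<Sum>j<n. (\<integral>w. X i w * X j w \<partial>M)) = (\<Sum>i<n. (\<integral>w. X i w * X i w \<partial>M))"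
 proof (rule sum.cong[OF refl])
  fix i assume i: "i \<in> {..<n}"
  have "(\<Sum>j<n. (\<integral>w. X i w * X j w \<partial>M)) = (\<Sum>j\<in>{i}. (\<integral>w. X i w * X j w \<partial>M))"
   using i Xij0 by (intro sum.mono_neutral_right) auto
  then show "(\<Sum>j<n. (\<integral>w. X i w * X j w \<partial>M)) = (\<integral>w. X i w * X i w \<partial>M)" by simp
 qed
 also have "... / n\<^sup>2 = (\<integral>y. (\<phi> y - m)\<^sup>2 \<partial>P) / n"
  using n by (simp add: Xii power2_eq_square)
 also have "(\<integral>y. (\<phi> y - m)\<^sup>2 \<partial>P) = (\<integral>y. (\<phi> y)\<^sup>2 \<partial>P) - m\<^sup>2"
  unfolding m_def by (rule P.variance_eq[OF int sq])
 also have "((\<integral>y. (\<phi> y)\<^sup>2 \<partial>P) - m\<^sup>2) / n <= (\<integral>y. (\<phi> y)\<^sup>2 \<partial>P) / n" by (intro divide_right_mono) auto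
 finally show "(\<integral>w. (emp n \<phi> (ys w) - (\<integral>y. \<phi> y \<partial>P))\<^sup>2 \<partial>M) <= (\<integral>y. (\<phi> y)\<^sup>2 \<partial>P) / n"
  by (simp add: m_def)
qed

lemma nn_emp_second_moment:
 assumes "\<phi> \<in> borel_measurable borel" "integrable P (%y. (\<phi> y)\<^sup>2)" "0 < n"
 shows "(\<integral>\<^sup>+w. ennreal ((emp n \<phi> (ys w) - (\<integral>y. \<phi> y \<partial>P))\<^sup>2) \<partial>M) <= ennreal ((\<integral>y. (\<phi> y)\<^sup>2 \<partial>P) / n)"
 using emp_second_moment[OF assms(1,2)] assms(3)
 by (subst nn_integral_eq_integral) (auto intro: ennreal_leI)

lemma emp_LLN_rate:
 assumes [measurable]: "\<phi> \<in> borel_measurable borel" and "integrable P (%y. (\<phi> y)\<^sup>2)"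
 shows "Op (%n w. \<bar>emp n \<phi> (ys w) - (\<integral>y. \<phi> y \<partial>P)\<bar>) (%n. 1 / sqrt n)"
proof (rule bdd_in_prob_Markov_sq[where C = "\<integral>y. (\<phi> y)\<^sup>2 \<partial>P"])
 show "LARGE n. (\<integral>\<^sup>+w. ennreal ((emp n \<phi> (ys w) - (\<integral>y. \<phi> y \<partial>P))\<^sup>2) \<partial>M)
   <= ennreal ((\<integral>y. (\<phi> y)\<^sup>2 \<partial>P) * (1 / sqrt n)\<^sup>2)"
  using eventually_gt_at_top[of 0]
  by eventually_elim (use nn_emp_second_moment[OF assms] in \<open>simp add: power_divide\<close>)
qed (use eventually_gt_at_top[of 0] in \<open>auto elim: eventually_mono\<close>)

lemma emp_LLN:
 assumes "\<phi> \<in> borel_measurable borel" "integrable P (%y. (\<phi> y)\<^sup>2)" "\<epsilon> > 0"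
 shows "wpo (%n w. \<bar>emp n \<phi> (ys w) - (\<integral>y. \<phi> y \<partial>P)\<bar> <= \<epsilon>)"
proof (rule wpo_of_bdd_in_prob[OF emp_LLN_rate[OF assms(1,2)]])
 fix K
 have "(%n. K * (1 / sqrt (real n))) \<longlonglongrightarrow> 0"
  by real_asymp
 from order_tendstoD(2)[OF this assms(3)] show "LARGE n. K * (1 / sqrt (real n)) <= \<epsilon>"
  by eventually_elim simp
qed

text \<open>Characteristic functions: each factor is within \<open>\<bar>t\<bar>\<^sup>3 B v / 6 + (t\<^sup>2 v)\<^sup>2 / 8\<close> of
  \<open>exp (- t\<^sup>2 v / 2)\<close>, where \<open>v\<close> is the variance and \<open>B\<close> the bound of the \<open>n\<close>-th row.\<close>

lemma triangular_CLT:
 assumes [measurable]: "\<And>n. \<phi> n \<in> borel_measurable borel"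
  and mean: "\<And>n. (\<integral>y. \<phi> n y \<partial>P) = 0"
  and bound: "\<And>n y. \<bar>\<phi> n y\<bar> <= B n" and B: "B \<longlonglongrightarrow> 0"
  and var: "(%n. real n * (\<integral>y. (\<phi> n y)\<^sup>2 \<partial>P)) \<longlonglongrightarrow> \<sigma>\<^sup>2" and \<sigma>: "\<sigma> > 0"
  and V: "\<And>n. V n \<in> borel_measurable M"
  and near: "\<And>\<epsilon>. \<epsilon> > 0 ==> wpo (%n w. \<bar>V n w - (\<mu> + (\<Sum>i<n. \<phi> n (Y i w)))\<bar> <= \<epsilon>)"
 shows "weak_conv_m (%n. distr M borel (V n)) (density lborel (normal_density \<mu> \<sigma>))"
proof (rule levy_continuity)
 interpret P: prob_space P by (rule prob_space_P)
 show "real_distribution (distr M borel (V n))" for n using V by (rule real_distribution_distr)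
 show "real_distribution (density lborel (normal_density \<mu> \<sigma>))"
  using prob_space_normal_density[OF \<sigma>, of \<mu>]
  by (auto simp: real_distribution_def real_distribution_axioms_def)
 fix t :: real
 define S where "S = (%n w. \<Sum>i<n. \<phi> n (Y i w))"
 have [measurable]: "S n \<in> borel_measurable M" for n unfolding S_def by measurable
 note V[measurable]
 define v where "v = (%n. \<integral>y. (\<phi> n y)\<^sup>2 \<partial>P)"
 have v0: "0 <= v n" for n unfolding v_def by simp
 have intP: "integrable P (\<phi> n)" "integrable P (%y. (\<phi> n y)\<^sup>2)" for n
 proof -
  show "integrable P (\<phi> n)" using bound by (intro P.integrable_const_bound[of _ "B n"]) (auto simp: measurable_P)
  have "(\<phi> n y)\<^sup>2 <= (B n)\<^sup>2" for y using bound[of n y] by (rule abs_le_square_iff[THEN iffD1, OF order_trans]) simp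
  then show "integrable P (%y. (\<phi> n y)\<^sup>2)" by (intro P.integrable_const_bound[of _ "(B n)\<^sup>2"]) (auto simp: measurable_P)
 qed
 have B0: "0 <= B n" for n using bound[of n undefined] by linarith
 define e where "e = (%n. \<bar>t\<bar> ^ 3 / 6 * B n * (real n * v n) + (t\<^sup>2 * (real n * v n))\<^sup>2 / 8 * inverse (real n))"
 have e: "e \<longlonglongrightarrow> \<bar>t\<bar> ^ 3 / 6 * 0 * \<sigma>\<^sup>2 + (t\<^sup>2 * \<sigma>\<^sup>2)\<^sup>2 / 8 * 0"
  unfolding e_def v_def by (intro tendsto_intros B var lim_inverse_n) auto
 have char_S: "cmod (char (distr M borel (S n)) t - exp (- t\<^sup>2 * (real n * v n) / 2)) <= e n" for n
 proof -
  define c where "c = char (distr P borel (\<phi> n)) t"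
  have distr_eq: "distr M borel (%w. \<phi> n (Y i w)) = distr P borel (\<phi> n)" for i
   unfolding law[of i, symmetric] by (subst distr_distr) (auto simp: comp_def)
  have "char (distr M borel (S n)) t = (\<Prod>i<n. char (distr M borel (%w. \<phi> n (Y i w))) t)"
   unfolding S_def
   by (rule char_distr_sum, rule indep_vars_subset[of _ _ UNIV], rule indep_vars_compose2[OF indep]) auto
  then have S: "char (distr M borel (S n)) t = c ^ n" by (simp add: distr_eq c_def)
  have rd: "real_distribution (distr P borel (\<phi> n))"
   by (rule P.real_distribution_distr) (simp add: measurable_P)
  have c1: "cmod c <= 1" unfolding c_def by (rule real_distribution.cmod_char_le_1[OF rd])
  \<comment> \<open>Expansion of a characteristic function to third order. Since the row is bounded
    by \<open>B n\<close>, its third absolute moment is at most \<open>B n\<close> times the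
    variance.\<close>
  have "cmod (c - (1 - t\<^sup>2 * v n / 2)) <= (t\<^sup>2 / 6) * P.expectation (%y. min (6 * (\<phi> n y)\<^sup>2) (\<bar>t\<bar> * \<bar>\<phi> n y\<bar> ^ 3))"
   unfolding c_def by (rule P.char_approx3'[OF _ intP mean]) (auto simp: mean v_def measurable_P)
  also have "... <= (t\<^sup>2 / 6) * P.expectation (%y. \<bar>t\<bar> * B n * (\<phi> n y)\<^sup>2)"
  proof (rule mult_left_mono[OF integral_mono'])
   fix y
   have "\<bar>t\<bar> * \<bar>\<phi> n y\<bar> ^ 3 = \<bar>t\<bar> * \<bar>\<phi> n y\<bar> * (\<phi> n y)\<^sup>2"
    by (simp add: power3_eq_cube power2_eq_square mult.assoc flip: abs_mult)
   also have "... <= \<bar>t\<bar> * B n * (\<phi> n y)\<^sup>2"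
    using bound by (intro mult_right_mono mult_left_mono) auto
   finally show "min (6 * (\<phi> n y)\<^sup>2) (\<bar>t\<bar> * \<bar>\<phi> n y\<bar> ^ 3) <= \<bar>t\<bar> * B n * (\<phi> n y)\<^sup>2" by simp
  qed (use intP B0 in auto)
  also have "P.expectation (%y. \<bar>t\<bar> * B n * (\<phi> n y)\<^sup>2) = \<bar>t\<bar> * B n * v n" by (simp add: v_def)
  finally have 1: "cmod (c - (1 - t\<^sup>2 * v n / 2)) <= \<bar>t\<bar> ^ 3 / 6 * B n * v n"
   by (simp add: power3_eq_cube power2_eq_square mult_ac)
  have 2: "cmod ((1 - t\<^sup>2 * v n / 2) - exp (- (t\<^sup>2 * v n / 2))) <= (t\<^sup>2 * v n)\<^sup>2 / 8"
  proof -
   have "cmod (of_real ((1 - t\<^sup>2 * v n / 2) - exp (- (t\<^sup>2 * v n / 2)))) = \<bar>exp (- (t\<^sup>2 * v n / 2)) - (1 - t\<^sup>2 * v n / 2)\<bar>"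
    unfolding norm_of_real by simp
   also have "... <= (t\<^sup>2 * v n / 2)\<^sup>2 / 2" using v0[of n] by (intro exp_neg_quadratic_bound) auto
   finally show ?thesis by (simp add: power_divide exp_of_real)
  qed
  define d where "d = exp (- (t\<^sup>2 * v n / 2))"
  have d: "cmod (of_real d) <= 1" "(of_real d :: complex) ^ n = of_real (exp (- t\<^sup>2 * (real n * v n) / 2))"
   using v0[of n] by (auto simp: d_def simp flip: exp_of_nat_mult of_real_power)
  \<comment> \<open>Both bases lie in the closed unit disc, so the difference of the powers is at
    most \<open>n\<close> times the difference of the bases.\<close>
  have "cmod (c ^ n - of_real d ^ n) <= n * cmod (c - of_real d)"
   by (rule norm_power_diff[OF c1 d(1)])
  also have "cmod (c - of_real d) <= \<bar>t\<bar> ^ 3 / 6 * B n * v n + (t\<^sup>2 * v n)\<^sup>2 / 8"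
   using norm_triangle_mono[OF 1 2] by (simp add: d_def exp_of_real)
  also have "n * (\<bar>t\<bar> ^ 3 / 6 * B n * v n + (t\<^sup>2 * v n)\<^sup>2 / 8) = e n"
   by (cases "n = 0") (auto simp: e_def field_simps power2_eq_square)
  finally show ?thesis by (simp add: S d exp_of_real mult_left_mono)
 qed
 have lim: "(%n. of_real (exp (- t\<^sup>2 * (real n * v n) / 2)) :: complex) \<longlonglongrightarrow> of_real (exp (- t\<^sup>2 * \<sigma>\<^sup>2 / 2))"
  unfolding v_def by (intro tendsto_intros var) simp
 have "(%n. char (distr M borel (S n)) t - of_real (exp (- t\<^sup>2 * (real n * v n) / 2))) \<longlonglongrightarrow> 0"
  by (rule Lim_null_comparison[OF always_eventually[OF allI[OF char_S]]]) (use e in simp)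
 from tendsto_add[OF this lim]
 have S_lim: "(%n. char (distr M borel (S n)) t) \<longlonglongrightarrow> of_real (exp (- t\<^sup>2 * \<sigma>\<^sup>2 / 2))" by simp
 have "(%n. char (distr M borel (V n)) t - iexp (t * \<mu>) * char (distr M borel (S n)) t) \<longlonglongrightarrow> 0"
 proof (rule LIMSEQ_I)
  fix r :: real assume r: "0 < r"
  \<comment> \<open>On the likely event the two exponentials differ by at most
    \<open>\<bar>t\<bar> * \<epsilon>\<close>, hence by \<open>r / 4\<close>; off it, on an event of
    probability at most \<open>r / 8\<close>, by at most 2. The total stays below
    \<open>r\<close>.\<close>
  define \<epsilon> where "\<epsilon> = r / (4 * (\<bar>t\<bar> + 1))"
  have \<epsilon>: "\<epsilon> > 0" "\<bar>t\<bar> * \<epsilon> <= r / 4" using r by (auto simp: \<epsilon>_def field_simps)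
  have "LARGE n. \<exists>A\<in>sets M. prob A >= 1 - r / 8 \<and> (\<forall>w\<in>A. \<bar>V n w - (\<mu> + S n w)\<bar> <= \<epsilon>)"
   using near[OF \<epsilon>(1)] r unfolding with_prob_to_one_iff S_def by (auto elim!: allE[of _ "r / 8"])
  then have "LARGE n. cmod (char (distr M borel (V n)) t - iexp (t * \<mu>) * char (distr M borel (S n)) t) < r"
  proof eventually_elim
   case (elim n)
   then obtain A where A: "A \<in> events" "prob A >= 1 - r / 8" "\<And>w. w \<in> A ==> \<bar>V n w - (\<mu> + S n w)\<bar> <= \<epsilon>" by blast
   have int: "integrable M (%w. iexp (t * X w))" if "X \<in> borel_measurable M" for X
    using that by (intro integrable_iexp) auto
   have "char (distr M borel (V n)) t - iexp (t * \<mu>) * char (distr M borel (S n)) t =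
     (CLINT w|M. iexp (t * V n w)) - (CLINT w|M. iexp (t * (\<mu> + S n w)))"
    unfolding char_def
    by (simp add: integral_distr distrib_left exp_add flip: integral_mult_right_zero)
   also have "... = (CLINT w|M. iexp (t * V n w) - iexp (t * (\<mu> + S n w)))"
    by (intro Bochner_Integration.integral_diff[symmetric] int) auto
   also have "cmod ... <= (\<integral>w. cmod (iexp (t * V n w) - iexp (t * (\<mu> + S n w))) \<partial>M)"
    by (rule integral_norm_bound)
   also have "... <= (\<integral>w. r / 4 + 2 * indicator (space M - A) w \<partial>M)"
   proof (rule integral_mono)
    show "integrable M (%w. cmod (iexp (t * V n w) - iexp (t * (\<mu> + S n w))))"
     by (intro integrable_norm Bochner_Integration.integrable_diff int) auto
    show "integrable M (%w. r / 4 + 2 * indicator (space M - A) w)"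
     by (intro Bochner_Integration.integrable_add integrable_const integrable_mult_right
       integrable_real_indicator) (use A in \<open>auto simp: emeasure_eq_measure\<close>)
    fix w assume w: "w \<in> space M"
    show "cmod (iexp (t * V n w) - iexp (t * (\<mu> + S n w))) <= r / 4 + 2 * indicator (space M - A) w"
    proof (cases "w \<in> A")
     case True
     have "cmod (iexp (t * V n w) - iexp (t * (\<mu> + S n w))) <= \<bar>t * V n w - t * (\<mu> + S n w)\<bar>"
      by (rule iexp_diff_le)
     also have "... = \<bar>t\<bar> * \<bar>V n w - (\<mu> + S n w)\<bar>" by (simp add: right_diff_distrib flip: abs_mult)
     also have "... <= \<bar>t\<bar> * \<epsilon>" using A(3)[OF True] by (intro mult_left_mono) auto
     finally show ?thesis using \<epsilon> True by simp
    next
     case False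
     have "cmod (iexp (t * V n w) - iexp (t * (\<mu> + S n w))) <= 1 + 1"
      by (rule order_trans[OF norm_triangle_ineq4]) (simp add: norm_exp_i_times del: of_real_mult of_real_add flip: of_real_mult of_real_add)
     then show ?thesis using False w r by simp
    qed
   qed
   also have "... = r / 4 + 2 * prob (space M - A)"
    using A by (subst Bochner_Integration.integral_add)
     (auto simp: prob_space emeasure_eq_measure intro!: integrable_real_indicator)
   also have "... = r / 4 + 2 * (1 - prob A)" using A by (simp add: prob_compl)
   also have "... < r" using A r by simp
   finally show ?case .
  qed
  then show "\<exists>no. \<forall>n\<ge>no. cmod (char (distr M borel (V n)) t - iexp (t * \<mu>) * char (distr M borel (S n)) t - 0) < r"
   by (simp add: eventually_sequentially)
 qed
 from tendsto_add[OF this tendsto_mult_left[OF S_lim, of "iexp (t * \<mu>)"]]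
 show "(%n. char (distr M borel (V n)) t) \<longlonglongrightarrow> char (density lborel (normal_density \<mu> \<sigma>)) t"
  by (simp add: char_normal_distribution[OF \<sigma>] power_mult_distrib)
qed

end

section \<open>The law of one observation\<close>

lemma borel_measurable_fst' [measurable]:
 "(fst :: 'a::second_countable_topology \<times> 'b::second_countable_topology => 'a) \<in> borel \<rightarrow>\<^sub>M borel"
 by (simp flip: borel_prod)

lemma borel_measurable_snd' [measurable]:
 "(snd :: 'a::second_countable_topology \<times> 'b::second_countable_topology => 'b) \<in> borel \<rightarrow>\<^sub>M borel"
 by (simp flip: borel_prod)

lemma borel_measurable_Pair' [measurable (raw)]:
 fixes f :: "'c => 'a::second_countable_topology" and g :: "'c => 'b::second_countable_topology"
 shows "f \<in> borel_measurable M ==> g \<in> borel_measurable M ==> (%x. (f x, g x)) \<in> borel_measurable M"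
 unfolding borel_prod[symmetric] by (rule measurable_Pair)

text \<open>\<open>joint_law\<close> is given on measurable rectangles only; this generator lets it
  be extended to all Borel sets of triples by uniqueness of measures.\<close>

lemma sets_borel_triple:
 "sets (borel :: ('a::second_countable_topology \<times> 'b::second_countable_topology \<times> 'c::second_countable_topology) measure) =
  sigma_sets UNIV {A \<times> B \<times> D | A B D. A \<in> sets borel \<and> B \<in> sets borel \<and> D \<in> sets borel}"
 (is "_ = sigma_sets UNIV ?E")
proof
 let ?S = "sigma UNIV ?E"
 have rect: "A \<times> B \<times> D \<in> sets ?S" if "A \<in> sets borel" "B \<in> sets borel" "D \<in> sets borel" for A B D
  using that by (auto intro!: sigma_sets.Basic)
 have "(%p. fst p) \<in> borel_measurable ?S"
 proof (rule measurableI)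
  fix A :: "'a set" assume "A \<in> sets borel"
  moreover have "fst -` A = A \<times> (UNIV::'b set) \<times> (UNIV::'c set)" by auto
  ultimately show "fst -` A \<inter> space ?S \<in> sets ?S" using rect[of A UNIV UNIV] by simp
 qed simp
 moreover have "(%p. fst (snd p)) \<in> borel_measurable ?S"
 proof (rule measurableI)
  fix A :: "'b set" assume "A \<in> sets borel"
  moreover have "(%p. fst (snd p)) -` A = (UNIV::'a set) \<times> A \<times> (UNIV::'c set)" by auto
  ultimately show "(%p. fst (snd p)) -` A \<inter> space ?S \<in> sets ?S" using rect[of UNIV A UNIV] by simp
 qed simp
 moreover have "(%p. snd (snd p)) \<in> borel_measurable ?S"
 proof (rule measurableI)
  fix A :: "'c set" assume "A \<in> sets borel"
  moreover have "(%p. snd (snd p)) -` A = (UNIV::'a set) \<times> (UNIV::'b set) \<times> A" by auto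
  ultimately show "(%p. snd (snd p)) -` A \<inter> space ?S \<in> sets ?S" using rect[of UNIV UNIV A] by simp
 qed simp
 ultimately have "(%p. (fst p, fst (snd p), snd (snd p))) \<in> borel_measurable ?S"
  by (intro borel_measurable_Pair')
 then have id: "(%p. p) \<in> borel_measurable ?S" by simp
 show "sets borel \<subseteq> sigma_sets UNIV ?E"
 proof
  fix X :: "('a \<times> 'b \<times> 'c) set" assume "X \<in> sets borel"
  from measurable_sets[OF id this] show "X \<in> sigma_sets UNIV ?E" by simp
 qed
 have "?E \<subseteq> sets borel"
  unfolding borel_prod[symmetric] by (auto intro!: pair_measureI)
 then show "sigma_sets UNIV ?E \<subseteq> sets borel"
  using sets.sigma_sets_subset[of ?E borel] by simp
qed

text \<open>Every point outside the support has a null ball around it, and by Lindelof countably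
  many such balls cover the complement of the support.\<close>

lemma AE_measure_support:
 assumes "prob_space \<mu>" and sets: "sets \<mu> = sets borel"
 shows "AE x in \<mu>. x \<in> measure_support \<mu>"
proof -
 interpret prob_space \<mu> by fact
 let ?F = "{ball x e | x e. e > 0 \<and> measure \<mu> (ball x e) = 0}"
 obtain F where F: "F \<subseteq> ?F" "countable F" "\<Union>F = \<Union>?F"
  by (rule Lindelof[of ?F]) auto
 have "(\<Union>S\<in>F. S) \<in> null_sets \<mu>"
  using F by (intro null_sets_UN') (auto simp: null_sets_def sets emeasure_eq_measure)
 moreover have "{x \<in> space \<mu>. x \<notin> measure_support \<mu>} \<subseteq> \<Union>?F"
 proof
  fix x assume "x \<in> {x \<in> space \<mu>. x \<notin> measure_support \<mu>}"
  then obtain e where e: "e > 0" "\<not> measure \<mu> (ball x e) > 0" by (auto simp: measure_support_def)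
  then have "measure \<mu> (ball x e) = 0" using measure_nonneg[of \<mu> "ball x e"] by linarith
  with e show "x \<in> \<Union>?F" by (intro UnionI[of "ball x e"]) auto
 qed
 ultimately show ?thesis using F(3) by (intro AE_I'[of "\<Union>F"]) auto
qed

lemma AE_le_right_endpoint:
 assumes "prob_space \<mu>" "sets \<mu> = sets borel" "right_endpoint \<mu> = ereal \<tau>"
 shows "AE x in \<mu>. x <= \<tau>"
 using AE_measure_support[OF assms(1,2)]
proof eventually_elim
 case (elim x)
 then have "ereal x <= right_endpoint \<mu>" unfolding right_endpoint_def by (rule SUP_upper)
 then show ?case using assms(3) by simp
qed

text \<open>Some support point lies above \<open>s\<close>, and the ball around it that reaches down
  to \<open>s\<close> has positive measure.\<close>

lemma measure_gt_pos_below_right_endpoint: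
 assumes "prob_space \<mu>" "sets \<mu> = sets borel" "ereal s < right_endpoint \<mu>"
 shows "measure \<mu> {s<..} > 0"
proof -
 interpret prob_space \<mu> by fact
 obtain x where x: "x \<in> measure_support \<mu>" "s < x"
  using assms(3) unfolding right_endpoint_def less_SUP_iff by auto
 then have "0 < measure \<mu> (ball x (x - s))" unfolding measure_support_def by auto
 also have "... <= measure \<mu> {s<..}"
  using assms(2) by (intro finite_measure_mono) (auto simp: dist_real_def)
 finally show ?thesis .
qed

text \<open>The hazard identity is silent where the conditional survival function vanishes, so the
  density must be shown to vanish there separately. The set \<open>S\<close> is closed upwards: it
  consists of countably many half-lines that start at rational points of \<open>S\<close>, all null,
  and at most one further point, its least element.\<close>

lemma AE_lborel_survival_zero:
 fixes p :: "real => real"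
 assumes [measurable]: "p \<in> borel_measurable borel" and p1: "(\<integral>\<^sup>+x. ennreal (p x) \<partial>lborel) = 1"
  and p0: "\<And>x. 0 <= p x"
 shows "AE s in lborel. emeasure (density lborel p) {s..} = 0 --> p s = 0"
proof -
 let ?D = "density lborel p"
 define S where "S = {s. emeasure ?D {s..} = 0}"
 have "(\<Union>q\<in>S \<inter> \<rat>. {q..}) \<in> null_sets ?D"
  by (intro null_sets_UN') (auto simp: S_def null_sets_def countable_rat intro: countable_subset[OF _ countable_rat])
 moreover have "{s. s \<in> S \<and> (\<forall>t<s. t \<notin> S)} \<in> null_sets ?D"
 proof -
  have dis: "{s. s \<in> S \<and> (\<forall>t<s. t \<notin> S)} = {} \<or> (\<exists>s. {s. s \<in> S \<and> (\<forall>t<s. t \<notin> S)} = {s})"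
  proof (cases "\<exists>s. s \<in> S \<and> (\<forall>t<s. t \<notin> S)")
   case True
   then obtain s where s: "s \<in> S" "\<forall>t<s. t \<notin> S" by blast
   then have "t = s" if "t \<in> S" "\<forall>u<t. u \<notin> S" for t
    using that by (cases s t rule: linorder_cases) auto
   with s show ?thesis by blast
  qed blast
  have nul: "{s} \<in> null_sets ?D" for s
  proof -
   have "AE x in lborel. x \<in> {s} --> ennreal (p x) = 0"
    using AE_lborel_singleton[of s] by eventually_elim simp
   then show ?thesis by (subst null_sets_density_iff) simp_all
  qed
  from dis show ?thesis
  proof
   assume eq: "{s. s \<in> S \<and> (\<forall>t<s. t \<notin> S)} = {}"
   show ?thesis unfolding eq by simp
  next
   assume "\<exists>s. {s. s \<in> S \<and> (\<forall>t<s. t \<notin> S)} = {s}"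
   then obtain s where eq: "{s. s \<in> S \<and> (\<forall>t<s. t \<notin> S)} = {s}" ..
   show ?thesis unfolding eq by (rule nul)
  qed
 qed
 ultimately have null: "(\<Union>q\<in>S \<inter> \<rat>. {q..}) \<union> {s. s \<in> S \<and> (\<forall>t<s. t \<notin> S)} \<in> null_sets ?D"
  by (rule null_sets.Un)
 have up: "t \<in> S" if "s \<in> S" "s <= t" for s t
  using that emeasure_mono[of "{t..}" "{s..}" ?D] by (auto simp: S_def)
 have "S \<subseteq> (\<Union>q\<in>S \<inter> \<rat>. {q..}) \<union> {s. s \<in> S \<and> (\<forall>t<s. t \<notin> S)}"
 proof
  fix s assume s: "s \<in> S"
  show "s \<in> (\<Union>q\<in>S \<inter> \<rat>. {q..}) \<union> {s. s \<in> S \<and> (\<forall>t<s. t \<notin> S)}"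
  proof (cases "\<forall>t<s. t \<notin> S")
   case False
   then obtain t where "t < s" "t \<in> S" by blast
   then obtain q where "q \<in> \<rat>" "t < q" "q < s" using Rats_dense_in_real by blast
   then show ?thesis using up[OF \<open>t \<in> S\<close>, of q] by (intro UnI1 UN_I[of q]) auto
  qed (use s in auto)
 qed
 then have "AE s in ?D. s \<notin> S" by (intro AE_I'[OF null]) auto
 then have "AE s in lborel. 0 < p s --> s \<notin> S" by (subst (asm) AE_density) auto
 then show ?thesis
 proof eventually_elim
  case (elim s)
  then show ?case using p0[of s] by (auto simp: S_def)
 qed
qed

text \<open>The assumption
  \<open>compensation\<close> says that, under the law of one observation, the compensator of the
  counting process \<open>\<Delta> 1{T \<le> s}\<close> has intensity \<open>1{s \<le> T} exp (\<beta>\<^sub>0 \<bullet> Z) \<lambda>\<^sub>0 s\<close>.\<close>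

locale cox_observation = prob_space P
 for P :: "('p::finite) obs measure" +
 fixes lam0 :: "real => real" and beta0 :: "real ^ 'p" and tauH :: real
 assumes sets_P: "sets P = sets borel"
  and tauH_pos: "0 < tauH"
  and Delta_AE: "AE (t, \<delta>, z) in P. \<delta> = 0 \<or> \<delta> = 1"
  and T_AE: "AE (t, \<delta>, z) in P. 0 < t \<and> t <= tauH"
  and T_tail: "\<And>s. s < tauH ==> prob {y. s <= fst y} > 0"
  and lam0_nonneg: "\<And>s. s \<in> {0..tauH} ==> 0 <= lam0 s"
  and lam0_cont: "continuous_on {0..tauH} lam0"
  and envelope: "\<exists>\<epsilon>>0. integrable P (%(t, \<delta>, z). (exp (beta0 \<bullet> z + \<epsilon> * norm z))\<^sup>2)"
  and compensation: "\<And>\<phi> :: real \<times> (real ^ 'p) => ennreal. \<phi> \<in> borel_measurable borel ==>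
   (\<integral>\<^sup>+(t, \<delta>, z). of_bool (\<delta> = 1) * \<phi> (t, z) \<partial>P) =
   (\<integral>\<^sup>+s\<in>{0..tauH}. ennreal (lam0 s) *
     (\<integral>\<^sup>+(t, \<delta>, z). of_bool (s <= t) * ennreal (exp (beta0 \<bullet> z)) * \<phi> (s, z) \<partial>P) \<partial>lborel)"

section \<open>Joint law of event time, censoring time and covariate\<close>

context cox_model
begin

declare X_rv [measurable] C_rv [measurable] Z_rv [measurable]

lemma f_meas [measurable (raw)]:
 "u \<in> borel_measurable L ==> v \<in> borel_measurable L ==> (%w. f (u w) (v w)) \<in> borel_measurable L"
 using measurable_compose[OF borel_measurable_Pair'[of u L v] f_measurable] by simp

lemma g_meas [measurable (raw)]:
 "u \<in> borel_measurable L ==> v \<in> borel_measurable L ==> (%w. g (u w) (v w)) \<in> borel_measurable L"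
 using measurable_compose[OF borel_measurable_Pair'[of u L v] g_measurable] by simp

abbreviation "LZ \<equiv> distr N borel Z"

lemma prob_f: "prob_space (density lborel (f z))" and prob_g: "prob_space (density lborel (g z))"
 using f_density[of z] g_density[of z] by (auto intro!: prob_spaceI simp: emeasure_density)

lemma sets_lborel_LZ: "sets (lborel \<Otimes>\<^sub>M LZ) = sets (borel :: (real \<times> (real ^ 'p)) measure)"
 unfolding borel_prod[symmetric] by (intro sets_pair_measure_cong) auto

text \<open>The two laws agree on rectangles by \<open>joint_law\<close>, hence on all Borel sets;
  conditional independence shows as the product of the two conditional densities.\<close>

lemma nn_integral_joint:
 assumes [measurable]: "h \<in> borel_measurable borel"
 shows "(\<integral>\<^sup>+w. h (X w, C w, Z w) \<partial>N) =
  (\<integral>\<^sup>+z. (\<integral>\<^sup>+x. (\<integral>\<^sup>+c. h (x, c, z) * (ennreal (f z x) * ennreal (g z c)) \<partial>lborel) \<partial>lborel) \<partial>LZ)"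
proof -
 interpret LZ: prob_space LZ by (rule prob_space_distr) measurable
 interpret L: pair_sigma_finite lborel LZ
  by (intro pair_sigma_finite.intro sigma_finite_lborel LZ.sigma_finite_measure_axioms)
 have Q: "sigma_finite_measure (lborel \<Otimes>\<^sub>M LZ)" ..
 define J where "J = distr N borel (%w. (X w, C w, Z w))"
 define J' where "J' = density (lborel \<Otimes>\<^sub>M (lborel \<Otimes>\<^sub>M LZ)) (%(x, c, z). ennreal (f z x) * ennreal (g z c))"
 have sets_prod: "sets (lborel \<Otimes>\<^sub>M (lborel \<Otimes>\<^sub>M LZ)) = sets (borel :: (real \<times> real \<times> (real ^ 'p)) measure)"
  unfolding borel_prod[symmetric] by (intro sets_pair_measure_cong) auto
 \<comment> \<open>The product measure lists the covariate last; Tonelli makes its integral the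
   outermost one, so that the inner integrals are conditional expectations given the
   covariate.\<close>
 have prod_int: "(\<integral>\<^sup>+y. k y \<partial>(lborel \<Otimes>\<^sub>M (lborel \<Otimes>\<^sub>M LZ))) =
   (\<integral>\<^sup>+z. (\<integral>\<^sup>+x. (\<integral>\<^sup>+c. k (x, c, z) \<partial>lborel) \<partial>lborel) \<partial>LZ)"
  if [measurable]: "k \<in> borel_measurable borel" for k :: "real \<times> real \<times> (real ^ 'p) => ennreal"
 proof -
  have k: "k \<in> borel_measurable (lborel \<Otimes>\<^sub>M (lborel \<Otimes>\<^sub>M LZ))"
   using that unfolding measurable_cong_sets[OF sets_prod refl] .
  have "(\<integral>\<^sup>+y. k y \<partial>(lborel \<Otimes>\<^sub>M (lborel \<Otimes>\<^sub>M LZ))) = (\<integral>\<^sup>+x. (\<integral>\<^sup>+q. k (x, q) \<partial>(lborel \<Otimes>\<^sub>M LZ)) \<partial>lborel)"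
   by (rule sigma_finite_measure.nn_integral_fst[OF Q k, symmetric])
  also have "... = (\<integral>\<^sup>+x. (\<integral>\<^sup>+z. (\<integral>\<^sup>+c. k (x, c, z) \<partial>lborel) \<partial>LZ) \<partial>lborel)"
  proof (rule nn_integral_cong)
   fix x
   have "(%q. k (x, q)) \<in> borel_measurable (lborel \<Otimes>\<^sub>M LZ)"
    unfolding measurable_cong_sets[OF sets_lborel_LZ refl] by measurable
   from L.nn_integral_snd[OF this]
   show "(\<integral>\<^sup>+q. k (x, q) \<partial>(lborel \<Otimes>\<^sub>M LZ)) = (\<integral>\<^sup>+z. (\<integral>\<^sup>+c. k (x, c, z) \<partial>lborel) \<partial>LZ)"
    by (simp add: case_prod_beta')
  qed
  also have "... = (\<integral>\<^sup>+z. (\<integral>\<^sup>+x. (\<integral>\<^sup>+c. k (x, c, z) \<partial>lborel) \<partial>lborel) \<partial>LZ)"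
   by (rule L.Fubini'[symmetric]) (simp add: case_prod_beta')
  finally show ?thesis .
 qed
 have dens: "(%(x, c, z). ennreal (f z x) * ennreal (g z c)) \<in> borel_measurable (lborel \<Otimes>\<^sub>M (lborel \<Otimes>\<^sub>M LZ))"
  unfolding measurable_cong_sets[OF sets_prod refl] case_prod_beta' by measurable
 let ?E = "{A \<times> B \<times> D | A B D. A \<in> sets borel \<and> B \<in> sets borel \<and> D \<in> sets borel} :: (real \<times> real \<times> (real ^ 'p)) set set"
 have "J = J'"
 proof (rule measure_eqI_generator_eq[where E = "?E" and \<Omega> = UNIV and A = "%_. UNIV"])
  show "Int_stable ?E"
  proof (rule Int_stableI)
   fix a b assume "a \<in> ?E" "b \<in> ?E"
   then obtain A B D A' B' D' where "a = A \<times> B \<times> D" "b = A' \<times> B' \<times> D'" 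
    "A \<in> sets borel" "B \<in> sets borel" "D \<in> sets borel" "A' \<in> sets borel" "B' \<in> sets borel" "D' \<in> sets borel"
    by blast
   then have "a \<inter> b = (A \<inter> A') \<times> (B \<inter> B') \<times> (D \<inter> D')" 
    "A \<inter> A' \<in> sets borel" "B \<inter> B' \<in> sets borel" "D \<inter> D' \<in> sets borel" by auto
   then show "a \<inter> b \<in> ?E" by blast
  qed
  show "sets J = sigma_sets UNIV ?E" unfolding J_def by (simp add: sets_borel_triple)
  show "sets J' = sigma_sets UNIV ?E" unfolding J'_def sets_density sets_prod by (rule sets_borel_triple)
  show "range (%_. UNIV) \<subseteq> ?E" by (auto intro!: exI[of _ UNIV])
  show "emeasure J UNIV \<noteq> \<infinity>" unfolding J_def by (subst emeasure_distr) auto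
  fix R assume "R \<in> ?E"
  then obtain A B D where R: "R = A \<times> B \<times> D" and [measurable]: "A \<in> sets borel" "B \<in> sets borel" "D \<in> sets borel"
   by auto
  have Rm: "R \<in> sets borel" unfolding R borel_prod[symmetric] by (intro pair_measureI) measurable
  have "emeasure J R = ennreal (prob {w \<in> space N. X w \<in> A \<and> C w \<in> B \<and> Z w \<in> D})"
   unfolding J_def using Rm
   by (subst emeasure_distr) (auto simp: R emeasure_eq_measure intro!: arg_cong[where f = prob])
  also have "... = ennreal (\<integral>z\<in>D. measure (density lborel (f z)) A * measure (density lborel (g z)) B \<partial>LZ)"
   by (subst joint_law) auto
  also have "... = (\<integral>\<^sup>+z. ennreal (indicator D z * (measure (density lborel (f z)) A * measure (density lborel (g z)) B)) \<partial>LZ)"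
   (is "_ = (\<integral>\<^sup>+z. ennreal (?k z) \<partial>LZ)")
  proof -
   have mf: "measure (density lborel (f z)) A = enn2real (\<integral>\<^sup>+x. ennreal (f z x) * indicator A x \<partial>lborel)"
    "measure (density lborel (g z)) B = enn2real (\<integral>\<^sup>+c. ennreal (g z c) * indicator B c \<partial>lborel)" for z
    unfolding measure_def by (subst emeasure_density; simp)+
   have "integrable LZ ?k"
   proof (rule LZ.integrable_const_bound[of _ 1])
    show "AE z in LZ. norm (?k z) <= 1"
     using prob_space.prob_le_1[OF prob_f] prob_space.prob_le_1[OF prob_g]
     by (auto simp: indicator_def abs_mult intro!: mult_le_one)
    show "?k \<in> borel_measurable LZ" unfolding mf by measurable
   qed
   then show ?thesis unfolding set_lebesgue_integral_def
    by (subst nn_integral_eq_integral) auto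
  qed
  also have "... = (\<integral>\<^sup>+z. indicator D z * ((\<integral>\<^sup>+x. ennreal (f z x) * indicator A x \<partial>lborel) * (\<integral>\<^sup>+c. ennreal (g z c) * indicator B c \<partial>lborel)) \<partial>LZ)"
  proof (rule nn_integral_cong)
   fix z
   have "ennreal (measure (density lborel (f z)) A) = (\<integral>\<^sup>+x. ennreal (f z x) * indicator A x \<partial>lborel)"
    "ennreal (measure (density lborel (g z)) B) = (\<integral>\<^sup>+c. ennreal (g z c) * indicator B c \<partial>lborel)"
    using finite_measure.emeasure_eq_measure[OF prob_space.finite_measure[OF prob_f], of z A]
     finite_measure.emeasure_eq_measure[OF prob_space.finite_measure[OF prob_g], of z B]
    by (simp_all add: emeasure_density)
   then show "ennreal (indicator D z * (measure (density lborel (f z)) A * measure (density lborel (g z)) B)) =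
    indicator D z * ((\<integral>\<^sup>+x. ennreal (f z x) * indicator A x \<partial>lborel) * (\<integral>\<^sup>+c. ennreal (g z c) * indicator B c \<partial>lborel))"
    by (auto simp: ennreal_mult split: split_indicator)
  qed
  also have "... = (\<integral>\<^sup>+z. (\<integral>\<^sup>+x. (\<integral>\<^sup>+c. (ennreal (f z x) * ennreal (g z c)) * indicator R (x, c, z) \<partial>lborel) \<partial>lborel) \<partial>LZ)"
  proof (rule nn_integral_cong)
   fix z
   have "(\<integral>\<^sup>+x. (\<integral>\<^sup>+c. (ennreal (f z x) * ennreal (g z c)) * indicator R (x, c, z) \<partial>lborel) \<partial>lborel) =
    (\<integral>\<^sup>+x. (\<integral>\<^sup>+c. (indicator D z * (ennreal (f z x) * indicator A x)) * (ennreal (g z c) * indicator B c) \<partial>lborel) \<partial>lborel)"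
    by (intro nn_integral_cong) (auto simp: R split: split_indicator)
   also have "... = (\<integral>\<^sup>+x. (indicator D z * (\<integral>\<^sup>+c. ennreal (g z c) * indicator B c \<partial>lborel)) * (ennreal (f z x) * indicator A x) \<partial>lborel)"
    by (intro nn_integral_cong, subst nn_integral_cmult) (auto simp: mult_ac)
   also have "... = (indicator D z * (\<integral>\<^sup>+c. ennreal (g z c) * indicator B c \<partial>lborel)) * (\<integral>\<^sup>+x. ennreal (f z x) * indicator A x \<partial>lborel)"
    by (subst nn_integral_cmult) auto
   finally show "indicator D z * ((\<integral>\<^sup>+x. ennreal (f z x) * indicator A x \<partial>lborel) * (\<integral>\<^sup>+c. ennreal (g z c) * indicator B c \<partial>lborel)) =
     (\<integral>\<^sup>+x. (\<integral>\<^sup>+c. (ennreal (f z x) * ennreal (g z c)) * indicator R (x, c, z) \<partial>lborel) \<partial>lborel)"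
    by (simp add: mult_ac)
  qed
  also have "... = emeasure J' R"
  proof -
   have Rs: "R \<in> sets (lborel \<Otimes>\<^sub>M (lborel \<Otimes>\<^sub>M LZ))" using Rm unfolding sets_prod .
   show ?thesis
    unfolding J'_def emeasure_density[OF dens Rs]
    by (subst prod_int) (use Rm in \<open>auto simp: case_prod_beta'\<close>)
  qed
  finally show "emeasure J R = emeasure J' R" .
 qed auto
 have "(\<integral>\<^sup>+w. h (X w, C w, Z w) \<partial>N) = (\<integral>\<^sup>+y. h y \<partial>J)"
  unfolding J_def by (subst nn_integral_distr) auto
 also have "... = (\<integral>\<^sup>+y. (%(x, c, z). ennreal (f z x) * ennreal (g z c)) y * h y \<partial>(lborel \<Otimes>\<^sub>M (lborel \<Otimes>\<^sub>M LZ)))"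
  unfolding \<open>J = J'\<close> J'_def
  by (subst nn_integral_density[OF dens]) (use assms in \<open>simp_all only: measurable_cong_sets[OF sets_prod refl]\<close>)
 also have "... = (\<integral>\<^sup>+z. (\<integral>\<^sup>+x. (\<integral>\<^sup>+c. h (x, c, z) * (ennreal (f z x) * ennreal (g z c)) \<partial>lborel) \<partial>lborel) \<partial>LZ)"
  by (subst prod_int) (auto simp: case_prod_beta' mult.commute)
 finally show ?thesis .
qed

text \<open>Conditional survival functions, closed at \<open>s\<close> because an individual counts
  as at risk at time \<open>s\<close> when its observed time is at least \<open>s\<close>.\<close>

abbreviation "Fbar z s \<equiv> (\<integral>\<^sup>+x. ennreal (f z x) * indicator {s..} x \<partial>lborel)"
abbreviation "Gbar z s \<equiv> (\<integral>\<^sup>+c. ennreal (g z c) * indicator {s..} c \<partial>lborel)"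

lemma Fbar_meas [measurable (raw)]:
 assumes [measurable]: "u \<in> borel_measurable L" "v \<in> borel_measurable L"
 shows "(%w. Fbar (u w) (v w)) \<in> borel_measurable L"
 unfolding indicator_def of_bool_def atLeast_iff by measurable

lemma Gbar_meas [measurable (raw)]:
 assumes [measurable]: "u \<in> borel_measurable L" "v \<in> borel_measurable L"
 shows "(%w. Gbar (u w) (v w)) \<in> borel_measurable L"
 unfolding indicator_def of_bool_def atLeast_iff by measurable

lemma Fbar_cdf: "Fbar z s = ennreal (1 - cdf (density lborel (f z)) s)"
proof -
 interpret F: prob_space "density lborel (f z)" by (rule prob_f)
 have "F.prob {s} = 0"
 proof -
  have "AE x in lborel. x \<in> {s} --> ennreal (f z x) = 0"
   using AE_lborel_singleton[of s] by eventually_elim simp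
  then have "{s} \<in> null_sets (density lborel (f z))" by (subst null_sets_density_iff) simp_all
  then show ?thesis by (rule measure_eq_0_null_sets)
 qed
 moreover have "F.prob {s..} = F.prob {s} + F.prob {s<..}"
  by (subst F.finite_measure_Union[symmetric]) (auto intro!: arg_cong[where f = F.prob])
 moreover have "F.prob {s<..} = 1 - F.prob {..s}"
  using F.prob_compl[of "{..s}"] by (auto simp: Compl_eq_Diff_UNIV[symmetric])
 ultimately have "F.prob {s..} = 1 - cdf (density lborel (f z)) s" by (simp add: cdf_def)
 then have "emeasure (density lborel (f z)) {s..} = ennreal (1 - cdf (density lborel (f z)) s)"
  by (simp add: F.emeasure_eq_measure)
 then show ?thesis by (simp add: emeasure_density)
qed

lemma obs_map_meas [measurable]:
 "(%w. (min (X w) (C w), of_bool (X w <= C w) :: real, Z w)) \<in> borel_measurable N"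
 unfolding of_bool_def by measurable

lemma nn_integral_obs:
 "h \<in> borel_measurable borel ==>
  (\<integral>\<^sup>+y. h y \<partial>obs_law N X C Z) = (\<integral>\<^sup>+w. h (min (X w) (C w), of_bool (X w <= C w), Z w) \<partial>N)"
 unfolding obs_law_def by (subst nn_integral_distr) auto

lemma prob_space_LZ: "prob_space LZ" by (rule prob_space_distr) measurable

text \<open>Given the covariate and an event at time \<open>s\<close>, the chance of being
  uncensored is \<open>Gbar z s\<close>, by conditional independence.\<close>

lemma nn_integral_uncensored:
 assumes [measurable]: "\<phi> \<in> borel_measurable borel"
 shows "(\<integral>\<^sup>+w. indicator {X w..} (C w) * \<phi> (X w, Z w) \<partial>N) =
  (\<integral>\<^sup>+z. (\<integral>\<^sup>+s. \<phi> (s, z) * (ennreal (f z s) * Gbar z s) \<partial>lborel) \<partial>LZ)"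
proof -
 have [measurable]: "(%p. indicator {fst p..} (fst (snd p)) * \<phi> (fst p, snd (snd p))) \<in> borel_measurable borel"
  unfolding indicator_def of_bool_def atLeast_iff by measurable
 have "(\<integral>\<^sup>+w. indicator {X w..} (C w) * \<phi> (X w, Z w) \<partial>N) =
  (\<integral>\<^sup>+z. (\<integral>\<^sup>+s. (\<integral>\<^sup>+c. (indicator {s..} c * \<phi> (s, z)) * (ennreal (f z s) * ennreal (g z c)) \<partial>lborel) \<partial>lborel) \<partial>LZ)"
  using nn_integral_joint[of "%p. indicator {fst p..} (fst (snd p)) * \<phi> (fst p, snd (snd p))"] by simp
 also have "... = (\<integral>\<^sup>+z. (\<integral>\<^sup>+s. (\<integral>\<^sup>+c. (\<phi> (s, z) * ennreal (f z s)) * (ennreal (g z c) * indicator {s..} c) \<partial>lborel) \<partial>lborel) \<partial>LZ)"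
  by (intro nn_integral_cong) (simp add: mult_ac)
 also have "... = (\<integral>\<^sup>+z. (\<integral>\<^sup>+s. \<phi> (s, z) * (ennreal (f z s) * Gbar z s) \<partial>lborel) \<partial>LZ)"
  by (intro nn_integral_cong, subst nn_integral_cmult) (auto simp: mult_ac)
 finally show ?thesis .
qed

lemma nn_integral_at_risk:
 assumes [measurable]: "\<phi> \<in> borel_measurable borel"
 shows "(\<integral>\<^sup>+w. indicator {s..} (X w) * indicator {s..} (C w) * \<phi> (Z w) \<partial>N) =
  (\<integral>\<^sup>+z. \<phi> z * (Fbar z s * Gbar z s) \<partial>LZ)"
proof -
 have [measurable]: "(%p. indicator {s..} (fst p) * indicator {s..} (fst (snd p)) * \<phi> (snd (snd p)))
   \<in> borel_measurable (borel :: (real \<times> real \<times> (real ^ 'p)) measure)"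
  by measurable
 have "(\<integral>\<^sup>+w. indicator {s..} (X w) * indicator {s..} (C w) * \<phi> (Z w) \<partial>N) =
  (\<integral>\<^sup>+z. (\<integral>\<^sup>+x. (\<integral>\<^sup>+c. (indicator {s..} x * indicator {s..} c * \<phi> z) * (ennreal (f z x) * ennreal (g z c)) \<partial>lborel) \<partial>lborel) \<partial>LZ)"
  using nn_integral_joint[of "%p. indicator {s..} (fst p) * indicator {s..} (fst (snd p)) * \<phi> (snd (snd p))"] by simp
 also have "... = (\<integral>\<^sup>+z. (\<integral>\<^sup>+x. (\<integral>\<^sup>+c. (\<phi> z * (ennreal (f z x) * indicator {s..} x)) * (ennreal (g z c) * indicator {s..} c) \<partial>lborel) \<partial>lborel) \<partial>LZ)"
  by (intro nn_integral_cong) (simp add: mult_ac)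
 also have "... = (\<integral>\<^sup>+z. (\<integral>\<^sup>+x. (\<phi> z * Gbar z s) * (ennreal (f z x) * indicator {s..} x) \<partial>lborel) \<partial>LZ)"
  by (intro nn_integral_cong, subst nn_integral_cmult) (auto simp: mult_ac)
 also have "... = (\<integral>\<^sup>+z. \<phi> z * (Fbar z s * Gbar z s) \<partial>LZ)"
  by (intro nn_integral_cong, subst nn_integral_cmult) (auto simp: mult_ac)
 finally show ?thesis .
qed

text \<open>Conditional densities exclude atoms. With \<open>a = 0\<close> this makes the observed
  time strictly positive almost surely.\<close>

lemma AE_X_neq: "AE w in N. X w \<noteq> a" and AE_C_neq: "AE w in N. C w \<noteq> a"
proof -
 have "(\<integral>\<^sup>+w. indicator {a} (X w) \<partial>N) =
  (\<integral>\<^sup>+z. (\<integral>\<^sup>+x. (\<integral>\<^sup>+c. indicator {a} x * (ennreal (f z x) * ennreal (g z c)) \<partial>lborel) \<partial>lborel) \<partial>LZ)"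
  using nn_integral_joint[of "%p. indicator {a} (fst p)"] by simp
 also have "... = (\<integral>\<^sup>+z. (\<integral>\<^sup>+x. 0 \<partial>(lborel :: real measure)) \<partial>LZ)"
 proof (rule nn_integral_cong, rule nn_integral_cong_AE)
  show "AE x in lborel. (\<integral>\<^sup>+c. indicator {a} x * (ennreal (f z x) * ennreal (g z c)) \<partial>lborel) = 0" for z
   using AE_lborel_singleton[of a] by eventually_elim simp
 qed
 finally have "(\<integral>\<^sup>+w. indicator {a} (X w) \<partial>N) = 0" by simp
 then show "AE w in N. X w \<noteq> a" by (subst (asm) nn_integral_0_iff_AE) (auto simp: indicator_def)
 have "(\<integral>\<^sup>+w. indicator {a} (C w) \<partial>N) =
  (\<integral>\<^sup>+z. (\<integral>\<^sup>+x. (\<integral>\<^sup>+c. indicator {a} c * (ennreal (f z x) * ennreal (g z c)) \<partial>lborel) \<partial>lborel) \<partial>LZ)"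
  using nn_integral_joint[of "%p. indicator {a} (fst (snd p))"] by simp
 also have "... = (\<integral>\<^sup>+z. (\<integral>\<^sup>+x. (\<integral>\<^sup>+c. 0 \<partial>(lborel :: real measure)) \<partial>(lborel :: real measure)) \<partial>LZ)"
 proof (rule nn_integral_cong, rule nn_integral_cong, rule nn_integral_cong_AE)
  show "AE c in lborel. indicator {a} c * (ennreal (f z x) * ennreal (g z c)) = 0" for z x
   using AE_lborel_singleton[of a] by eventually_elim simp
 qed
 finally have "(\<integral>\<^sup>+w. indicator {a} (C w) \<partial>N) = 0" by simp
 then show "AE w in N. C w \<noteq> a" by (subst (asm) nn_integral_0_iff_AE) (auto simp: indicator_def)
qed

text \<open>Given the covariate, uncensored event times have density
  \<open>f z s * Gbar z s\<close>. The hazard identity writes \<open>f z s\<close> as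
  \<open>lam0 s * exp (beta0 \<bullet> z) * Fbar z s\<close>, and \<open>Fbar z s * Gbar z s\<close>
  is the conditional probability of being at risk at \<open>s\<close>.\<close>

lemma obs_compensation:
 assumes T_le: "AE w in N. min (X w) (C w) <= \<tau>"
  and nonneg: "\<And>s. s \<in> {0..\<tau>} ==> 0 <= lam0 s" and cont: "continuous_on {0..\<tau>} lam0"
  and [measurable]: "\<phi> \<in> borel_measurable borel"
 shows "(\<integral>\<^sup>+(t, \<delta>, z). of_bool (\<delta> = 1) * \<phi> (t, z) \<partial>obs_law N X C Z) =
   (\<integral>\<^sup>+s\<in>{0..\<tau>}. ennreal (lam0 s) *
     (\<integral>\<^sup>+(t, \<delta>, z). of_bool (s <= t) * ennreal (exp (beta0 \<bullet> z)) * \<phi> (s, z) \<partial>obs_law N X C Z) \<partial>lborel)"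
proof -
 interpret LZ: prob_space LZ by (rule prob_space_LZ)
 interpret L: pair_sigma_finite lborel LZ
  by (intro pair_sigma_finite.intro sigma_finite_lborel LZ.sigma_finite_measure_axioms)
 have lam: "(%s. indicator {0..\<tau>} s * lam0 s) \<in> borel_measurable borel"
  using borel_measurable_continuous_on_indicator[OF _ cont] by simp
 define l where "l s = ennreal (indicator {0..\<tau>} s * lam0 s)" for s
 have [measurable]: "l \<in> borel_measurable borel" unfolding l_def using lam by measurable
 have "(\<integral>\<^sup>+(t, \<delta>, z). of_bool (\<delta> = 1) * \<phi> (t, z) \<partial>obs_law N X C Z) =
   (\<integral>\<^sup>+w. of_bool (of_bool (X w <= C w) = (1::real)) * \<phi> (min (X w) (C w), Z w) \<partial>N)"
  by (subst nn_integral_obs) (auto simp: case_prod_beta' of_bool_def)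
 also have "... = (\<integral>\<^sup>+w. indicator {X w..} (C w) * \<phi> (X w, Z w) \<partial>N)"
  by (intro nn_integral_cong) (auto simp: indicator_def)
 also have "... = (\<integral>\<^sup>+z. (\<integral>\<^sup>+s. \<phi> (s, z) * (ennreal (f z s) * Gbar z s) \<partial>lborel) \<partial>LZ)"
  by (rule nn_integral_uncensored) measurable
 also have "... = (\<integral>\<^sup>+z. (\<integral>\<^sup>+s. l s * (ennreal (exp (beta0 \<bullet> z)) * \<phi> (s, z) * (Fbar z s * Gbar z s)) \<partial>lborel) \<partial>LZ)"
 proof (rule nn_integral_cong_AE)
  \<comment> \<open>Observed times do not exceed \<open>\<tau>\<close>, so the uncensored density
    vanishes almost everywhere off \<open>{0..\<tau>}\<close> and the hazard may be cut off
    there.\<close>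
  have "(\<integral>\<^sup>+w. indicator {X w..} (C w) * indicator (- {0..\<tau>}) (X w) \<partial>N) = (\<integral>\<^sup>+w. 0 \<partial>N)"
   by (rule nn_integral_cong_AE, use T_le X_nonneg in eventually_elim) (auto simp: indicator_def)
  then have "(\<integral>\<^sup>+z. (\<integral>\<^sup>+s. indicator (- {0..\<tau>}) s * (ennreal (f z s) * Gbar z s) \<partial>lborel) \<partial>LZ) = 0"
   using nn_integral_uncensored[of "%p. indicator (- {0..\<tau>}) (fst p)"] by simp
  then have "AE z in LZ. (\<integral>\<^sup>+s. indicator (- {0..\<tau>}) s * (ennreal (f z s) * Gbar z s) \<partial>lborel) = 0"
   by (subst (asm) nn_integral_0_iff_AE) auto
  then show "AE z in LZ. (\<integral>\<^sup>+s. \<phi> (s, z) * (ennreal (f z s) * Gbar z s) \<partial>lborel) =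
    (\<integral>\<^sup>+s. l s * (ennreal (exp (beta0 \<bullet> z)) * \<phi> (s, z) * (Fbar z s * Gbar z s)) \<partial>lborel)"
   using hazard
  proof eventually_elim
   case (elim z)
   from elim(1) have "AE s in lborel. indicator (- {0..\<tau>}) s * (ennreal (f z s) * Gbar z s) = 0"
    by (subst (asm) nn_integral_0_iff_AE) auto
   moreover have "AE s in lborel. Fbar z s = 0 --> f z s = 0"
    using AE_lborel_survival_zero[of "f z"] f_density[of z] f_nonneg[of z] by (simp add: emeasure_density)
   ultimately have "AE s in lborel. \<phi> (s, z) * (ennreal (f z s) * Gbar z s) =
     l s * (ennreal (exp (beta0 \<bullet> z)) * \<phi> (s, z) * (Fbar z s * Gbar z s))"
    using elim(2)
   proof eventually_elim
    case (elim s)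
    show ?case
    proof (cases "s \<in> {0..\<tau>}")
     case False
     then have "ennreal (f z s) * Gbar z s = 0" using elim(1) by (simp add: indicator_def)
     then show ?thesis using False by (simp add: l_def)
    next
     case True
     have "ennreal (f z s) = l s * ennreal (exp (beta0 \<bullet> z)) * Fbar z s"
     proof (cases "cdf (density lborel (f z)) s < 1")
      case c: True
      then have "f z s = (1 - cdf (density lborel (f z)) s) * (lam0 s * exp (beta0 \<bullet> z))"
       using elim(3) True by (simp add: field_simps)
      then show ?thesis using True c nonneg[OF True]
       by (simp add: Fbar_cdf l_def mult_ac flip: ennreal_mult')
     next
      case False
      then have "Fbar z s = 0" by (simp add: Fbar_cdf ennreal_neg)
      then show ?thesis using elim(2) by simp
     qed
     then show ?thesis by (simp add: mult_ac)
    qed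
   qed
   then show ?case by (rule nn_integral_cong_AE)
  qed
 qed
 also have "... = (\<integral>\<^sup>+s. (\<integral>\<^sup>+z. l s * (ennreal (exp (beta0 \<bullet> z)) * \<phi> (s, z) * (Fbar z s * Gbar z s)) \<partial>LZ) \<partial>lborel)"
  by (rule L.Fubini') (unfold measurable_cong_sets[OF sets_lborel_LZ refl] case_prod_beta', measurable)
 also have "... = (\<integral>\<^sup>+s. l s * (\<integral>\<^sup>+z. ennreal (exp (beta0 \<bullet> z)) * \<phi> (s, z) * (Fbar z s * Gbar z s) \<partial>LZ) \<partial>lborel)"
  by (intro nn_integral_cong nn_integral_cmult) measurable
 also have "... = (\<integral>\<^sup>+s. l s * (\<integral>\<^sup>+w. indicator {s..} (X w) * indicator {s..} (C w) * (ennreal (exp (beta0 \<bullet> Z w)) * \<phi> (s, Z w)) \<partial>N) \<partial>lborel)"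
  by (intro nn_integral_cong, subst nn_integral_at_risk) auto
 also have "... = (\<integral>\<^sup>+s\<in>{0..\<tau>}. ennreal (lam0 s) *
     (\<integral>\<^sup>+(t, \<delta>, z). of_bool (s <= t) * ennreal (exp (beta0 \<bullet> z)) * \<phi> (s, z) \<partial>obs_law N X C Z) \<partial>lborel)"
 proof (rule nn_integral_cong)
  fix s
  have "(\<integral>\<^sup>+(t, \<delta>, z). of_bool (s <= t) * ennreal (exp (beta0 \<bullet> z)) * \<phi> (s, z) \<partial>obs_law N X C Z) =
   (\<integral>\<^sup>+w. indicator {s..} (X w) * indicator {s..} (C w) * (ennreal (exp (beta0 \<bullet> Z w)) * \<phi> (s, Z w)) \<partial>N)"
   by (subst nn_integral_obs) (auto simp: case_prod_beta' of_bool_def indicator_def intro!: nn_integral_cong)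
  then show "l s * (\<integral>\<^sup>+w. indicator {s..} (X w) * indicator {s..} (C w) * (ennreal (exp (beta0 \<bullet> Z w)) * \<phi> (s, Z w)) \<partial>N) =
    ennreal (lam0 s) * (\<integral>\<^sup>+(t, \<delta>, z). of_bool (s <= t) * ennreal (exp (beta0 \<bullet> z)) * \<phi> (s, z) \<partial>obs_law N X C Z) * indicator {0..\<tau>} s"
   by (simp add: l_def indicator_def)
 qed
 finally show ?thesis .
qed

text \<open>A negative value at \<open>s0\<close> would by monotonicity make the hazard negative on
  all of \<open>{0..s0}\<close>. The hazard quotient is nonnegative wherever the conditional
  distribution function is below 1, so that function would reach 1 within \<open>{0..s0}\<close> for
  almost every covariate, and the event time could not exceed \<open>\<tau>\<close>. The value at 0
  follows by continuity.\<close>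

lemma lam0_nonneg_on:
 assumes tauF: "ereal \<tau> < right_endpoint (distr N borel X)"
  and cont: "continuous_on {0..\<tau>} lam0" and \<tau>: "0 < \<tau>" and s: "s \<in> {0..\<tau>}"
 shows "0 <= lam0 s"
proof -
 have pos: "0 <= lam0 s0" if s0: "0 < s0" "s0 <= \<tau>" for s0
 proof (rule ccontr)
  assume neg: "\<not> 0 <= lam0 s0"
  have neg': "lam0 s < 0" if "s \<in> {0..s0}" for s
  proof -
   have "lam0 s <= lam0 s0"
    using that s0 by (intro mono_onD[OF lam0_mono]) (auto intro: le_less_trans[OF _ tauF])
   then show ?thesis using neg by simp
  qed
  interpret LZ: prob_space LZ by (rule prob_space_LZ)
  have "AE z in LZ. Fbar z \<tau> = 0"
   using hazard
  proof eventually_elim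
   case (elim z)
   have "\<exists>s\<in>{0..s0}. \<not> cdf (density lborel (f z)) s < 1"
   proof (rule ccontr)
    assume *: "\<not> ?thesis"
    have "AE s in lborel. s \<notin> {0..s0}"
     using elim
    proof eventually_elim
     case (elim s)
     show ?case
     proof
      assume s: "s \<in> {0..s0}"
      then have c: "cdf (density lborel (f z)) s < 1" using * by blast
      then have "f z s / (1 - cdf (density lborel (f z)) s) < 0"
       using elim s neg'[OF s] by (simp add: mult_neg_pos)
      moreover have "f z s / (1 - cdf (density lborel (f z)) s) >= 0"
       using c f_nonneg[of z s] by simp
      ultimately show False by simp
     qed
    qed
    then have "emeasure lborel {0..s0} = 0"
     by (subst (asm) AE_iff_measurable[where N = "{0..s0}"]) auto
    then show False using s0 by simp
   qed
   then obtain s where s: "s \<in> {0..s0}" "\<not> cdf (density lborel (f z)) s < 1" by blast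
   have "Fbar z \<tau> <= Fbar z s"
    using s s0 by (intro nn_integral_mono) (auto split: split_indicator)
   also have "Fbar z s = 0" using s by (simp add: Fbar_cdf ennreal_neg)
   finally show ?case by simp
  qed
  then have z0: "(\<integral>\<^sup>+z. 1 * (Fbar z \<tau> * 1) \<partial>LZ) = (\<integral>\<^sup>+z. 0 \<partial>LZ)"
   by (intro nn_integral_cong_AE) auto
  have "emeasure N {w \<in> space N. \<tau> < X w} = (\<integral>\<^sup>+w. indicator {\<tau><..} (X w) \<partial>N)"
  proof -
   have "(\<integral>\<^sup>+w. indicator {\<tau><..} (X w) \<partial>N) = (\<integral>\<^sup>+w. indicator {w \<in> space N. \<tau> < X w} w \<partial>N)"
    by (intro nn_integral_cong) (auto split: split_indicator)
   then show ?thesis by simp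
  qed
  also have "... = (\<integral>\<^sup>+z. (\<integral>\<^sup>+x. (\<integral>\<^sup>+c. indicator {\<tau><..} x * (ennreal (f z x) * ennreal (g z c)) \<partial>lborel) \<partial>lborel) \<partial>LZ)"
   using nn_integral_joint[of "%p. indicator {\<tau><..} (fst p)"] by simp
  also have "... <= (\<integral>\<^sup>+z. (\<integral>\<^sup>+x. (\<integral>\<^sup>+c. (ennreal (f z x) * indicator {\<tau>..} x) * ennreal (g z c) \<partial>lborel) \<partial>lborel) \<partial>LZ)"
   by (intro nn_integral_mono) (auto split: split_indicator)
  also have "... = (\<integral>\<^sup>+z. (\<integral>\<^sup>+x. (ennreal (f z x) * indicator {\<tau>..} x) * 1 \<partial>lborel) \<partial>LZ)"
   by (intro nn_integral_cong, subst nn_integral_cmult) (auto simp: g_density)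
  also have "... = 0" using z0 by simp
  finally have "measure N {w \<in> space N. \<tau> < X w} = 0" by (simp add: measure_def)
  moreover have "measure (distr N borel X) {\<tau><..} > 0"
   by (rule measure_gt_pos_below_right_endpoint[OF _ _ tauF]) (auto intro!: prob_space_distr)
  ultimately show False by (simp add: measure_distr vimage_def Int_def conj_commute)
 qed
 show ?thesis
 proof (cases "s = 0")
  case True
  have "continuous_on {0..\<tau>} lam0" by (rule cont)
  then have "(lam0 \<longlongrightarrow> lam0 0) (at_right 0)"
   using \<tau> by (intro continuous_on_Icc_at_rightD) auto
  moreover have "\<forall>\<^sub>F s in at_right 0. 0 <= lam0 s"
   unfolding eventually_at_right_field using pos \<tau> by (intro exI[of _ \<tau>]) auto
  ultimately have "0 <= lam0 0" by (rule tendsto_lowerbound) simp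
  then show ?thesis using True by simp
 qed (use s pos in auto)
qed

text \<open>The moment condition concerns linear exponents, the envelope contains
  \<open>norm (Z w)\<close>. Some coordinate carries at least the fraction
  \<open>1 / CARD('p)\<close> of the norm, so one of the finitely many shifts of
  \<open>beta0\<close> by \<open>\<epsilon>\<close> along a coordinate axis, in either direction,
  dominates. For \<open>norm (Z w) <= 1\<close> the constant \<open>K\<close> suffices; otherwise
  the factor \<open>(norm (Z w))\<^sup>2\<close> is at least 1.\<close>

lemma envelope_finite:
 assumes moment: "\<exists>\<epsilon>>0. (SUP \<beta>\<in>cball beta0 \<epsilon>.
     \<integral>\<^sup>+ w. ennreal ((norm (Z w))\<^sup>2 * exp (2 * (\<beta> \<bullet> Z w))) \<partial>N) < \<infinity>"
 shows "\<exists>\<epsilon>>0. (\<integral>\<^sup>+w. ennreal ((exp (beta0 \<bullet> Z w + \<epsilon> * norm (Z w)))\<^sup>2) \<partial>N) < \<infinity>"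
proof -
 obtain \<epsilon> where \<epsilon>: "\<epsilon> > 0" "(SUP \<beta>\<in>cball beta0 \<epsilon>.
     \<integral>\<^sup>+ w. ennreal ((norm (Z w))\<^sup>2 * exp (2 * (\<beta> \<bullet> Z w))) \<partial>N) < \<infinity>" using moment by blast
 define \<epsilon>' where "\<epsilon>' = \<epsilon> / real CARD('p)"
 have card: "0 < real CARD('p)" by simp
 have \<epsilon>': "\<epsilon>' > 0" using \<epsilon>(1) card by (simp add: \<epsilon>'_def)
 define \<beta> where "\<beta> k r = beta0 + (r * \<epsilon>) *\<^sub>R axis k (1::real)" for k :: 'p and r :: real
 define I where "I k r w = (norm (Z w))\<^sup>2 * exp (2 * (\<beta> k r \<bullet> Z w))" for k :: 'p and r w
 have fin: "(\<integral>\<^sup>+w. ennreal (I k r w) \<partial>N) < \<infinity>" if "\<bar>r\<bar> = 1" for k r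
 proof -
  have "\<beta> k r \<in> cball beta0 \<epsilon>" using that \<epsilon>(1) by (simp add: \<beta>_def dist_norm abs_mult)
  then have "(\<integral>\<^sup>+w. ennreal (I k r w) \<partial>N) <= (SUP \<beta>\<in>cball beta0 \<epsilon>.
     \<integral>\<^sup>+ w. ennreal ((norm (Z w))\<^sup>2 * exp (2 * (\<beta> \<bullet> Z w))) \<partial>N)"
   unfolding I_def by (rule SUP_upper)
  then show ?thesis using \<epsilon>(2) by (rule le_less_trans)
 qed
 define K where "K = exp (2 * (norm beta0 + \<epsilon>'))"
 have pointwise: "(exp (beta0 \<bullet> Z w + \<epsilon>' * norm (Z w)))\<^sup>2 <= K + (\<Sum>k\<in>UNIV. I k 1 w + I k (-1) w)" for w
 proof (cases "norm (Z w) <= 1")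
  case True
  have "beta0 \<bullet> Z w <= norm beta0 * norm (Z w)" by (rule norm_cauchy_schwarz)
  also have "... <= norm beta0 * 1" using True by (intro mult_left_mono) auto
  finally have "beta0 \<bullet> Z w + \<epsilon>' * norm (Z w) <= norm beta0 + \<epsilon>'"
   using True \<epsilon>' mult_left_mono[of "norm (Z w)" 1 \<epsilon>'] by linarith
  then have "(exp (beta0 \<bullet> Z w + \<epsilon>' * norm (Z w)))\<^sup>2 <= K"
   by (simp add: K_def flip: exp_double)
  also have "... <= K + (\<Sum>k\<in>UNIV. I k 1 w + I k (-1) w)"
   by (auto simp: I_def intro!: sum_nonneg)
  finally show ?thesis .
 next
  case False
  have "\<exists>k. norm (Z w) / real CARD('p) <= \<bar>Z w $ k\<bar>"
  proof (rule ccontr)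
   assume "\<not> ?thesis"
   then have "(\<Sum>k\<in>UNIV. \<bar>Z w $ k\<bar>) < (\<Sum>k\<in>(UNIV::'p set). norm (Z w) / real CARD('p))"
    by (intro sum_strict_mono) (auto simp: not_le)
   then show False using norm_le_l1_cart[of "Z w"] by simp
  qed
  then obtain k where k: "norm (Z w) / real CARD('p) <= \<bar>Z w $ k\<bar>" by blast
  define r where "r = (if Z w $ k >= 0 then 1 else - 1 :: real)"
  have r: "r * Z w $ k = \<bar>Z w $ k\<bar>" by (simp add: r_def)
  have "beta0 \<bullet> Z w + \<epsilon>' * norm (Z w) <= beta0 \<bullet> Z w + \<epsilon> * \<bar>Z w $ k\<bar>"
   using mult_left_mono[OF k, of \<epsilon>] \<epsilon>(1) by (simp add: \<epsilon>'_def)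
  also have "... = \<beta> k r \<bullet> Z w"
   unfolding \<beta>_def inner_add_left inner_scaleR_left inner_axis' r[symmetric] by simp
  finally have "(exp (beta0 \<bullet> Z w + \<epsilon>' * norm (Z w)))\<^sup>2 <= exp (2 * (\<beta> k r \<bullet> Z w))"
   by (simp flip: exp_double)
  also have "... <= I k r w"
   using False one_le_power[of "norm (Z w)" 2] unfolding I_def by (simp add: mult_le_cancel_right1)
  also have "... <= I k 1 w + I k (-1) w" by (auto simp: r_def I_def)
  also have "... <= (\<Sum>k\<in>UNIV. I k 1 w + I k (-1) w)"
   by (rule member_le_sum) (auto simp: I_def)
  finally show ?thesis by (simp add: K_def add_increasing)
 qed
 have [measurable]: "I k r \<in> borel_measurable N" for k r unfolding I_def by measurable
 have I0: "0 <= I k r w" for k r w by (simp add: I_def)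
 have "(\<integral>\<^sup>+w. ennreal ((exp (beta0 \<bullet> Z w + \<epsilon>' * norm (Z w)))\<^sup>2) \<partial>N) \<le>
  (\<integral>\<^sup>+w. ennreal K + (\<Sum>k\<in>UNIV. ennreal (I k 1 w) + ennreal (I k (-1) w)) \<partial>N)"
 proof (rule nn_integral_mono)
  fix w
  have "ennreal (K + (\<Sum>k\<in>UNIV. I k 1 w + I k (-1) w)) =
    ennreal K + ennreal (\<Sum>k\<in>UNIV. I k 1 w + I k (-1) w)"
   by (rule ennreal_plus) (auto simp: K_def intro!: sum_nonneg add_nonneg_nonneg I0)
  also have "ennreal (\<Sum>k\<in>UNIV. I k 1 w + I k (-1) w) = (\<Sum>k\<in>UNIV. ennreal (I k 1 w + I k (-1) w))"
   by (rule sum_ennreal[symmetric]) (auto intro!: add_nonneg_nonneg I0)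
  also have "... = (\<Sum>k\<in>UNIV. ennreal (I k 1 w) + ennreal (I k (-1) w))"
   by (intro sum.cong refl ennreal_plus I0)
  finally have "ennreal (K + (\<Sum>k\<in>UNIV. I k 1 w + I k (-1) w)) =
    ennreal K + (\<Sum>k\<in>UNIV. ennreal (I k 1 w) + ennreal (I k (-1) w))" .
  then show "ennreal ((exp (beta0 \<bullet> Z w + \<epsilon>' * norm (Z w)))\<^sup>2) \<le>
   ennreal K + (\<Sum>k\<in>UNIV. ennreal (I k 1 w) + ennreal (I k (-1) w))"
   using ennreal_leI[OF pointwise[of w]] by simp
 qed
 also have "... = ennreal K + (\<Sum>k\<in>UNIV. (\<integral>\<^sup>+w. ennreal (I k 1 w) \<partial>N) + (\<integral>\<^sup>+w. ennreal (I k (-1) w) \<partial>N))"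
  by (simp add: nn_integral_add nn_integral_sum emeasure_space_1)
 also have "... < \<infinity>" using fin by (simp add: less_top ennreal_add_eq_top)
 finally show ?thesis using \<epsilon>' by blast
qed

lemma cox_observation_obs_law:
 assumes tauH: "right_endpoint (distr N borel (%w. min (X w) (C w))) = ereal \<tau>"
  and tauF: "ereal \<tau> < right_endpoint (distr N borel X)"
  and moment: "\<exists>\<epsilon>>0. (SUP \<beta>\<in>cball beta0 \<epsilon>.
     \<integral>\<^sup>+ w. ennreal ((norm (Z w))\<^sup>2 * exp (2 * (\<beta> \<bullet> Z w))) \<partial>N) < \<infinity>"
  and cont: "continuous_on {0..\<tau>} lam0" and \<tau>: "0 < \<tau>"
 shows "cox_observation (obs_law N X C Z) lam0 beta0 \<tau>"
proof (rule cox_observation.intro)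
 let ?P = "obs_law N X C Z"
 show "prob_space ?P" unfolding obs_law_def by (rule prob_space_distr) measurable
 have T_law: "prob_space (distr N borel (%w. min (X w) (C w)))"
  by (rule prob_space_distr) measurable
 have "AE t in distr N borel (%w. min (X w) (C w)). t <= \<tau>"
  by (rule AE_le_right_endpoint[OF T_law _ tauH]) simp
 then have T_le: "AE w in N. min (X w) (C w) <= \<tau>" by (subst (asm) AE_distr_iff) auto
 note nonneg = lam0_nonneg_on[OF tauF cont \<tau>]
 show "cox_observation_axioms ?P lam0 beta0 \<tau>"
 proof (unfold_locales)
  show "sets ?P = sets borel" by (simp add: obs_law_def)
  show "0 < \<tau>" by (rule \<tau>)
  show "AE (t, \<delta>, z) in ?P. \<delta> = 0 \<or> \<delta> = 1"
   unfolding obs_law_def case_prod_beta' by (subst AE_distr_iff) auto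
  have "AE w in N. 0 < min (X w) (C w) \<and> min (X w) (C w) <= \<tau>"
   using T_le X_nonneg C_nonneg AE_X_neq[of 0] AE_C_neq[of 0] by eventually_elim auto
  then show "AE (t, \<delta>, z) in ?P. 0 < t \<and> t <= \<tau>"
   unfolding obs_law_def case_prod_beta' by (subst AE_distr_iff) auto
  show "0 < measure ?P {y. s <= fst y}" if "s < \<tau>" for s
  proof -
   have "0 < measure (distr N borel (%w. min (X w) (C w))) {s<..}"
    using that tauH by (intro measure_gt_pos_below_right_endpoint[OF T_law]) auto
   also have "... = prob {w \<in> space N. s < min (X w) (C w)}"
    by (subst measure_distr) (auto intro!: arg_cong[where f = prob])
   also have "... <= prob {w \<in> space N. s <= min (X w) (C w)}"
    by (intro finite_measure_mono) auto
   also have "... = measure ?P {y. s <= fst y}"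
    unfolding obs_law_def by (subst measure_distr) (auto intro!: arg_cong[where f = prob])
   finally show ?thesis .
  qed
  show "continuous_on {0..\<tau>} lam0" by (rule cont)
  show "\<exists>\<epsilon>>0. integrable ?P (%(t, \<delta>, z). (exp (beta0 \<bullet> z + \<epsilon> * norm z))\<^sup>2)"
  proof -
   obtain \<epsilon> where \<epsilon>: "\<epsilon> > 0" "(\<integral>\<^sup>+w. ennreal ((exp (beta0 \<bullet> Z w + \<epsilon> * norm (Z w)))\<^sup>2) \<partial>N) < \<infinity>"
    using envelope_finite[OF moment] by blast
   have "integrable N (%w. (exp (beta0 \<bullet> Z w + \<epsilon> * norm (Z w)))\<^sup>2)"
    using \<epsilon>(2) by (intro integrableI_nonneg) auto
   then have "integrable ?P (%(t, \<delta>, z). (exp (beta0 \<bullet> z + \<epsilon> * norm z))\<^sup>2)"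
    unfolding obs_law_def case_prod_beta' by (subst integrable_distr_eq) auto
   then show ?thesis using \<epsilon>(1) by blast
  qed
 qed (use obs_compensation[OF T_le nonneg cont] nonneg in auto)
qed

end

section \<open>Compensation of the events of a sample\<close>

definition risk :: "nat => real ^ 'p => real => (nat => ('p::finite) obs) => real" where
 "risk n \<beta> s y = (\<Sum>j<n. of_bool (s <= fst (y j)) * exp (\<beta> \<bullet> snd (snd (y j))))"

text \<open>The average of \<open>\<zeta>\<close> over the risk set at \<open>s\<close>, with
  weights proportional to \<open>exp (\<beta> \<bullet> z)\<close>; for an empty risk set the
  division yields 0.\<close>

definition risk_mean :: "nat => real ^ 'p => (real ^ 'p => real) => real => (nat => ('p::finite) obs) => real" where
 "risk_mean n \<beta> \<zeta> s y =
   (\<Sum>j<n. of_bool (s <= fst (y j)) * exp (\<beta> \<bullet> snd (snd (y j))) * \<zeta> (snd (snd (y j)))) / risk n \<beta> s y"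

text \<open>A version of the recorded indicator that takes the values 0 and 1 everywhere and not
  just almost surely.\<close>

definition event :: "('p::finite) obs => real" where
 "event y = of_bool (fst (snd y) = 1)"

text \<open>For linear \<open>\<zeta>\<close> this is the contribution of individual
  \<open>i\<close> to a directional derivative of the log partial likelihood.\<close>

definition score_term :: "nat => real ^ 'p => (real ^ 'p => real) => nat => (nat => ('p::finite) obs) => real" where
 "score_term n \<beta> \<zeta> i y = event (y i) * (\<zeta> (snd (snd (y i))) - risk_mean n \<beta> \<zeta> (fst (y i)) y)"

lemma of_bool_measurable [measurable (raw)]:
 "Measurable.pred M P ==> (%x. of_bool (P x) :: 'b::{zero_neq_one, topological_space}) \<in> borel_measurable M"
 unfolding of_bool_def by measurable

lemma event_measurable [measurable]: "event \<in> borel_measurable borel"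
 unfolding event_def[abs_def] by measurable

lemma event_cases: "event y = 0 \<or> event y = 1" and event_sq: "(event y)\<^sup>2 = event y"
 and event_nonneg: "0 <= event y" and event_le_1: "event y <= 1"
 by (auto simp: event_def)

lemma risk_measurable [measurable (raw)]:
 assumes [measurable]: "s \<in> borel_measurable L" "\<And>j. (%w. y w j) \<in> borel_measurable L" "\<beta> \<in> borel_measurable L"
 shows "(%w. risk n (\<beta> w) (s w) (y w)) \<in> borel_measurable L"
 unfolding risk_def by measurable

lemma risk_mean_measurable [measurable (raw)]:
 assumes [measurable]: "s \<in> borel_measurable L" "\<And>j. (%w. y w j) \<in> borel_measurable L" "\<zeta> \<in> borel_measurable borel"
 shows "(%w. risk_mean n \<beta> \<zeta> (s w) (y w)) \<in> borel_measurable L"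
 unfolding risk_mean_def by measurable

lemma score_term_measurable [measurable (raw)]:
 assumes [measurable]: "\<And>j. (%w. y w j) \<in> borel_measurable L" "\<zeta> \<in> borel_measurable borel"
 shows "(%w. score_term n \<beta> \<zeta> i (y w)) \<in> borel_measurable L"
 unfolding score_term_def by measurable

lemma risk_antimono: "s <= t ==> risk n \<beta> t y <= risk n \<beta> s y"
 unfolding risk_def by (intro sum_mono mult_right_mono) auto

locale cox_sample = iid_sample M Y P + obs: cox_observation P lam0 beta0 tauH
 for M :: "'w measure" and Y :: "nat => 'w => ('p::finite) obs" and P :: "('p::finite) obs measure"
  and lam0 beta0 tauH
begin

lemma component_measurable [measurable]:
 "(%y. y j) \<in> (\<Pi>\<^sub>M i\<in>UNIV. (borel :: 'p obs measure)) \<rightarrow>\<^sub>M borel"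
 by (rule measurable_component_singleton) simp

lemma fst_component_measurable [measurable]:
 "(%y. fst (y j)) \<in> borel_measurable (\<Pi>\<^sub>M i\<in>UNIV. (borel :: 'p obs measure))"
 by (rule measurable_compose[OF component_measurable]) measurable

text \<open>Independence makes the law of the sample an infinite product, so one coordinate can be
  integrated out first with the rest of the sample frozen.\<close>

lemma nn_integral_sample_split:
 assumes h: "h \<in> borel_measurable (\<Pi>\<^sub>M i\<in>UNIV. borel)"
 shows "(\<integral>\<^sup>+w. h (ys w) \<partial>M) = (\<integral>\<^sup>+r. (\<integral>\<^sup>+x. h (r(i := x)) \<partial>P) \<partial>(\<Pi>\<^sub>M j\<in>UNIV - {i}. P))"
proof -
 interpret P: prob_space P by (rule prob_space_P)
 let ?J = "UNIV - {i}"
 interpret R: prob_space "\<Pi>\<^sub>M j\<in>?J. P" by (intro prob_space_PiM prob_space_P)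
 interpret PR: pair_sigma_finite P "\<Pi>\<^sub>M j\<in>?J. P" ..
 have sets_eq: "sets (\<Pi>\<^sub>M j\<in>UNIV. P) = sets (\<Pi>\<^sub>M j\<in>UNIV. (borel :: 'p obs measure))"
  by (intro sets_PiM_cong) (auto simp: sets_P)
 have "distr M (\<Pi>\<^sub>M i\<in>UNIV. borel) (%w. \<lambda>i\<in>UNIV. Y i w) = (\<Pi>\<^sub>M i\<in>UNIV. distr M borel (Y i))"
  using indep by (subst indep_vars_iff_distr_eq_PiM[symmetric]) auto
 then have D: "distr M (\<Pi>\<^sub>M i\<in>UNIV. borel) ys = (\<Pi>\<^sub>M i\<in>UNIV. P)" by (simp add: law restrict_def)
 have ysm: "ys \<in> M \<rightarrow>\<^sub>M (\<Pi>\<^sub>M i\<in>UNIV. borel)"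
  by (rule measurable_PiM_single') auto
 have split: "distr (P \<Otimes>\<^sub>M (\<Pi>\<^sub>M j\<in>?J. P)) (\<Pi>\<^sub>M j\<in>UNIV. P) (%(x, X). X(i := x)) = (\<Pi>\<^sub>M j\<in>UNIV. P)"
  using distr_pair_PiM_eq_PiM[of ?J "%_. P" i] prob_space_P by (simp add: insert_UNIV)
 have upd: "(%(x, X). X(i := x)) \<in> P \<Otimes>\<^sub>M (\<Pi>\<^sub>M j\<in>?J. P) \<rightarrow>\<^sub>M (\<Pi>\<^sub>M j\<in>UNIV. P)"
  unfolding case_prod_beta' by (rule measurable_fun_upd[where J = ?J]) auto
 have hP: "h \<in> borel_measurable (\<Pi>\<^sub>M j\<in>UNIV. P)"
  using h unfolding measurable_cong_sets[OF sets_eq refl] .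
 have "(\<integral>\<^sup>+w. h (ys w) \<partial>M) = (\<integral>\<^sup>+y. h y \<partial>(\<Pi>\<^sub>M j\<in>UNIV. P))"
  unfolding D[symmetric] using nn_integral_distr[OF ysm, of h] h by simp
 also have "... = (\<integral>\<^sup>+q. h (case q of (x, X) => X(i := x)) \<partial>(P \<Otimes>\<^sub>M (\<Pi>\<^sub>M j\<in>?J. P)))"
  by (subst split[symmetric]) (use nn_integral_distr[OF upd, of h] hP in simp)
 also have "... = (\<integral>\<^sup>+r. (\<integral>\<^sup>+x. h (r(i := x)) \<partial>P) \<partial>(\<Pi>\<^sub>M j\<in>?J. P))"
  using PR.nn_integral_snd[OF measurable_compose[OF upd hP]] by simp
 finally show ?thesis .
qed

text \<open>The hypothesis \<open>predictable\<close> says that \<open>H s\<close> does not depend on what happens to the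
  \<open>i\<close>-th individual from time \<open>s\<close> on, as long as it is at risk at time \<open>s\<close>.\<close>

lemma sample_compensation:
 fixes H :: "real => (nat => 'p obs) => ennreal"
 assumes meas: "(%p. H (fst p) (snd p)) \<in> borel_measurable (borel \<Otimes>\<^sub>M (\<Pi>\<^sub>M i\<in>UNIV. borel))"
  and predictable: "\<And>s y. s <= fst (y i) ==> H s (y(i := (s, 1, snd (snd (y i))))) = H s y"
 shows "(\<integral>\<^sup>+w. ennreal (event (Y i w)) * H (fst (Y i w)) (ys w) \<partial>M) =
  (\<integral>\<^sup>+s\<in>{0..tauH}. ennreal (lam0 s) *
   (\<integral>\<^sup>+w. of_bool (s <= fst (Y i w)) * ennreal (exp (beta0 \<bullet> snd (snd (Y i w)))) * H s (ys w) \<partial>M) \<partial>lborel)"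
proof -
 interpret P: prob_space P by (rule prob_space_P)
 let ?J = "UNIV - {i}" and ?B = "\<Pi>\<^sub>M i\<in>UNIV. (borel :: 'p obs measure)"
 let ?R = "\<Pi>\<^sub>M j\<in>?J. P"
 interpret R: prob_space ?R by (intro prob_space_PiM prob_space_P)
 interpret LR: pair_sigma_finite lborel ?R ..
 have Hm [measurable (raw)]: "(%w. H (a w) (b w)) \<in> borel_measurable L"
  if "a \<in> borel_measurable L" "b \<in> L \<rightarrow>\<^sub>M ?B" for a b and L :: "'z measure"
  using measurable_compose[OF measurable_Pair[OF that] meas] by simp
 have upd [measurable (raw)]: "(%w. (r w)(i := x w)) \<in> L \<rightarrow>\<^sub>M ?B"
  if r: "r \<in> L \<rightarrow>\<^sub>M ?R" and x: "x \<in> borel_measurable L" for r x and L :: "'z measure"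
 proof (rule measurable_fun_upd[where J = ?J])
  have "sets ?R = sets (\<Pi>\<^sub>M j\<in>?J. (borel :: 'p obs measure))" by (intro sets_PiM_cong) (auto simp: sets_P)
  then show "r \<in> L \<rightarrow>\<^sub>M (\<Pi>\<^sub>M j\<in>?J. borel)" using r measurable_cong_sets by blast
 qed (use x in auto)
 have Pm: "measurable P L = measurable borel L" for L :: "'z measure" by (rule measurable_P)
 have lam: "(%s. ennreal (lam0 s) * indicator {0..tauH} s) \<in> borel_measurable borel"
 proof -
  have "(%s. indicator {0..tauH} s *\<^sub>R lam0 s) \<in> borel_measurable borel"
   by (rule borel_measurable_continuous_on_indicator[OF _ obs.lam0_cont]) simp
  then have "(%s. ennreal (indicator {0..tauH} s *\<^sub>R lam0 s)) \<in> borel_measurable borel" by measurable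
  moreover have "ennreal (indicator {0..tauH} s *\<^sub>R lam0 s) = ennreal (lam0 s) * indicator {0..tauH} s" for s
   by (auto split: split_indicator)
  ultimately show ?thesis by simp
 qed
 define k where "k s y = of_bool (s <= fst (y i)) * ennreal (exp (beta0 \<bullet> snd (snd (y i)))) * H s y" for s y
 have km: "(%w. k (a w) (b w)) \<in> borel_measurable L"
  if [measurable]: "a \<in> borel_measurable L" "b \<in> L \<rightarrow>\<^sub>M ?B" for a b and L :: "'z measure"
  unfolding k_def by measurable
 have "(\<integral>\<^sup>+w. ennreal (event (Y i w)) * H (fst (Y i w)) (ys w) \<partial>M) =
   (\<integral>\<^sup>+r. (\<integral>\<^sup>+x. ennreal (event x) * H (fst x) (r(i := x)) \<partial>P) \<partial>?R)"
 proof -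
  have "(%y. H (fst (y i)) y) \<in> borel_measurable ?B"
   by (rule Hm[OF fst_component_measurable]) simp
  then have "(%y. ennreal (event (y i)) * H (fst (y i)) y) \<in> borel_measurable ?B" by measurable
  from nn_integral_sample_split[OF this, of i] show ?thesis by simp
 qed
 also have "... = (\<integral>\<^sup>+r. (\<integral>\<^sup>+s. (ennreal (lam0 s) * indicator {0..tauH} s) * (\<integral>\<^sup>+x. k s (r(i := x)) \<partial>P) \<partial>lborel) \<partial>?R)"
 proof (rule nn_integral_cong)
  fix r assume r: "r \<in> space ?R"
  have [measurable]: "(%_. r) \<in> L \<rightarrow>\<^sub>M ?R" for L :: "'z measure" using r by (rule measurable_const)
  \<comment> \<open>With the other observations frozen, putting \<open>(s, 1, z)\<close> in place of
    the \<open>i\<close>-th gives a function of time and covariate alone, as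
    \<open>compensation\<close> requires; \<open>predictable\<close> restores the actual observation
    afterwards.\<close>
  define \<phi> where "\<phi> p = H (fst p) (r(i := (fst p, 1, snd p)))" for p
  have \<phi> [measurable]: "\<phi> \<in> borel_measurable borel" unfolding \<phi>_def by measurable
  have "(\<integral>\<^sup>+x. ennreal (event x) * H (fst x) (r(i := x)) \<partial>P) = (\<integral>\<^sup>+(t, \<delta>, z). of_bool (\<delta> = 1) * \<phi> (t, z) \<partial>P)"
   by (intro nn_integral_cong) (auto simp: event_def \<phi>_def)
  also have "... = (\<integral>\<^sup>+s\<in>{0..tauH}. ennreal (lam0 s) *
     (\<integral>\<^sup>+(t, \<delta>, z). of_bool (s <= t) * ennreal (exp (beta0 \<bullet> z)) * \<phi> (s, z) \<partial>P) \<partial>lborel)"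
   by (rule obs.compensation[OF \<phi>])
  also have "... = (\<integral>\<^sup>+s. (ennreal (lam0 s) * indicator {0..tauH} s) * (\<integral>\<^sup>+x. k s (r(i := x)) \<partial>P) \<partial>lborel)"
  proof (rule nn_integral_cong)
   fix s
   have "(\<integral>\<^sup>+(t, \<delta>, z). of_bool (s <= t) * ennreal (exp (beta0 \<bullet> z)) * \<phi> (s, z) \<partial>P) = (\<integral>\<^sup>+x. k s (r(i := x)) \<partial>P)"
   proof (rule nn_integral_cong)
    fix x :: "'p obs"
    have "H s (r(i := (s, 1, snd (snd x)))) = H s (r(i := x))" if "s <= fst x"
     using predictable[of s "r(i := x)"] that by simp
    then show "(case x of (t, \<delta>, z) => of_bool (s <= t) * ennreal (exp (beta0 \<bullet> z)) * \<phi> (s, z)) = k s (r(i := x))"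
     by (auto simp: k_def \<phi>_def case_prod_beta')
   qed
   then show "ennreal (lam0 s) * (\<integral>\<^sup>+(t, \<delta>, z). of_bool (s <= t) * ennreal (exp (beta0 \<bullet> z)) * \<phi> (s, z) \<partial>P) * indicator {0..tauH} s
     = ennreal (lam0 s) * indicator {0..tauH} s * (\<integral>\<^sup>+x. k s (r(i := x)) \<partial>P)"
    by (simp add: mult_ac)
  qed
  finally show "(\<integral>\<^sup>+x. ennreal (event x) * H (fst x) (r(i := x)) \<partial>P) =
    (\<integral>\<^sup>+s. (ennreal (lam0 s) * indicator {0..tauH} s) * (\<integral>\<^sup>+x. k s (r(i := x)) \<partial>P) \<partial>lborel)" .
 qed
 also have "... = (\<integral>\<^sup>+s. (\<integral>\<^sup>+r. (ennreal (lam0 s) * indicator {0..tauH} s) * (\<integral>\<^sup>+x. k s (r(i := x)) \<partial>P) \<partial>?R) \<partial>lborel)"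
 proof (rule LR.Fubini')
  have "(%q. \<integral>\<^sup>+x. k (fst q) ((snd q)(i := x)) \<partial>P) \<in> borel_measurable (lborel \<Otimes>\<^sub>M ?R)"
  proof (rule obs.borel_measurable_nn_integral)
   have 1: "(%q. fst (fst q)) \<in> borel_measurable ((lborel \<Otimes>\<^sub>M ?R) \<Otimes>\<^sub>M P)" by measurable
   have "snd \<in> ((lborel \<Otimes>\<^sub>M ?R) \<Otimes>\<^sub>M P) \<rightarrow>\<^sub>M P" by measurable
   then have 3: "snd \<in> borel_measurable ((lborel \<Otimes>\<^sub>M ?R) \<Otimes>\<^sub>M P)"
    using measurable_cong_sets[OF refl sets_P] by blast
   have 2: "(%q. (snd (fst q))(i := snd q)) \<in> ((lborel \<Otimes>\<^sub>M ?R) \<Otimes>\<^sub>M P) \<rightarrow>\<^sub>M ?B"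
    by (rule upd[OF _ 3]) measurable
   show "(%(q, x). k (fst q) ((snd q)(i := x))) \<in> borel_measurable ((lborel \<Otimes>\<^sub>M ?R) \<Otimes>\<^sub>M P)"
    unfolding case_prod_beta' using km[OF 1 2] .
  qed
  moreover have "(%q. ennreal (lam0 (fst q)) * indicator {0..tauH} (fst q)) \<in> borel_measurable (lborel \<Otimes>\<^sub>M ?R)"
   by (rule measurable_compose[OF _ lam]) measurable
  ultimately show "(%(s, r). (ennreal (lam0 s) * indicator {0..tauH} s) * (\<integral>\<^sup>+x. k s (r(i := x)) \<partial>P)) \<in> borel_measurable (lborel \<Otimes>\<^sub>M ?R)"
   unfolding case_prod_beta' by (rule borel_measurable_times_ennreal[rotated])
 qed
 also have "... = (\<integral>\<^sup>+s. (ennreal (lam0 s) * indicator {0..tauH} s) * (\<integral>\<^sup>+w. k s (ys w) \<partial>M) \<partial>lborel)"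
 proof (rule nn_integral_cong)
  fix s
  have "(%r. \<integral>\<^sup>+x. k s (r(i := x)) \<partial>P) \<in> borel_measurable ?R"
  proof (rule obs.borel_measurable_nn_integral)
   have "snd \<in> (?R \<Otimes>\<^sub>M P) \<rightarrow>\<^sub>M P" by measurable
   then have 3: "snd \<in> borel_measurable (?R \<Otimes>\<^sub>M P)"
    using measurable_cong_sets[OF refl sets_P] by blast
   have 2: "(%q. (fst q)(i := snd q)) \<in> (?R \<Otimes>\<^sub>M P) \<rightarrow>\<^sub>M ?B"
    by (rule upd[OF _ 3]) measurable
   show "(%(r, x). k s (r(i := x))) \<in> borel_measurable (?R \<Otimes>\<^sub>M P)"
    unfolding case_prod_beta' using km[OF borel_measurable_const 2] .
  qed
  then have "(\<integral>\<^sup>+r. (ennreal (lam0 s) * indicator {0..tauH} s) * (\<integral>\<^sup>+x. k s (r(i := x)) \<partial>P) \<partial>?R) =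
    (ennreal (lam0 s) * indicator {0..tauH} s) * (\<integral>\<^sup>+r. (\<integral>\<^sup>+x. k s (r(i := x)) \<partial>P) \<partial>?R)"
   by (rule nn_integral_cmult)
  also have "(\<integral>\<^sup>+r. (\<integral>\<^sup>+x. k s (r(i := x)) \<partial>P) \<partial>?R) = (\<integral>\<^sup>+w. k s (ys w) \<partial>M)"
   by (rule nn_integral_sample_split[symmetric]) (rule km; simp)
  finally show "(\<integral>\<^sup>+r. (ennreal (lam0 s) * indicator {0..tauH} s) * (\<integral>\<^sup>+x. k s (r(i := x)) \<partial>P) \<partial>?R) =
    (ennreal (lam0 s) * indicator {0..tauH} s) * (\<integral>\<^sup>+w. k s (ys w) \<partial>M)" .
 qed
 finally show ?thesis by (simp add: k_def mult_ac)
qed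

end

section \<open>Weighted means over the risk set and the variance of the score\<close>

lemma weighted_variance_le:
 fixes v \<zeta> :: "'i => real"
 assumes "finite I" "\<And>j. j \<in> I ==> 0 <= v j"
 shows "(\<Sum>j\<in>I. v j * (\<zeta> j - (\<Sum>j\<in>I. v j * \<zeta> j) / (\<Sum>j\<in>I. v j))\<^sup>2) <= (\<Sum>j\<in>I. v j * (\<zeta> j)\<^sup>2)"
proof (cases "(\<Sum>j\<in>I. v j) = 0")
 case True
 then have "v j = 0" if "j \<in> I" for j using assms sum_nonneg_eq_0_iff[of I v] that by blast
 then show ?thesis by simp
next
 case False
 define V where "V = (\<Sum>j\<in>I. v j)"
 define m where "m = (\<Sum>j\<in>I. v j * \<zeta> j) / V"
 have mV: "(\<Sum>j\<in>I. v j * \<zeta> j) = m * V" using False by (simp add: m_def V_def)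
 have "(\<Sum>j\<in>I. v j * (\<zeta> j - m)\<^sup>2) = (\<Sum>j\<in>I. v j * (\<zeta> j)\<^sup>2 - 2 * m * (v j * \<zeta> j) + m\<^sup>2 * v j)"
  by (intro sum.cong) (auto simp: power2_eq_square algebra_simps)
 also have "... = (\<Sum>j\<in>I. v j * (\<zeta> j)\<^sup>2) - 2 * m * (m * V) + m\<^sup>2 * V"
  unfolding sum.distrib sum_subtractf sum_distrib_left[symmetric] mV V_def ..
 also have "... = (\<Sum>j\<in>I. v j * (\<zeta> j)\<^sup>2) - m\<^sup>2 * V" by (simp add: power2_eq_square)
 also have "... <= (\<Sum>j\<in>I. v j * (\<zeta> j)\<^sup>2)" using assms by (simp add: V_def sum_nonneg)
 finally show ?thesis by (simp add: m_def V_def)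
qed

lemma weighted_mean_deviation:
 fixes v \<zeta> :: "'i => real"
 assumes "finite I" "\<And>j. j \<in> I ==> 0 <= v j"
 shows "(\<Sum>j\<in>I. v j * (\<zeta> j - (\<Sum>j\<in>I. v j * \<zeta> j) / (\<Sum>j\<in>I. v j))) = 0"
proof (cases "(\<Sum>j\<in>I. v j) = 0")
 case True
 then have "v j = 0" if "j \<in> I" for j using assms sum_nonneg_eq_0_iff[of I v] that by blast
 then show ?thesis by simp
next
 case False
 define m where "m = (\<Sum>j\<in>I. v j * \<zeta> j) / (\<Sum>j\<in>I. v j)"
 have "(\<Sum>j\<in>I. v j * (\<zeta> j - m)) = (\<Sum>j\<in>I. v j * \<zeta> j) - (\<Sum>j\<in>I. v j) * m"
  by (simp add: right_diff_distrib sum_subtractf sum_distrib_right)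
 then show ?thesis using False by (simp add: m_def)
qed

abbreviation cov :: "('p::finite) obs => real ^ 'p" where "cov y \<equiv> snd (snd y)"

context cox_sample
begin

definition eps :: real where
 "eps = (SOME \<epsilon>. \<epsilon> > 0 \<and> integrable P (%(t, \<delta>, z). (exp (beta0 \<bullet> z + \<epsilon> * norm z))\<^sup>2))"

text \<open>A square integrable majorant of the relative risk around \<open>beta0\<close>; its spare
  factor \<open>exp (eps * norm z)\<close> absorbs powers of \<open>norm z\<close>.\<close>

definition env :: "real ^ 'p => real" where "env z = exp (beta0 \<bullet> z + eps * norm z)"

lemma eps_pos: "eps > 0" and env_sq_integrable: "integrable P (%y. (env (cov y))\<^sup>2)"
proof -
 have *: "eps > 0 \<and> integrable P (%(t, \<delta>, z). (exp (beta0 \<bullet> z + eps * norm z))\<^sup>2)"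
  unfolding eps_def by (rule someI_ex) (rule obs.envelope)
 from * show "eps > 0" by blast
 from * show "integrable P (%y. (env (cov y))\<^sup>2)" unfolding env_def case_prod_beta' by blast
qed

lemma env_measurable [measurable]: "env \<in> borel_measurable borel"
 unfolding env_def[abs_def] by measurable

lemma env_integrable: "integrable P (%y. env (cov y))"
proof (rule obs.square_integrable_imp_integrable[OF _ env_sq_integrable])
 show "(%y. env (cov y)) \<in> borel_measurable P" unfolding measurable_P by measurable
qed

lemma env_pos: "0 < env z" by (simp add: env_def)

lemma env_nonneg: "0 <= env z" using env_pos[of z] by simp

lemma exp_le_env: "exp (beta0 \<bullet> z) <= env z"
 using eps_pos by (simp add: env_def)

lemma norm_exp_le_env: "norm z * exp (beta0 \<bullet> z) <= env z / eps"
proof -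
 have "eps * norm z <= exp (eps * norm z)" using exp_ge_add_one_self[of "eps * norm z"] by linarith
 then have "norm z <= exp (eps * norm z) / eps" using eps_pos by (simp add: field_simps)
 then have "norm z * exp (beta0 \<bullet> z) <= exp (eps * norm z) / eps * exp (beta0 \<bullet> z)"
  by (rule mult_right_mono) simp
 then show ?thesis by (simp add: env_def exp_add mult.commute)
qed

lemma norm_sq_exp_le_env: "(norm z)\<^sup>2 * exp (beta0 \<bullet> z) <= 2 / eps\<^sup>2 * env z"
proof -
 have "(eps * norm z)\<^sup>2 / 2 <= exp (eps * norm z)"
 proof -
  have "0 <= eps * norm z" using eps_pos by simp
  with exp_lower_Taylor_quadratic[OF this] show ?thesis by linarith
 qed
 then have "(norm z)\<^sup>2 <= 2 / eps\<^sup>2 * exp (eps * norm z)" using eps_pos by (simp add: field_simps power_mult_distrib)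
 then have "(norm z)\<^sup>2 * exp (beta0 \<bullet> z) <= 2 / eps\<^sup>2 * exp (eps * norm z) * exp (beta0 \<bullet> z)"
  by (rule mult_right_mono) simp
 then show ?thesis by (simp add: env_def exp_add mult_ac)
qed

definition lamB :: real where "lamB = (SOME B. \<forall>s\<in>{0..tauH}. \<bar>lam0 s\<bar> <= B)"

lemma lam0_le: "s \<in> {0..tauH} ==> lam0 s <= lamB" and lamB_nonneg: "0 <= lamB"
proof -
 have "\<forall>s\<in>{0..tauH}. \<bar>lam0 s\<bar> <= lamB"
  unfolding lamB_def by (rule someI_ex[OF continuous_on_interval_bounded[OF obs.lam0_cont]])
 then show "s \<in> {0..tauH} ==> lam0 s <= lamB" "0 <= lamB"
  using obs.tauH_pos abs_ge_zero[of "lam0 0"] by (force simp: abs_le_iff)+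
qed

abbreviation "T i w \<equiv> fst (Y i w)"
abbreviation "zc i w \<equiv> cov (Y i w)"
abbreviation "atrisk i s w \<equiv> of_bool (s <= T i w) * exp (beta0 \<bullet> zc i w)"
abbreviation "PIB \<equiv> \<Pi>\<^sub>M i\<in>UNIV. (borel :: 'p obs measure)"

lemma ys_measurable: "ys \<in> M \<rightarrow>\<^sub>M PIB"
 by (rule measurable_PiM_single') auto

lemma compensation_sum:
 fixes h :: "nat => real => (nat => 'p obs) => real"
 assumes meas: "\<And>j. (%p. h j (fst p) (snd p)) \<in> borel_measurable (borel \<Otimes>\<^sub>M PIB)"
  and nonneg: "\<And>j s y. 0 <= h j s y"
  and predictable: "\<And>j s y. s <= fst (y j) ==> h j s (y(j := (s, 1, cov (y j)))) = h j s y"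
 shows "(\<integral>\<^sup>+w. ennreal (\<Sum>j<n. event (Y j w) * h j (T j w) (ys w)) \<partial>M) =
  (\<integral>\<^sup>+s\<in>{0..tauH}. ennreal (lam0 s) * (\<integral>\<^sup>+w. ennreal (\<Sum>j<n. atrisk j s w * h j s (ys w)) \<partial>M) \<partial>lborel)"
proof -
 interpret LM: pair_sigma_finite lborel M ..
 have hm: "(%w. h j (a w) (b w)) \<in> borel_measurable L"
  if "a \<in> borel_measurable L" "b \<in> L \<rightarrow>\<^sub>M PIB" for a b j and L :: "'z measure"
  using measurable_compose[OF measurable_Pair[OF that] meas] by simp
 have hT [measurable]: "(%w. h j (T i w) (ys w)) \<in> borel_measurable M" for i j
  by (rule hm[OF _ ys_measurable]) measurable
 have hs [measurable]: "(%w. h j s (ys w)) \<in> borel_measurable M" for s j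
  by (rule hm[OF _ ys_measurable]) measurable
 have hp [measurable]: "(%q. h j (fst q) (ys (snd q))) \<in> borel_measurable (lborel \<Otimes>\<^sub>M M)" for j
  by (rule hm[OF _ measurable_compose[OF _ ys_measurable]]) measurable
 have [measurable]: "(%q. Y j (snd q)) \<in> borel_measurable (lborel \<Otimes>\<^sub>M M)" for j
  by (rule measurable_compose[OF _ Y_meas]) measurable
 define l where "l s = ennreal (indicator {0..tauH} s *\<^sub>R lam0 s)" for s
 have [measurable]: "l \<in> borel_measurable borel"
  unfolding l_def using borel_measurable_continuous_on_indicator[OF _ obs.lam0_cont] by measurable
 have l: "l s = ennreal (lam0 s) * indicator {0..tauH} s" for s
  by (auto simp: l_def split: split_indicator)
 define q where "q j s w = ennreal (atrisk j s w * h j s (ys w))" for j s w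
 have qm [measurable]: "(%p. q j (fst p) (snd p)) \<in> borel_measurable (lborel \<Otimes>\<^sub>M M)" for j
  unfolding q_def by measurable
 have qs [measurable]: "q j s \<in> borel_measurable M" for j s unfolding q_def by measurable
 have q2 [measurable]: "(%s. \<integral>\<^sup>+w. q j s w \<partial>M) \<in> borel_measurable lborel" for j
  by (rule borel_measurable_nn_integral) (simp add: case_prod_beta')
 have qeq: "of_bool (s <= T j w) * ennreal (exp (beta0 \<bullet> zc j w)) * ennreal (h j s (ys w)) = q j s w" for j s w
  using nonneg by (auto simp: q_def ennreal_mult' of_bool_def)
 have "(\<integral>\<^sup>+w. ennreal (\<Sum>j<n. event (Y j w) * h j (T j w) (ys w)) \<partial>M) =
  (\<integral>\<^sup>+w. (\<Sum>j<n. ennreal (event (Y j w)) * ennreal (h j (T j w) (ys w))) \<partial>M)"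
 proof (rule nn_integral_cong)
  fix w
  have "ennreal (\<Sum>j<n. event (Y j w) * h j (T j w) (ys w)) = (\<Sum>j<n. ennreal (event (Y j w) * h j (T j w) (ys w)))"
   by (rule sum_ennreal[symmetric]) (simp add: nonneg event_nonneg)
  then show "ennreal (\<Sum>j<n. event (Y j w) * h j (T j w) (ys w)) =
    (\<Sum>j<n. ennreal (event (Y j w)) * ennreal (h j (T j w) (ys w)))"
   by (simp add: ennreal_mult' event_nonneg)
 qed
 also have "... = (\<Sum>j<n. \<integral>\<^sup>+w. ennreal (event (Y j w)) * ennreal (h j (T j w) (ys w)) \<partial>M)"
  by (rule nn_integral_sum) measurable
 also have "... = (\<Sum>j<n. \<integral>\<^sup>+s. l s * (\<integral>\<^sup>+w. q j s w \<partial>M) \<partial>lborel)"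
 proof (rule sum.cong[OF refl])
  fix j assume "j \<in> {..<n}"
  have "(\<integral>\<^sup>+w. ennreal (event (Y j w)) * ennreal (h j (T j w) (ys w)) \<partial>M) =
   (\<integral>\<^sup>+s\<in>{0..tauH}. ennreal (lam0 s) *
   (\<integral>\<^sup>+w. of_bool (s <= T j w) * ennreal (exp (beta0 \<bullet> zc j w)) * ennreal (h j s (ys w)) \<partial>M) \<partial>lborel)"
   by (rule sample_compensation[where H = "%s y. ennreal (h j s y)"])
     (use meas predictable in \<open>auto intro: measurable_compose[OF _ measurable_ennreal]\<close>)
  then show "(\<integral>\<^sup>+w. ennreal (event (Y j w)) * ennreal (h j (T j w) (ys w)) \<partial>M) = (\<integral>\<^sup>+s. l s * (\<integral>\<^sup>+w. q j s w \<partial>M) \<partial>lborel)"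
   unfolding qeq l by (simp only: mult_ac)
 qed
 also have "... = (\<integral>\<^sup>+s. (\<Sum>j<n. l s * (\<integral>\<^sup>+w. q j s w \<partial>M)) \<partial>lborel)"
  by (rule nn_integral_sum[symmetric]) measurable
 also have "... = (\<integral>\<^sup>+s. l s * (\<integral>\<^sup>+w. (\<Sum>j<n. q j s w) \<partial>M) \<partial>lborel)"
  by (intro nn_integral_cong) (simp add: nn_integral_sum sum_distrib_left)
 also have "... = (\<integral>\<^sup>+s\<in>{0..tauH}. ennreal (lam0 s) * (\<integral>\<^sup>+w. ennreal (\<Sum>j<n. atrisk j s w * h j s (ys w)) \<partial>M) \<partial>lborel)"
 proof (rule nn_integral_cong)
  fix s
  have "(\<Sum>j<n. q j s w) = ennreal (\<Sum>j<n. atrisk j s w * h j s (ys w))" for w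
   unfolding q_def by (rule sum_ennreal) (simp add: nonneg)
  then show "l s * (\<integral>\<^sup>+w. (\<Sum>j<n. q j s w) \<partial>M) =
   ennreal (lam0 s) * (\<integral>\<^sup>+w. ennreal (\<Sum>j<n. atrisk j s w * h j s (ys w)) \<partial>M) * indicator {0..tauH} s"
   unfolding l by (simp only: mult_ac)
 qed
 finally show ?thesis .
qed

text \<open>The length \<open>b - a\<close> of the time window survives as a factor, because
  \<open>lam0\<close> is bounded; in short windows this factor later makes up for the height of the
  kernel.\<close>

lemma compensation_sum_bound:
 fixes h :: "nat => real => (nat => 'p obs) => real"
 assumes "\<And>j. (%p. h j (fst p) (snd p)) \<in> borel_measurable (borel \<Otimes>\<^sub>M PIB)"
  "\<And>j s y. 0 <= h j s y"
  "\<And>j s y. s <= fst (y j) ==> h j s (y(j := (s, 1, cov (y j)))) = h j s y"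
  and bound: "\<And>s. s \<in> {0..tauH} ==>
   (\<integral>\<^sup>+w. ennreal (\<Sum>j<n. atrisk j s w * h j s (ys w)) \<partial>M) <= ennreal (K * indicator {a..b} s)"
  and K: "0 <= K" and ab: "a <= b"
 shows "(\<integral>\<^sup>+w. ennreal (\<Sum>j<n. event (Y j w) * h j (T j w) (ys w)) \<partial>M) <= ennreal (lamB * K * (b - a))"
proof -
 have "(\<integral>\<^sup>+w. ennreal (\<Sum>j<n. event (Y j w) * h j (T j w) (ys w)) \<partial>M) =
  (\<integral>\<^sup>+s\<in>{0..tauH}. ennreal (lam0 s) * (\<integral>\<^sup>+w. ennreal (\<Sum>j<n. atrisk j s w * h j s (ys w)) \<partial>M) \<partial>lborel)"
  using assms(1-3) by (rule compensation_sum[where h = h])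
 also have "... <= (\<integral>\<^sup>+s. ennreal (lamB * K) * indicator {a..b} s \<partial>lborel)"
 proof (rule nn_integral_mono)
  fix s
  show "ennreal (lam0 s) * (\<integral>\<^sup>+w. ennreal (\<Sum>j<n. atrisk j s w * h j s (ys w)) \<partial>M) * indicator {0..tauH} s
   <= ennreal (lamB * K) * indicator {a..b} s"
  proof (cases "s \<in> {0..tauH}")
   case True
   have "ennreal (lam0 s) * (\<integral>\<^sup>+w. ennreal (\<Sum>j<n. atrisk j s w * h j s (ys w)) \<partial>M)
     <= ennreal lamB * ennreal (K * indicator {a..b} s)"
    using bound[OF True] lam0_le[OF True] by (intro mult_mono ennreal_leI) auto
   also have "... = ennreal (lamB * K) * indicator {a..b} s"
    using K lamB_nonneg by (simp add: ennreal_mult' split: split_indicator)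
   finally show ?thesis using True by simp
  qed simp
 qed
 also have "... = ennreal (lamB * K * (b - a))"
  using ab K lamB_nonneg by (subst nn_integral_cmult_indicator) (auto simp: ennreal_mult')
 finally show ?thesis .
qed

text \<open>Orthogonality of the terms of the score: conditionally on what happened before the later of
  two events, the later term has mean zero. Positive and negative parts of the products are
  treated separately, so that only nonnegative integrals occur.\<close>

lemma score_second_moment:
 assumes \<zeta>m [measurable]: "\<zeta> \<in> borel_measurable borel" and \<zeta>: "\<And>z. \<bar>\<zeta> z\<bar> <= norm z"
 shows "\<exists>C. \<forall>n. (\<integral>\<^sup>+w. ennreal ((\<Sum>i<n. score_term n beta0 \<zeta> i (ys w))\<^sup>2) \<partial>M) <= ennreal (C * real n)"
proof -
 define K where "K = 2 / eps\<^sup>2 * (\<integral>y. env (cov y) \<partial>P)"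
 have Env0: "0 <= (\<integral>y. env (cov y) \<partial>P)" using env_pos by (intro Bochner_Integration.integral_nonneg) (auto intro: less_imp_le)
 then have K0: "0 <= K" by (simp add: K_def)
 have [measurable]: "(%p. snd p j) \<in> borel_measurable (borel \<Otimes>\<^sub>M PIB)" for j
  by (rule measurable_compose[OF measurable_snd component_measurable])
 have "(\<integral>\<^sup>+w. ennreal ((\<Sum>i<n. score_term n beta0 \<zeta> i (ys w))\<^sup>2) \<partial>M) <= ennreal ((lamB * K * tauH) * real n)" for n
 proof -
  define m where "m = risk_mean n beta0 \<zeta>"
  define D where "D i y = score_term n beta0 \<zeta> i y" for i and y :: "nat => 'p obs"
  have D: "D i y = event (y i) * (\<zeta> (cov (y i)) - m (fst (y i)) y)" for i y
   by (simp add: D_def score_term_def m_def)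
  have [measurable]: "(%p. m (fst p) (snd p)) \<in> borel_measurable (borel \<Otimes>\<^sub>M PIB)"
   unfolding m_def by measurable
  have [measurable]: "(%p. D i (snd p)) \<in> borel_measurable (borel \<Otimes>\<^sub>M PIB)" for i
   unfolding D_def by measurable
  have Dm [measurable]: "(%w. D i (ys w)) \<in> borel_measurable M" for i
   unfolding D_def by measurable
  have m_pred: "m s (y(j := (s, 1, cov (y j)))) = m s y" if "s <= fst (y j)" for s y j
   using that unfolding m_def risk_mean_def risk_def
   by (intro arg_cong2[where f = "(/)"] sum.cong) auto
  have m_pred': "m u (y(j := (s, 1, cov (y j)))) = m u y" if "s <= fst (y j)" "u < s" for s u y j
   using that unfolding m_def risk_mean_def risk_def
   by (intro arg_cong2[where f = "(/)"] sum.cong) auto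
  \<comment> \<open>Compensation turns the squared terms into the weighted variance of
    \<open>\<zeta>\<close> over the risk set. This is at most the weighted second moment, which the
    envelope controls.\<close>
  have diag: "(\<integral>\<^sup>+w. ennreal (\<Sum>j<n. (D j (ys w))\<^sup>2) \<partial>M) <= ennreal (lamB * (K * real n) * (tauH - 0))"
  proof -
   have "(\<integral>\<^sup>+w. ennreal (\<Sum>j<n. (D j (ys w))\<^sup>2) \<partial>M) =
     (\<integral>\<^sup>+w. ennreal (\<Sum>j<n. event (Y j w) * (\<zeta> (cov (Y j w)) - m (T j w) (ys w))\<^sup>2) \<partial>M)"
    by (simp add: D power_mult_distrib event_sq)
   also have "... <= ennreal (lamB * (K * real n) * (tauH - 0))"
   proof (rule compensation_sum_bound[where h = "%j s y. (\<zeta> (cov (y j)) - m s y)\<^sup>2"])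
    fix s assume s: "s \<in> {0..tauH}"
    have "(\<integral>\<^sup>+w. ennreal (\<Sum>j<n. atrisk j s w * (\<zeta> (cov (Y j w)) - m s (ys w))\<^sup>2) \<partial>M) \<le>
     (\<integral>\<^sup>+w. (\<Sum>j<n. ennreal (2 / eps\<^sup>2 * env (zc j w))) \<partial>M)"
    proof (rule nn_integral_mono)
     fix w
     have "(\<Sum>j<n. atrisk j s w * (\<zeta> (cov (Y j w)) - m s (ys w))\<^sup>2) <= (\<Sum>j<n. atrisk j s w * (\<zeta> (cov (Y j w)))\<^sup>2)"
      unfolding m_def risk_mean_def risk_def by (rule weighted_variance_le) auto
     also have "... <= (\<Sum>j<n. 2 / eps\<^sup>2 * env (zc j w))"
     proof (rule sum_mono)
      fix j
      have "atrisk j s w * (\<zeta> (cov (Y j w)))\<^sup>2 <= exp (beta0 \<bullet> zc j w) * (norm (zc j w))\<^sup>2"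
       using power_mono[OF \<zeta>[of "zc j w"], of 2] by (intro mult_mono) auto
      also have "... <= 2 / eps\<^sup>2 * env (zc j w)" using norm_sq_exp_le_env[of "zc j w"] by (simp add: mult.commute)
      finally show "atrisk j s w * (\<zeta> (cov (Y j w)))\<^sup>2 <= 2 / eps\<^sup>2 * env (zc j w)" .
     qed
     finally show "ennreal (\<Sum>j<n. atrisk j s w * (\<zeta> (cov (Y j w)) - m s (ys w))\<^sup>2) <= (\<Sum>j<n. ennreal (2 / eps\<^sup>2 * env (zc j w)))"
      by (subst sum_ennreal) (simp_all add: env_nonneg ennreal_leI)
    qed
    also have "... = (\<Sum>j<n. \<integral>\<^sup>+w. ennreal (2 / eps\<^sup>2 * env (zc j w)) \<partial>M)"
     by (rule nn_integral_sum) measurable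
    also have "... = (\<Sum>j<n. ennreal K)"
    proof (rule sum.cong[OF refl])
     fix j
     have "(\<integral>\<^sup>+w. ennreal (2 / eps\<^sup>2 * env (zc j w)) \<partial>M) = (\<integral>\<^sup>+y. ennreal (2 / eps\<^sup>2 * env (cov y)) \<partial>P)"
      by (rule nn_integral_Y[of "%y. ennreal (2 / eps\<^sup>2 * env (cov y))"]) measurable
     also have "... = ennreal K"
      unfolding K_def using env_integrable
      by (subst nn_integral_eq_integral) (auto simp: env_nonneg)
     finally show "(\<integral>\<^sup>+w. ennreal (2 / eps\<^sup>2 * env (zc j w)) \<partial>M) = ennreal K" .
    qed
    also have "... = ennreal (K * real n)" using K0 by (simp add: ennreal_mult ennreal_of_nat_eq_real_of_nat mult.commute)
    finally show "(\<integral>\<^sup>+w. ennreal (\<Sum>j<n. atrisk j s w * (\<zeta> (cov (Y j w)) - m s (ys w))\<^sup>2) \<partial>M)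
     <= ennreal (K * real n * indicator {0..tauH} s)" using s by simp
   qed (use K0 obs.tauH_pos m_pred in auto)
   finally show ?thesis .
  qed
  \<comment> \<open>Positive parts, and below negative parts, of the off-diagonal products in which
    the time of \<open>i\<close> precedes that of \<open>j\<close>.\<close>
  define Gp where "Gp i w = (\<Sum>j<n. of_bool (T i w < T j w) * max 0 (D i (ys w) * D j (ys w)))" for i w
  define Gm where "Gm i w = (\<Sum>j<n. of_bool (T i w < T j w) * max 0 (- (D i (ys w) * D j (ys w))))" for i w
  have [measurable]: "Gp i \<in> borel_measurable M" "Gm i \<in> borel_measurable M" for i
   unfolding Gp_def Gm_def by measurable
  have G0: "0 <= Gp i w" "0 <= Gm i w" for i w by (auto simp: Gp_def Gm_def intro!: sum_nonneg)
  have Geq: "(\<integral>\<^sup>+w. ennreal (Gp i w) \<partial>M) = (\<integral>\<^sup>+w. ennreal (Gm i w) \<partial>M)" for i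
  proof -
   \<comment> \<open>The factor \<open>D i\<close> is settled before time \<open>s\<close> and
     therefore predictable for \<open>j\<close>; the sign \<open>\<sigma>\<close> selects the
     positive or the negative part.\<close>
   define h where "h \<sigma> j s y = of_bool (fst (y i) < s) * max 0 (\<sigma> * (D i y * (\<zeta> (cov (y j)) - m s y)))"
    for \<sigma> :: real and j s and y :: "nat => 'p obs"
   have pred: "h \<sigma> j s (y(j := (s, 1, cov (y j)))) = h \<sigma> j s y" if s: "s <= fst (y j)" for \<sigma> j s y
   proof (cases "i = j")
    case True
    then show ?thesis using s by (simp add: h_def)
   next
    case False
    show ?thesis
    proof (cases "fst (y i) < s")
     case True
     with False s show ?thesis by (simp add: h_def D m_pred m_pred')
    next
     case f: False
     then show ?thesis using False by (simp add: h_def)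
    qed
   qed
   have hm: "(%p. h \<sigma> j (fst p) (snd p)) \<in> borel_measurable (borel \<Otimes>\<^sub>M PIB)" for \<sigma> j
    unfolding h_def by measurable
   have eq: "(\<Sum>j<n. event (Y j w) * h \<sigma> j (T j w) (ys w)) =
     (\<Sum>j<n. of_bool (T i w < T j w) * max 0 (\<sigma> * (D i (ys w) * D j (ys w))))" for w \<sigma>
   proof (rule sum.cong[OF refl])
    fix j
    show "event (Y j w) * h \<sigma> j (T j w) (ys w) = of_bool (T i w < T j w) * max 0 (\<sigma> * (D i (ys w) * D j (ys w)))"
     using event_cases[of "Y j w"] by (auto simp: h_def D)
   qed
   \<comment> \<open>After compensation the two parts differ by a multiple of the weighted sum of
     deviations from the weighted mean, which is 0.\<close>
   have bal: "(\<Sum>j<n. atrisk j s w * h 1 j s (ys w)) = (\<Sum>j<n. atrisk j s w * h (-1) j s (ys w))" for s w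
   proof -
    have "(\<Sum>j<n. atrisk j s w * h 1 j s (ys w)) - (\<Sum>j<n. atrisk j s w * h (-1) j s (ys w)) =
     (\<Sum>j<n. of_bool (T i w < s) * D i (ys w) * (atrisk j s w * (\<zeta> (zc j w) - m s (ys w))))"
     unfolding sum_subtractf[symmetric] by (intro sum.cong refl) (auto simp: h_def max_def)
    also have "... = of_bool (T i w < s) * D i (ys w) * (\<Sum>j<n. atrisk j s w * (\<zeta> (zc j w) - m s (ys w)))"
     by (rule sum_distrib_left[symmetric])
    also have "(\<Sum>j<n. atrisk j s w * (\<zeta> (zc j w) - m s (ys w))) = 0"
     unfolding m_def risk_mean_def risk_def by (rule weighted_mean_deviation) auto
    finally show ?thesis by simp
   qed
   have "(\<integral>\<^sup>+w. ennreal (Gp i w) \<partial>M) = (\<integral>\<^sup>+w. ennreal (\<Sum>j<n. event (Y j w) * h 1 j (T j w) (ys w)) \<partial>M)"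
    unfolding eq by (simp add: Gp_def)
   also have "... = (\<integral>\<^sup>+w. ennreal (\<Sum>j<n. event (Y j w) * h (-1) j (T j w) (ys w)) \<partial>M)"
   proof -
    have h0: "0 <= h \<sigma> j s y" for \<sigma> j s y by (simp add: h_def)
    have c: "(\<integral>\<^sup>+w. ennreal (\<Sum>j<n. event (Y j w) * h \<sigma> j (T j w) (ys w)) \<partial>M) =
     (\<integral>\<^sup>+s\<in>{0..tauH}. ennreal (lam0 s) * (\<integral>\<^sup>+w. ennreal (\<Sum>j<n. atrisk j s w * h \<sigma> j s (ys w)) \<partial>M) \<partial>lborel)" for \<sigma>
     using hm h0 pred by (rule compensation_sum[where h = "h \<sigma>"])
    show ?thesis unfolding c[of 1] c[of "-1"] bal ..
   qed
   also have "... = (\<integral>\<^sup>+w. ennreal (Gm i w) \<partial>M)" unfolding eq by (simp add: Gm_def)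
   finally show ?thesis .
  qed
  \<comment> \<open>Finiteness is what permits cancelling this term from both sides of an identity
    between extended nonnegative numbers.\<close>
  have Gfin: "(\<integral>\<^sup>+w. ennreal (Gm i w) \<partial>M) < \<infinity>" if i: "i < n" for i
  proof -
   have "(\<integral>\<^sup>+w. ennreal (Gm i w) \<partial>M) <= (\<integral>\<^sup>+w. ennreal (real n) * ennreal (\<Sum>j<n. (D j (ys w))\<^sup>2) \<partial>M)"
   proof (rule nn_integral_mono)
    fix w
    have "Gm i w <= (\<Sum>j<n. (D i (ys w))\<^sup>2 / 2 + (D j (ys w))\<^sup>2 / 2)"
     unfolding Gm_def
    proof (rule sum_mono)
     fix j
     have "0 <= (D i (ys w) + D j (ys w))\<^sup>2" by simp
     then have "- (D i (ys w) * D j (ys w)) <= (D i (ys w))\<^sup>2 / 2 + (D j (ys w))\<^sup>2 / 2"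
      by (simp add: power2_sum)
     then show "of_bool (T i w < T j w) * max 0 (- (D i (ys w) * D j (ys w))) <= (D i (ys w))\<^sup>2 / 2 + (D j (ys w))\<^sup>2 / 2"
      by auto
    qed
    also have "... <= real n * (\<Sum>j<n. (D j (ys w))\<^sup>2)"
    proof -
     let ?S = "\<Sum>j<n. (D j (ys w))\<^sup>2"
     have 1: "(D i (ys w))\<^sup>2 <= ?S" using i by (intro member_le_sum) auto
     have "0 <= ?S" by (simp add: sum_nonneg)
     then have 2: "?S <= real n * ?S" using i mult_right_mono[of 1 "real n" ?S] by simp
     have "(\<Sum>j<n. (D i (ys w))\<^sup>2 / 2 + (D j (ys w))\<^sup>2 / 2) = real n * ((D i (ys w))\<^sup>2 / 2) + ?S / 2"
      by (simp add: sum.distrib sum_divide_distrib)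
     also have "... <= real n * (?S / 2) + (real n * ?S) / 2" using 1 2 by (intro add_mono mult_left_mono) auto
     finally show ?thesis by simp
    qed
    finally show "ennreal (Gm i w) <= ennreal (real n) * ennreal (\<Sum>j<n. (D j (ys w))\<^sup>2)"
     by (subst ennreal_mult[symmetric]) (auto intro!: ennreal_leI sum_nonneg)
   qed
   also have "... = ennreal (real n) * (\<integral>\<^sup>+w. ennreal (\<Sum>j<n. (D j (ys w))\<^sup>2) \<partial>M)"
    by (rule nn_integral_cmult) measurable
   also have "... < \<infinity>" using diag by (auto simp: ennreal_mult_less_top intro: le_less_trans)
   finally show ?thesis .
  qed
  \<comment> \<open>Pairs with equal times occur in neither order. They contribute nothing: event
    times have an intensity with respect to Lebesgue measure and almost surely avoid the time of any
    other individual.\<close>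
  have ties: "AE w in M. \<forall>i<n. \<forall>j<n. i \<noteq> j --> T i w = T j w --> event (Y j w) = 0"
  proof -
   have "AE w in M. T i w = T j w --> event (Y j w) = 0" if ij: "i \<noteq> j" for i j
   proof -
    interpret LM: pair_sigma_finite lborel M ..
    have "(%p. ennreal (of_bool (fst p = fst (snd p i)))) \<in> borel_measurable (borel \<Otimes>\<^sub>M PIB)" by measurable
    then have "(\<integral>\<^sup>+w. ennreal (event (Y j w)) * ennreal (of_bool (T j w = T i w)) \<partial>M) =
     (\<integral>\<^sup>+s\<in>{0..tauH}. ennreal (lam0 s) *
      (\<integral>\<^sup>+w. of_bool (s <= T j w) * ennreal (exp (beta0 \<bullet> zc j w)) * ennreal (of_bool (s = T i w)) \<partial>M) \<partial>lborel)"
     using ij by (intro sample_compensation[where H = "%s y. ennreal (of_bool (s = fst (y i)))"]) auto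
    also have "... = (\<integral>\<^sup>+s. 0 \<partial>(lborel :: real measure))"
    proof (rule nn_integral_cong_AE)
     have [measurable]: "(%q. Y i (snd q)) \<in> borel_measurable (lborel \<Otimes>\<^sub>M M)"
      by (rule measurable_compose[OF _ Y_meas]) measurable
     have "(\<integral>\<^sup>+s. (\<integral>\<^sup>+w. ennreal (of_bool (s = T i w)) \<partial>M) \<partial>lborel) = (\<integral>\<^sup>+w. (\<integral>\<^sup>+s. ennreal (of_bool (s = T i w)) \<partial>lborel) \<partial>M)"
      by (rule LM.Fubini'[symmetric]) (simp add: case_prod_beta')
     also have "... = (\<integral>\<^sup>+w. 0 \<partial>M)"
     proof (rule nn_integral_cong)
      fix w
      have "(\<integral>\<^sup>+s. ennreal (of_bool (s = T i w)) \<partial>lborel) = (\<integral>\<^sup>+s. 0 \<partial>(lborel :: real measure))"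
      proof (rule nn_integral_cong_AE)
       show "AE s in lborel. ennreal (of_bool (s = T i w)) = 0"
        using AE_lborel_singleton[of "T i w"] by eventually_elim simp
      qed
      then show "(\<integral>\<^sup>+s. ennreal (of_bool (s = T i w)) \<partial>lborel) = 0" by simp
     qed
     finally have "(\<integral>\<^sup>+s. (\<integral>\<^sup>+w. ennreal (of_bool (s = T i w)) \<partial>M) \<partial>lborel) = 0" by simp
     then have "AE s in lborel. (\<integral>\<^sup>+w. ennreal (of_bool (s = T i w)) \<partial>M) = 0"
      by (subst (asm) nn_integral_0_iff_AE) (auto intro!: borel_measurable_nn_integral simp: case_prod_beta')
     then show "AE s in lborel. ennreal (lam0 s) *
      (\<integral>\<^sup>+w. of_bool (s <= T j w) * ennreal (exp (beta0 \<bullet> zc j w)) * ennreal (of_bool (s = T i w)) \<partial>M) * indicator {0..tauH} s = 0"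
     proof eventually_elim
      case (elim s)
      then have "AE w in M. ennreal (of_bool (s = T i w)) = 0" by (subst (asm) nn_integral_0_iff_AE) auto
      then have "AE w in M. of_bool (s <= T j w) * ennreal (exp (beta0 \<bullet> zc j w)) * ennreal (of_bool (s = T i w)) = 0"
       by eventually_elim simp
      then have "(\<integral>\<^sup>+w. of_bool (s <= T j w) * ennreal (exp (beta0 \<bullet> zc j w)) * ennreal (of_bool (s = T i w)) \<partial>M) = 0"
       by (subst nn_integral_0_iff_AE) auto
      then show ?case by simp
     qed
    qed
    finally have "(\<integral>\<^sup>+w. ennreal (event (Y j w)) * ennreal (of_bool (T j w = T i w)) \<partial>M) = 0" by simp
    then have "AE w in M. ennreal (event (Y j w)) * ennreal (of_bool (T j w = T i w)) = 0"
     by (subst (asm) nn_integral_0_iff_AE) auto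
    then show ?thesis by eventually_elim (auto simp: event_def)
   qed
   then show ?thesis by (intro AE_all_countable[THEN iffD2] allI AE_impI) auto
  qed
  let ?U = "%w. \<Sum>i<n. D i (ys w)"
  \<comment> \<open>The expansion of the square, with the subtracted terms moved to the other side
    so that it can be integrated in \<open>ennreal\<close>.\<close>
  have ident: "AE w in M. (?U w)\<^sup>2 + 2 * (\<Sum>i<n. Gm i w) = (\<Sum>j<n. (D j (ys w))\<^sup>2) + 2 * (\<Sum>i<n. Gp i w)"
   using ties
  proof eventually_elim
   case (elim w)
   define a where "a i j = D i (ys w) * D j (ys w)" for i j
   define b where "b i j = of_bool (T i w < T j w) * a i j" for i j
   have split: "a i j = of_bool (i = j) * a i j + b i j + b j i" if "i < n" "j < n" for i j
   proof (cases "i = j")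
    case False
    show ?thesis
    proof (cases "T i w = T j w")
     case True
     then have "D j (ys w) = 0" using elim that False by (simp add: D)
     then show ?thesis by (simp add: a_def b_def)
    qed (use False in \<open>auto simp: b_def a_def mult.commute\<close>)
   qed (simp add: b_def)
   have bG: "(\<Sum>j<n. b i j) = Gp i w - Gm i w" for i
    unfolding Gp_def Gm_def sum_subtractf[symmetric] b_def a_def
    by (intro sum.cong refl) (auto simp: max_def)
   have "(?U w)\<^sup>2 = (\<Sum>i<n. \<Sum>j<n. a i j)" by (simp add: power2_eq_square sum_product a_def)
   also have "... = (\<Sum>i<n. \<Sum>j<n. of_bool (i = j) * a i j + b i j + b j i)"
    by (intro sum.cong refl split) auto
   also have "... = (\<Sum>i<n. \<Sum>j<n. of_bool (i = j) * a i j) + (\<Sum>i<n. \<Sum>j<n. b i j) + (\<Sum>i<n. \<Sum>j<n. b j i)"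
    by (simp add: sum.distrib)
   also have "(\<Sum>i<n. \<Sum>j<n. b j i) = (\<Sum>i<n. \<Sum>j<n. b i j)" by (rule sum.swap)
   also have "(\<Sum>i<n. \<Sum>j<n. of_bool (i = j) * a i j) = (\<Sum>i<n. a i i)"
    by (intro sum.cong refl) (simp add: of_bool_def if_distrib[of "%u. u * _"] cong: if_cong)
   finally show ?case by (simp add: a_def power2_eq_square sum_subtractf bG)
  qed
  have "(\<integral>\<^sup>+w. ennreal ((?U w)\<^sup>2) \<partial>M) + 2 * (\<Sum>i<n. \<integral>\<^sup>+w. ennreal (Gm i w) \<partial>M) =
    (\<integral>\<^sup>+w. ennreal ((?U w)\<^sup>2) + 2 * (\<Sum>i<n. ennreal (Gm i w)) \<partial>M)"
   by (simp add: nn_integral_add nn_integral_cmult nn_integral_sum)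
  also have "... = (\<integral>\<^sup>+w. ennreal (\<Sum>j<n. (D j (ys w))\<^sup>2) + 2 * (\<Sum>i<n. ennreal (Gp i w)) \<partial>M)"
  proof (rule nn_integral_cong_AE)
   show "AE w in M. ennreal ((?U w)\<^sup>2) + 2 * (\<Sum>i<n. ennreal (Gm i w)) =
     ennreal (\<Sum>j<n. (D j (ys w))\<^sup>2) + 2 * (\<Sum>i<n. ennreal (Gp i w))"
   using ident proof eventually_elim
   case (elim w)
   have tw: "2 * (\<Sum>i<n. ennreal (g i)) = ennreal (2 * (\<Sum>i<n. g i))" if "\<And>i. 0 <= g i" for g :: "nat => real"
    using that by (simp add: ennreal_mult' sum_nonneg)
   have "ennreal ((?U w)\<^sup>2) + 2 * (\<Sum>i<n. ennreal (Gm i w)) = ennreal ((?U w)\<^sup>2 + 2 * (\<Sum>i<n. Gm i w))"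
    unfolding tw[OF G0(2)] by (subst ennreal_plus) (auto intro!: sum_nonneg G0)
   also have "... = ennreal ((\<Sum>j<n. (D j (ys w))\<^sup>2) + 2 * (\<Sum>i<n. Gp i w))" by (simp add: elim)
   also have "... = ennreal (\<Sum>j<n. (D j (ys w))\<^sup>2) + 2 * (\<Sum>i<n. ennreal (Gp i w))"
    unfolding tw[OF G0(1)] by (subst ennreal_plus) (auto intro!: sum_nonneg G0)
   finally show ?case .
   qed
  qed
  also have "... = (\<integral>\<^sup>+w. ennreal (\<Sum>j<n. (D j (ys w))\<^sup>2) \<partial>M) + 2 * (\<Sum>i<n. \<integral>\<^sup>+w. ennreal (Gp i w) \<partial>M)"
   by (simp add: nn_integral_add nn_integral_cmult nn_integral_sum)
  also have "(\<Sum>i<n. \<integral>\<^sup>+w. ennreal (Gp i w) \<partial>M) = (\<Sum>i<n. \<integral>\<^sup>+w. ennreal (Gm i w) \<partial>M)" by (simp add: Geq)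
  finally have "(\<integral>\<^sup>+w. ennreal ((?U w)\<^sup>2) \<partial>M) + 2 * (\<Sum>i<n. \<integral>\<^sup>+w. ennreal (Gm i w) \<partial>M) =
   (\<integral>\<^sup>+w. ennreal (\<Sum>j<n. (D j (ys w))\<^sup>2) \<partial>M) + 2 * (\<Sum>i<n. \<integral>\<^sup>+w. ennreal (Gm i w) \<partial>M)" .
  moreover have "2 * (\<Sum>i<n. \<integral>\<^sup>+w. ennreal (Gm i w) \<partial>M) < \<top>"
   using Gfin by (auto simp: ennreal_mult_less_top)
  ultimately have "(\<integral>\<^sup>+w. ennreal ((?U w)\<^sup>2) \<partial>M) = (\<integral>\<^sup>+w. ennreal (\<Sum>j<n. (D j (ys w))\<^sup>2) \<partial>M)"
   unfolding add.commute[of _ "2 * (\<Sum>i<n. \<integral>\<^sup>+w. ennreal (Gm i w) \<partial>M)"] ennreal_add_left_cancel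
   by (elim disjE) (simp_all only: infinity_ennreal_def less_irrefl)
  then show ?thesis using diag by (simp add: D_def mult_ac)
 qed
 then show ?thesis by blast
qed

end

section \<open>The partial likelihood\<close>

declare sum_of_bool_mult_eq [simp del] sum_mult_of_bool_eq [simp del]

text \<open>Square \<open>1 + x / 2 <= exp (x / 2)\<close>; the restriction on \<open>x\<close>
  makes the smaller side nonnegative.\<close>

lemma exp_ge_quadratic: fixes x :: real assumes "- 2 <= x" shows "1 + x + x\<^sup>2 / 4 <= exp x"
proof -
 have "(1 + x / 2)\<^sup>2 <= (exp (x / 2))\<^sup>2"
  using assms exp_ge_add_one_self[of "x / 2"] by (intro power_mono) auto
 also have "... = exp x" by (simp flip: exp_double)
 finally show ?thesis by (simp add: power2_eq_square algebra_simps)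
qed

lemma ln_one_plus_ge_half:
 fixes q :: real assumes "0 <= q" "q <= 1" shows "q / 2 <= ln (1 + q)"
proof -
 have "ln (1 / (1 + q)) <= 1 / (1 + q) - 1" using assms by (intro ln_le_minus_one) auto
 then have "1 - 1 / (1 + q) <= ln (1 + q)" using assms by (simp add: ln_div)
 moreover have "q / 2 <= 1 - 1 / (1 + q)"
 proof -
  have "q * (1 + q) <= q * 2" using assms by (intro mult_left_mono) auto
  then show ?thesis using assms by (simp add: field_simps)
 qed
 ultimately show ?thesis by linarith
qed

definition loglik :: "nat => (nat => ('p::finite) obs) => real ^ 'p => real" where
 "loglik n y \<beta> = (\<Sum>i<n. event (y i) * (\<beta> \<bullet> cov (y i) - ln (risk n \<beta> (fst (y i)) y)))"

lemma risk_pos: "i < n ==> s <= fst (y i) ==> 0 < risk n \<beta> s y"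
 unfolding risk_def by (intro sum_pos2[where i = i]) auto

lemma ln_partial_lik: "0 < partial_lik n y \<beta> \<and> ln (partial_lik n y \<beta>) = loglik n y \<beta>"
proof -
 define I where "I = {i. i < n \<and> fst (snd (y i)) = 1}"
 have fin: "finite I" by (simp add: I_def)
 have eq: "partial_lik n y \<beta> = (\<Prod>i\<in>I. exp (\<beta> \<bullet> cov (y i)) / risk n \<beta> (fst (y i)) y)"
  by (simp add: partial_lik_def Let_def risk_def I_def)
 have pos: "0 < exp (\<beta> \<bullet> cov (y i)) / risk n \<beta> (fst (y i)) y" if "i \<in> I" for i
  using that risk_pos[of i n "fst (y i)" y \<beta>] by (simp add: I_def)
 then have "0 < partial_lik n y \<beta>" unfolding eq by (rule prod_pos)
 moreover have "ln (partial_lik n y \<beta>) = (\<Sum>i\<in>I. \<beta> \<bullet> cov (y i) - ln (risk n \<beta> (fst (y i)) y))"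
 proof -
  have "ln (exp (\<beta> \<bullet> cov (y i)) / risk n \<beta> (fst (y i)) y) = \<beta> \<bullet> cov (y i) - ln (risk n \<beta> (fst (y i)) y)" if "i \<in> I" for i
   using that risk_pos[of i n "fst (y i)" y \<beta>] by (simp add: I_def ln_div)
  moreover have "ln (\<Prod>i\<in>I. exp (\<beta> \<bullet> cov (y i)) / risk n \<beta> (fst (y i)) y) =
    (\<Sum>i\<in>I. ln (exp (\<beta> \<bullet> cov (y i)) / risk n \<beta> (fst (y i)) y))"
  proof (rule ln_prod)
   show "exp (\<beta> \<bullet> cov (y i)) / risk n \<beta> (fst (y i)) y \<noteq> 0" if "i \<in> I" for i
    using pos[OF that] by (rule less_imp_neq[symmetric])
  qed (simp add: I_def)
  ultimately show ?thesis unfolding eq by (simp cong: sum.cong)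
 qed
 moreover have "... = loglik n y \<beta>"
  unfolding loglik_def using fin
  by (intro sum.mono_neutral_cong_left) (auto simp: I_def event_def)
 ultimately show ?thesis by simp
qed

lemma is_mple_loglik: "is_mple n y \<beta> ==> loglik n y \<beta>' <= loglik n y \<beta>"
proof -
 assume "is_mple n y \<beta>"
 then have "partial_lik n y \<beta>' <= partial_lik n y \<beta>"
  unfolding is_mple_def by (cases "\<beta>' = \<beta>") (auto intro: less_imp_le)
 then have "ln (partial_lik n y \<beta>') <= ln (partial_lik n y \<beta>)"
  using ln_partial_lik[of n y \<beta>'] by (intro ln_mono) auto
 then show ?thesis by (simp add: ln_partial_lik)
qed

text \<open>A shift of \<open>\<beta>\<close> by \<open>a\<close> multiplies the numerators and the
  risk sums by the same factor \<open>exp c\<close>, so the partial likelihood does not change and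
  no maximizer is unique.\<close>

lemma not_is_mple_degenerate:
 assumes "a \<noteq> 0" "\<And>i. i < n ==> a \<bullet> cov (y i) = c"
 shows "\<not> is_mple n y \<beta>"
proof -
 have risk: "risk n (\<beta> + a) s y = exp c * risk n \<beta> s y" for s
  using assms(2) by (simp add: risk_def sum_distrib_left inner_add_left exp_add mult_ac)
 have "loglik n y (\<beta> + a) = loglik n y \<beta>"
  unfolding loglik_def risk
  using assms(2) by (intro sum.cong refl) (simp add: ln_mult_pos risk_pos inner_add_left)
 then have "partial_lik n y (\<beta> + a) = partial_lik n y \<beta>"
  using ln_partial_lik[of n y \<beta>] ln_partial_lik[of n y "\<beta> + a"] by (metis exp_ln)
 then show ?thesis using assms(1) unfolding is_mple_def by (auto intro!: exI[of _ "\<beta> + a"])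
qed

text \<open>Centring the exponents at the risk-set mean removes the linear term, and
  \<open>exp u >= 1 + u\<close> alone gives Jensen's inequality. Observations marked by
  \<open>g\<close> contribute an additional quadratic term, at the price of the lower bound -2 on
  their exponents; \<open>q\<close> collects this gain.\<close>

lemma ln_risk_shift:
 fixes v :: "real ^ 'p"
 assumes pos: "0 < risk n \<beta> s y" and q: "0 <= q" "q <= 1" and g: "\<And>j. g j = 0 \<or> g j = (1::real)"
  and small: "\<And>j. j < n ==> g j = 1 ==> - 2 <= v \<bullet> cov (y j) - risk_mean n \<beta> (%z. v \<bullet> z) s y"
  and le: "q * risk n \<beta> s y <= (\<Sum>j<n. of_bool (s <= fst (y j)) * exp (\<beta> \<bullet> cov (y j)) *
    (g j * (v \<bullet> cov (y j) - risk_mean n \<beta> (%z. v \<bullet> z) s y)\<^sup>2 / 4))"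
 shows "risk_mean n \<beta> (%z. v \<bullet> z) s y + q / 2 <= ln (risk n (\<beta> + v) s y) - ln (risk n \<beta> s y)"
proof -
 define m where "m = risk_mean n \<beta> (%z. v \<bullet> z) s y"
 define a where "a j = of_bool (s <= fst (y j)) * exp (\<beta> \<bullet> cov (y j))" for j
 define u where "u j = v \<bullet> cov (y j) - m" for j
 have R: "risk n \<beta> s y = (\<Sum>j<n. a j)" by (simp add: risk_def a_def)
 have u0: "(\<Sum>j<n. a j * u j) = 0"
  unfolding u_def m_def risk_mean_def R a_def[symmetric] by (rule weighted_mean_deviation) (auto simp: a_def)
 have "risk n (\<beta> + v) s y = (\<Sum>j<n. exp m * (a j * exp (u j)))"
  unfolding risk_def by (intro sum.cong refl) (simp add: a_def u_def inner_add_left flip: exp_add)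
 also have "... = exp m * (\<Sum>j<n. a j * exp (u j))" by (rule sum_distrib_left[symmetric])
 also have "... >= exp m * ((1 + q) * risk n \<beta> s y)"
 proof (rule mult_left_mono)
  have "(1 + q) * risk n \<beta> s y <= (\<Sum>j<n. a j) + (\<Sum>j<n. a j * u j) + (\<Sum>j<n. a j * (g j * (u j)\<^sup>2 / 4))"
  proof -
   have "q * risk n \<beta> s y <= (\<Sum>j<n. a j * (g j * (u j)\<^sup>2 / 4))"
    using le unfolding a_def u_def m_def .
   then show ?thesis by (simp add: distrib_right u0 R)
  qed
  also have "... = (\<Sum>j<n. a j * (1 + u j + g j * (u j)\<^sup>2 / 4))"
   by (simp add: sum.distrib distrib_left)
  also have "... <= (\<Sum>j<n. a j * exp (u j))"
  proof (intro sum_mono mult_left_mono)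
   fix j assume j: "j \<in> {..<n}"
   show "1 + u j + g j * (u j)\<^sup>2 / 4 <= exp (u j)"
    using g[of j] small[of j] j exp_ge_quadratic[of "u j"] exp_ge_add_one_self[of "u j"]
    by (auto simp: u_def m_def)
  qed (simp add: a_def)
  finally show "(1 + q) * risk n \<beta> s y <= (\<Sum>j<n. a j * exp (u j))" .
 qed simp
 finally have "ln (exp m * ((1 + q) * risk n \<beta> s y)) <= ln (risk n (\<beta> + v) s y)"
  using pos q by (intro ln_mono) auto
 then have "m + (ln (1 + q) + ln (risk n \<beta> s y)) <= ln (risk n (\<beta> + v) s y)"
  using pos q by (simp add: ln_mult_pos)
 then show ?thesis using ln_one_plus_ge_half[OF q] unfolding m_def by linarith
qed

text \<open>The case \<open>g = 0\<close>, \<open>q = 0\<close> of the shift inequality: concavity,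
  in the form of a global tangent bound.\<close>

lemma loglik_tangent:
 "loglik n y (\<beta> + v) <= loglik n y \<beta> + (\<Sum>i<n. score_term n \<beta> (%z. v \<bullet> z) i y)"
proof -
 have "loglik n y (\<beta> + v) <= (\<Sum>i<n. event (y i) * (\<beta> \<bullet> cov (y i) - ln (risk n \<beta> (fst (y i)) y)) + score_term n \<beta> (%z. v \<bullet> z) i y)"
  unfolding loglik_def
 proof (rule sum_mono)
  fix i assume i: "i \<in> {..<n}"
  have "risk_mean n \<beta> (%z. v \<bullet> z) (fst (y i)) y + 0 / 2 <= ln (risk n (\<beta> + v) (fst (y i)) y) - ln (risk n \<beta> (fst (y i)) y)"
   using i by (intro ln_risk_shift[where g = "%_. 0"]) (auto intro: risk_pos)
  then have "event (y i) * ((\<beta> + v) \<bullet> cov (y i) - ln (risk n (\<beta> + v) (fst (y i)) y)) \<le>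
   event (y i) * ((\<beta> \<bullet> cov (y i) - ln (risk n \<beta> (fst (y i)) y)) + (v \<bullet> cov (y i) - risk_mean n \<beta> (%z. v \<bullet> z) (fst (y i)) y))"
   by (intro mult_left_mono event_nonneg) (simp add: inner_add_left)
  then show "event (y i) * ((\<beta> + v) \<bullet> cov (y i) - ln (risk n (\<beta> + v) (fst (y i)) y)) \<le>
   event (y i) * (\<beta> \<bullet> cov (y i) - ln (risk n \<beta> (fst (y i)) y)) + score_term n \<beta> (%z. v \<bullet> z) i y"
   by (simp add: score_term_def distrib_left)
 qed
 then show ?thesis by (simp add: loglik_def sum.distrib)
qed

lemma score_term_scale: "score_term n \<beta> (%z. (r *\<^sub>R v) \<bullet> z) i y = r * score_term n \<beta> (%z. v \<bullet> z) i y"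
proof -
 have "risk_mean n \<beta> (%z. (r *\<^sub>R v) \<bullet> z) s y = r * risk_mean n \<beta> (%z. v \<bullet> z) s y" for s
  by (simp add: risk_mean_def sum_distrib_left mult_ac)
 then show ?thesis by (simp add: score_term_def algebra_simps)
qed

lemma score_term_expand: "score_term n \<beta> (%z. a \<bullet> z) i y = (\<Sum>k\<in>UNIV. a $ k * score_term n \<beta> (%z. z $ k) i y)"
proof -
 have "risk_mean n \<beta> (%z. a \<bullet> z) s y = (\<Sum>k\<in>UNIV. a $ k * risk_mean n \<beta> (%z. z $ k) s y)" for s
 proof -
  have "(\<Sum>j<n. of_bool (s <= fst (y j)) * exp (\<beta> \<bullet> cov (y j)) * (a \<bullet> cov (y j))) =
    (\<Sum>j<n. \<Sum>k\<in>UNIV. a $ k * (of_bool (s <= fst (y j)) * exp (\<beta> \<bullet> cov (y j)) * cov (y j) $ k))"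
   unfolding inner_vec_def[of a] by (intro sum.cong refl) (simp add: sum_distrib_left mult_ac)
  also have "... = (\<Sum>k\<in>UNIV. a $ k * (\<Sum>j<n. of_bool (s <= fst (y j)) * exp (\<beta> \<bullet> cov (y j)) * cov (y j) $ k))"
   by (subst sum.swap) (simp add: sum_distrib_left)
  finally show ?thesis unfolding risk_mean_def by (simp only: sum_divide_distrib[of _ UNIV] times_divide_eq_right)
 qed
 then show ?thesis
  by (simp add: score_term_def inner_vec_def sum_distrib_left right_diff_distrib sum_subtractf mult_ac)
qed

text \<open>Take the tangent at the intermediate point. Depending on the sign of its slope
  \<open>G\<close>, it bounds the value at one of the two ends of the segment by the intermediate
  value.\<close>

lemma loglik_segment:
 assumes "loglik n y \<beta> <= loglik n y (\<beta> + r *\<^sub>R v)" "0 <= s" "s <= r"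
 shows "loglik n y \<beta> <= loglik n y (\<beta> + s *\<^sub>R v)"
proof -
 define G where "G = (\<Sum>i<n. score_term n (\<beta> + s *\<^sub>R v) (%z. v \<bullet> z) i y)"
 have G: "loglik n y (\<beta> + s *\<^sub>R v + t *\<^sub>R v) <= loglik n y (\<beta> + s *\<^sub>R v) + t * G" for t
  using loglik_tangent[of n y "\<beta> + s *\<^sub>R v" "t *\<^sub>R v"] unfolding score_term_scale
  by (simp add: G_def sum_distrib_left)
 show ?thesis
 proof (cases "0 <= G")
  case True
  have "loglik n y \<beta> <= loglik n y (\<beta> + s *\<^sub>R v) + (- s) * G" using G[of "- s"] by simp
  moreover have "(- s) * G <= 0" using True assms(2) by simp
  ultimately show ?thesis by linarith
 next
  case False
  have "\<beta> + s *\<^sub>R v + (r - s) *\<^sub>R v = \<beta> + r *\<^sub>R v" by (simp add: algebra_simps)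
  with G[of "r - s"] have "loglik n y (\<beta> + r *\<^sub>R v) <= loglik n y (\<beta> + s *\<^sub>R v) + (r - s) * G" by simp
  moreover have "(r - s) * G <= 0" using False assms(3) by (intro mult_nonneg_nonpos) auto
  ultimately show ?thesis using assms(1) by linarith
 qed
qed

text \<open>Observations that last until \<open>t0\<close> with covariate of norm at most
  \<open>B\<close> belong to the risk set of every event up to \<open>t0\<close>, with weights
  bounded below. Their spread in direction \<open>a\<close> yields a fixed quadratic loss for each
  such event; for later events only concavity is used.\<close>

lemma loglik_quadratic_drop:
 fixes a :: "real ^ 'p" and B t0 :: real
 defines "good \<equiv> %y :: 'p obs. of_bool (t0 <= fst y \<and> norm (cov y) <= B)"
 assumes n: "0 < n" and B: "0 <= B" and a: "norm a = 1"
  and \<kappa>: "\<kappa> <= emp n good y * emp n (%y. good y * (a \<bullet> cov y)\<^sup>2) y - (emp n (%y. good y * (a \<bullet> cov y)) y)\<^sup>2" "0 <= \<kappa>"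
  and Cw: "0 < Cw" "\<And>s. risk n \<beta> s y <= real n * Cw"
  and Mb: "\<And>i. i < n ==> fst (y i) <= t0 ==> \<bar>risk_mean n \<beta> (%z. a \<bullet> z) (fst (y i)) y\<bar> <= Mb"
  and c1: "c1 = exp (- norm \<beta> * B) * \<kappa> / (4 * Cw)"
  and s: "0 <= s" "s * (B + Mb) <= 2" "s\<^sup>2 * c1 <= 1"
 shows "loglik n y (\<beta> + s *\<^sub>R a) <= loglik n y \<beta> + s * (\<Sum>i<n. score_term n \<beta> (%z. a \<bullet> z) i y)
   - s\<^sup>2 * c1 / 2 * (\<Sum>i<n. event (y i) * of_bool (fst (y i) <= t0))"
proof -
 let ?v = "s *\<^sub>R a"
 define M where "M i = risk_mean n \<beta> (%z. a \<bullet> z) (fst (y i)) y" for i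
 have M: "risk_mean n \<beta> (%z. ?v \<bullet> z) (fst (y i)) y = s * M i" for i
  by (simp add: M_def risk_mean_def sum_distrib_left mult_ac)
 have c10: "0 <= c1" using \<kappa> Cw by (simp add: c1)
 have drop: "s * M i + s\<^sup>2 * c1 * of_bool (fst (y i) <= t0) / 2 \<le>
   ln (risk n (\<beta> + ?v) (fst (y i)) y) - ln (risk n \<beta> (fst (y i)) y)" if i: "i < n" for i
 proof (cases "fst (y i) <= t0")
  case False
  have "risk_mean n \<beta> (%z. ?v \<bullet> z) (fst (y i)) y + 0 / 2 <= ln (risk n (\<beta> + ?v) (fst (y i)) y) - ln (risk n \<beta> (fst (y i)) y)"
   using i by (intro ln_risk_shift[where g = "%_. 0"]) (auto intro: risk_pos)
  then show ?thesis unfolding M using False by simp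
 next
  case True
  have abs_a: "\<bar>a \<bullet> z\<bar> <= norm z" for z using Cauchy_Schwarz_ineq2[of a z] a by simp
  have "risk_mean n \<beta> (%z. ?v \<bullet> z) (fst (y i)) y + (s\<^sup>2 * c1) / 2 <= ln (risk n (\<beta> + ?v) (fst (y i)) y) - ln (risk n \<beta> (fst (y i)) y)"
  proof (rule ln_risk_shift[where g = "%j. good (y j)"])
   show "0 < risk n \<beta> (fst (y i)) y" using i by (auto intro: risk_pos)
   show "0 <= s\<^sup>2 * c1" "s\<^sup>2 * c1 <= 1" using c10 s by auto
   show "good (y j) = 0 \<or> good (y j) = 1" for j by (simp add: good_def)
   show "- 2 <= ?v \<bullet> cov (y j) - risk_mean n \<beta> (%z. ?v \<bullet> z) (fst (y i)) y" if "good (y j) = 1" for j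
   proof -
    have "\<bar>a \<bullet> cov (y j)\<bar> <= B" using abs_a[of "cov (y j)"] that by (simp add: good_def split: if_splits)
    then have "- (B + Mb) <= a \<bullet> cov (y j) - M i" using Mb[OF i True] by (auto simp: M_def)
    then have "s * - (B + Mb) <= s * (a \<bullet> cov (y j) - M i)" using s by (intro mult_left_mono)
    then show ?thesis using s(2) unfolding M unfolding inner_scaleR_left right_diff_distrib by linarith
   qed
   define ec where "ec = exp (- norm \<beta> * B)"
   define S where "S = (\<Sum>j<n. good (y j) * (a \<bullet> cov (y j) - M i)\<^sup>2)"
   have "real n * \<kappa> <= S"
   proof -
    define m0 where "m0 = emp n good y"
    define m1 where "m1 = emp n (%y. good y * (a \<bullet> cov y)) y"
    define m2 where "m2 = emp n (%y. good y * (a \<bullet> cov y)\<^sup>2) y"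
    have "S = (\<Sum>j<n. good (y j) * (a \<bullet> cov (y j))\<^sup>2 - 2 * M i * (good (y j) * (a \<bullet> cov (y j))) + (M i)\<^sup>2 * good (y j))"
     unfolding S_def by (intro sum.cong refl) (simp add: power2_eq_square algebra_simps)
    also have "... = (\<Sum>j<n. good (y j) * (a \<bullet> cov (y j))\<^sup>2) - 2 * M i * (\<Sum>j<n. good (y j) * (a \<bullet> cov (y j))) + (M i)\<^sup>2 * (\<Sum>j<n. good (y j))"
     by (simp add: sum.distrib sum_subtractf sum_distrib_left)
    finally have S: "S / n = m2 - 2 * M i * m1 + (M i)\<^sup>2 * m0"
     using n by (simp add: m0_def m1_def m2_def emp_def field_simps)
    have m0: "0 <= m0" "m0 <= 1"
    proof -
     have "(\<Sum>j<n. good (y j)) <= (\<Sum>j<n. 1)" by (rule sum_mono) (simp add: good_def)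
     then show "m0 <= 1" using n by (simp add: m0_def emp_def)
     show "0 <= m0" by (auto simp: m0_def emp_def good_def intro!: divide_nonneg_nonneg sum_nonneg)
    qed
    have S0: "0 <= S / n" unfolding S_def by (auto simp: good_def intro!: divide_nonneg_nonneg sum_nonneg)
    \<comment> \<open>The second moment about any centre is at least the one about the mean, so the
      same \<open>\<kappa>\<close> serves for the centres \<open>M i\<close> of all events.\<close>
    have "\<kappa> <= m0 * m2 - m1\<^sup>2" using \<kappa> by (simp add: m0_def m1_def m2_def)
    also have "... <= m0 * m2 - m1\<^sup>2 + (m1 - M i * m0)\<^sup>2" by simp
    also have "... = m0 * (S / n)" unfolding S by (simp add: power2_eq_square algebra_simps)
    also have "... <= 1 * (S / n)" by (rule mult_right_mono[OF m0(2) S0])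
    finally show ?thesis using n by (simp add: field_simps)
   qed
   have "s\<^sup>2 * c1 * risk n \<beta> (fst (y i)) y <= s\<^sup>2 * c1 * (real n * Cw)"
    using Cw c10 by (intro mult_left_mono) auto
   also have "... = s\<^sup>2 * ec / 4 * (real n * \<kappa>)" using Cw by (simp add: c1 ec_def field_simps)
   also have "... <= s\<^sup>2 * ec / 4 * S" using \<open>real n * \<kappa> <= S\<close> by (intro mult_left_mono) (auto simp: ec_def)
   also have "... = (\<Sum>j<n. ec * (good (y j) * (s * (a \<bullet> cov (y j) - M i))\<^sup>2 / 4))"
    unfolding S_def sum_distrib_left by (intro sum.cong refl) (simp add: power_mult_distrib mult_ac)
   also have "... <= (\<Sum>j<n. of_bool (fst (y i) <= fst (y j)) * exp (\<beta> \<bullet> cov (y j)) * (good (y j) * (s * (a \<bullet> cov (y j) - M i))\<^sup>2 / 4))"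
   proof (rule sum_mono)
    fix j
    show "ec * (good (y j) * (s * (a \<bullet> cov (y j) - M i))\<^sup>2 / 4) \<le>
     of_bool (fst (y i) <= fst (y j)) * exp (\<beta> \<bullet> cov (y j)) * (good (y j) * (s * (a \<bullet> cov (y j) - M i))\<^sup>2 / 4)"
    proof (cases "t0 <= fst (y j) \<and> norm (cov (y j)) <= B")
     case g: True
     have "- (norm \<beta> * B) <= - (norm \<beta> * norm (cov (y j)))" using g by (simp add: mult_left_mono)
     also have "... <= \<beta> \<bullet> cov (y j)" using Cauchy_Schwarz_ineq2[of \<beta> "cov (y j)"] by linarith
     finally have "ec <= of_bool (fst (y i) <= fst (y j)) * exp (\<beta> \<bullet> cov (y j))"
      using g True by (simp add: ec_def)
     then show ?thesis by (rule mult_right_mono) (simp add: good_def)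
    qed (auto simp: good_def)
   qed
   finally show "s\<^sup>2 * c1 * risk n \<beta> (fst (y i)) y <= (\<Sum>j<n. of_bool (fst (y i) <= fst (y j)) * exp (\<beta> \<bullet> cov (y j)) *
     (good (y j) * (?v \<bullet> cov (y j) - risk_mean n \<beta> (%z. ?v \<bullet> z) (fst (y i)) y)\<^sup>2 / 4))"
    unfolding M by (simp add: right_diff_distrib)
  qed
  then show ?thesis unfolding M using True by simp
 qed
 have "loglik n y (\<beta> + ?v) <= (\<Sum>i<n. event (y i) * (\<beta> \<bullet> cov (y i) - ln (risk n \<beta> (fst (y i)) y))
   + s * score_term n \<beta> (%z. a \<bullet> z) i y - s\<^sup>2 * c1 / 2 * (event (y i) * of_bool (fst (y i) <= t0)))"
  unfolding loglik_def
 proof (rule sum_mono)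
  fix i assume i: "i \<in> {..<n}"
  have "event (y i) * ((\<beta> + ?v) \<bullet> cov (y i) - ln (risk n (\<beta> + ?v) (fst (y i)) y)) \<le>
   event (y i) * ((\<beta> \<bullet> cov (y i) - ln (risk n \<beta> (fst (y i)) y)) + s * (a \<bullet> cov (y i) - M i) - s\<^sup>2 * c1 * of_bool (fst (y i) <= t0) / 2)"
   using drop[of i] i by (intro mult_left_mono event_nonneg) (simp add: inner_add_left right_diff_distrib)
  then show "event (y i) * ((\<beta> + ?v) \<bullet> cov (y i) - ln (risk n (\<beta> + ?v) (fst (y i)) y)) \<le>
   event (y i) * (\<beta> \<bullet> cov (y i) - ln (risk n \<beta> (fst (y i)) y))
   + s * score_term n \<beta> (%z. a \<bullet> z) i y - s\<^sup>2 * c1 / 2 * (event (y i) * of_bool (fst (y i) <= t0))"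
   by (simp add: score_term_def M_def algebra_simps)
 qed
 also have "... = loglik n y \<beta> + s * (\<Sum>i<n. score_term n \<beta> (%z. a \<bullet> z) i y) - s\<^sup>2 * c1 / 2 * (\<Sum>i<n. event (y i) * of_bool (fst (y i) <= t0))"
  by (simp add: loglik_def sum.distrib sum_subtractf sum_distrib_left)
 finally show ?thesis .
qed

lemma (in prob_space) wpo_finite_Ball:
 assumes "finite I" "\<And>i. i \<in> I ==> wpo (Q i)"
 shows "wpo (%n w. \<forall>i\<in>I. Q i n w)"
 using assms
proof (induction I rule: finite_induct)
 case empty
 then show ?case by (intro wpo_AE) simp
next
 case (insert i I)
 then have "wpo (%n w. Q i n w \<and> (\<forall>i\<in>I. Q i n w))" by (intro wpo_conj) auto
 then show ?case by simp
qed

lemma (in prob_space) bdd_in_prob_sum: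
 assumes "finite I" "I \<noteq> {}" "\<And>i. i \<in> I ==> Op (\<phi> i) a"
 shows "Op (%n w. \<Sum>i\<in>I. \<phi> i n w) a"
 using assms
proof (induction I rule: finite_ne_induct)
 case (insert i I)
 then have "Op (%n w. \<phi> i n w + (\<Sum>i\<in>I. \<phi> i n w)) a" by (intro bdd_in_prob_add) auto
 with insert show ?case by simp
qed simp

section \<open>Nondegeneracy of the covariate\<close>

context cox_sample
begin

text \<open>If the covariate lay almost surely in a hyperplane, so would almost every sample, and
  then no unique maximizer could exist.\<close>

lemma cov_nondegenerate:
 assumes mple: "wpo (%n w. is_mple n (ys w) (betahat n w))" and "a \<noteq> 0"
 shows "\<not> (AE y in P. a \<bullet> cov y = c)"
proof
 assume deg: "AE y in P. a \<bullet> cov y = c"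
 have "AE w in M. a \<bullet> zc i w = c" for i
  using deg by (subst AE_Y[of "%y. a \<bullet> cov y = c"]) auto
 then have "AE w in M. \<forall>i. a \<bullet> zc i w = c" by (intro AE_all_countable[THEN iffD2]) auto
 then have "AE w in M. \<not> is_mple n (ys w) (betahat n w)" for n
  by eventually_elim (rule not_is_mple_degenerate[OF \<open>a \<noteq> 0\<close>], simp)
 then have "wpo (%n w. \<not> is_mple n (ys w) (betahat n w))" by (rule wpo_AE)
 from wpo_conj[OF mple this] have "wpo (%n w. False)" by simp
 then have "LARGE n. \<exists>A\<in>events. 1 - 1 / 2 <= prob A \<and> (\<forall>w\<in>A. False)"
  unfolding with_prob_to_one_iff by (auto elim!: allE[of _ "1 / 2"])
 then obtain A where "A \<in> events" "1 - 1 / 2 <= prob A" "\<forall>w\<in>A. False"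
  using eventually_happens[of _ sequentially] by auto
 then show False by (cases "A = {}") auto
qed

text \<open>One index drives both truncations, of early times and of large covariates; almost every
  observation is good for all large indices.\<close>

definition good :: "nat => 'p obs => real" where
 "good j y = of_bool (1 / real (Suc j) <= fst y \<and> norm (cov y) <= real j)"

lemma good_measurable [measurable]: "good j \<in> borel_measurable borel"
 unfolding good_def[abs_def] by measurable

definition gm0 where "gm0 j = (\<integral>y. good j y \<partial>P)"
definition gm1 where "gm1 j k = (\<integral>y. good j y * cov y $ k \<partial>P)"
definition gm2 where "gm2 j k l = (\<integral>y. good j y * (cov y $ k * cov y $ l) \<partial>P)"

lemma good_bounded_integrable:
 assumes [measurable]: "\<psi> \<in> borel_measurable borel" and "\<And>z. norm z <= real j ==> \<bar>\<psi> z\<bar> <= K"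
 shows "integrable P (%y. good j y * \<psi> (cov y))" "\<And>y. \<bar>good j y * \<psi> (cov y)\<bar> <= \<bar>K\<bar>"
proof -
 show b: "\<bar>good j y * \<psi> (cov y)\<bar> <= \<bar>K\<bar>" for y
  using assms(2)[of "cov y"] by (auto simp: good_def)
 have "(%y. good j y * \<psi> (cov y)) \<in> borel_measurable P" unfolding measurable_P by measurable
 then show "integrable P (%y. good j y * \<psi> (cov y))"
  using b by (intro obs.integrable_const_bound[of _ "\<bar>K\<bar>"]) auto
qed

lemma comp_bounds:
 fixes z :: "real ^ 'p"
 assumes "norm z <= real j"
 shows "\<bar>z $ k\<bar> <= real j" "\<bar>z $ k * z $ l\<bar> <= real j * real j"
proof -
 show 1: "\<bar>z $ k\<bar> <= real j" for k using component_le_norm_cart[of z k] assms by linarith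
 show "\<bar>z $ k * z $ l\<bar> <= real j * real j" unfolding abs_mult by (intro mult_mono 1) auto
qed

lemma gm_expand:
 shows "(\<integral>y. good j y * (a \<bullet> cov y) \<partial>P) = (\<Sum>k\<in>UNIV. a $ k * gm1 j k)"
  and "(\<integral>y. good j y * (a \<bullet> cov y)\<^sup>2 \<partial>P) = (\<Sum>k\<in>UNIV. \<Sum>l\<in>UNIV. a $ k * a $ l * gm2 j k l)"
proof -
 have i1: "integrable P (%y. good j y * cov y $ k)" for k
  by (rule good_bounded_integrable(1)[of "%z. z $ k" j "real j"]) (auto intro: comp_bounds)
 have i2: "integrable P (%y. good j y * (cov y $ k * cov y $ l))" for k l
  by (rule good_bounded_integrable(1)[of "%z. z $ k * z $ l" j "real j * real j"]) (auto intro: comp_bounds)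
 have "(\<integral>y. good j y * (a \<bullet> cov y) \<partial>P) = (\<integral>y. (\<Sum>k\<in>UNIV. a $ k * (good j y * cov y $ k)) \<partial>P)"
  by (intro Bochner_Integration.integral_cong refl) (simp add: inner_vec_def sum_distrib_left mult_ac)
 also have "... = (\<Sum>k\<in>UNIV. a $ k * gm1 j k)"
  using i1 by (simp add: gm1_def)
 finally show "(\<integral>y. good j y * (a \<bullet> cov y) \<partial>P) = (\<Sum>k\<in>UNIV. a $ k * gm1 j k)" .
 have "(\<integral>y. good j y * (a \<bullet> cov y)\<^sup>2 \<partial>P) =
   (\<integral>y. (\<Sum>k\<in>UNIV. \<Sum>l\<in>UNIV. a $ k * a $ l * (good j y * (cov y $ k * cov y $ l))) \<partial>P)"
  by (intro Bochner_Integration.integral_cong refl)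
    (simp add: inner_vec_def sum_distrib_left power2_eq_square sum_product mult_ac)
 also have "... = (\<Sum>k\<in>UNIV. \<Sum>l\<in>UNIV. a $ k * a $ l * gm2 j k l)"
  using i2 by (simp add: gm2_def)
 finally show "(\<integral>y. good j y * (a \<bullet> cov y)\<^sup>2 \<partial>P) = (\<Sum>k\<in>UNIV. \<Sum>l\<in>UNIV. a $ k * a $ l * gm2 j k l)" .
qed

text \<open>When \<open>gm0 j\<close> is positive, this is \<open>(gm0 j)\<^sup>2\<close> times the
  variance of \<open>a \<bullet> cov y\<close> given that the observation is good. As a polynomial
  in \<open>a\<close> it is visibly continuous and free of division.\<close>

definition gq where
 "gq j a = gm0 j * (\<Sum>k\<in>UNIV. \<Sum>l\<in>UNIV. a $ k * a $ l * gm2 j k l) - (\<Sum>k\<in>UNIV. a $ k * gm1 j k)\<^sup>2"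

lemma gm0_pos: "\<exists>j0. \<forall>j\<ge>j0. 0 < gm0 j"
proof -
 have "(%j. \<integral>y. good j y \<partial>P) \<longlonglongrightarrow> (\<integral>y. 1 \<partial>P)"
 proof (rule integral_dominated_convergence[where w = "%_. 1"])
  show "(%y. good j y) \<in> borel_measurable P" for j unfolding measurable_P by measurable
  show "AE y in P. norm (good j y) <= 1" for j by (simp add: good_def)
  show "AE y in P. (%j. good j y) \<longlonglongrightarrow> 1"
   using obs.T_AE
  proof eventually_elim
   case (elim y)
   then have "0 < fst y" by (simp add: case_prod_beta')
   have "(%j. 1 / real (Suc j)) \<longlonglongrightarrow> 0" by (rule LIMSEQ_Suc[OF lim_const_over_n])
   then have "\<forall>\<^sub>F j in sequentially. 1 / real (Suc j) < fst y" using \<open>0 < fst y\<close> by (rule order_tendstoD)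
   moreover have "\<forall>\<^sub>F j in sequentially. norm (cov y) <= real j"
    using filterlim_real_sequentially unfolding filterlim_at_top by blast
   ultimately have "\<forall>\<^sub>F j in sequentially. good j y = 1"
    by eventually_elim (simp add: good_def less_imp_le)
   then show ?case by (rule tendsto_eventually)
  qed
 qed auto
 then have "gm0 \<longlonglongrightarrow> 1" by (simp add: gm0_def[abs_def] obs.prob_space)
 then have "\<forall>\<^sub>F j in sequentially. 0 < gm0 j" by (rule order_tendstoD) simp
 then show ?thesis by (simp add: eventually_sequentially)
qed

text \<open>Centring at \<open>c = m1 / gm0 j\<close> makes the truncated second moment equal to
  \<open>gq j a / gm0 j\<close>, hence zero.\<close>

lemma gq_zero_degenerate:
 assumes "gq j a <= 0" "0 < gm0 j"
 shows "\<exists>c. AE y in P. good j y = 1 --> a \<bullet> cov y = c"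
proof -
 define m1 where "m1 = (\<integral>y. good j y * (a \<bullet> cov y) \<partial>P)"
 define m2 where "m2 = (\<integral>y. good j y * (a \<bullet> cov y)\<^sup>2 \<partial>P)"
 define c where "c = m1 / gm0 j"
 have ab: "\<bar>a \<bullet> z\<bar> <= norm a * real j" if "norm z <= real j" for z
  using Cauchy_Schwarz_ineq2[of a z] mult_left_mono[OF that norm_ge_zero[of a]] by linarith
 have i0: "integrable P (good j)"
  using good_bounded_integrable(1)[of "%_. 1" j 1] by simp
 have i1: "integrable P (%y. good j y * (a \<bullet> cov y))"
  by (rule good_bounded_integrable(1)[of "%z. a \<bullet> z" j "norm a * real j"]) (auto intro: ab)
 have i2: "integrable P (%y. good j y * (a \<bullet> cov y)\<^sup>2)"
  by (rule good_bounded_integrable(1)[of "%z. (a \<bullet> z)\<^sup>2" j "(norm a * real j)\<^sup>2"])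
    (use power_mono[OF ab, of _ 2] in \<open>auto simp: power_mult_distrib\<close>)
 have eq: "good j y * (a \<bullet> cov y - c)\<^sup>2 = good j y * (a \<bullet> cov y)\<^sup>2 - 2 * c * (good j y * (a \<bullet> cov y)) + c\<^sup>2 * good j y" for y
  by (simp add: power2_eq_square algebra_simps)
 have int: "integrable P (%y. good j y * (a \<bullet> cov y - c)\<^sup>2)" unfolding eq using i0 i1 i2 by auto
 have "(\<integral>y. good j y * (a \<bullet> cov y - c)\<^sup>2 \<partial>P) = m2 - 2 * c * m1 + c\<^sup>2 * gm0 j"
  unfolding eq using i0 i1 i2 by (simp add: m1_def m2_def gm0_def)
 also have "... = gq j a / gm0 j"
  using assms(2) unfolding gq_def gm_expand[symmetric] m1_def[symmetric] m2_def[symmetric]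
  by (simp add: c_def power2_eq_square field_simps)
 also have "... <= 0" using assms by (simp add: divide_nonpos_pos)
 finally have "(\<integral>y. good j y * (a \<bullet> cov y - c)\<^sup>2 \<partial>P) = 0"
  by (intro antisym Bochner_Integration.integral_nonneg) (auto simp: good_def)
 then have "AE y in P. good j y * (a \<bullet> cov y - c)\<^sup>2 = 0"
  using int by (subst (asm) integral_nonneg_eq_0_iff_AE) (auto simp: good_def)
 then have "AE y in P. good j y = 1 --> a \<bullet> cov y = c" by eventually_elim auto
 then show ?thesis by blast
qed

text \<open>If the truncated covariance forms degenerated along unit vectors \<open>a\<^sub>j\<close> for all truncation
  levels \<open>j\<close>, the covariate would degenerate along any limit point of the \<open>a\<^sub>j\<close>.\<close>

lemma exists_gq_pos:
 assumes mple: "wpo (%n w. is_mple n (ys w) (betahat n w))"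
 shows "\<exists>j \<kappa>. 1 / real (Suc j) < tauH \<and> 0 < \<kappa> \<and> (\<forall>a. norm a = 1 --> \<kappa> <= gq j a)"
proof -
 obtain j0 where j0: "\<And>j. j0 <= j ==> 0 < gm0 j" using gm0_pos by blast
 have "(%j. 1 / real (Suc j)) \<longlonglongrightarrow> 0" by (rule LIMSEQ_Suc[OF lim_const_over_n])
 from order_tendstoD(2)[OF this obs.tauH_pos]
 obtain j1 where j1: "\<And>j. j1 <= j ==> 1 / real (Suc j) < tauH" by (auto simp: eventually_sequentially)
 define J where "J = max j0 j1"
 have "\<exists>j\<ge>J. \<forall>a. norm a = 1 --> 0 < gq j a"
 proof (rule ccontr)
  assume "\<not> ?thesis"
  then have "\<forall>j. \<exists>a. J <= j --> norm a = 1 \<and> gq j a <= 0" by (auto simp: not_less)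
  from choice[OF this]
  obtain A where A: "\<And>j. J <= j ==> norm (A j) = 1" "\<And>j. J <= j ==> gq j (A j) <= 0" by blast
  have "\<exists>c. AE y in P. good j y = 1 --> A j \<bullet> cov y = c" if "J <= j" for j
   using gq_zero_degenerate[OF A(2)[OF that]] j0[of j] that by (simp add: J_def)
  then have "\<forall>j. \<exists>c. J <= j --> (AE y in P. good j y = 1 --> A j \<bullet> cov y = c)" by blast
  from choice[OF this]
  obtain c where c: "\<And>j. J <= j ==> AE y in P. good j y = 1 --> A j \<bullet> cov y = c j" by blast
  have "seq_compact (sphere (0 :: real ^ 'p) 1)" by (simp add: compact_imp_seq_compact)
  then obtain a r where a: "a \<in> sphere 0 1" and r: "strict_mono r" "(%i. A (r i + J)) \<longlonglongrightarrow> a"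
  proof -
   assume *: "\<And>a r. a \<in> sphere 0 1 ==> strict_mono r ==> (%i. A (r i + J)) \<longlonglongrightarrow> a ==> thesis"
   have "\<forall>n. A (n + J) \<in> sphere 0 1" using A(1) by simp
   with seq_compactE[OF \<open>seq_compact (sphere 0 1)\<close>, of "%n. A (n + J)"]
   obtain l r where "l \<in> sphere 0 1" "strict_mono r" "((%n. A (n + J)) \<circ> r) \<longlonglongrightarrow> l" by blast
   with *[of l r] show thesis by (simp add: comp_def)
  qed
  have all: "AE y in P. \<forall>j. J <= j --> good j y = 1 --> A j \<bullet> cov y = c j"
   using c by (intro AE_all_countable[THEN iffD2] allI AE_impI) auto
  \<comment> \<open>For a fixed observation all late truncation levels apply, so the constants
    \<open>c\<close> converge to \<open>a \<bullet> cov y\<close> along the subsequence; their limit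
    does not depend on the observation.\<close>
  have conv: "AE y in P. (%i. c (r i + J)) \<longlonglongrightarrow> a \<bullet> cov y"
   using all obs.T_AE
  proof eventually_elim
   case (elim y)
   then have "0 < fst y" by (simp add: case_prod_beta')
   have "(%j. 1 / real (Suc j)) \<longlonglongrightarrow> 0" by (rule LIMSEQ_Suc[OF lim_const_over_n])
   then have "\<forall>\<^sub>F j in sequentially. 1 / real (Suc j) < fst y" using \<open>0 < fst y\<close> by (rule order_tendstoD)
   moreover have "\<forall>\<^sub>F j in sequentially. norm (cov y) <= real j"
    using filterlim_real_sequentially unfolding filterlim_at_top by blast
   ultimately have "\<forall>\<^sub>F j in sequentially. J <= j --> A j \<bullet> cov y = c j"
    by eventually_elim (use elim(1) in \<open>simp add: good_def less_imp_le\<close>)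
   moreover have "filterlim (%i. r i + J) sequentially sequentially"
    using filterlim_subseq[OF r(1)] by (rule filterlim_at_top_mono) simp
   ultimately have "\<forall>\<^sub>F i in sequentially. J <= r i + J --> A (r i + J) \<bullet> cov y = c (r i + J)"
    by (rule eventually_compose_filterlim)
   then have "\<forall>\<^sub>F i in sequentially. A (r i + J) \<bullet> cov y = c (r i + J)" by simp
   moreover have "(%i. A (r i + J) \<bullet> cov y) \<longlonglongrightarrow> a \<bullet> cov y" by (intro tendsto_intros r)
   ultimately show ?case by (rule Lim_transform_eventually[rotated])
  qed
  have "AE y in P. a \<bullet> cov y = lim (%i. c (r i + J))"
   using conv by eventually_elim (simp add: limI)
  moreover have "a \<noteq> 0" using a by auto
  ultimately show False using cov_nondegenerate[OF mple] by blast
 qed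
 then obtain j where j: "J <= j" "\<And>a. norm a = 1 ==> 0 < gq j a" by blast
 \<comment> \<open>At level \<open>j\<close> the form is positive at every unit vector; its minimum
   over the compact sphere is the uniform \<open>\<kappa>\<close>.\<close>
 have "continuous_on (sphere 0 1) (gq j)" unfolding gq_def by (intro continuous_intros)
 moreover have "sphere (0 :: real ^ 'p) 1 \<noteq> {}" by simp
 ultimately obtain a0 where a0: "a0 \<in> sphere 0 1" "\<And>a. a \<in> sphere 0 1 ==> gq j a0 <= gq j a"
  using continuous_attains_inf[of "sphere (0 :: real ^ 'p) 1" "gq j"] by auto
 then show ?thesis using j j1[of j] by (intro exI[of _ j] exI[of _ "gq j a0"]) (auto simp: J_def)
qed

section \<open>The empirical risk and the rate of the partial likelihood estimator\<close>

definition phi :: "real => real" where "phi s = Phi P s beta0"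

definition Env :: real where "Env = (\<integral>y. env (cov y) \<partial>P)"

lemma Env_nonneg: "0 <= Env"
 unfolding Env_def by (intro Bochner_Integration.integral_nonneg) (simp add: env_nonneg)

definition rf :: "real => 'p obs => real" where
 "rf s y = of_bool (s <= fst y) * exp (beta0 \<bullet> cov y)"

lemma rf_measurable [measurable]: "rf s \<in> borel_measurable borel"
 unfolding rf_def[abs_def] by measurable

lemma rf_nonneg: "0 <= rf s y" and rf_le: "rf s y <= env (cov y)"
 using exp_le_env[of "cov y"] by (auto simp: rf_def env_nonneg)

lemma rf_integrable: "integrable P (rf s)"
 by (rule Bochner_Integration.integrable_bound[OF env_integrable])
   (auto simp: measurable_P rf_nonneg rf_le env_nonneg)

lemma rf_sq: "integrable P (%y. (rf s y)\<^sup>2)" "(\<integral>y. (rf s y)\<^sup>2 \<partial>P) <= (\<integral>y. (env (cov y))\<^sup>2 \<partial>P)"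
proof -
 have le: "(rf s y)\<^sup>2 <= (env (cov y))\<^sup>2" for y by (intro power_mono rf_le rf_nonneg)
 show i: "integrable P (%y. (rf s y)\<^sup>2)"
  by (rule Bochner_Integration.integrable_bound[OF env_sq_integrable]) (auto simp: measurable_P le)
 show "(\<integral>y. (rf s y)\<^sup>2 \<partial>P) <= (\<integral>y. (env (cov y))\<^sup>2 \<partial>P)"
  by (intro integral_mono i env_sq_integrable le)
qed

lemma phi_eq: "phi s = (\<integral>y. rf s y \<partial>P)"
 unfolding phi_def Phi_def rf_def by (simp add: case_prod_beta')

lemma risk_emp: "risk n beta0 s y / n = emp n (rf s) y"
 by (simp add: risk_def emp_def rf_def)

lemma phi_antimono: "s <= t ==> phi t <= phi s"
 unfolding phi_eq by (intro integral_mono rf_integrable) (auto simp: rf_def)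

lemma phi_measurable [measurable]: "phi \<in> borel_measurable borel"
proof -
 have "mono (%s. - phi s)" by (intro monoI) (simp add: phi_antimono)
 from borel_measurable_mono[OF this] have "(%s. - (- phi s)) \<in> borel_measurable borel" by measurable
 then show ?thesis by simp
qed

lemma phi_nonneg: "0 <= phi s"
 unfolding phi_eq by (intro Bochner_Integration.integral_nonneg rf_nonneg)

lemma phi_le: "phi s <= Env"
 unfolding phi_eq Env_def by (intro integral_mono rf_integrable env_integrable rf_le)

lemma phi_pos: assumes "s < tauH" shows "0 < phi s"
proof (rule ccontr)
 assume "\<not> 0 < phi s"
 then have "(\<integral>y. rf s y \<partial>P) = 0" using phi_nonneg[of s] unfolding phi_eq by linarith
 then have "AE y in P. rf s y = 0"
  using rf_integrable rf_nonneg by (subst (asm) integral_nonneg_eq_0_iff_AE) auto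
 then have "AE y in P. y \<notin> {y. s <= fst y}" by eventually_elim (simp add: rf_def)
 moreover have "{y. s <= fst y} \<in> sets P" unfolding sets_P by measurable
 ultimately have "obs.prob {y. s <= fst y} = 0"
  using obs.prob_eq_0[of "{y. s <= fst y}"] by simp
 then show False using obs.T_tail[OF assms] by simp
qed

text \<open>\<open>compensation\<close> for a function of time alone: the inner expectation is
  \<open>phi s\<close>, so event times have the sub-density \<open>lam0 s * phi s\<close>.\<close>

lemma nn_integral_event:
 assumes [measurable]: "\<psi> \<in> borel_measurable borel" and "\<And>s. 0 <= \<psi> s"
 shows "(\<integral>\<^sup>+y. ennreal (event y * \<psi> (fst y)) \<partial>P) =
  (\<integral>\<^sup>+s. ennreal (indicator {0..tauH} s * (lam0 s * phi s * \<psi> s)) \<partial>lborel)"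
proof -
 have "(\<integral>\<^sup>+y. ennreal (event y * \<psi> (fst y)) \<partial>P) = (\<integral>\<^sup>+(t, \<delta>, z). of_bool (\<delta> = 1) * ennreal (\<psi> (fst (t, z))) \<partial>P)"
  by (intro nn_integral_cong) (auto simp: event_def)
 also have "... = (\<integral>\<^sup>+s\<in>{0..tauH}. ennreal (lam0 s) *
     (\<integral>\<^sup>+(t, \<delta>, z). of_bool (s <= t) * ennreal (exp (beta0 \<bullet> z)) * ennreal (\<psi> (fst (s, z))) \<partial>P) \<partial>lborel)"
  by (rule obs.compensation) measurable
 also have "... = (\<integral>\<^sup>+s. ennreal (indicator {0..tauH} s * (lam0 s * phi s * \<psi> s)) \<partial>lborel)"
 proof (rule nn_integral_cong)
  fix s
  have "(\<integral>\<^sup>+(t, \<delta>, z). of_bool (s <= t) * ennreal (exp (beta0 \<bullet> z)) * ennreal (\<psi> (fst (s, z))) \<partial>P) =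
   (\<integral>\<^sup>+y. ennreal (\<psi> s * rf s y) \<partial>P)"
   using assms(2) by (intro nn_integral_cong) (auto simp: rf_def case_prod_beta' ennreal_mult' mult.commute)
  also have "... = ennreal (\<psi> s * phi s)"
   unfolding phi_eq using assms(2) rf_integrable rf_nonneg by (subst nn_integral_eq_integral) auto
  finally show "ennreal (lam0 s) * (\<integral>\<^sup>+(t, \<delta>, z). of_bool (s <= t) * ennreal (exp (beta0 \<bullet> z)) * ennreal (\<psi> (fst (s, z))) \<partial>P) * indicator {0..tauH} s
   = ennreal (indicator {0..tauH} s * (lam0 s * phi s * \<psi> s))"
   using assms(2) phi_nonneg obs.lam0_nonneg
   by (auto simp: ennreal_mult' mult_ac split: split_indicator)
 qed
 finally show ?thesis .
qed

lemma risk_variance: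
 assumes "0 < n"
 shows "(\<integral>\<^sup>+w. ennreal ((risk n beta0 s (ys w) / n - phi s)\<^sup>2) \<partial>M) <= ennreal ((\<integral>y. (env (cov y))\<^sup>2 \<partial>P) / n)"
 unfolding risk_emp phi_eq
 by (rule order_trans[OF nn_emp_second_moment[OF rf_measurable rf_sq(1) assms, of s]])
   (auto intro!: ennreal_leI divide_right_mono rf_sq(2))

text \<open>Compensation moves the evaluation from random event times to fixed times
  \<open>s\<close>, at which the centred empirical risk has variance of order 1/n. This takes the
  place of a uniform bound for the risk process and retains the window length.\<close>

lemma risk_fluctuation:
 "\<exists>C\<ge>0. \<forall>n>0. \<forall>a b. a <= b -->
  (\<integral>\<^sup>+w. ennreal (\<Sum>j<n. event (Y j w) * (indicator {a..b} (T j w) * \<bar>risk n beta0 (T j w) (ys w) / n - phi (T j w)\<bar>)) \<partial>M)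
   <= ennreal (C * sqrt n * (b - a))"
proof -
 define V where "V = (\<integral>y. (env (cov y))\<^sup>2 \<partial>P)"
 have V0: "0 <= V" unfolding V_def by simp
 define K where "K = Env * (V + 1) / 2 + V"
 have K0: "0 <= K" using V0 Env_nonneg by (simp add: K_def)
 have "(\<integral>\<^sup>+w. ennreal (\<Sum>j<n. event (Y j w) * (indicator {a..b} (T j w) * \<bar>risk n beta0 (T j w) (ys w) / n - phi (T j w)\<bar>)) \<partial>M)
   <= ennreal (lamB * (K * sqrt n) * (b - a))" if n: "0 < n" and ab: "a <= b" for n a b
 proof (rule compensation_sum_bound[where h = "%j s y. indicator {a..b} s * \<bar>risk n beta0 s y / n - phi s\<bar>"])
  have [measurable]: "(%p. snd p j) \<in> borel_measurable (borel \<Otimes>\<^sub>M PIB)" for j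
   by (rule measurable_compose[OF measurable_snd component_measurable])
  show "(%p. indicator {a..b} (fst p) * \<bar>risk n beta0 (fst p) (snd p) / n - phi (fst p)\<bar>) \<in> borel_measurable (borel \<Otimes>\<^sub>M PIB)"
   by measurable
  show "0 <= indicator {a..b} s * \<bar>risk n beta0 s y / real n - phi s\<bar>" for s y by simp
  show "indicator {a..b} s * \<bar>risk n beta0 s (y(j := (s, 1, cov (y j)))) / real n - phi s\<bar> =
    indicator {a..b} s * \<bar>risk n beta0 s y / real n - phi s\<bar>" if "s <= fst (y j)" for j s y
  proof -
   have "risk n beta0 s (y(j := (s, 1, cov (y j)))) = risk n beta0 s y"
    using that unfolding risk_def by (intro sum.cong) auto
   then show ?thesis by simp
  qed
  fix s
  define D where "D w = risk n beta0 s (ys w) / n - phi s" for w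
  have [measurable]: "D \<in> borel_measurable M" unfolding D_def by measurable
  have pt: "(\<Sum>j<n. atrisk j s w * (indicator {a..b} s * \<bar>risk n beta0 s (ys w) / n - phi s\<bar>)) \<le>
    indicator {a..b} s * ((n * (Env * sqrt n / 2 + 1)) * (D w)\<^sup>2 + Env * sqrt n / 2)" for w
  proof -
   have "(\<Sum>j<n. atrisk j s w * (indicator {a..b} s * \<bar>risk n beta0 s (ys w) / n - phi s\<bar>)) =
    indicator {a..b} s * (risk n beta0 s (ys w) * \<bar>D w\<bar>)"
   proof -
    have c: "(\<Sum>j<n. atrisk j s w * c) = risk n beta0 s (ys w) * c" for c
     by (simp only: risk_def sum_distrib_right)
    show ?thesis unfolding D_def[symmetric] c by (rule mult.left_commute)
   qed
   also have "risk n beta0 s (ys w) = n * (phi s + D w)" using n by (simp add: D_def)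
   also have "n * (phi s + D w) * \<bar>D w\<bar> <= n * (Env * \<bar>D w\<bar> + (D w)\<^sup>2)"
   proof -
    have "(phi s + D w) * \<bar>D w\<bar> <= (Env + \<bar>D w\<bar>) * \<bar>D w\<bar>"
     using phi_le[of s] by (intro mult_right_mono) auto
    also have "... = Env * \<bar>D w\<bar> + (D w)\<^sup>2" by (simp add: distrib_right power2_eq_square)
    finally show ?thesis unfolding mult.assoc by (rule mult_left_mono) simp
   qed
   \<comment> \<open>Young's inequality with weight \<open>sqrt n\<close>, so that only the second
     moment of \<open>D\<close> enters; both summands then have size 1/sqrt n in the mean.\<close>
   also have "... <= n * (Env * ((sqrt n * (D w)\<^sup>2 + 1 / sqrt n) / 2) + (D w)\<^sup>2)"
   proof -
    have "0 <= (sqrt n * \<bar>D w\<bar> - 1)\<^sup>2 / sqrt n" using n by simp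
    also have "... = sqrt n * (D w)\<^sup>2 - 2 * \<bar>D w\<bar> + 1 / sqrt n"
    proof -
     have "(sqrt n * \<bar>D w\<bar> - 1)\<^sup>2 = sqrt n * sqrt n * (D w)\<^sup>2 - 2 * sqrt n * \<bar>D w\<bar> + 1"
      by (simp add: power2_eq_square algebra_simps)
     then show ?thesis using n by (simp add: field_simps)
    qed
    finally have "\<bar>D w\<bar> <= (sqrt n * (D w)\<^sup>2 + 1 / sqrt n) / 2" by simp
    then show ?thesis using Env_nonneg by (intro mult_left_mono add_right_mono) auto
   qed
   also have "... = (n * (Env * sqrt n / 2 + 1)) * (D w)\<^sup>2 + Env * (n / sqrt n) / 2"
    by (simp add: field_simps)
   also have "n / sqrt n = sqrt n" by (simp add: real_div_sqrt)
   finally show ?thesis unfolding D_def[symmetric] by (simp add: mult_left_mono)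
  qed
  have "(\<integral>\<^sup>+w. ennreal (\<Sum>j<n. atrisk j s w * (indicator {a..b} s * \<bar>risk n beta0 s (ys w) / n - phi s\<bar>)) \<partial>M) \<le>
   (\<integral>\<^sup>+w. ennreal (n * (Env * sqrt n / 2 + 1)) * ennreal ((D w)\<^sup>2) + ennreal (Env * sqrt n / 2) \<partial>M)
    * indicator {a..b} s"
   unfolding nn_integral_multc[symmetric]
  proof (subst nn_integral_multc[symmetric], measurable, rule nn_integral_mono)
   fix w
   show "ennreal (\<Sum>j<n. atrisk j s w * (indicator {a..b} s * \<bar>risk n beta0 s (ys w) / n - phi s\<bar>)) \<le>
     (ennreal (n * (Env * sqrt n / 2 + 1)) * ennreal ((D w)\<^sup>2) + ennreal (Env * sqrt n / 2)) * indicator {a..b} s"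
    using ennreal_leI[OF pt[of w]] Env_nonneg
    by (auto simp: ennreal_mult ennreal_plus split: split_indicator)
  qed
  also have "(\<integral>\<^sup>+w. ennreal (n * (Env * sqrt n / 2 + 1)) * ennreal ((D w)\<^sup>2) + ennreal (Env * sqrt n / 2) \<partial>M) =
    ennreal (n * (Env * sqrt n / 2 + 1)) * (\<integral>\<^sup>+w. ennreal ((D w)\<^sup>2) \<partial>M) + ennreal (Env * sqrt n / 2)"
   by (subst nn_integral_add) (auto simp: nn_integral_cmult emeasure_space_1)
  also have "... <= ennreal (n * (Env * sqrt n / 2 + 1)) * ennreal (V / n) + ennreal (Env * sqrt n / 2)"
   unfolding D_def V_def by (intro add_mono mult_left_mono risk_variance n) auto
  also have "... = ennreal ((n * (Env * sqrt n / 2 + 1)) * (V / n) + Env * sqrt n / 2)"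
  proof -
   have 1: "0 <= n * (Env * sqrt n / 2 + 1)" "0 <= V / n" "0 <= Env * sqrt n / 2" using Env_nonneg V0 by auto
   show ?thesis
    by (simp only: ennreal_plus[OF mult_nonneg_nonneg[OF 1(1,2)] 1(3)] ennreal_mult[OF 1(1,2)])
  qed
  also have "(n * (Env * sqrt n / 2 + 1)) * (V / n) + Env * sqrt n / 2 = Env * sqrt n * (V + 1) / 2 + V"
   using n by (simp add: field_simps)
  also have "... <= K * sqrt n"
  proof -
   have "V * 1 <= V * sqrt n" using n V0 by (intro mult_left_mono) auto
   then show ?thesis by (simp add: K_def algebra_simps)
  qed
  finally show "(\<integral>\<^sup>+w. ennreal (\<Sum>j<n. atrisk j s w * (indicator {a..b} s * \<bar>risk n beta0 s (ys w) / n - phi s\<bar>)) \<partial>M)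
    <= ennreal (K * sqrt n * indicator {a..b} s)"
   by (auto simp: mult_right_mono ennreal_leI split: split_indicator)
 qed (use K0 ab in auto)
 then show ?thesis using K0 lamB_nonneg by (intro exI[of _ "lamB * K"]) (auto simp: mult_ac)
qed

lemma event_mass:
 assumes "a <= b"
 shows "(\<integral>y. event y * indicator {a..b} (fst y) \<partial>P) <= lamB * Env * (b - a)"
proof -
 have "(\<integral>\<^sup>+y. ennreal (event y * indicator {a..b} (fst y)) \<partial>P) =
   (\<integral>\<^sup>+s. ennreal (indicator {0..tauH} s * (lam0 s * phi s * indicator {a..b} s)) \<partial>lborel)"
  by (rule nn_integral_event) auto
 also have "... <= (\<integral>\<^sup>+s. ennreal (lamB * Env) * indicator {a..b} s \<partial>lborel)"
 proof (rule nn_integral_mono)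
  fix s
  have "lam0 s * phi s <= lamB * Env" if "s \<in> {0..tauH}"
   using lam0_le[OF that] phi_le lamB_nonneg phi_nonneg by (intro mult_mono) auto
  then show "ennreal (indicator {0..tauH} s * (lam0 s * phi s * indicator {a..b} s)) <= ennreal (lamB * Env) * indicator {a..b} s"
   by (auto split: split_indicator intro!: ennreal_leI)
 qed
 also have "... = ennreal (lamB * Env * (b - a))"
  using assms lamB_nonneg Env_nonneg by (subst nn_integral_cmult_indicator) (auto simp: ennreal_mult')
 finally have "(\<integral>\<^sup>+y. ennreal (event y * indicator {a..b} (fst y)) \<partial>P) <= ennreal (lamB * Env * (b - a))" .
 moreover have "integrable P (%y. event y * indicator {a..b} (fst y))"
  using event_le_1 event_nonneg
  by (intro obs.integrable_const_bound[of _ 1]) (auto simp: measurable_P abs_mult event_def)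
 ultimately show ?thesis
  using assms lamB_nonneg Env_nonneg
  by (subst (asm) nn_integral_eq_integral) (simp_all add: ennreal_le_iff event_nonneg)
qed

text \<open>Otherwise the sub-density \<open>lam0 s * phi s\<close>, which is positive on
  \<open>{0<..t0}\<close>, would vanish almost everywhere there.\<close>

lemma event_early_pos:
 assumes t0: "0 < t0" "t0 < tauH" and lam_pos: "\<And>s. s \<in> {0<..tauH} ==> 0 < lam0 s"
 shows "0 < (\<integral>y. event y * of_bool (fst y <= t0) \<partial>P)"
proof (rule ccontr)
 assume "\<not> ?thesis"
 moreover have int: "integrable P (%y. event y * of_bool (fst y <= t0))"
  by (intro obs.integrable_const_bound[of _ 1]) (auto simp: measurable_P event_def)
 moreover have "0 <= (\<integral>y. event y * of_bool (fst y <= t0) \<partial>P)"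
  by (intro Bochner_Integration.integral_nonneg) (simp add: event_nonneg)
 ultimately have "(\<integral>\<^sup>+y. ennreal (event y * of_bool (fst y <= t0)) \<partial>P) = 0"
  by (subst nn_integral_eq_integral) (auto simp: event_nonneg)
 moreover have "(\<integral>\<^sup>+y. ennreal (event y * of_bool (fst y <= t0)) \<partial>P) =
   (\<integral>\<^sup>+s. ennreal (indicator {0..tauH} s * (lam0 s * phi s * of_bool (s <= t0))) \<partial>lborel)"
  by (rule nn_integral_event) auto
 moreover have lm: "(%s. indicator {0..tauH} s * lam0 s) \<in> borel_measurable borel"
  using borel_measurable_continuous_on_indicator[OF _ obs.lam0_cont] by simp
 have "(%s. ennreal (indicator {0..tauH} s * (lam0 s * phi s * of_bool (s <= t0)))) \<in> borel_measurable borel"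
 proof -
  have "(%s. ennreal ((indicator {0..tauH} s * lam0 s) * phi s * of_bool (s <= t0))) \<in> borel_measurable borel"
   using lm by measurable
  then show ?thesis by (simp add: mult.assoc)
 qed
 ultimately have "AE s in lborel. ennreal (indicator {0..tauH} s * (lam0 s * phi s * of_bool (s <= t0))) = 0"
  by (simp add: nn_integral_0_iff_AE)
 then have "AE s in lborel. s \<notin> {0<..t0}"
 proof eventually_elim
  case (elim s)
  show ?case
  proof
   assume s: "s \<in> {0<..t0}"
   then have "0 < lam0 s * phi s" using t0 lam_pos[of s] phi_pos[of s] by auto
   then show False using elim s t0 by (auto simp: indicator_def ennreal_eq_0_iff)
  qed
 qed
 then have "emeasure lborel {0<..t0} = 0" by (subst (asm) AE_iff_measurable[where N = "{0<..t0}"]) auto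
 then show False using t0 by simp
qed

text \<open>At distance \<open>s\<close> from \<open>beta0\<close> towards the estimator the log
  partial likelihood is not below its value at \<open>beta0\<close>, while the quadratic loss has
  order \<open>n * s\<^sup>2\<close> and the gain from the score order \<open>s * sqrt n\<close>;
  hence \<open>s\<close> has order 1/sqrt n. As the quadratic bound holds only up to the distance
  \<open>\<rho>\<close>, the comparison is made at a capped distance, and the resulting bound shows
  that the cap is inactive.\<close>

theorem mple_root_n:
 assumes mple: "wpo (%n w. is_mple n (ys w) (betahat n w))"
  and lam_pos: "\<And>s. s \<in> {0<..tauH} ==> 0 < lam0 s"
 shows "Op (%n w. norm (betahat n w - beta0)) (%n. 1 / sqrt n)"
proof -
 obtain j \<kappa> where j: "1 / real (Suc j) < tauH" and \<kappa>: "0 < \<kappa>" "\<And>a. norm a = 1 ==> \<kappa> <= gq j a"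
  using exists_gq_pos[OF mple] by blast
 define t0 where "t0 = 1 / real (Suc j)"
 define B where "B = real j"
 have t0: "0 < t0" "t0 < tauH" using j by (auto simp: t0_def)
 have B: "0 <= B" by (simp add: B_def)
 have good_eq: "good j = (%y. of_bool (t0 <= fst y \<and> norm (cov y) <= B))"
  by (simp add: fun_eq_iff good_def t0_def B_def)
 define p where "p = real CARD('p)"
 \<comment> \<open>Error budget: replacing the truncated moments by sample averages within
   \<open>e\<close> lowers the form by at most
   \<open>e * (B\<^sup>2 + p\<^sup>2 + 2 * B * p)\<close>, which is kept below half of
   \<open>\<kappa>\<close>. The added 1 keeps the denominator positive.\<close>
 define Q where "Q = B\<^sup>2 + p\<^sup>2 + 2 * B * p + 1"
 define e where "e = \<kappa> / (2 * Q)"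
 have den: "0 < Q" using B by (simp add: Q_def p_def add_nonneg_pos)
 have e: "0 < e" "e * (B\<^sup>2 + p\<^sup>2 + 2 * B * p) <= \<kappa> / 2"
 proof -
  show "0 < e" using \<kappa> den by (simp add: e_def)
  then have "e * (B\<^sup>2 + p\<^sup>2 + 2 * B * p) <= e * Q" by (intro mult_left_mono) (auto simp: Q_def)
  also have "... = \<kappa> / 2" using den by (simp add: e_def)
  finally show "e * (B\<^sup>2 + p\<^sup>2 + 2 * B * p) <= \<kappa> / 2" .
 qed
 define Cw where "Cw = Env + 1"
 have Cw: "0 < Cw" using Env_nonneg by (simp add: Cw_def)
 have phi0: "0 < phi t0" by (rule phi_pos[OF t0(2)])
 define Mb where "Mb = 2 * Cw / (eps * phi t0)"
 have Mb: "0 < Mb" using Cw phi0 eps_pos by (simp add: Mb_def)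
 define p1 where "p1 = (\<integral>y. event y * of_bool (fst y <= t0) \<partial>P)"
 have p1: "0 < p1" unfolding p1_def by (rule event_early_pos[OF t0 lam_pos])
 define c1 where "c1 = exp (- norm beta0 * B) * (\<kappa> / 2) / (4 * Cw)"
 have c1: "0 < c1" using \<kappa> Cw by (simp add: c1_def)
 \<comment> \<open>The minima enforce the side conditions of the quadratic drop: exponents not below
   -2 and a gain of at most 1.\<close>
 define \<rho> where "\<rho> = min 1 (min (2 / (B + Mb)) (1 / c1))"
 have \<rho>: "0 < \<rho>" "\<rho> * (B + Mb) <= 2" "\<rho>\<^sup>2 * c1 <= 1"
 proof -
  show "0 < \<rho>" using B Mb c1 by (simp add: \<rho>_def)
  have "\<rho> <= 2 / (B + Mb)" by (simp add: \<rho>_def)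
  then show "\<rho> * (B + Mb) <= 2" using B Mb by (simp add: field_simps)
  have "\<rho> * \<rho> <= 1 * (1 / c1)" using \<open>0 < \<rho>\<close> by (intro mult_mono) (auto simp: \<rho>_def)
  then show "\<rho>\<^sup>2 * c1 <= 1" using c1 by (simp add: power2_eq_square field_simps)
 qed
 define U where "U k n w = (\<Sum>i<n. score_term n beta0 (%z. z $ k) i (ys w))" for k n w
 define Ub where "Ub n w = (\<Sum>k\<in>UNIV. \<bar>U k n w\<bar>)" for n w
 \<comment> \<open>The 4 collects the factor 1/2 of the quadratic drop and the factor 1/2 lost in
   bounding the fraction of early events by \<open>p1 / 2\<close>.\<close>
 define K1 where "K1 = 4 / (c1 * p1)"
 have K1: "0 < K1" using c1 p1 by (simp add: K1_def)
 have Ubdd: "Op Ub (%n. sqrt n)"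
  unfolding Ub_def
 proof (rule bdd_in_prob_sum)
  fix k :: 'p
  obtain C where C: "\<And>n. (\<integral>\<^sup>+w. ennreal ((\<Sum>i<n. score_term n beta0 (%z. z $ k) i (ys w))\<^sup>2) \<partial>M) <= ennreal (C * real n)"
   using score_second_moment[of "%z. z $ k"] component_le_norm_cart by auto
  show "Op (%n w. \<bar>U k n w\<bar>) (%n. sqrt n)"
  proof (rule bdd_in_prob_Markov_sq[where C = C])
   show "U k n \<in> borel_measurable M" for n unfolding U_def by measurable
   show "LARGE n. (\<integral>\<^sup>+w. ennreal ((U k n w)\<^sup>2) \<partial>M) <= ennreal (C * (sqrt n)\<^sup>2)"
    unfolding U_def using C by simp
   show "0 <= sqrt (real n)" for n by simp
   show "LARGE n. 0 < sqrt (real n)" using eventually_gt_at_top[of 0] by eventually_elim simp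
  qed
 qed auto
 have UbK: "Op (%n w. K1 / real n * Ub n w) (%n. 1 / sqrt n)"
 proof -
  have "Op (%n w. K1 / real n * Ub n w) (%n. K1 / real n * sqrt n)"
   using K1 by (intro bdd_in_prob_mult bdd_in_prob_const Ubdd) (auto simp: Ub_def sum_nonneg)
  then show ?thesis
  proof (rule bdd_in_prob_rate[where C = K1])
   show "0 <= K1 / real n * sqrt n" for n using K1 by simp
   show "LARGE n. K1 / real n * sqrt n <= K1 * (1 / sqrt n)"
    using eventually_gt_at_top[of 0]
   proof eventually_elim
    case (elim n)
    then show ?case by (simp add: field_simps)
   qed
  qed
 qed
 have small: "wpo (%n w. K1 / real n * Ub n w <= \<rho> / 2)"
 proof (rule wpo_of_bdd_in_prob[OF UbK])
  fix K
  have "(%n. K * (1 / sqrt (real n))) \<longlonglongrightarrow> 0" by real_asymp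
  from order_tendstoD(2)[OF this, of "\<rho> / 2"] \<rho>(1)
  show "LARGE n. K * (1 / sqrt (real n)) <= \<rho> / 2" by (auto elim: eventually_mono)
 qed
 have e1: "wpo (%n w. \<bar>emp n (%y. env (cov y)) (ys w) - Env\<bar> <= 1)"
  unfolding Env_def by (rule emp_LLN[OF _ env_sq_integrable]) auto
 have e2: "wpo (%n w. \<bar>emp n (rf t0) (ys w) - phi t0\<bar> <= phi t0 / 2)"
  unfolding phi_eq by (rule emp_LLN[OF _ rf_sq(1)]) (use phi0 in \<open>auto simp: phi_eq\<close>)
 have e3: "wpo (%n w. \<bar>emp n (%y. event y * of_bool (fst y <= t0)) (ys w) - p1\<bar> <= p1 / 2)"
  unfolding p1_def
 proof (rule emp_LLN)
  show "integrable P (%y. (event y * of_bool (fst y <= t0))\<^sup>2)"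
   by (intro obs.integrable_const_bound[of _ 1]) (auto simp: measurable_P event_def)
 qed (use p1 in \<open>auto simp: p1_def\<close>)
 have good_LLN: "wpo (%n w. \<bar>emp n (%y. good j y * \<psi> (cov y)) (ys w) - (\<integral>y. good j y * \<psi> (cov y) \<partial>P)\<bar> <= e)"
  if [measurable]: "\<psi> \<in> borel_measurable borel" and b: "\<And>z. norm z <= real j ==> \<bar>\<psi> z\<bar> <= K" for \<psi> K
 proof (rule emp_LLN[OF _ _ e(1)])
  have sq: "\<bar>(\<psi> z)\<^sup>2\<bar> <= K\<^sup>2" if "norm z <= real j" for z
   using power_mono[OF b[OF that], of 2] by simp
  have "integrable P (%y. good j y * (\<psi> (cov y))\<^sup>2)"
   using sq by (intro good_bounded_integrable(1)[of "%z. (\<psi> z)\<^sup>2"]) auto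
  moreover have "(good j y * \<psi> (cov y))\<^sup>2 = good j y * (\<psi> (cov y))\<^sup>2" for y by (auto simp: good_def)
  ultimately show "integrable P (%y. (good j y * \<psi> (cov y))\<^sup>2)" by simp
 qed measurable
 have e4: "wpo (%n w. \<bar>emp n (good j) (ys w) - gm0 j\<bar> <= e)"
  using good_LLN[of "%_. 1" 1] by (simp add: gm0_def)
 have e5: "wpo (%n w. \<forall>k\<in>UNIV. \<bar>emp n (%y. good j y * cov y $ k) (ys w) - gm1 j k\<bar> <= e)"
  unfolding gm1_def
  by (rule wpo_finite_Ball, simp, rule good_LLN[of "%z. z $ _" "real j"]) (auto intro: comp_bounds)
 have e6: "wpo (%n w. \<forall>kl\<in>UNIV. \<bar>emp n (%y. good j y * (cov y $ fst kl * cov y $ snd kl)) (ys w) - gm2 j (fst kl) (snd kl)\<bar> <= e)"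
  unfolding gm2_def
  by (rule wpo_finite_Ball, simp, rule good_LLN[of "%z. z $ fst _ * z $ snd _" "real j * real j"]) (auto intro: comp_bounds)
 \<comment> \<open>A deterministic statement about one sample point at which all the approximations
   hold.\<close>
 have key: "norm (betahat n w - beta0) <= K1 / real n * Ub n w"
  if n: "0 < n" and mle: "is_mple n (ys w) (betahat n w)" and sm: "K1 / real n * Ub n w <= \<rho> / 2"
   and E1: "\<bar>emp n (%y. env (cov y)) (ys w) - Env\<bar> <= 1"
   and E2: "\<bar>emp n (rf t0) (ys w) - phi t0\<bar> <= phi t0 / 2"
   and E3: "\<bar>emp n (%y. event y * of_bool (fst y <= t0)) (ys w) - p1\<bar> <= p1 / 2"
   and E4: "\<bar>emp n (good j) (ys w) - gm0 j\<bar> <= e"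
   and E5: "\<And>k. \<bar>emp n (%y. good j y * cov y $ k) (ys w) - gm1 j k\<bar> <= e"
   and E6: "\<And>k l. \<bar>emp n (%y. good j y * (cov y $ k * cov y $ l)) (ys w) - gm2 j k l\<bar> <= e" for n w
 proof (cases "betahat n w = beta0")
  case True
  then show ?thesis using K1 by (simp add: Ub_def sum_nonneg)
 next
  case False
  let ?y = "ys w"
  define r where "r = norm (betahat n w - beta0)"
  define a where "a = (1 / r) *\<^sub>R (betahat n w - beta0)"
  have r: "0 < r" using False by (simp add: r_def)
  have a: "norm a = 1" "betahat n w = beta0 + r *\<^sub>R a" using r by (auto simp: a_def r_def)
  have ak: "\<bar>a $ k\<bar> <= 1" for k using component_le_norm_cart[of a k] a by simp
  have abs_a: "\<bar>a \<bullet> z\<bar> <= norm z" for z using Cauchy_Schwarz_ineq2[of a z] a by simp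
  define m0 where "m0 = emp n (good j) ?y"
  define m1 where "m1 = emp n (%y. good j y * (a \<bullet> cov y)) ?y"
  define m2 where "m2 = emp n (%y. good j y * (a \<bullet> cov y)\<^sup>2) ?y"
  define M1 where "M1 = (\<Sum>k\<in>UNIV. a $ k * gm1 j k)"
  define M2 where "M2 = (\<Sum>k\<in>UNIV. \<Sum>l\<in>UNIV. a $ k * a $ l * gm2 j k l)"
  have m1_eq: "m1 = (\<Sum>k\<in>UNIV. a $ k * emp n (%y. good j y * cov y $ k) ?y)"
  proof -
   have "(\<Sum>i<n. good j (Y i w) * (a \<bullet> zc i w)) = (\<Sum>i<n. \<Sum>k\<in>UNIV. a $ k * (good j (Y i w) * zc i w $ k))"
    by (intro sum.cong refl) (simp add: inner_vec_def sum_distrib_left mult_ac)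
   also have "... = (\<Sum>k\<in>UNIV. a $ k * (\<Sum>i<n. good j (Y i w) * zc i w $ k))"
    by (subst sum.swap) (simp add: sum_distrib_left)
   finally show ?thesis by (simp add: m1_def emp_def sum_divide_distrib[of _ UNIV])
  qed
  have m2_eq: "m2 = (\<Sum>k\<in>UNIV. \<Sum>l\<in>UNIV. a $ k * a $ l * emp n (%y. good j y * (cov y $ k * cov y $ l)) ?y)"
  proof -
   have "(\<Sum>i<n. good j (Y i w) * (a \<bullet> zc i w)\<^sup>2) =
     (\<Sum>i<n. \<Sum>k\<in>UNIV. \<Sum>l\<in>UNIV. a $ k * a $ l * (good j (Y i w) * (zc i w $ k * zc i w $ l)))"
    by (intro sum.cong refl) (simp add: inner_vec_def sum_distrib_left power2_eq_square sum_product mult_ac)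
   also have "... = (\<Sum>k\<in>UNIV. \<Sum>i<n. \<Sum>l\<in>UNIV. a $ k * a $ l * (good j (Y i w) * (zc i w $ k * zc i w $ l)))"
    by (rule sum.swap)
   also have "... = (\<Sum>k\<in>UNIV. \<Sum>l\<in>UNIV. a $ k * a $ l * (\<Sum>i<n. good j (Y i w) * (zc i w $ k * zc i w $ l)))"
    by (intro sum.cong refl, subst sum.swap) (simp add: sum_distrib_left)
   finally show ?thesis by (simp add: m2_def emp_def sum_divide_distrib[of _ UNIV])
  qed
  have card: "(\<Sum>k\<in>(UNIV :: 'p set). c) = p * c" for c by (simp add: p_def)
  have d1: "\<bar>m1 - M1\<bar> <= p * e"
  proof -
   have "\<bar>m1 - M1\<bar> <= (\<Sum>k\<in>UNIV. \<bar>a $ k * (emp n (%y. good j y * cov y $ k) ?y - gm1 j k)\<bar>)"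
    unfolding m1_eq M1_def sum_subtractf[symmetric] right_diff_distrib[symmetric] by (rule sum_abs)
   also have "... <= (\<Sum>k\<in>(UNIV :: 'p set). 1 * e)"
    unfolding abs_mult by (intro sum_mono mult_mono ak E5) auto
   finally show ?thesis by (simp only: mult_1 card)
  qed
  have d2: "\<bar>m2 - M2\<bar> <= p * (p * e)"
  proof -
   have "\<bar>m2 - M2\<bar> <= (\<Sum>k\<in>UNIV. \<bar>\<Sum>l\<in>UNIV. a $ k * a $ l * (emp n (%y. good j y * (cov y $ k * cov y $ l)) ?y - gm2 j k l)\<bar>)"
    unfolding m2_eq M2_def sum_subtractf[symmetric] right_diff_distrib[symmetric] by (rule sum_abs)
   also have "... <= (\<Sum>k\<in>(UNIV :: 'p set). p * e)"
   proof (rule sum_mono)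
    fix k
    have "\<bar>\<Sum>l\<in>UNIV. a $ k * a $ l * (emp n (%y. good j y * (cov y $ k * cov y $ l)) ?y - gm2 j k l)\<bar> \<le>
     (\<Sum>l\<in>UNIV. \<bar>a $ k * a $ l * (emp n (%y. good j y * (cov y $ k * cov y $ l)) ?y - gm2 j k l)\<bar>)" by (rule sum_abs)
    also have "... <= (\<Sum>l\<in>(UNIV :: 'p set). 1 * 1 * e)"
     unfolding abs_mult by (intro sum_mono mult_mono ak E6) auto
    finally show "\<bar>\<Sum>l\<in>UNIV. a $ k * a $ l * (emp n (%y. good j y * (cov y $ k * cov y $ l)) ?y - gm2 j k l)\<bar> <= p * e"
     by (simp only: mult_1 card)
   qed
   finally show ?thesis by (simp only: card)
  qed
  have emp_bound: "\<bar>emp n \<psi> ?y\<bar> <= b" if "\<And>y. \<bar>\<psi> y\<bar> <= b" for \<psi> b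
  proof -
   have "\<bar>\<Sum>i<n. \<psi> (Y i w)\<bar> <= (\<Sum>i<n. b)" by (rule order_trans[OF sum_abs]) (intro sum_mono that)
   then show ?thesis using n by (simp add: emp_def field_simps)
  qed
  have P_bound: "\<bar>\<integral>y. \<psi> y \<partial>P\<bar> <= b" if "\<And>y. \<bar>\<psi> y\<bar> <= b" "integrable P \<psi>" for \<psi> :: "'p obs => real" and b
  proof -
   have "\<bar>\<integral>y. \<psi> y \<partial>P\<bar> <= (\<integral>y. \<bar>\<psi> y\<bar> \<partial>P)" using integral_norm_bound[of P \<psi>] by simp
   also have "... <= (\<integral>y. b \<partial>P)" using that by (intro integral_mono) auto
   finally show ?thesis by (simp add: obs.prob_space)
  qed
  have b1: "\<bar>good j y * (a \<bullet> cov y)\<bar> <= B" for y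
   using abs_a[of "cov y"] by (auto simp: good_def B_def)
  have b2: "\<bar>good j y * (a \<bullet> cov y)\<^sup>2\<bar> <= B\<^sup>2" for y
  proof (cases "norm (cov y) <= real j")
   case True
   then have "\<bar>a \<bullet> cov y\<bar> <= B" using abs_a[of "cov y"] by (simp add: B_def)
   then have "\<bar>a \<bullet> cov y\<bar>\<^sup>2 <= B\<^sup>2" by (intro power_mono) auto
   then show ?thesis by (auto simp: good_def)
  qed (simp add: good_def)
  have bm1: "\<bar>m1\<bar> <= B" unfolding m1_def by (rule emp_bound[OF b1])
  have bm2: "\<bar>m2\<bar> <= B\<^sup>2" unfolding m2_def by (rule emp_bound[OF b2])
  have ab': "\<bar>a \<bullet> z\<bar> <= real j" if "norm z <= real j" for z using abs_a[of z] that by linarith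
  have bM1: "\<bar>M1\<bar> <= B"
   unfolding M1_def gm_expand(1)[symmetric]
   by (rule P_bound[OF b1 good_bounded_integrable(1)[of "%z. a \<bullet> z" j "real j"]]) (auto intro: ab')
  have bM0: "\<bar>gm0 j\<bar> <= 1"
   unfolding gm0_def using good_bounded_integrable(1)[of "%_. 1" j 1]
   by (intro P_bound) (auto simp: good_def)
  have q: "\<kappa> / 2 <= m0 * m2 - m1\<^sup>2"
  proof -
   have "\<bar>m0 - gm0 j\<bar> * \<bar>m2\<bar> <= e * B\<^sup>2" using E4 bm2 e(1) by (intro mult_mono) (auto simp: m0_def)
   moreover have "\<bar>gm0 j\<bar> * \<bar>m2 - M2\<bar> <= 1 * (p * (p * e))" using bM0 d2 by (intro mult_mono) auto
   moreover have "\<bar>m1 - M1\<bar> * \<bar>m1 + M1\<bar> <= (p * e) * (2 * B)" using d1 bm1 bM1 by (intro mult_mono) auto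
   moreover have "gm0 j * M2 - M1\<^sup>2 - (m0 * m2 - m1\<^sup>2) = - ((m0 - gm0 j) * m2) - gm0 j * (m2 - M2) + (m1 - M1) * (m1 + M1)"
    by (simp add: power2_eq_square algebra_simps)
   moreover have "- ((m0 - gm0 j) * m2) <= \<bar>m0 - gm0 j\<bar> * \<bar>m2\<bar>" "- (gm0 j * (m2 - M2)) <= \<bar>gm0 j\<bar> * \<bar>m2 - M2\<bar>"
    "(m1 - M1) * (m1 + M1) <= \<bar>m1 - M1\<bar> * \<bar>m1 + M1\<bar>"
    unfolding abs_mult[symmetric] by auto
   ultimately have "gm0 j * M2 - M1\<^sup>2 - (m0 * m2 - m1\<^sup>2) <= e * B\<^sup>2 + p * (p * e) + (p * e) * (2 * B)" by linarith
   also have "... = e * (B\<^sup>2 + p\<^sup>2 + 2 * B * p)" by (simp add: power2_eq_square algebra_simps)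
   also have "... <= \<kappa> / 2" by (rule e(2))
   finally have "gq j a - (m0 * m2 - m1\<^sup>2) <= \<kappa> / 2" by (simp add: gq_def M1_def M2_def)
   then show ?thesis using \<kappa>(2)[OF a(1)] by linarith
  qed
  have risk_le: "risk n beta0 s ?y <= real n * Cw" for s
  proof -
   have "emp n (rf s) ?y <= emp n (%y. env (cov y)) ?y"
    unfolding emp_def by (intro divide_right_mono sum_mono rf_le) auto
   also have "... <= Cw" using E1 by (simp add: Cw_def)
   finally show ?thesis using n unfolding risk_emp[symmetric] by (simp add: field_simps)
  qed
  have mean_le: "\<bar>risk_mean n beta0 (%z. a \<bullet> z) (fst (?y i)) ?y\<bar> <= Mb" if i: "i < n" "fst (?y i) <= t0" for i
  proof -
   let ?s = "fst (?y i)"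
   have R: "real n * (phi t0 / 2) <= risk n beta0 ?s ?y"
   proof -
    have "phi t0 / 2 <= emp n (rf t0) ?y" using E2 by linarith
    then have "real n * (phi t0 / 2) <= risk n beta0 t0 ?y" using n unfolding risk_emp[symmetric] by (simp add: field_simps)
    also have "... <= risk n beta0 ?s ?y" by (rule risk_antimono[OF i(2)])
    finally show ?thesis .
   qed
   have "\<bar>\<Sum>k<n. atrisk k ?s w * (a \<bullet> zc k w)\<bar> <= (\<Sum>k<n. env (zc k w) / eps)"
   proof (rule order_trans[OF sum_abs], rule sum_mono)
    fix k
    have "\<bar>atrisk k ?s w * (a \<bullet> zc k w)\<bar> <= exp (beta0 \<bullet> zc k w) * norm (zc k w)"
     unfolding abs_mult using abs_a by (intro mult_mono) auto
    also have "... <= env (zc k w) / eps" using norm_exp_le_env[of "zc k w"] by (simp add: mult.commute)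
    finally show "\<bar>atrisk k ?s w * (a \<bullet> zc k w)\<bar> <= env (zc k w) / eps" .
   qed
   also have "... = real n * (emp n (%y. env (cov y)) ?y / eps)" using n by (simp add: emp_def flip: sum_divide_distrib)
   also have "... <= real n * (Cw / eps)" using E1 eps_pos by (intro mult_left_mono divide_right_mono) (auto simp: Cw_def)
   finally have num: "\<bar>\<Sum>k<n. atrisk k ?s w * (a \<bullet> zc k w)\<bar> <= real n * (Cw / eps)" .
   have "0 < real n * (phi t0 / 2)" using n phi0 by simp
   with R have "0 < risk n beta0 ?s ?y" by linarith
   then have "\<bar>risk_mean n beta0 (%z. a \<bullet> z) ?s ?y\<bar> = \<bar>\<Sum>k<n. atrisk k ?s w * (a \<bullet> zc k w)\<bar> / risk n beta0 ?s ?y"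
    by (simp add: risk_mean_def)
   also have "... <= (real n * (Cw / eps)) / (real n * (phi t0 / 2))"
    using num R \<open>0 < real n * (phi t0 / 2)\<close> Cw eps_pos by (intro frac_le) auto
   also have "... = Mb" using n by (simp add: Mb_def field_simps)
   finally show ?thesis .
  qed
  define s where "s = min r \<rho>"
  have s: "0 < s" "s <= r" "s <= \<rho>" using r \<rho> by (auto simp: s_def)
  have le1: "loglik n ?y beta0 <= loglik n ?y (beta0 + s *\<^sub>R a)"
  proof (rule loglik_segment)
   show "loglik n ?y beta0 <= loglik n ?y (beta0 + r *\<^sub>R a)"
    unfolding a(2)[symmetric] by (rule is_mple_loglik[OF mle])
  qed (use s in auto)
  have le2: "loglik n ?y (beta0 + s *\<^sub>R a) <= loglik n ?y beta0 + s * (\<Sum>i<n. score_term n beta0 (%z. a \<bullet> z) i ?y)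
   - s\<^sup>2 * c1 / 2 * (\<Sum>i<n. event (?y i) * of_bool (fst (?y i) <= t0))"
  proof (rule loglik_quadratic_drop[where B = B and Cw = Cw and Mb = Mb and \<kappa> = "\<kappa> / 2"])
   show "\<kappa> / 2 <= emp n (%y. of_bool (t0 <= fst y \<and> norm (cov y) <= B)) ?y *
    emp n (%y. of_bool (t0 <= fst y \<and> norm (cov y) <= B) * (a \<bullet> cov y)\<^sup>2) ?y
    - (emp n (%y. of_bool (t0 <= fst y \<and> norm (cov y) <= B) * (a \<bullet> cov y)) ?y)\<^sup>2"
    using q unfolding m0_def m1_def m2_def good_eq .
   show "s * (B + Mb) <= 2" using mult_right_mono[OF s(3), of "B + Mb"] B Mb \<rho>(2) by linarith
   have "s\<^sup>2 <= \<rho>\<^sup>2" using s by (intro power_mono) auto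
   then show "s\<^sup>2 * c1 <= 1" using mult_right_mono[of "s\<^sup>2" "\<rho>\<^sup>2" c1] c1 \<rho>(3) by linarith
   show "0 < n" "0 <= B" "norm a = 1" "0 < Cw" "0 <= \<kappa> / 2" "0 <= s"
    using n B a Cw \<kappa> s by auto
   show "c1 = exp (- norm beta0 * B) * (\<kappa> / 2) / (4 * Cw)" by (rule c1_def)
  qed (fact risk_le mean_le)+
  have ev: "real n * (p1 / 2) <= (\<Sum>i<n. event (?y i) * of_bool (fst (?y i) <= t0))"
  proof -
   have "p1 / 2 <= emp n (%y. event y * of_bool (fst y <= t0)) ?y" using E3 by linarith
   then show ?thesis using n by (simp add: emp_def field_simps)
  qed
  have sc: "(\<Sum>i<n. score_term n beta0 (%z. a \<bullet> z) i ?y) <= Ub n w"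
  proof -
   have "(\<Sum>i<n. score_term n beta0 (%z. a \<bullet> z) i ?y) = (\<Sum>k\<in>UNIV. a $ k * U k n w)"
    unfolding score_term_expand[of _ _ a] U_def by (subst sum.swap) (simp add: sum_distrib_left)
   also have "... <= (\<Sum>k\<in>UNIV. \<bar>U k n w\<bar>)"
   proof (rule sum_mono)
    fix k
    have "a $ k * U k n w <= \<bar>a $ k\<bar> * \<bar>U k n w\<bar>" unfolding abs_mult[symmetric] by simp
    also have "... <= 1 * \<bar>U k n w\<bar>" by (intro mult_right_mono ak) auto
    finally show "a $ k * U k n w <= \<bar>U k n w\<bar>" by simp
   qed
   finally show ?thesis by (simp add: Ub_def)
  qed
  have "s\<^sup>2 * c1 / 2 * (real n * (p1 / 2)) <= s\<^sup>2 * c1 / 2 * (\<Sum>i<n. event (?y i) * of_bool (fst (?y i) <= t0))"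
   using ev c1 by (intro mult_left_mono) auto
  also have "... <= s * (\<Sum>i<n. score_term n beta0 (%z. a \<bullet> z) i ?y)" using le1 le2 by linarith
  also have "... <= s * Ub n w" using sc s by (intro mult_left_mono) auto
  finally have "s * (s * (c1 * p1 * real n / 4)) <= s * Ub n w" by (simp add: power2_eq_square mult_ac)
  then have "s * (c1 * p1 * real n / 4) <= Ub n w" using s by simp
  then have sK: "s <= K1 / real n * Ub n w" using n c1 p1 by (simp add: K1_def field_simps)
  \<comment> \<open>The cap is not attained, so \<open>s\<close> is the actual distance
    \<open>r\<close>.\<close>
  then have "s < \<rho>" using sm \<rho>(1) by linarith
  then have "s = r" by (simp add: s_def min_def split: if_splits)
  then show ?thesis using sK by (simp add: r_def)
 qed
 have "wpo (%n w. norm (betahat n w - beta0) <= K1 / real n * Ub n w)"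
  by (rule wpo_eventually_mp[OF wpo_conj[OF mple wpo_conj[OF small wpo_conj[OF e1 wpo_conj[OF e2 wpo_conj[OF e3 wpo_conj[OF e4 wpo_conj[OF e5 e6]]]]]]]])
    (use eventually_gt_at_top[of 0] in \<open>eventually_elim, use key in auto\<close>)
 then show ?thesis by (rule bdd_in_prob_mono[OF UbK])
qed

end

section \<open>The smoothed Breslow estimator\<close>

lemma integral_empirical:
 assumes [measurable]: "\<phi> \<in> borel_measurable borel"
 shows "(\<integral>x. \<phi> x \<partial>empirical n y) = (\<Sum>i<n. \<phi> (y i)) / real n"
proof -
 have "(\<integral>x. \<phi> x \<partial>empirical n y) = (\<integral>i. \<phi> (y i) \<partial>uniform_count_measure {..<n})"
  unfolding empirical_def
 proof (rule integral_distr)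
  show "y \<in> uniform_count_measure {..<n} \<rightarrow>\<^sub>M borel"
   by (auto simp: uniform_count_measure_def measurable_def space_point_measure sets_point_measure)
 qed measurable
 also have "... = (\<Sum>i<n. \<phi> (y i)) / real n"
  unfolding uniform_count_measure_def
  by (subst lebesgue_integral_point_measure_finite) (auto simp: sum_divide_distrib)
 finally show ?thesis .
qed

lemma Phi_empirical: "Phi (empirical n y) t \<beta> = risk n \<beta> t y / real n"
 unfolding Phi_def case_prod_beta' by (subst integral_empirical) (simp_all add: risk_def)

lemma breslow_empirical:
 "breslow (empirical n y) \<beta> t =
  (\<Sum>i<n. fst (snd (y i)) * of_bool (fst (y i) <= t) / (risk n \<beta> (fst (y i)) y / real n)) / real n"
 unfolding breslow_def Phi_empirical case_prod_beta'
 by (subst integral_empirical) (simp_all add: risk_def)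

text \<open>One constant \<open>kB\<close> bounds the kernel and its derivative, so that sums built
  from either can be treated by the same lemmas.\<close>

locale smooth_kernel =
 fixes k k' :: "real => real" and kB :: real
 assumes k_supp: "\<And>u. u \<notin> {-1..1} ==> k u = 0"
  and k_deriv: "\<And>u. (k has_real_derivative k' u) (at u)"
  and k'_cont: "continuous_on UNIV k'"
  and k_bound: "\<And>u. \<bar>k u\<bar> <= kB" and k'_bound: "\<And>u. \<bar>k' u\<bar> <= kB"
  and k_int: "(\<integral>u. k u \<partial>lborel) = 1"
begin

lemma k_cont: "continuous_on S k"
 by (rule DERIV_continuous_on) (rule has_field_derivative_at_within[OF k_deriv])

lemma k_measurable [measurable]: "k \<in> borel_measurable borel"
 and k'_measurable [measurable]: "k' \<in> borel_measurable borel"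
 using k_cont k'_cont by (auto intro: borel_measurable_continuous_onI)

lemma kB_nonneg: "0 <= kB" using k_bound[of 0] by linarith

lemma k'_supp: assumes "u \<notin> {-1..1}" shows "k' u = 0"
proof -
 have "open (- {-1..1::real})" by auto
 have "((%_. 0) has_real_derivative k' u) (at u)"
  by (rule has_field_derivative_transform_within_open[OF k_deriv \<open>open (- {-1..1::real})\<close>])
    (use assms k_supp in auto)
 then show ?thesis using DERIV_unique[OF _ DERIV_const] by blast
qed

lemma k_integrable: "integrable lborel k" and k_sq_integrable: "integrable lborel (%u. (k u)\<^sup>2)"
proof -
 have "integrable lborel (%u. indicator {-1..1} u *\<^sub>R k u)"
  by (rule borel_integrable_compact) (auto intro: k_cont)
 moreover have "(%u. indicator {-1..1} u *\<^sub>R k u) = k" using k_supp by (auto simp: fun_eq_iff indicator_def)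
 ultimately show "integrable lborel k" by simp
 have "integrable lborel (%u. indicator {-1..1} u *\<^sub>R (k u)\<^sup>2)"
  by (rule borel_integrable_compact) (auto intro!: continuous_intros k_cont)
 moreover have "(%u. indicator {-1..1} u *\<^sub>R (k u)\<^sup>2) = (%u. (k u)\<^sup>2)" using k_supp by (auto simp: fun_eq_iff indicator_def)
 ultimately show "integrable lborel (%u. (k u)\<^sup>2)" by simp
qed

text \<open>The primitive of the kernel. Smoothing a unit jump at \<open>t\<close> produces
  \<open>K ((v - t) / b)\<close>, which makes the smoothed estimator an explicit differentiable
  sum.\<close>

definition K :: "real => real" where "K v = (\<integral>u. k u * indicator {..v} u \<partial>lborel)"

lemma K_eq_integral:
 assumes "a <= -1" "a <= v" shows "K v = integral {a..v} k"
proof -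
 have "K v = (\<integral>u. indicator {a..v} u *\<^sub>R k u \<partial>lborel)"
  unfolding K_def using k_supp assms
  by (intro Bochner_Integration.integral_cong refl) (auto simp: indicator_def)
 also have "... = integral {a..v} k"
  using set_borel_integral_eq_integral(2)[of "{a..v}" k] borel_integrable_compact[of "{a..v}" k]
  by (simp add: set_lebesgue_integral_def set_integrable_def k_cont)
 finally show ?thesis .
qed

lemma K_deriv: "(K has_real_derivative k v) (at v)"
proof -
 \<comment> \<open>A base point below -1 loses nothing of the kernel, and one below \<open>v\<close>
   puts \<open>v\<close> in the interior of the interval of integration.\<close>
 define a where "a = min (-1) v - 1"
 have "((%x. integral {a..x} k) has_real_derivative k v) (at v within {a..v + 1})"
  by (rule integral_has_real_derivative) (auto simp: a_def k_cont)
 then have "((%x. integral {a..x} k) has_real_derivative k v) (at v)"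
  by (simp add: at_within_Icc_at a_def)
 then show ?thesis
  by (rule has_field_derivative_transform_within_open[of _ _ _ "{a<..}"]) (auto simp: a_def K_eq_integral[of a])
qed

lemma K_zero: "v < -1 ==> K v = 0"
 unfolding K_def using k_supp by (subst Bochner_Integration.integral_cong[OF refl, of _ _ "%_. 0"]) (auto simp: indicator_def)

lemma K_bound: "\<bar>K v\<bar> <= 2 * kB"
proof -
 have "\<bar>K v\<bar> <= (\<integral>u. norm (k u * indicator {..v} u) \<partial>lborel)"
  unfolding K_def using integral_norm_bound[of lborel "%u. k u * indicator {..v} u"] by simp
 also have "... <= (\<integral>u. kB * indicator {-1..1::real} u \<partial>lborel)"
 proof (rule integral_mono)
  show "integrable lborel (%u. norm (k u * indicator {..v} u))"
   by (intro integrable_norm integrable_real_mult_indicator k_integrable) auto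
  show "integrable lborel (%u. kB * indicator {-1..1::real} u)" by simp
  show "norm (k u * indicator {..v} u) <= kB * indicator {-1..1} u" for u
   using k_supp[of u] k_bound[of u] by (auto simp: indicator_def)
 qed
 also have "... = 2 * kB" by simp
 finally show ?thesis .
qed

lemma K_continuous: "continuous_on S K"
 by (rule DERIV_continuous_on) (rule has_field_derivative_at_within[OF K_deriv])

lemma K_measurable [measurable]: "K \<in> borel_measurable borel"
 using K_continuous by (rule borel_measurable_continuous_onI)

lemma kernel_indicator:
 assumes b: "0 < b"
 shows "integrable lborel (%u. k ((v - u) / b) / b * of_bool (t <= u))"
  "(\<integral>u. k ((v - u) / b) / b * of_bool (t <= u) \<partial>lborel) = K ((v - t) / b)"
proof -
 define f where "f u = k ((v - u) / b) / b * of_bool (t <= u)" for u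
 have eq: "f (v + (- b) * u) = (k u * indicator {..(v - t) / b} u) / b" for u
  using b by (auto simp: f_def indicator_def field_simps)
 have "integrable lborel (%u. f (v + (- b) * u))"
  unfolding eq by (intro integrable_divide integrable_real_mult_indicator k_integrable) auto
 then show "integrable lborel f"
  using b by (subst (asm) lborel_integrable_real_affine_iff) auto
 have "(\<integral>u. f u \<partial>lborel) = \<bar>- b\<bar> * (\<integral>u. f (v + (- b) * u) \<partial>lborel)"
  using lborel_integral_real_affine[of "- b" f v] b by simp
 then show "(\<integral>u. f u \<partial>lborel) = K ((v - t) / b)"
  unfolding eq using b by (simp add: K_def)
qed

text \<open>The recorded indicator is kept, as in \<open>breslow\<close>; it is exchanged for
  \<open>event\<close> only on an almost sure event.\<close>

definition smoothed :: "real => nat => (nat => ('p::finite) obs) => real ^ 'p => real => real" where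
 "smoothed b n y \<beta> v =
  (\<Sum>i<n. fst (snd (y i)) / (risk n \<beta> (fst (y i)) y / real n) * K ((v - fst (y i)) / b)) / real n"

definition smoothed' :: "real => nat => (nat => ('p::finite) obs) => real ^ 'p => real => real" where
 "smoothed' b n y \<beta> v =
  (\<Sum>i<n. fst (snd (y i)) / (risk n \<beta> (fst (y i)) y / real n) * (k ((v - fst (y i)) / b) / b)) / real n"

lemma kernel_smooth_breslow:
 assumes b: "0 < b"
 shows "kernel_smooth k b (breslow (empirical n y) \<beta>) v = smoothed b n y \<beta> v"
proof -
 define d where "d i = fst (snd (y i)) / (risk n \<beta> (fst (y i)) y / real n) / real n" for i
 have "kernel_smooth k b (breslow (empirical n y) \<beta>) v =
   (\<integral>u. (\<Sum>i<n. d i * (k ((v - u) / b) / b * of_bool (fst (y i) <= u))) \<partial>lborel)"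
  unfolding kernel_smooth_def breslow_empirical
  by (intro Bochner_Integration.integral_cong refl) (simp add: d_def sum_distrib_left sum_divide_distrib mult_ac)
 also have "... = (\<Sum>i<n. d i * K ((v - fst (y i)) / b))"
 proof -
  have "(\<integral>u. (\<Sum>i<n. d i * (k ((v - u) / b) / b * of_bool (fst (y i) <= u))) \<partial>lborel) =
   (\<Sum>i<n. (\<integral>u. d i * (k ((v - u) / b) / b * of_bool (fst (y i) <= u)) \<partial>lborel))"
   by (rule Bochner_Integration.integral_sum) (rule integrable_mult_right[OF kernel_indicator(1)[OF b]])
  then show ?thesis by (simp only: integral_mult_right_zero kernel_indicator(2)[OF b])
 qed
 also have "... = smoothed b n y \<beta> v"
  by (simp add: smoothed_def d_def sum_divide_distrib)
 finally show ?thesis .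
qed

lemma smoothed_deriv:
 assumes b: "0 < b"
 shows "(smoothed b n y \<beta> has_real_derivative smoothed' b n y \<beta> v) (at v)"
proof -
 have "((%v. K ((v - t) / b)) has_real_derivative k ((v - t) / b) * (1 / b)) (at v)" for t
  by (rule DERIV_chain2[OF K_deriv]) (use b in \<open>auto intro!: derivative_eq_intros\<close>)
 then show ?thesis unfolding smoothed_def smoothed'_def
  by (intro DERIV_cdivide DERIV_sum DERIV_cmult) simp
qed

lemma smoothed_continuous: "0 < b ==> continuous_on S (smoothed b n y \<beta>)"
 by (rule DERIV_continuous_on) (rule has_field_derivative_at_within[OF smoothed_deriv])

lemma iso_smoothed_breslow_eq:
 assumes b: "0 < b"
 shows "iso_smoothed_breslow k b \<tau> (empirical n y) \<beta> = left_deriv (gcm \<tau> (smoothed b n y \<beta>))"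
proof -
 have "kernel_smooth k b (breslow (empirical n y) \<beta>) = smoothed b n y \<beta>"
  using kernel_smooth_breslow[OF b] by blast
 then show ?thesis by (simp add: iso_smoothed_breslow_def)
qed

end

text \<open>Sobolev-type bounds: they turn second moments of a random function and of its derivative
  at fixed points into bounds for suprema.\<close>

lemma sobolev_square_bound:
 fixes f f' :: "real => real"
 assumes f: "\<And>r. (f has_real_derivative f' r) (at r)" and f': "continuous_on UNIV f'"
  and v: "v \<in> {\<alpha>..\<beta>}" and c: "0 < c"
 shows "(f v)\<^sup>2 <= (f \<alpha>)\<^sup>2 + (\<integral>r. indicator {\<alpha>..\<beta>} r * ((f r)\<^sup>2 / c + c * (f' r)\<^sup>2) \<partial>lborel)"
proof -
 have fc: "continuous_on S f" for S
  by (rule DERIV_continuous_on) (rule has_field_derivative_at_within[OF f])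
 have f'c: "continuous_on S f'" for S using continuous_on_subset[OF f'] by blast
 have "has_bochner_integral lborel (%r. indicator {\<alpha>..v} r *\<^sub>R (2 * f r * f' r)) ((f v)\<^sup>2 - (f \<alpha>)\<^sup>2)"
 proof (rule has_bochner_integral_FTC_Icc)
  show "\<alpha> <= v" using v by simp
  show "((%r. (f r)\<^sup>2) has_vector_derivative 2 * f r * f' r) (at r within {\<alpha>..v})" for r
   unfolding has_real_derivative_iff_has_vector_derivative[symmetric]
   by (rule has_field_derivative_at_within) (auto intro!: derivative_eq_intros f)
  show "continuous_on {\<alpha>..v} (%r. 2 * f r * f' r)" by (intro continuous_intros fc f'c)
 qed
 then have i1: "integrable lborel (%r. indicator {\<alpha>..v} r *\<^sub>R (2 * f r * f' r))"
  and e1: "(\<integral>r. indicator {\<alpha>..v} r *\<^sub>R (2 * f r * f' r) \<partial>lborel) = (f v)\<^sup>2 - (f \<alpha>)\<^sup>2"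
  by (auto simp: has_bochner_integral_iff)
 have "integrable lborel (%r. indicator {\<alpha>..\<beta>} r *\<^sub>R ((f r)\<^sup>2 / c + c * (f' r)\<^sup>2))"
  by (rule borel_integrable_compact) (use c in \<open>auto intro!: continuous_intros fc f'c\<close>)
 then have i2: "integrable lborel (%r. indicator {\<alpha>..\<beta>} r * ((f r)\<^sup>2 / c + c * (f' r)\<^sup>2))" by simp
 have "(f v)\<^sup>2 - (f \<alpha>)\<^sup>2 <= (\<integral>r. indicator {\<alpha>..\<beta>} r * ((f r)\<^sup>2 / c + c * (f' r)\<^sup>2) \<partial>lborel)"
  unfolding e1[symmetric]
 proof (rule integral_mono[OF i1 i2])
  fix r
  \<comment> \<open>Young's inequality, weighted by a free \<open>c\<close> that is later used to
    balance the two second moments.\<close>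
  have "0 <= (f r - c * f' r)\<^sup>2 / c" using c by simp
  also have "... = (f r)\<^sup>2 / c + c * (f' r)\<^sup>2 - 2 * f r * f' r" using c by (simp add: power2_eq_square field_simps)
  finally have "2 * f r * f' r <= (f r)\<^sup>2 / c + c * (f' r)\<^sup>2" by simp
  moreover have "0 <= (f r)\<^sup>2 / c + c * (f' r)\<^sup>2" using c by simp
  ultimately show "indicator {\<alpha>..v} r *\<^sub>R (2 * f r * f' r) <= indicator {\<alpha>..\<beta>} r * ((f r)\<^sup>2 / c + c * (f' r)\<^sup>2)"
   using v by (auto simp: indicator_def)
 qed
 then show ?thesis by simp
qed

text \<open>Young's inequality is applied to \<open>\<bar>f' r\<bar>\<close> itself. With
  \<open>c\<close> of the typical size of the derivative, the bound has the order of
  \<open>\<rho> * c\<close>.\<close>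

lemma sobolev_increment_bound:
 fixes f f' :: "real => real"
 assumes f: "\<And>r. (f has_real_derivative f' r) (at r)" and f': "continuous_on UNIV f'"
  and v: "\<bar>v - x\<bar> <= \<rho>" and c: "0 < c"
 shows "\<bar>f v - f x\<bar> <= (\<integral>r. indicator {x-\<rho>..x+\<rho>} r * (c + (f' r)\<^sup>2 / c) \<partial>lborel)"
proof -
 have f'c: "continuous_on S f'" for S using continuous_on_subset[OF f'] by blast
 have *: "\<bar>f q - f p\<bar> <= (\<integral>r. indicator {x-\<rho>..x+\<rho>} r * (c + (f' r)\<^sup>2 / c) \<partial>lborel)"
  if pq: "p <= q" "x - \<rho> <= p" "q <= x + \<rho>" for p q
 proof -
  have "has_bochner_integral lborel (%r. indicator {p..q} r *\<^sub>R f' r) (f q - f p)"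
  proof (rule has_bochner_integral_FTC_Icc[OF pq(1)])
   show "(f has_vector_derivative f' r) (at r within {p..q})" for r
    unfolding has_real_derivative_iff_has_vector_derivative[symmetric]
    by (rule has_field_derivative_at_within) (rule f)
  qed (rule f'c)
  then have i1: "integrable lborel (%r. indicator {p..q} r *\<^sub>R f' r)"
   and e1: "(\<integral>r. indicator {p..q} r *\<^sub>R f' r \<partial>lborel) = f q - f p"
   by (auto simp: has_bochner_integral_iff)
  have "integrable lborel (%r. indicator {x-\<rho>..x+\<rho>} r *\<^sub>R (c + (f' r)\<^sup>2 / c))"
   by (rule borel_integrable_compact) (use c in \<open>auto intro!: continuous_intros f'c\<close>)
  then have i2: "integrable lborel (%r. indicator {x-\<rho>..x+\<rho>} r * (c + (f' r)\<^sup>2 / c))" by simp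
  have "\<bar>f q - f p\<bar> <= (\<integral>r. norm (indicator {p..q} r *\<^sub>R f' r) \<partial>lborel)"
   unfolding e1[symmetric] using integral_norm_bound[of lborel "%r. indicator {p..q} r *\<^sub>R f' r"] by simp
  also have "... <= (\<integral>r. indicator {x-\<rho>..x+\<rho>} r * (c + (f' r)\<^sup>2 / c) \<partial>lborel)"
  proof (rule integral_mono[OF integrable_norm[OF i1] i2])
   fix r
   have "0 <= (\<bar>f' r\<bar> - c)\<^sup>2 / c" using c by simp
   also have "... = c + (f' r)\<^sup>2 / c - 2 * \<bar>f' r\<bar>" using c by (simp add: power2_diff field_simps power2_eq_square)
   finally have "\<bar>f' r\<bar> <= c + (f' r)\<^sup>2 / c" by simp
   then show "norm (indicator {p..q} r *\<^sub>R f' r) <= indicator {x-\<rho>..x+\<rho>} r * (c + (f' r)\<^sup>2 / c)"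
    using pq c by (auto simp: indicator_def)
  qed
  finally show ?thesis .
 qed
 show ?thesis
 proof (cases "x <= v")
  case True then show ?thesis using *[of x v] v by auto
 next
  case False then show ?thesis using *[of v x] v by (auto simp: abs_minus_commute)
 qed
qed

text \<open>Tonelli. A section that is not integrable has Bochner integral 0, so for it the
  inequality is trivial.\<close>

lemma (in prob_space) nn_integral_of_integral_le:
 fixes g :: "'a => real => real"
 assumes g [measurable]: "(%(w, r). g w r) \<in> borel_measurable (M \<Otimes>\<^sub>M borel)"
  and nonneg: "\<And>w r. 0 <= g w r"
  and bound: "\<And>r. r \<in> {\<alpha>..\<beta>} ==> (\<integral>\<^sup>+w. ennreal (g w r) \<partial>M) <= ennreal c"
  and c: "0 <= c" and ab: "\<alpha> <= \<beta>"
 shows "(\<integral>\<^sup>+w. ennreal (\<integral>r. indicator {\<alpha>..\<beta>} r * g w r \<partial>lborel) \<partial>M) <= ennreal (c * (\<beta> - \<alpha>))"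
proof -
 interpret WR: pair_sigma_finite M "lborel :: real measure" ..
 have g' [measurable]: "(%q. g (fst q) (snd q)) \<in> borel_measurable (M \<Otimes>\<^sub>M lborel)"
  using g by (simp add: case_prod_beta' cong: measurable_cong_sets)
 have "(\<integral>\<^sup>+w. ennreal (\<integral>r. indicator {\<alpha>..\<beta>} r * g w r \<partial>lborel) \<partial>M) \<le>
  (\<integral>\<^sup>+w. (\<integral>\<^sup>+r. ennreal (indicator {\<alpha>..\<beta>} r * g w r) \<partial>lborel) \<partial>M)"
 proof (rule nn_integral_mono)
  fix w
  show "ennreal (\<integral>r. indicator {\<alpha>..\<beta>} r * g w r \<partial>lborel) <= (\<integral>\<^sup>+r. ennreal (indicator {\<alpha>..\<beta>} r * g w r) \<partial>lborel)"
  proof (cases "integrable lborel (%r. indicator {\<alpha>..\<beta>} r * g w r)")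
   case True
   then show ?thesis using nonneg by (subst nn_integral_eq_integral) auto
  qed (simp add: not_integrable_integral_eq)
 qed
 also have "... = (\<integral>\<^sup>+r. (\<integral>\<^sup>+w. ennreal (indicator {\<alpha>..\<beta>} r * g w r) \<partial>M) \<partial>lborel)"
  by (rule WR.Fubini'[symmetric]) (simp add: case_prod_beta')
 also have "... <= (\<integral>\<^sup>+r. ennreal c * indicator {\<alpha>..\<beta>} r \<partial>lborel)"
  using bound by (intro nn_integral_mono) (auto simp: indicator_def)
 also have "... = ennreal (c * (\<beta> - \<alpha>))"
  using ab c by (subst nn_integral_cmult_indicator) (auto simp: ennreal_mult')
 finally show ?thesis .
qed

lemma exp_minus_one_bound: fixes u :: real shows "\<bar>exp u - 1\<bar> <= \<bar>u\<bar> * exp \<bar>u\<bar>"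
proof (cases "0 <= u")
 case True
 have "1 + (- u) <= exp (- u)" by (rule exp_ge_add_one_self)
 then have "(1 - exp (- u)) * exp u <= u * exp u" by (intro mult_right_mono) auto
 then show ?thesis using True by (simp add: left_diff_distrib flip: exp_add)
next
 case False
 have "1 + u <= exp u" by (rule exp_ge_add_one_self)
 moreover have "\<bar>exp u - 1\<bar> = 1 - exp u" using False by simp
 ultimately have "\<bar>exp u - 1\<bar> <= \<bar>u\<bar> * 1" using False by linarith
 also have "... <= \<bar>u\<bar> * exp \<bar>u\<bar>" by (intro mult_left_mono) auto
 finally show ?thesis .
qed

lemma smoothed_measurable:
 assumes "smooth_kernel k k' kB" "\<And>i. Y i \<in> borel_measurable M" "B \<in> borel_measurable M"
 shows "(%w. smooth_kernel.smoothed k b n (%i. Y i w) (B w) v) \<in> borel_measurable M"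
proof -
 interpret smooth_kernel k k' kB by fact
 note [measurable] = assms(2,3)
 show ?thesis unfolding smoothed_def by measurable
qed

section \<open>Kernel sums with the true risk\<close>

locale cox_smoothing = cox_sample M Y P lam0 beta0 tauH + smooth_kernel k k' kB
 for M :: "'w measure" and Y :: "nat => 'w => ('p::finite) obs" and P :: "('p::finite) obs measure"
  and lam0 beta0 tauH k k' kB +
 fixes tau2 :: real
 assumes tau2: "0 < tau2" "tau2 < tauH"
begin

text \<open>Since \<open>tau2\<close> lies strictly before \<open>tauH\<close>, the risk is bounded
  below by \<open>\<kappa>\<close> up to \<open>tau2\<close>; divisions by a risk are confined to
  that range.\<close>

definition \<kappa> :: real where "\<kappa> = phi tau2"

lemma \<kappa>_pos: "0 < \<kappa>" unfolding \<kappa>_def by (rule phi_pos[OF tau2(2)])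

lemma \<kappa>_le: "s <= tau2 ==> \<kappa> <= phi s" unfolding \<kappa>_def by (rule phi_antimono)

text \<open>The nonnegative identity is applied to the positive and the negative part of
  \<open>g\<close>.\<close>

lemma integral_event:
 assumes [measurable]: "g \<in> borel_measurable borel" and g: "\<And>s. \<bar>g s\<bar> <= B"
 shows "integrable P (%y. event y * g (fst y))"
  and "(\<integral>y. event y * g (fst y) \<partial>P) = (\<integral>s. indicator {0..tauH} s * (lam0 s * phi s * g s) \<partial>lborel)"
proof -
 have lm: "(%s. indicator {0..tauH} s * lam0 s) \<in> borel_measurable borel"
  using borel_measurable_continuous_on_indicator[OF _ obs.lam0_cont] by simp
 have m: "(%s. indicator {0..tauH} s * (lam0 s * phi s * h s)) \<in> borel_measurable lborel"
  if [measurable]: "h \<in> borel_measurable borel" for h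
 proof -
  have "(%s. (indicator {0..tauH} s * lam0 s) * phi s * h s) \<in> borel_measurable borel" using lm by measurable
  then show ?thesis by (simp add: mult.assoc)
 qed
 have *: "integrable P (%y. event y * h (fst y)) \<and> integrable lborel (%s. indicator {0..tauH} s * (lam0 s * phi s * h s)) \<and>
  (\<integral>y. event y * h (fst y) \<partial>P) = (\<integral>s. indicator {0..tauH} s * (lam0 s * phi s * h s) \<partial>lborel)"
  if h [measurable]: "h \<in> borel_measurable borel" and h0: "\<And>s. 0 <= h s" and hB: "\<And>s. h s <= B" for h
 proof -
  have hP: "(%y. event y * h (fst y)) \<in> borel_measurable P" unfolding measurable_P by measurable
  have ev: "0 <= event y * h (fst y)" "event y * h (fst y) <= B" for y
   using event_cases[of y] h0[of "fst y"] hB[of "fst y"] by auto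
  have i: "integrable P (%y. event y * h (fst y))"
   by (rule obs.integrable_const_bound[of _ B]) (simp_all add: ev hP abs_of_nonneg)
  have nn: "0 <= indicator {0..tauH} s * (lam0 s * phi s * h s)" for s
   using obs.lam0_nonneg phi_nonneg h0 by (auto simp: indicator_def)
  have fin: "(\<integral>\<^sup>+s. ennreal (indicator {0..tauH} s * (lam0 s * phi s * h s)) \<partial>lborel) = ennreal (\<integral>y. event y * h (fst y) \<partial>P)"
   unfolding nn_integral_event[OF h h0, symmetric] using i by (intro nn_integral_eq_integral) (simp_all add: ev)
  have "integrable lborel (%s. indicator {0..tauH} s * (lam0 s * phi s * h s))"
   by (rule integrableI_nonneg) (use m[OF h] nn fin in auto)
  moreover from this have "ennreal (\<integral>s. indicator {0..tauH} s * (lam0 s * phi s * h s) \<partial>lborel) = ennreal (\<integral>y. event y * h (fst y) \<partial>P)"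
   using fin nn by (subst (asm) nn_integral_eq_integral) auto
  moreover have "0 <= (\<integral>y. event y * h (fst y) \<partial>P)" by (intro Bochner_Integration.integral_nonneg ev)
  moreover have "0 <= (\<integral>s. indicator {0..tauH} s * (lam0 s * phi s * h s) \<partial>lborel)"
   by (intro Bochner_Integration.integral_nonneg nn)
  ultimately show ?thesis using i by (metis ennreal_inj)
 qed
 have B: "0 <= B" using g[of 0] by linarith
 have p: "integrable P (%y. event y * max 0 (g (fst y))) \<and> integrable lborel (%s. indicator {0..tauH} s * (lam0 s * phi s * max 0 (g s))) \<and>
  (\<integral>y. event y * max 0 (g (fst y)) \<partial>P) = (\<integral>s. indicator {0..tauH} s * (lam0 s * phi s * max 0 (g s)) \<partial>lborel)"
  by (rule *) (use g B in \<open>auto simp: abs_le_iff\<close>)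
 have q: "integrable P (%y. event y * max 0 (- g (fst y))) \<and> integrable lborel (%s. indicator {0..tauH} s * (lam0 s * phi s * max 0 (- g s))) \<and>
  (\<integral>y. event y * max 0 (- g (fst y)) \<partial>P) = (\<integral>s. indicator {0..tauH} s * (lam0 s * phi s * max 0 (- g s)) \<partial>lborel)"
  by (rule *[of "%s. max 0 (- g s)"]) (use g B in \<open>auto simp: abs_le_iff minus_le_iff\<close>)
 have e1: "event y * g (fst y) = event y * max 0 (g (fst y)) - event y * max 0 (- g (fst y))" for y
  by (auto simp: max_def)
 have e2: "indicator {0..tauH} s * (lam0 s * phi s * g s) =
   indicator {0..tauH} s * (lam0 s * phi s * max 0 (g s)) - indicator {0..tauH} s * (lam0 s * phi s * max 0 (- g s))" for s
  by (auto simp: max_def)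
 show "integrable P (%y. event y * g (fst y))" unfolding e1 using p q by (intro Bochner_Integration.integrable_diff) auto
 show "(\<integral>y. event y * g (fst y) \<partial>P) = (\<integral>s. indicator {0..tauH} s * (lam0 s * phi s * g s) \<partial>lborel)"
  unfolding e1 e2 using p q by (simp add: Bochner_Integration.integral_diff)
qed

text \<open>A summand of \<open>smoothed'\<close> with the empirical risk replaced by
  \<open>phi\<close>; \<open>psi'\<close> is its derivative in \<open>v\<close>.\<close>

definition psi :: "real => real => 'p obs => real" where
 "psi b v y = event y * (k ((v - fst y) / b) / b / phi (fst y))"

definition psi' :: "real => real => 'p obs => real" where
 "psi' b v y = event y * (k' ((v - fst y) / b) / b\<^sup>2 / phi (fst y))"

text \<open>For \<open>v + b <= tau2\<close> this is the expectation of \<open>psi b v\<close>: the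
  risk cancels, and \<open>lam0\<close> smoothed by the kernel remains.\<close>

definition mean :: "real => real => real" where
 "mean b v = integral {0..tauH} (%u. lam0 u * (k ((v - u) / b) / b))"

definition mean' :: "real => real => real" where
 "mean' b v = integral {0..tauH} (%u. lam0 u * (k' ((v - u) / b) / b\<^sup>2))"

definition Q :: "real => nat => 'w => real => real" where
 "Q b n w v = emp n (psi b v) (ys w) - mean b v"

definition Q' :: "real => nat => 'w => real => real" where
 "Q' b n w v = emp n (psi' b v) (ys w) - mean' b v"

lemma psi_measurable [measurable]: "psi b v \<in> borel_measurable borel" "psi' b v \<in> borel_measurable borel"
 unfolding psi_def[abs_def] psi'_def[abs_def] by measurable

lemma kk_cont:
 assumes b: "0 < b" and kk: "continuous_on UNIV kk"
 shows "continuous_on (S \<times> {0..tauH}) (%(v, u). lam0 u * (kk ((v - u) / b) / c))"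
proof -
 have "continuous_on (S \<times> {0..tauH}) (%p. lam0 (snd p))"
  by (rule continuous_on_compose2[OF obs.lam0_cont]) (auto intro!: continuous_intros)
 moreover have "continuous_on (S \<times> {0..tauH}) (%p. kk ((fst p - snd p) / b))"
  by (rule continuous_on_compose2[OF kk]) (use b in \<open>auto intro!: continuous_intros\<close>)
 ultimately show ?thesis
  unfolding case_prod_beta' divide_inverse by (intro continuous_on_mult continuous_on_const)
qed

lemma kk_cont1:
 assumes b: "0 < b" and kk: "continuous_on UNIV kk"
 shows "continuous_on {0..tauH} (%u. lam0 u * (kk ((v - u) / b) / c))"
proof -
 have "continuous_on {0..tauH} (%u. kk ((v - u) / b))"
  by (rule continuous_on_compose2[OF kk]) (use b in \<open>auto intro!: continuous_intros\<close>)
 then show ?thesis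
  unfolding divide_inverse by (intro continuous_on_mult continuous_on_const obs.lam0_cont)
qed

lemma mean_deriv:
 assumes b: "0 < b" shows "(mean b has_real_derivative mean' b v) (at v)"
 unfolding mean_def[abs_def] mean'_def box_real(2)[symmetric]
proof (rule leibniz_rule_field_derivative[where U = UNIV])
 fix v u :: real
 show "((%v. lam0 u * (k ((v - u) / b) / b)) has_real_derivative lam0 u * (k' ((v - u) / b) / b\<^sup>2)) (at v within UNIV)"
 proof -
  have "((%v. k ((v - u) / b)) has_real_derivative k' ((v - u) / b) * (1 / b)) (at v)"
   by (rule DERIV_chain2[OF k_deriv]) (use b in \<open>auto intro!: derivative_eq_intros\<close>)
  then have "((%v. lam0 u * (k ((v - u) / b) / b)) has_real_derivative lam0 u * (k' ((v - u) / b) * (1 / b) / b)) (at v)"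
   by (intro DERIV_cmult DERIV_cdivide)
  then show ?thesis by (simp add: power2_eq_square)
 qed
next
 show "(%u. lam0 u * (k ((v - u) / b) / b)) integrable_on cbox 0 tauH" for v
  unfolding box_real(2) by (intro integrable_continuous_interval kk_cont1[OF b k_cont])
 show "continuous_on (UNIV \<times> cbox 0 tauH) (%(v, u). lam0 u * (k' ((v - u) / b) / b\<^sup>2))"
  unfolding box_real(2) by (rule kk_cont[OF b k'_cont])
qed auto

lemma mean'_cont: assumes b: "0 < b" shows "continuous_on UNIV (mean' b)"
proof -
 have "continuous_on UNIV (%v. integral (cbox 0 tauH) (%u. lam0 u * (k' ((v - u) / b) / b\<^sup>2)))"
  by (rule integral_continuous_on_param) (use kk_cont[OF b k'_cont, of UNIV] in simp)
 then show ?thesis by (simp add: mean'_def[abs_def])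
qed

text \<open>Division by \<open>phi\<close> is harmless because the kernel vanishes unless
  \<open>t\<close> lies in a window that ends before \<open>tau2\<close>. The general
  \<open>kk\<close> and \<open>c\<close> cover both \<open>k\<close> with \<open>b\<close> and
  \<open>k'\<close> with \<open>b\<^sup>2\<close>.\<close>

lemma kernel_div:
 assumes b: "0 < b" and v: "v + b <= tau2"
  and kk: "\<And>u. u \<notin> {-1..1} ==> kk u = (0::real)" "\<And>u. \<bar>kk u\<bar> <= kB" and c: "0 < c"
 shows "\<bar>kk ((v - t) / b) / c / phi t\<bar> <= kB / (c * \<kappa>) * indicator {v-b..v+b} t"
  and "kk ((v - t) / b) / c / phi t * phi t = kk ((v - t) / b) / c"
proof -
 have z: "kk ((v - t) / b) = 0" if "t \<notin> {v-b..v+b}"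
  using that b by (intro kk(1)) (auto simp: field_simps)
 have p: "\<kappa> <= phi t" if "t \<in> {v-b..v+b}" using that v by (intro \<kappa>_le) auto
 show "\<bar>kk ((v - t) / b) / c / phi t\<bar> <= kB / (c * \<kappa>) * indicator {v-b..v+b} t"
 proof (cases "t \<in> {v-b..v+b}")
  case True
  then have "\<bar>kk ((v - t) / b) / c / phi t\<bar> = \<bar>kk ((v - t) / b)\<bar> / (c * phi t)"
   using p \<kappa>_pos c by (simp add: abs_mult)
  also have "... <= kB / (c * \<kappa>)"
   using p[OF True] \<kappa>_pos c kk(2) kB_nonneg by (intro frac_le mult_left_mono) auto
  finally show ?thesis using True by simp
 qed (simp add: z)
 show "kk ((v - t) / b) / c / phi t * phi t = kk ((v - t) / b) / c"
  using z p \<kappa>_pos by (cases "t \<in> {v-b..v+b}") auto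
qed

text \<open>The intensity of events contains \<open>phi\<close>, which cancels the division and
  leaves \<open>lam0\<close>. The second moment is at most the squared height of the summand times
  the probability of an event in a window of length \<open>2 * b\<close>.\<close>

lemma kernel_mean:
 assumes b: "0 < b" and v: "v + b <= tau2" and kc: "continuous_on UNIV kk"
  and kk: "\<And>u. u \<notin> {-1..1} ==> kk u = (0::real)" "\<And>u. \<bar>kk u\<bar> <= kB" and c: "0 < c"
 shows "(\<integral>y. event y * (kk ((v - fst y) / b) / c / phi (fst y)) \<partial>P) = integral {0..tauH} (%u. lam0 u * (kk ((v - u) / b) / c))"
  and "integrable P (%y. (event y * (kk ((v - fst y) / b) / c / phi (fst y)))\<^sup>2)"
  and "(\<integral>y. (event y * (kk ((v - fst y) / b) / c / phi (fst y)))\<^sup>2 \<partial>P) <= (kB / (c * \<kappa>))\<^sup>2 * (lamB * Env * (2 * b))"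
proof -
 have [measurable]: "kk \<in> borel_measurable borel" using kc by (rule borel_measurable_continuous_onI)
 note kd = kernel_div[where kk = kk and c = c, OF b v kk c]
 have "\<bar>kk ((v - t) / b) / c / phi t\<bar> <= kB / (c * \<kappa>)" for t
  using kd(1)[where t = t] kB_nonneg c \<kappa>_pos by (auto simp: indicator_def split: if_splits intro: order_trans)
 then have "(\<integral>y. event y * (kk ((v - fst y) / b) / c / phi (fst y)) \<partial>P) =
   (\<integral>s. indicator {0..tauH} s * (lam0 s * phi s * (kk ((v - s) / b) / c / phi s)) \<partial>lborel)"
  by (intro integral_event(2)) measurable
 also have "... = (\<integral>s. indicator {0..tauH} s *\<^sub>R (lam0 s * (kk ((v - s) / b) / c)) \<partial>lborel)"
 proof (rule Bochner_Integration.integral_cong[OF refl])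
  fix s
  have "phi s * (kk ((v - s) / b) / c / phi s) = kk ((v - s) / b) / c" using kd(2)[where t = s] by (simp add: mult.commute)
  then show "indicator {0..tauH} s * (lam0 s * phi s * (kk ((v - s) / b) / c / phi s)) = indicator {0..tauH} s *\<^sub>R (lam0 s * (kk ((v - s) / b) / c))"
   by (metis mult.assoc real_scaleR_def)
 qed
 also have "... = integral {0..tauH} (%u. lam0 u * (kk ((v - u) / b) / c))"
  using set_borel_integral_eq_integral(2)[of "{0..tauH}" "%u. lam0 u * (kk ((v - u) / b) / c)"]
   borel_integrable_compact[OF compact_Icc kk_cont1[OF b kc]]
  unfolding set_lebesgue_integral_def set_integrable_def by blast
 finally show "(\<integral>y. event y * (kk ((v - fst y) / b) / c / phi (fst y)) \<partial>P) = integral {0..tauH} (%u. lam0 u * (kk ((v - u) / b) / c))" .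
 have le: "(event y * (kk ((v - fst y) / b) / c / phi (fst y)))\<^sup>2 <= (kB / (c * \<kappa>))\<^sup>2 * (event y * indicator {v-b..v+b} (fst y))" for y
 proof -
  have "(event y * (kk ((v - fst y) / b) / c / phi (fst y)))\<^sup>2 = event y * \<bar>kk ((v - fst y) / b) / c / phi (fst y)\<bar>\<^sup>2"
   by (simp only: power_mult_distrib[of "event y"] event_sq power2_abs)
  also have "... <= event y * (kB / (c * \<kappa>) * indicator {v-b..v+b} (fst y))\<^sup>2"
   using kd(1)[where t = "fst y"] by (intro mult_left_mono power_mono event_nonneg) auto
  also have "... = (kB / (c * \<kappa>))\<^sup>2 * (event y * indicator {v-b..v+b} (fst y))"
   by (simp add: power_mult_distrib indicator_def)
  finally show ?thesis .
 qed
 have i: "integrable P (%y. event y * indicator {v-b..v+b} (fst y))"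
  by (rule integral_event(1)[of _ 1]) auto
 show i2: "integrable P (%y. (event y * (kk ((v - fst y) / b) / c / phi (fst y)))\<^sup>2)"
 proof (rule Bochner_Integration.integrable_bound[OF integrable_mult_right[OF i, of "(kB / (c * \<kappa>))\<^sup>2"]])
  show "(%y. (event y * (kk ((v - fst y) / b) / c / phi (fst y)))\<^sup>2) \<in> borel_measurable P"
   unfolding measurable_P by measurable
  show "AE y in P. norm ((event y * (kk ((v - fst y) / b) / c / phi (fst y)))\<^sup>2)
    <= norm ((kB / (c * \<kappa>))\<^sup>2 * (event y * indicator {v-b..v+b} (fst y)))"
  proof (rule AE_I2)
   show "norm ((event y * (kk ((v - fst y) / b) / c / phi (fst y)))\<^sup>2)
    <= norm ((kB / (c * \<kappa>))\<^sup>2 * (event y * indicator {v-b..v+b} (fst y)))" for y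
    using order_trans[OF le[of y] abs_ge_self] by (simp only: real_norm_def abs_power2)
  qed
 qed
 have "(\<integral>y. (event y * (kk ((v - fst y) / b) / c / phi (fst y)))\<^sup>2 \<partial>P) <= (\<integral>y. (kB / (c * \<kappa>))\<^sup>2 * (event y * indicator {v-b..v+b} (fst y)) \<partial>P)"
  by (rule integral_mono[OF i2 integrable_mult_right[OF i] le])
 also have "... = (kB / (c * \<kappa>))\<^sup>2 * (\<integral>y. event y * indicator {v-b..v+b} (fst y) \<partial>P)" by simp
 also have "... <= (kB / (c * \<kappa>))\<^sup>2 * (lamB * Env * (v + b - (v - b)))"
  using event_mass[of "v-b" "v+b"] b by (intro mult_left_mono) auto
 finally show "(\<integral>y. (event y * (kk ((v - fst y) / b) / c / phi (fst y)))\<^sup>2 \<partial>P) <= (kB / (c * \<kappa>))\<^sup>2 * (lamB * Env * (2 * b))"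
  by (simp add: mult.commute)
qed

lemma psi_mean:
 assumes "0 < b" "v + b <= tau2"
 shows "(\<integral>y. psi b v y \<partial>P) = mean b v" "(\<integral>y. psi' b v y \<partial>P) = mean' b v"
 unfolding psi_def mean_def psi'_def mean'_def
 using kernel_mean(1)[OF assms k_cont k_supp k_bound, of b] kernel_mean(1)[OF assms k'_cont k'_supp k'_bound, of "b\<^sup>2"] assms(1)
 by auto

definition C1 :: real where "C1 = (kB / \<kappa>)\<^sup>2 * (lamB * Env * 2)"

lemma C1_nonneg: "0 <= C1" using lamB_nonneg Env_nonneg by (simp add: C1_def)

lemma psi_sq:
 assumes b: "0 < b" "v + b <= tau2"
 shows "integrable P (%y. (psi b v y)\<^sup>2)" "(\<integral>y. (psi b v y)\<^sup>2 \<partial>P) <= C1 / b"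
  "integrable P (%y. (psi' b v y)\<^sup>2)" "(\<integral>y. (psi' b v y)\<^sup>2 \<partial>P) <= C1 / b ^ 3"
proof -
 have 1: "(kB / (b * \<kappa>))\<^sup>2 * (lamB * Env * (2 * b)) = C1 / b"
  using b \<kappa>_pos by (simp add: C1_def power2_eq_square field_simps)
 have 2: "(kB / (b\<^sup>2 * \<kappa>))\<^sup>2 * (lamB * Env * (2 * b)) = C1 / b ^ 3"
  using b \<kappa>_pos by (simp add: C1_def power2_eq_square power3_eq_cube field_simps)
 show "integrable P (%y. (psi b v y)\<^sup>2)" "(\<integral>y. (psi b v y)\<^sup>2 \<partial>P) <= C1 / b"
  "integrable P (%y. (psi' b v y)\<^sup>2)" "(\<integral>y. (psi' b v y)\<^sup>2 \<partial>P) <= C1 / b ^ 3"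
  unfolding psi_def psi'_def
  using kernel_mean(2,3)[OF b k_cont k_supp k_bound, of b] kernel_mean(2,3)[OF b k'_cont k'_supp k'_bound, of "b\<^sup>2"] b(1)
  unfolding 1 2 by auto
qed

lemma Q_deriv: assumes b: "0 < b" shows "(Q b n w has_real_derivative Q' b n w v) (at v)"
proof -
 have "((%v. psi b v y) has_real_derivative psi' b v y) (at v)" for y
 proof -
  have "((%v. k ((v - fst y) / b)) has_real_derivative k' ((v - fst y) / b) * (1 / b)) (at v)"
   by (rule DERIV_chain2[OF k_deriv]) (use b in \<open>auto intro!: derivative_eq_intros\<close>)
  then have "((%v. psi b v y) has_real_derivative event y * (k' ((v - fst y) / b) * (1 / b) / b / phi (fst y))) (at v)"
   unfolding psi_def by (intro DERIV_cmult DERIV_cdivide)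
  then show ?thesis by (simp add: psi'_def power2_eq_square)
 qed
 then show ?thesis unfolding Q_def[abs_def] Q'_def emp_def
  by (intro DERIV_diff DERIV_cdivide DERIV_sum mean_deriv[OF b]) simp
qed

lemma Q'_cont: assumes b: "0 < b" shows "continuous_on UNIV (Q' b n w)"
proof -
 have "continuous_on UNIV (%v. psi' b v y)" for y
 proof -
  have "continuous_on UNIV (%v. k' ((v - fst y) / b))"
   by (rule continuous_on_compose2[OF k'_cont]) (use b in \<open>auto intro!: continuous_intros\<close>)
  then show ?thesis unfolding psi'_def divide_inverse by (intro continuous_intros)
 qed
 then show ?thesis unfolding Q'_def[abs_def] emp_def divide_inverse
  by (intro continuous_intros mean'_cont[OF b]) simp
qed

lemma Q_measurable [measurable]:
 assumes b: "0 < b"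
 shows "(%(w, r). Q b n w r) \<in> borel_measurable (M \<Otimes>\<^sub>M borel)" "(%(w, r). Q' b n w r) \<in> borel_measurable (M \<Otimes>\<^sub>M borel)"
proof -
 have [measurable]: "mean b \<in> borel_measurable borel" "mean' b \<in> borel_measurable borel"
 proof -
  have "continuous_on UNIV (mean b)"
   by (rule DERIV_continuous_on) (rule has_field_derivative_at_within[OF mean_deriv[OF b]])
  then show "mean b \<in> borel_measurable borel" by (rule borel_measurable_continuous_onI)
  show "mean' b \<in> borel_measurable borel" using mean'_cont[OF b] by (rule borel_measurable_continuous_onI)
 qed
 have [measurable]: "(%q. Y i (fst q)) \<in> borel_measurable (M \<Otimes>\<^sub>M (borel :: real measure))" for i
  by (rule measurable_compose[OF measurable_fst Y_meas])
 show "(%(w, r). Q b n w r) \<in> borel_measurable (M \<Otimes>\<^sub>M borel)" "(%(w, r). Q' b n w r) \<in> borel_measurable (M \<Otimes>\<^sub>M borel)"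
  unfolding Q_def Q'_def emp_def psi_def psi'_def case_prod_beta' by measurable
qed

lemma Q_second_moment:
 assumes b: "0 < b" "v + b <= tau2" and n: "0 < n"
 shows "(\<integral>\<^sup>+w. ennreal ((Q b n w v)\<^sup>2) \<partial>M) <= ennreal (C1 / (n * b))"
  and "(\<integral>\<^sup>+w. ennreal ((Q' b n w v)\<^sup>2) \<partial>M) <= ennreal (C1 / (n * b ^ 3))"
proof -
 have "(\<integral>\<^sup>+w. ennreal ((Q b n w v)\<^sup>2) \<partial>M) <= ennreal ((\<integral>y. (psi b v y)\<^sup>2 \<partial>P) / n)"
  unfolding Q_def psi_mean(1)[OF b, symmetric] by (rule nn_emp_second_moment[OF _ psi_sq(1)[OF b] n]) measurable
 also have "... <= ennreal ((C1 / b) / n)" using psi_sq(2)[OF b] by (intro ennreal_leI divide_right_mono) auto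
 finally show "(\<integral>\<^sup>+w. ennreal ((Q b n w v)\<^sup>2) \<partial>M) <= ennreal (C1 / (n * b))" by (simp add: mult.commute)
 have "(\<integral>\<^sup>+w. ennreal ((Q' b n w v)\<^sup>2) \<partial>M) <= ennreal ((\<integral>y. (psi' b v y)\<^sup>2 \<partial>P) / n)"
  unfolding Q'_def psi_mean(2)[OF b, symmetric] by (rule nn_emp_second_moment[OF _ psi_sq(3)[OF b] n]) measurable
 also have "... <= ennreal ((C1 / b ^ 3) / n)" using psi_sq(4)[OF b] by (intro ennreal_leI divide_right_mono) auto
 finally show "(\<integral>\<^sup>+w. ennreal ((Q' b n w v)\<^sup>2) \<partial>M) <= ennreal (C1 / (n * b ^ 3))" by (simp add: mult.commute)
qed

text \<open>The Sobolev bound with parameter \<open>b n\<close>: \<open>Q\<close> has variance of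
  order 1/(n b) and \<open>Q'\<close> of order 1/(n b^3), so both integrands are of order 1/(n b^2),
  the square of the stated rate.\<close>

lemma Q_sup:
 fixes b :: "nat => real"
 assumes bpos: "\<And>n. 0 < b n" and b0: "b \<longlonglongrightarrow> 0" and ab: "\<alpha> <= \<beta>" "\<beta> < tau2"
 shows "\<exists>S. Op S (%n. 1 / (b n * sqrt n)) \<and> (\<forall>n w. \<forall>v\<in>{\<alpha>..\<beta>}. \<bar>Q (b n) n w v\<bar> <= S n w)"
proof -
 define g where "g n w r = (Q (b n) n w r)\<^sup>2 / b n + b n * (Q' (b n) n w r)\<^sup>2" for n w r
 define S where "S n w = (Q (b n) n w \<alpha>)\<^sup>2 + (\<integral>r. indicator {\<alpha>..\<beta>} r * g n w r \<partial>lborel)" for n w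
 have [measurable]: "(%q. Q (b n) n (fst q) (snd q)) \<in> borel_measurable (M \<Otimes>\<^sub>M borel)"
   "(%q. Q' (b n) n (fst q) (snd q)) \<in> borel_measurable (M \<Otimes>\<^sub>M borel)" for n
  using Q_measurable[OF bpos] by (simp_all add: case_prod_beta')
 have [measurable]: "(%w. Q (b n) n w v) \<in> borel_measurable M" "(%w. Q' (b n) n w v) \<in> borel_measurable M" for n v
  unfolding Q_def Q'_def by measurable
 have gm: "(%(w, r). g n w r) \<in> borel_measurable (M \<Otimes>\<^sub>M borel)" for n
  unfolding g_def case_prod_beta' by measurable
 have Sm [measurable]: "S n \<in> borel_measurable M" for n
 proof -
  have "(%q. indicator {\<alpha>..\<beta>} (snd q) * g n (fst q) (snd q)) \<in> borel_measurable (M \<Otimes>\<^sub>M lborel)"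
   using gm[of n] by (simp add: case_prod_beta' cong: measurable_cong_sets)
  then have "(%w. \<integral>r. indicator {\<alpha>..\<beta>} r * g n w r \<partial>lborel) \<in> borel_measurable M"
   by (intro sigma_finite_measure.borel_measurable_lebesgue_integral sigma_finite_lborel) (simp add: case_prod_beta')
  then show ?thesis unfolding S_def by measurable
 qed
 have bd: "Op S (%n. 1 / (n * (b n)\<^sup>2))"
 proof (rule bdd_in_prob_Markov[OF Sm, where C = "C1 * (1 + 2 * (\<beta> - \<alpha>))"])
  have "LARGE n. b n < min 1 (tau2 - \<beta>)"
   using order_tendstoD(2)[OF b0, of "min 1 (tau2 - \<beta>)"] ab by simp
  then show "LARGE n. (\<integral>\<^sup>+w. ennreal (S n w) \<partial>M) <= ennreal (C1 * (1 + 2 * (\<beta> - \<alpha>)) * (1 / (n * (b n)\<^sup>2)))"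
   using eventually_gt_at_top[of 0]
  proof eventually_elim
   case (elim n)
   have w: "v + b n <= tau2" if "v \<in> {\<alpha>..\<beta>}" for v using that elim by auto
   have gb: "(\<integral>\<^sup>+w. ennreal (g n w r) \<partial>M) <= ennreal (2 * C1 / (n * (b n)\<^sup>2))" if r: "r \<in> {\<alpha>..\<beta>}" for r
   proof -
    have "(\<integral>\<^sup>+w. ennreal (g n w r) \<partial>M) =
     ennreal (1 / b n) * (\<integral>\<^sup>+w. ennreal ((Q (b n) n w r)\<^sup>2) \<partial>M) + ennreal (b n) * (\<integral>\<^sup>+w. ennreal ((Q' (b n) n w r)\<^sup>2) \<partial>M)"
     unfolding g_def using bpos[of n]
     by (subst (1 2) nn_integral_cmult[symmetric], measurable, subst nn_integral_add[symmetric], measurable)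
       (intro nn_integral_cong, simp add: ennreal_mult'[symmetric] ennreal_plus[symmetric] del: ennreal_plus)
    also have "... <= ennreal (1 / b n) * ennreal (C1 / (n * b n)) + ennreal (b n) * ennreal (C1 / (n * b n ^ 3))"
     using Q_second_moment[OF bpos w[OF r] elim(2)] by (intro add_mono mult_left_mono) auto
    also have "... = ennreal (1 / b n * (C1 / (n * b n)) + b n * (C1 / (n * b n ^ 3)))"
     using bpos[of n] C1_nonneg by (simp add: ennreal_mult'[symmetric] ennreal_plus[symmetric] del: ennreal_plus)
    also have "1 / b n * (C1 / (n * b n)) + b n * (C1 / (n * b n ^ 3)) = 2 * C1 / (n * (b n)\<^sup>2)"
     using bpos[of n] elim by (simp add: power2_eq_square power3_eq_cube field_simps)
    finally show ?thesis .
   qed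
   have "(\<integral>\<^sup>+w. ennreal (S n w) \<partial>M) = (\<integral>\<^sup>+w. ennreal ((Q (b n) n w \<alpha>)\<^sup>2) + ennreal (\<integral>r. indicator {\<alpha>..\<beta>} r * g n w r \<partial>lborel) \<partial>M)"
    unfolding S_def using bpos[of n]
    by (intro nn_integral_cong ennreal_plus) (auto intro!: Bochner_Integration.integral_nonneg simp: g_def)
   also have "... = (\<integral>\<^sup>+w. ennreal ((Q (b n) n w \<alpha>)\<^sup>2) \<partial>M) + (\<integral>\<^sup>+w. ennreal (\<integral>r. indicator {\<alpha>..\<beta>} r * g n w r \<partial>lborel) \<partial>M)"
   proof (rule nn_integral_add)
    have "(%w. S n w - (Q (b n) n w \<alpha>)\<^sup>2) \<in> borel_measurable M" by measurable
    then show "(%w. ennreal (\<integral>r. indicator {\<alpha>..\<beta>} r * g n w r \<partial>lborel)) \<in> borel_measurable M"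
     by (simp add: S_def)
   qed measurable
   also have "... <= ennreal (C1 / (n * b n)) + ennreal (2 * C1 / (n * (b n)\<^sup>2) * (\<beta> - \<alpha>))"
   proof (rule add_mono)
    show "(\<integral>\<^sup>+w. ennreal ((Q (b n) n w \<alpha>)\<^sup>2) \<partial>M) <= ennreal (C1 / (n * b n))"
     using ab by (intro Q_second_moment(1) bpos w elim) auto
    show "(\<integral>\<^sup>+w. ennreal (\<integral>r. indicator {\<alpha>..\<beta>} r * g n w r \<partial>lborel) \<partial>M) <= ennreal (2 * C1 / (n * (b n)\<^sup>2) * (\<beta> - \<alpha>))"
     by (rule nn_integral_of_integral_le[OF gm]) (use gb ab C1_nonneg bpos[of n] in \<open>auto simp: g_def\<close>)
   qed
   also have "... = ennreal (C1 / (n * b n) + 2 * C1 / (n * (b n)\<^sup>2) * (\<beta> - \<alpha>))"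
    using C1_nonneg ab bpos[of n] by (intro ennreal_plus[symmetric]) auto
   also have "... <= ennreal (C1 * (1 + 2 * (\<beta> - \<alpha>)) * (1 / (n * (b n)\<^sup>2)))"
   proof (rule ennreal_leI)
    have "C1 / (n * b n) = C1 * b n / (n * (b n)\<^sup>2)" using bpos[of n] by (simp add: power2_eq_square)
    also have "... <= C1 * 1 / (n * (b n)\<^sup>2)" using C1_nonneg elim by (intro divide_right_mono mult_left_mono) auto
    moreover have "C1 * (1 + 2 * (\<beta> - \<alpha>)) * (1 / D) = C1 * 1 / D + 2 * C1 / D * (\<beta> - \<alpha>)" for D
     by (simp add: algebra_simps add_divide_distrib diff_divide_distrib)
    ultimately show "C1 / (n * b n) + 2 * C1 / (n * (b n)\<^sup>2) * (\<beta> - \<alpha>) <= C1 * (1 + 2 * (\<beta> - \<alpha>)) * (1 / (n * (b n)\<^sup>2))"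
     by simp
   qed
   finally show ?case .
  qed
  show "LARGE n. 0 < 1 / (real n * (b n)\<^sup>2)"
   using eventually_gt_at_top[of 0] by eventually_elim (use bpos in \<open>simp add: less_imp_neq[symmetric]\<close>)
 qed
 have "Op (%n w. sqrt (S n w)) (%n. sqrt (1 / (n * (b n)\<^sup>2)))"
  by (rule bdd_in_prob_sqrt[OF bd]) simp
 moreover have "sqrt (1 / (n * (b n)\<^sup>2)) = 1 / (b n * sqrt n)" for n
  using bpos[of n] by (simp add: real_sqrt_mult real_sqrt_divide mult.commute)
 ultimately have "Op (%n w. sqrt (S n w)) (%n. 1 / (b n * sqrt n))" by simp
 moreover have "\<bar>Q (b n) n w v\<bar> <= sqrt (S n w)" if "v \<in> {\<alpha>..\<beta>}" for n w v
 proof -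
  have "(Q (b n) n w v)\<^sup>2 <= S n w"
   unfolding S_def g_def by (rule sobolev_square_bound[OF Q_deriv[OF bpos] Q'_cont[OF bpos] that bpos])
  then have "sqrt ((Q (b n) n w v)\<^sup>2) <= sqrt (S n w)" by (rule real_sqrt_le_mono)
  then show ?thesis by simp
 qed
 ultimately show ?thesis by blast
qed

text \<open>Here the Sobolev parameter is \<open>c n\<close>, the order of the standard deviation of
  \<open>Q'\<close>; integration over the window contributes the factor
  \<open>\<rho> n\<close>.\<close>

lemma Q_increment:
 fixes b \<rho> :: "nat => real"
 assumes bpos: "\<And>n. 0 < b n" and \<rho>: "\<And>n. 0 < n ==> 0 < \<rho> n"
  and win: "LARGE n. x + \<rho> n + b n <= tau2"
 shows "\<exists>S. Op S (%n. \<rho> n / sqrt (n * b n ^ 3)) \<and>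
   (\<forall>n>0. \<forall>w v. \<bar>v - x\<bar> <= \<rho> n --> \<bar>Q (b n) n w v - Q (b n) n w x\<bar> <= S n w)"
proof -
 define c where "c n = 1 / sqrt (n * b n ^ 3)" for n
 have c: "0 < c n" if "0 < n" for n using that bpos[of n] by (simp add: c_def)
 define g where "g n w r = c n + (Q' (b n) n w r)\<^sup>2 / c n" for n w r
 define S where "S n w = (\<integral>r. indicator {x-\<rho> n..x+\<rho> n} r * g n w r \<partial>lborel)" for n w
 have [measurable]: "(%q. Q' (b n) n (fst q) (snd q)) \<in> borel_measurable (M \<Otimes>\<^sub>M borel)" for n
  using Q_measurable(2)[OF bpos] by (simp add: case_prod_beta')
 have [measurable]: "(%w. Q' (b n) n w v) \<in> borel_measurable M" for n v
  unfolding Q'_def by measurable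
 have gm: "(%(w, r). g n w r) \<in> borel_measurable (M \<Otimes>\<^sub>M borel)" for n
  unfolding g_def case_prod_beta' by measurable
 have Sm [measurable]: "S n \<in> borel_measurable M" for n
 proof -
  have "(%q. indicator {x-\<rho> n..x+\<rho> n} (snd q) * g n (fst q) (snd q)) \<in> borel_measurable (M \<Otimes>\<^sub>M lborel)"
   using gm[of n] by (simp add: case_prod_beta' cong: measurable_cong_sets)
  then show "S n \<in> borel_measurable M" unfolding S_def
   by (intro sigma_finite_measure.borel_measurable_lebesgue_integral sigma_finite_lborel) (simp add: case_prod_beta')
 qed
 have "Op S (%n. \<rho> n / sqrt (n * b n ^ 3))"
 proof (rule bdd_in_prob_Markov[OF Sm, where C = "2 * (1 + C1)"])
  show "LARGE n. (\<integral>\<^sup>+w. ennreal (S n w) \<partial>M) <= ennreal (2 * (1 + C1) * (\<rho> n / sqrt (n * b n ^ 3)))"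
   using win eventually_gt_at_top[of 0]
  proof eventually_elim
   case (elim n)
   note cn = c[OF elim(2)] and \<rho>n = \<rho>[OF elim(2)]
   have gb: "(\<integral>\<^sup>+w. ennreal (g n w r) \<partial>M) <= ennreal (c n * (1 + C1))" if r: "r \<in> {x-\<rho> n..x+\<rho> n}" for r
   proof -
    have w: "r + b n <= tau2" using r elim by auto
    have "(\<integral>\<^sup>+w. ennreal (g n w r) \<partial>M) = (\<integral>\<^sup>+w. ennreal (c n) + ennreal (1 / c n) * ennreal ((Q' (b n) n w r)\<^sup>2) \<partial>M)"
     unfolding g_def using cn
     by (intro nn_integral_cong) (simp add: ennreal_mult'[symmetric] ennreal_plus[symmetric] del: ennreal_plus)
    also have "... = ennreal (c n) + ennreal (1 / c n) * (\<integral>\<^sup>+w. ennreal ((Q' (b n) n w r)\<^sup>2) \<partial>M)"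
     by (subst nn_integral_add) (auto simp: nn_integral_cmult emeasure_space_1)
    also have "... <= ennreal (c n) + ennreal (1 / c n) * ennreal (C1 / (n * b n ^ 3))"
     using Q_second_moment(2)[OF bpos w elim(2)] by (intro add_mono mult_left_mono) auto
    also have "... = ennreal (c n + 1 / c n * (C1 / (n * b n ^ 3)))"
     using cn C1_nonneg bpos[of n] by (simp add: ennreal_mult'[symmetric] ennreal_plus[symmetric] del: ennreal_plus)
    also have "1 / c n * (C1 / (n * b n ^ 3)) = C1 * c n"
    proof -
     have "1 / (n * b n ^ 3) = c n * c n"
      using elim bpos[of n] by (simp add: c_def flip: real_sqrt_mult)
     then have "C1 / (n * b n ^ 3) = C1 * (c n * c n)" by (metis times_divide_eq_right mult.right_neutral)
     then show ?thesis using cn by simp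
    qed
    finally show ?thesis by (simp add: algebra_simps)
   qed
   have "(\<integral>\<^sup>+w. ennreal (S n w) \<partial>M) <= ennreal (c n * (1 + C1) * (x + \<rho> n - (x - \<rho> n)))"
    unfolding S_def
    by (rule nn_integral_of_integral_le[OF gm]) (use gb cn \<rho>n C1_nonneg in \<open>auto simp: g_def\<close>)
   also have "c n * (1 + C1) * (x + \<rho> n - (x - \<rho> n)) = 2 * (1 + C1) * (\<rho> n / sqrt (n * b n ^ 3))"
    by (simp add: c_def)
   finally show ?case .
  qed
  show "LARGE n. 0 < \<rho> n / sqrt (n * b n ^ 3)"
   using eventually_gt_at_top[of 0] by eventually_elim (use bpos \<rho> in simp)
 qed
 moreover have "\<bar>Q (b n) n w v - Q (b n) n w x\<bar> <= S n w" if "0 < n" "\<bar>v - x\<bar> <= \<rho> n" for n w v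
  unfolding S_def g_def by (rule sobolev_increment_bound[OF Q_deriv[OF bpos] Q'_cont[OF bpos] that(2) c[OF that(1)]])
 ultimately show ?thesis by blast
qed

section \<open>Replacing the empirical risk by its mean\<close>

abbreviation resid :: "real => nat => 'w => real ^ 'p => real => real" where
 "resid h n w \<beta> v \<equiv> smoothed' h n (ys w) \<beta> v - emp n (psi h v) (ys w)"

definition Ev :: "nat => real => real => 'w => real" where
 "Ev n a c w = emp n (%y. event y * indicator {a..c} (fst y)) (ys w)"

definition Fl :: "nat => real => real => 'w => real" where
 "Fl n a c w = (\<Sum>j<n. event (Y j w) * (indicator {a..c} (T j w) * \<bar>risk n beta0 (T j w) (ys w) / n - phi (T j w)\<bar>)) / n"

definition En :: "nat => 'w => real" where "En n w = emp n (%y. env (cov y)) (ys w)"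

lemma Ev_nonneg: "0 <= Ev n a c w" and Fl_nonneg: "0 <= Fl n a c w" and En_nonneg: "0 <= En n w"
 by (auto simp: Ev_def Fl_def En_def emp_def event_nonneg env_nonneg intro!: divide_nonneg_nonneg sum_nonneg)

lemma Ev_le_1: "Ev n a c w <= 1"
proof (cases "n = 0")
 case False
 have "(\<Sum>i<n. event (Y i w) * indicator {a..c} (T i w)) <= (\<Sum>i<n. 1)"
  by (intro sum_mono) (auto simp: event_le_1 indicator_def)
 then show ?thesis using False by (simp add: Ev_def emp_def)
qed (simp add: Ev_def emp_def)

text \<open>The thresholds leave \<open>\<kappa> / 2\<close> for the empirical risk at the estimated
  parameter: \<open>3 / 4 * \<kappa>\<close> at \<open>beta0\<close>, minus
  \<open>\<kappa> / 4\<close> for the change of parameter. Monotonicity in time lets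
  \<open>tau2\<close> serve for all earlier times. The last clause records what holds almost
  surely.\<close>

definition regular :: "real ^ 'p => nat => 'w => bool" where
 "regular \<beta> n w \<longleftrightarrow> 3 / 4 * \<kappa> <= risk n beta0 tau2 (ys w) / n \<and> norm (\<beta> - beta0) <= eps / 2 \<and>
  norm (\<beta> - beta0) * (2 / eps) * En n w <= \<kappa> / 4 \<and>
  (\<forall>i. fst (snd (Y i w)) = event (Y i w) \<and> 0 < T i w)"

lemma En_bdd: "Op En (%n. 1)"
proof -
 have "wpo (%n w. \<bar>En n w - Env\<bar> <= 1)"
  unfolding En_def Env_def by (rule emp_LLN[OF _ env_sq_integrable]) auto
 then have 1: "wpo (%n w. En n w <= Env + 1)" by (rule wpo_mono) linarith
 have "Op (%n w. Env + 1) (%n. Env + 1)"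
  using Env_nonneg by (intro bdd_in_prob_const) simp
 then have "Op (%n w. Env + 1) (%n. 1)"
  by (rule bdd_in_prob_rate[where C = "Env + 1"]) (use Env_nonneg in auto)
 then show ?thesis using 1 by (rule bdd_in_prob_mono)
qed

lemma regular_wpo:
 assumes r: "Op (%n w. norm (betahat n w - beta0)) (%n. 1 / sqrt n)"
 shows "wpo (%n w. regular (betahat n w) n w)"
proof -
 have small: "LARGE n. K * (1 / sqrt (real n)) <= c" if "0 < c" for K c :: real
 proof -
  have "(%n. K * (1 / sqrt (real n))) \<longlonglongrightarrow> 0" by real_asymp
  from order_tendstoD(2)[OF this that] show ?thesis by eventually_elim simp
 qed
 have e1: "wpo (%n w. \<bar>emp n (rf tau2) (ys w) - \<kappa>\<bar> <= \<kappa> / 4)"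
  unfolding \<kappa>_def phi_eq by (rule emp_LLN[OF _ rf_sq(1)]) (use \<kappa>_pos in \<open>auto simp: \<kappa>_def phi_eq\<close>)
 have e2: "wpo (%n w. norm (betahat n w - beta0) <= eps / 2)"
  by (rule wpo_of_bdd_in_prob[OF r small]) (use eps_pos in simp)
 have "Op (%n w. norm (betahat n w - beta0) * En n w) (%n. 1 / sqrt n * 1)"
  by (rule bdd_in_prob_mult[OF r En_bdd]) (auto simp: En_nonneg)
 then have "Op (%n w. (2 / eps) * (norm (betahat n w - beta0) * En n w)) (%n. 1 / sqrt n)"
  using eps_pos by (intro bdd_in_prob_cmult) auto
 then have e3: "wpo (%n w. (2 / eps) * (norm (betahat n w - beta0) * En n w) <= \<kappa> / 4)"
  by (rule wpo_of_bdd_in_prob[OF _ small]) (use \<kappa>_pos in simp)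
 have "AE w in M. \<forall>i. fst (snd (Y i w)) = event (Y i w) \<and> 0 < T i w"
 proof (intro AE_all_countable[THEN iffD2] allI)
  fix i
  have "AE y in P. fst (snd y) = event y \<and> 0 < fst y"
   using obs.Delta_AE obs.T_AE by eventually_elim (auto simp: event_def case_prod_beta')
  then show "AE w in M. fst (snd (Y i w)) = event (Y i w) \<and> 0 < T i w"
   by (subst AE_Y[of "%y. fst (snd y) = event y \<and> 0 < fst y"]) auto
 qed
 then have e4: "wpo (%n w. \<forall>i. fst (snd (Y i w)) = event (Y i w) \<and> 0 < T i w)"
  by (rule wpo_AE)
 show ?thesis
 proof (rule wpo_mono[OF wpo_conj[OF e1 wpo_conj[OF e2 wpo_conj[OF e3 e4]]]], elim conjE)
  fix n w assume a: "\<bar>emp n (rf tau2) (ys w) - \<kappa>\<bar> <= \<kappa> / 4" "norm (betahat n w - beta0) <= eps / 2"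
   "(2 / eps) * (norm (betahat n w - beta0) * En n w) <= \<kappa> / 4" "\<forall>i. fst (snd (Y i w)) = event (Y i w) \<and> 0 < T i w"
  have "3 / 4 * \<kappa> <= emp n (rf tau2) (ys w)" using a(1) by linarith
  moreover have "norm (betahat n w - beta0) * (2 / eps) * En n w <= \<kappa> / 4" using a(3) by (simp only: mult_ac)
  ultimately show "regular (betahat n w) n w"
   using a(2,4) unfolding regular_def risk_emp by blast
 qed
qed

text \<open>The spare factor of the envelope is split into two halves: one absorbs
  \<open>norm z\<close>, the other the exponential of the change in the exponent, which is at most
  \<open>eps / 2 * norm z\<close>.\<close>

lemma risk_diff:
 assumes "norm (\<beta> - beta0) <= eps / 2"
 shows "\<bar>risk n \<beta> s y / n - risk n beta0 s y / n\<bar> <= norm (\<beta> - beta0) * (2 / eps) * emp n (%y. env (cov y)) y"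
proof -
 let ?r = "norm (\<beta> - beta0)"
 have term_le: "\<bar>of_bool (s <= t) * exp (\<beta> \<bullet> z) - of_bool (s <= t) * exp (beta0 \<bullet> z)\<bar> <= ?r * (2 / eps) * env z" for t :: real and z
 proof -
  define u where "u = (\<beta> - beta0) \<bullet> z"
  have u1: "\<bar>u\<bar> <= ?r * norm z" unfolding u_def by (rule Cauchy_Schwarz_ineq2)
  also have "... <= eps / 2 * norm z" using assms by (rule mult_right_mono) simp
  finally have u2: "\<bar>u\<bar> <= eps / 2 * norm z" .
  have nz: "norm z <= (2 / eps) * exp (eps / 2 * norm z)"
  proof -
   have "eps / 2 * norm z <= exp (eps / 2 * norm z)" using exp_ge_add_one_self[of "eps / 2 * norm z"] by linarith
   then show ?thesis using eps_pos by (simp add: field_simps)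
  qed
  have "exp (\<beta> \<bullet> z) - exp (beta0 \<bullet> z) = exp (beta0 \<bullet> z) * (exp u - 1)"
   by (simp add: u_def inner_diff_left right_diff_distrib flip: exp_add)
  then have "\<bar>of_bool (s <= t) * exp (\<beta> \<bullet> z) - of_bool (s <= t) * exp (beta0 \<bullet> z)\<bar> <= exp (beta0 \<bullet> z) * \<bar>exp u - 1\<bar>"
   by (auto simp: abs_mult)
  also have "... <= exp (beta0 \<bullet> z) * (\<bar>u\<bar> * exp \<bar>u\<bar>)" by (intro mult_left_mono exp_minus_one_bound) simp
  also have "... <= exp (beta0 \<bullet> z) * (?r * norm z * exp (eps / 2 * norm z))"
   using u1 u2 by (intro mult_left_mono mult_mono) auto
  also have "... <= exp (beta0 \<bullet> z) * (?r * ((2 / eps) * exp (eps / 2 * norm z)) * exp (eps / 2 * norm z))"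
   using nz by (intro mult_left_mono mult_right_mono) auto
  also have "... = ?r * (2 / eps) * (exp (beta0 \<bullet> z) * (exp (eps / 2 * norm z) * exp (eps / 2 * norm z)))"
   by (simp add: mult_ac)
  also have "exp (beta0 \<bullet> z) * (exp (eps / 2 * norm z) * exp (eps / 2 * norm z)) = env z"
   by (simp add: env_def flip: exp_add)
  finally show ?thesis .
 qed
 have "\<bar>risk n \<beta> s y - risk n beta0 s y\<bar> <= (\<Sum>j<n. ?r * (2 / eps) * env (cov (y j)))"
  unfolding risk_def sum_subtractf[symmetric]
  by (rule order_trans[OF sum_abs]) (intro sum_mono term_le)
 also have "... = ?r * (2 / eps) * (\<Sum>j<n. env (cov (y j)))" by (rule sum_distrib_left[symmetric])
 finally have "\<bar>risk n \<beta> s y - risk n beta0 s y\<bar> / n <= ?r * (2 / eps) * (\<Sum>j<n. env (cov (y j))) / n"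
  by (rule divide_right_mono) simp
 then show ?thesis by (simp add: emp_def flip: diff_divide_distrib)
qed

lemma regular_inverse:
 assumes reg: "regular \<beta> n w" and s: "s <= tau2"
 shows "\<kappa> / 2 <= risk n \<beta> s (ys w) / n"
  and "\<bar>1 / (risk n \<beta> s (ys w) / n) - 1 / phi s\<bar> \<le>
   2 / \<kappa>\<^sup>2 * (norm (\<beta> - beta0) * (2 / eps) * En n w + \<bar>risk n beta0 s (ys w) / n - phi s\<bar>)"
proof -
 define a0 where "a0 = risk n beta0 s (ys w) / n"
 define a where "a = risk n \<beta> s (ys w) / n"
 define d where "d = norm (\<beta> - beta0) * (2 / eps) * En n w"
 have d: "\<bar>a - a0\<bar> <= d" unfolding a_def a0_def d_def En_def using reg by (intro risk_diff) (simp add: regular_def)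
 have "3 / 4 * \<kappa> <= risk n beta0 tau2 (ys w) / n" using reg by (simp add: regular_def)
 also have "... <= a0" unfolding a0_def using s by (intro divide_right_mono risk_antimono) auto
 finally have "3 / 4 * \<kappa> <= a0" .
 moreover have "d <= \<kappa> / 4" using reg by (simp add: regular_def d_def)
 ultimately have a: "\<kappa> / 2 <= a" using d by linarith
 then show "\<kappa> / 2 <= risk n \<beta> s (ys w) / n" by (simp add: a_def)
 have p: "\<kappa> <= phi s" by (rule \<kappa>_le[OF s])
 have pos: "0 < a" "0 < phi s" using a p \<kappa>_pos by linarith+
 have "1 / a - 1 / phi s = (phi s - a) / (a * phi s)" using pos by (simp add: field_simps)
 then have "\<bar>1 / a - 1 / phi s\<bar> = \<bar>phi s - a\<bar> / (a * phi s)" using pos by (simp add: abs_mult)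
 also have "... <= (d + \<bar>a0 - phi s\<bar>) / (\<kappa> / 2 * \<kappa>)"
 proof (rule frac_le)
  show "\<bar>phi s - a\<bar> <= d + \<bar>a0 - phi s\<bar>" using d by linarith
  show "\<kappa> / 2 * \<kappa> <= a * phi s" using a p \<kappa>_pos by (intro mult_mono) auto
 qed (use \<kappa>_pos d in auto)
 also have "... = 2 / \<kappa>\<^sup>2 * (d + \<bar>a0 - phi s\<bar>)" by (simp add: power2_eq_square)
 finally show "\<bar>1 / (risk n \<beta> s (ys w) / n) - 1 / phi s\<bar> \<le>
   2 / \<kappa>\<^sup>2 * (norm (\<beta> - beta0) * (2 / eps) * En n w + \<bar>risk n beta0 s (ys w) / n - phi s\<bar>)"
  by (simp add: a_def a0_def d_def)
qed

text \<open>Only events inside the kernel window contribute, so both errors are confined to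
  \<open>{a..c}\<close>: the first stems from estimating \<open>beta0\<close>, the second from the
  randomness of the risk at \<open>beta0\<close>.\<close>

lemma smoothed'_remainder:
 assumes reg: "regular \<beta> n w" and b: "0 < b" and sub: "a <= v - b" "v + b <= c" "c <= tau2"
 shows "\<bar>smoothed' b n (ys w) \<beta> v - emp n (psi b v) (ys w)\<bar> \<le>
  kB / b * (2 / \<kappa>\<^sup>2) * (norm (\<beta> - beta0) * (2 / eps) * En n w * Ev n a c w + Fl n a c w)"
proof -
 define d where "d = norm (\<beta> - beta0) * (2 / eps) * En n w"
 have d0: "0 <= d" using eps_pos by (simp add: d_def En_nonneg)
 define I where "I i = event (Y i w) * indicator {a..c} (T i w)" for i
 define A where "A i = \<bar>risk n beta0 (T i w) (ys w) / n - phi (T i w)\<bar>" for i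
 have t: "\<bar>fst (snd (Y i w)) / (risk n \<beta> (T i w) (ys w) / n) * (k ((v - T i w) / b) / b) - psi b v (Y i w)\<bar>
   <= kB / b * (2 / \<kappa>\<^sup>2) * (d * I i + I i * A i)" for i
 proof (cases "T i w \<in> {v-b..v+b}")
  case False
  then have "k ((v - T i w) / b) = 0" using b by (intro k_supp) (auto simp: field_simps)
  then show ?thesis
   using kB_nonneg b d0 \<kappa>_pos by (auto simp: psi_def I_def A_def event_nonneg intro!: mult_nonneg_nonneg add_nonneg_nonneg)
 next
  case True
  then have T: "T i w <= tau2" "T i w \<in> {a..c}" using sub by auto
  have eq: "fst (snd (Y i w)) / (risk n \<beta> (T i w) (ys w) / n) * (k ((v - T i w) / b) / b) - psi b v (Y i w) =
   event (Y i w) * (k ((v - T i w) / b) / b) * (1 / (risk n \<beta> (T i w) (ys w) / n) - 1 / phi (T i w))"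
  proof -
   have e: "fst (snd (Y i w)) = event (Y i w)" using reg by (simp add: regular_def)
   have g: "e / r * x - e * (x / p) = e * x * (1 / r - 1 / p)" for e r x p :: real
    by (simp add: divide_inverse algebra_simps)
   show ?thesis unfolding e psi_def by (subst g[symmetric]) (simp add: mult_ac)
  qed
  have "\<bar>event (Y i w) * (k ((v - T i w) / b) / b) * (1 / (risk n \<beta> (T i w) (ys w) / n) - 1 / phi (T i w))\<bar> =
   event (Y i w) * (\<bar>k ((v - T i w) / b)\<bar> / b) * \<bar>1 / (risk n \<beta> (T i w) (ys w) / n) - 1 / phi (T i w)\<bar>"
   using b by (simp only: abs_mult abs_divide abs_of_nonneg[OF event_nonneg] abs_of_pos[OF b])
  also have "... <= event (Y i w) * (kB / b) * (2 / \<kappa>\<^sup>2 * (d + A i))"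
   unfolding d_def A_def using b kB_nonneg
   by (intro mult_mono mult_left_mono divide_right_mono k_bound regular_inverse(2)[OF reg T(1)])
     (simp_all add: event_nonneg)
  also have "... = kB / b * (2 / \<kappa>\<^sup>2) * (d * I i + I i * A i)"
  proof -
   have I: "I i = event (Y i w)" using T by (simp add: I_def)
   have g: "e * q * (p * (d + A)) = q * p * (d * e + e * A)" for e q p d A :: real by (simp add: algebra_simps)
   show ?thesis unfolding I by (rule g)
  qed
  finally show ?thesis unfolding eq .
 qed
 have eq: "smoothed' b n (ys w) \<beta> v - emp n (psi b v) (ys w) =
  (\<Sum>i<n. fst (snd (Y i w)) / (risk n \<beta> (T i w) (ys w) / n) * (k ((v - T i w) / b) / b) - psi b v (Y i w)) / n"
  by (simp add: smoothed'_def emp_def sum_subtractf diff_divide_distrib)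
 have "\<bar>smoothed' b n (ys w) \<beta> v - emp n (psi b v) (ys w)\<bar> <= (\<Sum>i<n. kB / b * (2 / \<kappa>\<^sup>2) * (d * I i + I i * A i)) / n"
  unfolding eq abs_divide abs_of_nat using t
  by (intro divide_right_mono order_trans[OF sum_abs] sum_mono) auto
 also have "... = kB / b * (2 / \<kappa>\<^sup>2) * (d * ((\<Sum>i<n. I i) / n) + (\<Sum>i<n. I i * A i) / n)"
 proof -
  have g: "q * (d * X + Y) / N = q * (d * (X / N) + Y / N)" for q X Y N :: real
   by (simp add: distrib_left add_divide_distrib)
  show ?thesis unfolding sum_distrib_left[symmetric] sum.distrib by (rule g)
 qed
 also have "(\<Sum>i<n. I i) / n = Ev n a c w" by (simp add: Ev_def emp_def I_def)
 also have "(\<Sum>i<n. I i * A i) / n = Fl n a c w" by (simp add: Fl_def I_def A_def mult.assoc)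
 finally show ?thesis by (simp add: d_def)
qed

text \<open>\<open>K\<close> vanishes below -1, so only events up to \<open>v + b\<close> enter,
  each with bounded weight. The window may reach below 0, which is why this bound serves near the
  origin.\<close>

lemma smoothed_bound:
 assumes reg: "regular \<beta> n w" and b: "0 < b" and c: "v + b <= c" "c <= tau2"
 shows "\<bar>smoothed b n (ys w) \<beta> v\<bar> <= 4 * kB / \<kappa> * Ev n 0 c w"
proof -
 have t: "\<bar>fst (snd (Y i w)) / (risk n \<beta> (T i w) (ys w) / n) * K ((v - T i w) / b)\<bar> <= 4 * kB / \<kappa> * (event (Y i w) * indicator {0..c} (T i w))" for i
 proof (cases "T i w <= v + b")
  case False
  then have "(v - T i w) / b < -1" using b by (simp add: field_simps)
  then show ?thesis using K_zero kB_nonneg \<kappa>_pos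
   by (simp del: times_divide_eq_left add: mult_nonneg_nonneg divide_nonneg_pos event_nonneg)
 next
  case True
  then have T: "T i w <= tau2" "T i w \<in> {0..c}" using c reg by (auto simp: regular_def less_imp_le)
  have r: "\<kappa> / 2 <= risk n \<beta> (T i w) (ys w) / n" by (rule regular_inverse(1)[OF reg T(1)])
  have rp: "0 < risk n \<beta> (T i w) (ys w) / n" using r \<kappa>_pos by linarith
  have "\<bar>fst (snd (Y i w)) / (risk n \<beta> (T i w) (ys w) / n) * K ((v - T i w) / b)\<bar> =
   event (Y i w) / (risk n \<beta> (T i w) (ys w) / n) * \<bar>K ((v - T i w) / b)\<bar>"
   using reg by (simp only: regular_def abs_mult abs_divide[of "event (Y i w)"] abs_of_nonneg[OF event_nonneg] abs_of_pos[OF rp])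
  also have "... <= event (Y i w) / (\<kappa> / 2) * (2 * kB)"
   using r \<kappa>_pos rp by (intro mult_mono divide_left_mono mult_pos_pos K_bound) (simp_all add: event_nonneg)
  also have "... = 4 * kB / \<kappa> * (event (Y i w) * indicator {0..c} (T i w))" using T by (simp add: mult_ac)
  finally show ?thesis .
 qed
 have "\<bar>smoothed b n (ys w) \<beta> v\<bar> <= (\<Sum>i<n. 4 * kB / \<kappa> * (event (Y i w) * indicator {0..c} (T i w))) / n"
  unfolding smoothed_def abs_divide abs_of_nat
  by (intro divide_right_mono order_trans[OF sum_abs] sum_mono t) simp
 also have "... = 4 * kB / \<kappa> * Ev n 0 c w"
  by (simp only: Ev_def emp_def sum_distrib_left[symmetric] times_divide_eq_right)
 finally show ?thesis .
qed

lemma Ev_measurable [measurable]: "Ev n a c \<in> borel_measurable M"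
 unfolding Ev_def by measurable

lemma Fl_measurable [measurable]: "Fl n a c \<in> borel_measurable M"
 unfolding Fl_def by measurable

lemma Fl_bdd:
 fixes a c :: "nat => real"
 assumes ac: "\<And>n. a n < c n"
 shows "Op (%n w. Fl n (a n) (c n) w) (%n. (c n - a n) / sqrt n)"
proof -
 obtain C where C: "0 <= C" "\<And>n a b. 0 < n ==> a <= b ==>
  (\<integral>\<^sup>+w. ennreal (\<Sum>j<n. event (Y j w) * (indicator {a..b} (T j w) * \<bar>risk n beta0 (T j w) (ys w) / n - phi (T j w)\<bar>)) \<partial>M)
   <= ennreal (C * sqrt n * (b - a))" by (rule exE[OF risk_fluctuation]) blast
 show ?thesis
 proof (rule bdd_in_prob_Markov[where C = C])
  show "LARGE n. (\<integral>\<^sup>+w. ennreal (Fl n (a n) (c n) w) \<partial>M) <= ennreal (C * ((c n - a n) / sqrt n))"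
   using eventually_gt_at_top[of 0]
  proof eventually_elim
   case (elim n)
   define S where "S w = (\<Sum>j<n. event (Y j w) * (indicator {a n..c n} (T j w) * \<bar>risk n beta0 (T j w) (ys w) / n - phi (T j w)\<bar>))" for w
   have [measurable]: "S \<in> borel_measurable M" unfolding S_def by measurable
   have "(\<integral>\<^sup>+w. ennreal (Fl n (a n) (c n) w) \<partial>M) = (\<integral>\<^sup>+w. ennreal (1 / n) * ennreal (S w) \<partial>M)"
    by (intro nn_integral_cong) (simp add: Fl_def S_def ennreal_mult'[symmetric])
   also have "... = ennreal (1 / n) * (\<integral>\<^sup>+w. ennreal (S w) \<partial>M)" by (rule nn_integral_cmult) measurable
   also have "... <= ennreal (1 / n) * ennreal (C * sqrt n * (c n - a n))"
    unfolding S_def using C(2)[OF elim less_imp_le[OF ac]] by (intro mult_left_mono) auto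
   also have "... = ennreal (1 / n * (C * sqrt n * (c n - a n)))" by (rule ennreal_mult'[symmetric]) simp
   also have "1 / n * (C * sqrt n * (c n - a n)) = C * ((c n - a n) / sqrt n)"
   proof -
    have g: "1 / (s * s) * (C * s * d) = C * (d / s)" if "0 < s" for s d :: real
     using that by simp
    have "real n = sqrt n * sqrt n" by simp
    then show ?thesis using g[of "sqrt n" "c n - a n"] elim by simp
   qed
   finally show ?case .
  qed
  show "LARGE n. 0 < (c n - a n) / sqrt n"
   using eventually_gt_at_top[of 0] by eventually_elim (use ac in simp)
 qed measurable
qed

lemma Ev_bdd:
 fixes a c :: "nat => real"
 assumes ac: "\<And>n. a n < c n"
 shows "Op (%n w. Ev n (a n) (c n) w) (%n. c n - a n)"
proof (rule bdd_in_prob_Markov[where C = "lamB * Env"])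
 show "LARGE n. (\<integral>\<^sup>+w. ennreal (Ev n (a n) (c n) w) \<partial>M) <= ennreal (lamB * Env * (c n - a n))"
  using eventually_gt_at_top[of 0]
 proof eventually_elim
  case (elim n)
  define \<phi> where "\<phi> y = event y * indicator {a n..c n} (fst y)" for y :: "'p obs"
  have [measurable]: "\<phi> \<in> borel_measurable borel" unfolding \<phi>_def by measurable
  have \<phi>0: "0 <= \<phi> y" for y by (simp add: \<phi>_def event_nonneg)
  have int: "integrable P \<phi>" unfolding \<phi>_def by (rule integral_event(1)[of _ 1]) auto
  then have int': "integrable M (%w. \<phi> (Y i w))" for i using integrable_Y[of \<phi> i] by simp
  have "(\<integral>w. Ev n (a n) (c n) w \<partial>M) = (\<Sum>i<n. \<integral>w. \<phi> (Y i w) \<partial>M) / n"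
   unfolding Ev_def emp_def \<phi>_def[symmetric] using int' by simp
  also have "... = (\<integral>y. \<phi> y \<partial>P)" using elim by (simp add: integral_Y[of \<phi>])
  also have "... <= lamB * Env * (c n - a n)"
   unfolding \<phi>_def by (rule event_mass[OF less_imp_le[OF ac]])
  finally have le: "(\<integral>w. Ev n (a n) (c n) w \<partial>M) <= lamB * Env * (c n - a n)" .
  have "integrable M (%w. Ev n (a n) (c n) w)"
   unfolding Ev_def emp_def \<phi>_def[symmetric] using int' by auto
  then show ?case using le by (subst nn_integral_eq_integral) (auto simp: Ev_nonneg ennreal_leI)
 qed
qed (use ac in auto)

text \<open>The proportion of events is merely bounded by 1, so the kernel factor 1/b remains; the
  rate obtained is that of \<open>Q_sup\<close>.\<close>

lemma R_sup:
 fixes b :: "nat => real"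
 assumes r: "Op (%n w. norm (betahat n w - beta0)) (%n. 1 / sqrt n)"
  and bpos: "\<And>n. 0 < b n" and b0: "b \<longlonglongrightarrow> 0" and ab: "0 < \<alpha>" "\<beta> < tau2"
 shows "\<exists>S. Op S (%n. 1 / (b n * sqrt n)) \<and>
  wpo (%n w. \<forall>v\<in>{\<alpha>..\<beta>}. \<bar>resid (b n) n w (betahat n w) v\<bar> <= S n w)"
proof -
 define c where "c = kB * (2 / \<kappa>\<^sup>2)"
 have c0: "0 <= c" using kB_nonneg by (simp add: c_def)
 define S where "S n w = 1 / b n * (c * ((2 / eps) * (norm (betahat n w - beta0) * En n w) + Fl n 0 tau2 w))" for n w
 have 1: "Op (%n w. norm (betahat n w - beta0) * En n w) (%n. 1 / sqrt n * 1)"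
  by (rule bdd_in_prob_mult[OF r En_bdd]) (auto simp: En_nonneg)
 have "Op (%n w. Fl n 0 tau2 w) (%n. (tau2 - 0) / sqrt n)"
  by (rule Fl_bdd) (rule tau2(1))
 then have 2: "Op (%n w. Fl n 0 tau2 w) (%n. 1 / sqrt n)"
  by (rule bdd_in_prob_rate[where C = tau2]) (use tau2 in auto)
 have "Op (%n w. c * ((2 / eps) * (norm (betahat n w - beta0) * En n w) + Fl n 0 tau2 w)) (%n. 1 / sqrt n)"
  using 1 2 eps_pos c0 by (intro bdd_in_prob_cmult bdd_in_prob_add) auto
 then have "Op S (%n. 1 / b n * (1 / sqrt n))"
  unfolding S_def using bpos c0 eps_pos
  by (intro bdd_in_prob_mult bdd_in_prob_const)
    (auto intro!: mult_nonneg_nonneg add_nonneg_nonneg simp: less_imp_le En_nonneg Fl_nonneg)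
 then have "Op S (%n. 1 / (b n * sqrt n))" by simp
 moreover have "LARGE n. b n < min \<alpha> (tau2 - \<beta>)"
  using order_tendstoD(2)[OF b0, of "min \<alpha> (tau2 - \<beta>)"] ab by simp
 then have "LARGE n. \<forall>w\<in>space M. regular (betahat n w) n w -->
  (\<forall>v\<in>{\<alpha>..\<beta>}. \<bar>resid (b n) n w (betahat n w) v\<bar> <= S n w)"
 proof eventually_elim
  case (elim n)
  show ?case
  proof (intro ballI impI)
   fix w v assume reg: "regular (betahat n w) n w" and v: "v \<in> {\<alpha>..\<beta>}"
   let ?d = "norm (betahat n w - beta0) * (2 / eps) * En n w"
   have "\<bar>resid (b n) n w (betahat n w) v\<bar> \<le>
    kB / b n * (2 / \<kappa>\<^sup>2) * (?d * Ev n 0 tau2 w + Fl n 0 tau2 w)"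
    by (rule smoothed'_remainder[OF reg bpos]) (use v elim in auto)
   also have "... <= kB / b n * (2 / \<kappa>\<^sup>2) * (?d * 1 + Fl n 0 tau2 w)"
    using kB_nonneg bpos[of n] eps_pos
    by (intro mult_left_mono add_mono Ev_le_1) (auto simp: En_nonneg less_imp_le)
   also have "... = S n w" by (simp add: S_def c_def mult_ac)
   finally show "\<bar>resid (b n) n w (betahat n w) v\<bar> <= S n w" .
  qed
 qed
 from wpo_eventually_mp[OF regular_wpo[OF r] this]
 have "wpo (%n w. \<forall>v\<in>{\<alpha>..\<beta>}. \<bar>resid (b n) n w (betahat n w) v\<bar> <= S n w)" .
 ultimately show ?thesis by blast
qed

text \<open>Kernels centred within \<open>b n\<close> of \<open>x\<close> live on a window of length
  \<open>4 * b n\<close>. The proportion of events and the fluctuation over it gain a factor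
  \<open>b n\<close>, which cancels 1/b and leaves an error below the pointwise rate.\<close>

lemma R_local:
 fixes b :: "nat => real"
 assumes r: "Op (%n w. norm (betahat n w - beta0)) (%n. 1 / sqrt n)"
  and bpos: "\<And>n. 0 < b n" and b0: "b \<longlonglongrightarrow> 0" and x: "x < tau2"
 shows "\<exists>S. Op S (%n. 1 / sqrt n) \<and>
  wpo (%n w. \<forall>v. \<bar>v - x\<bar> <= b n --> \<bar>resid (b n) n w (betahat n w) v\<bar> <= S n w)"
proof -
 define c where "c = kB * (2 / \<kappa>\<^sup>2)"
 have c0: "0 <= c" using kB_nonneg by (simp add: c_def)
 define E where "E n w = Ev n (x - 2 * b n) (x + 2 * b n) w" for n w
 define F where "F n w = Fl n (x - 2 * b n) (x + 2 * b n) w" for n w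
 define S where "S n w = 1 / b n * (c * ((2 / eps) * (norm (betahat n w - beta0) * En n w * E n w) + F n w))" for n w
 have lt: "x - 2 * b n < x + 2 * b n" for n using bpos[of n] by linarith
 have 1: "Op (%n w. norm (betahat n w - beta0) * En n w) (%n. 1 / sqrt n * 1)"
  by (rule bdd_in_prob_mult[OF r En_bdd]) (auto simp: En_nonneg)
 have "Op F (%n. (x + 2 * b n - (x - 2 * b n)) / sqrt n)"
  unfolding F_def by (rule Fl_bdd[OF lt])
 then have 2: "Op F (%n. b n / sqrt n)"
  by (rule bdd_in_prob_rate[where C = 4]) (use bpos in \<open>auto simp: less_imp_le\<close>)
 have "Op E (%n. (x + 2 * b n - (x - 2 * b n)))"
  unfolding E_def by (rule Ev_bdd[OF lt])
 then have 3: "Op E b"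
  by (rule bdd_in_prob_rate[where C = 4]) (use bpos in \<open>auto simp: less_imp_le\<close>)
 have 4: "Op (%n w. norm (betahat n w - beta0) * En n w * E n w) (%n. 1 / sqrt n * 1 * b n)"
  by (rule bdd_in_prob_mult[OF 1 3]) (auto simp: En_nonneg E_def Ev_nonneg)
 have "Op (%n w. c * ((2 / eps) * (norm (betahat n w - beta0) * En n w * E n w) + F n w)) (%n. b n / sqrt n)"
  using 4 2 eps_pos c0 by (intro bdd_in_prob_cmult bdd_in_prob_add) auto
 then have "Op S (%n. 1 / b n * (b n / sqrt n))"
  unfolding S_def using bpos c0 eps_pos
  by (intro bdd_in_prob_mult bdd_in_prob_const)
    (auto intro!: mult_nonneg_nonneg add_nonneg_nonneg simp: less_imp_le En_nonneg E_def F_def Ev_nonneg Fl_nonneg)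
 moreover have "(%n. 1 / b n * (b n / sqrt (real n))) = (%n. 1 / sqrt (real n))"
  using bpos[THEN less_imp_neq] by (auto simp: fun_eq_iff)
 ultimately have Sb: "Op S (%n. 1 / sqrt n)" by (simp only:)
 have "LARGE n. b n < (tau2 - x) / 2"
  using order_tendstoD(2)[OF b0, of "(tau2 - x) / 2"] x by simp
 then have "LARGE n. \<forall>w\<in>space M. regular (betahat n w) n w -->
  (\<forall>v. \<bar>v - x\<bar> <= b n --> \<bar>resid (b n) n w (betahat n w) v\<bar> <= S n w)"
 proof eventually_elim
  case (elim n)
  show ?case
  proof (intro ballI allI impI)
   fix w v assume reg: "regular (betahat n w) n w" and v: "\<bar>v - x\<bar> <= b n"
   have "\<bar>resid (b n) n w (betahat n w) v\<bar> \<le>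
    kB / b n * (2 / \<kappa>\<^sup>2) * (norm (betahat n w - beta0) * (2 / eps) * En n w * E n w + F n w)"
    unfolding E_def F_def by (rule smoothed'_remainder[OF reg bpos]) (use v elim in \<open>auto simp: field_simps\<close>)
   also have "... = S n w" by (simp add: S_def c_def mult_ac)
   finally show "\<bar>resid (b n) n w (betahat n w) v\<bar> <= S n w" .
  qed
 qed
 from wpo_eventually_mp[OF regular_wpo[OF r] this] Sb show ?thesis by blast
qed

text \<open>Near 0 the kernel loses mass below the origin and the derivative need not be close to
  \<open>lam0\<close>. What remains is that few events occur in \<open>{0..2 * l}\<close>, by the
  law of large numbers, so the smoothed estimator itself is small in proportion to
  \<open>l\<close>.\<close>

lemma smoothed_small_near_0:
 fixes b :: "nat => real"
 assumes r: "Op (%n w. norm (betahat n w - beta0)) (%n. 1 / sqrt n)"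
  and bpos: "\<And>n. 0 < b n" and b0: "b \<longlonglongrightarrow> 0" and l: "0 < l" "2 * l <= tau2"
 shows "wpo (%n w. \<forall>v\<in>{0..l}. \<bar>smoothed (b n) n (ys w) (betahat n w) v\<bar> <= 4 * kB / \<kappa> * (2 * lamB * Env + 1) * l)"
proof -
 have LLN: "wpo (%n w. \<bar>Ev n 0 (2 * l) w - (\<integral>y. event y * indicator {0..2 * l} (fst y) \<partial>P)\<bar> <= l)"
  unfolding Ev_def
 proof (rule emp_LLN[OF _ _ l(1)])
  have "integrable P (%y. event y * indicator {0..2 * l} (fst y))" by (rule integral_event(1)[of _ 1]) auto
  moreover have "(event y * indicator {0..2 * l} (fst y))\<^sup>2 = event y * indicator {0..2 * l} (fst y)" for y :: "'p obs"
   by (simp add: power_mult_distrib event_sq indicator_def)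
  ultimately show "integrable P (%y. (event y * indicator {0..2 * l} (fst y))\<^sup>2)" by simp
 qed measurable
 have "LARGE n. b n < l" using order_tendstoD(2)[OF b0 l(1)] .
 then have "LARGE n. \<forall>w\<in>space M.
   regular (betahat n w) n w \<and> \<bar>Ev n 0 (2 * l) w - (\<integral>y. event y * indicator {0..2 * l} (fst y) \<partial>P)\<bar> <= l -->
   (\<forall>v\<in>{0..l}. \<bar>smoothed (b n) n (ys w) (betahat n w) v\<bar> <= 4 * kB / \<kappa> * (2 * lamB * Env + 1) * l)"
 proof eventually_elim
  case (elim n)
  show ?case
  proof (intro ballI impI, elim conjE)
   fix w v assume reg: "regular (betahat n w) n w" and v: "v \<in> {0..l}"
    and E: "\<bar>Ev n 0 (2 * l) w - (\<integral>y. event y * indicator {0..2 * l} (fst y) \<partial>P)\<bar> <= l"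
   have "Ev n 0 (2 * l) w <= lamB * Env * (2 * l - 0) + l"
    using E event_mass[of 0 "2 * l"] l by linarith
   also have "... = (2 * lamB * Env + 1) * l" by (simp add: algebra_simps)
   finally have Ev: "Ev n 0 (2 * l) w <= (2 * lamB * Env + 1) * l" .
   have "\<bar>smoothed (b n) n (ys w) (betahat n w) v\<bar> <= 4 * kB / \<kappa> * Ev n 0 (2 * l) w"
    by (rule smoothed_bound[OF reg bpos]) (use v elim l in auto)
   also have "... <= 4 * kB / \<kappa> * ((2 * lamB * Env + 1) * l)"
    using kB_nonneg \<kappa>_pos by (intro mult_left_mono Ev) auto
   finally show "\<bar>smoothed (b n) n (ys w) (betahat n w) v\<bar> <= 4 * kB / \<kappa> * (2 * lamB * Env + 1) * l" by (simp add: mult.assoc)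
  qed
 qed
 from wpo_eventually_mp[OF wpo_conj[OF regular_wpo[OF r] LLN] this] show ?thesis .
qed

end

section \<open>Bias\<close>

lemma real_abs_integral_le_of_support:
 fixes f :: "real => real"
 assumes "\<And>z. \<bar>f z\<bar> <= e * indicator {-1..1} z" "0 <= e"
 shows "\<bar>\<integral>z. f z \<partial>lborel\<bar> <= 2 * e"
proof (cases "integrable lborel f")
 case True
 have "\<bar>\<integral>z. f z \<partial>lborel\<bar> <= (\<integral>z. \<bar>f z\<bar> \<partial>lborel)" by (rule integral_abs_bound)
 also have "... <= (\<integral>z. e * indicator {-1..1::real} z \<partial>lborel)"
  using assms(1) True by (intro integral_mono) auto
 also have "... = 2 * e" by simp
 finally show ?thesis .
qed (use assms(2) in \<open>simp add: not_integrable_integral_eq\<close>)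

context smooth_kernel
begin

lemma k_mult_integrable:
 assumes "continuous_on {-1..1} f"
 shows "integrable lborel (%z. k z * f z)"
proof -
 have "integrable lborel (%z. indicator {-1..1} z *\<^sub>R (k z * f z))"
  by (rule borel_integrable_compact) (auto intro!: continuous_on_mult k_cont assms)
 moreover have "(%z. indicator {-1..1} z *\<^sub>R (k z * f z)) = (%z. k z * f z)"
  using k_supp by (auto simp: fun_eq_iff indicator_def)
 ultimately show ?thesis by simp
qed

lemma k_mult_integral_bound:
 assumes "\<And>z. z \<in> {-1..1} ==> \<bar>f z\<bar> <= e" "0 <= e"
 shows "\<bar>\<integral>z. k z * f z \<partial>lborel\<bar> <= 2 * (kB * e)"
proof (rule real_abs_integral_le_of_support)
 show "\<bar>k z * f z\<bar> <= kB * e * indicator {-1..1} z" for z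
  using k_supp[of z] assms k_bound[of z] kB_nonneg
  by (cases "z \<in> {-1..1}") (auto simp: abs_mult intro!: mult_mono)
qed (use assms kB_nonneg in simp)

end

context cox_smoothing
begin

text \<open>Substitution; the window lies inside \<open>{0..tauH}\<close>, so the cut-off in
  \<open>mean\<close> is not felt.\<close>

lemma mean_eq:
 assumes b: "0 < b" and v: "0 <= v - b" "v + b <= tauH"
 shows "mean b v = (\<integral>z. k z * lam0 (v - b * z) \<partial>lborel)"
proof -
 define f where "f u = indicator {0..tauH} u * (lam0 u * (k ((v - u) / b) / b))" for u
 have "mean b v = (\<integral>u. f u \<partial>lborel)"
  using set_borel_integral_eq_integral(2)[of "{0..tauH}" "%u. lam0 u * (k ((v - u) / b) / b)",
   unfolded set_lebesgue_integral_def set_integrable_def, OF borel_integrable_compact[OF compact_Icc kk_cont1[OF b k_cont]]]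
  by (simp only: mean_def f_def real_scaleR_def)
 also have "... = \<bar>- b\<bar> * (\<integral>z. f (v + (- b) * z) \<partial>lborel)"
  using lborel_integral_real_affine[of "- b" f v] b by simp
 also have "... = (\<integral>z. b * f (v + (- b) * z) \<partial>lborel)" using b by simp
 also have "... = (\<integral>z. k z * lam0 (v - b * z) \<partial>lborel)"
 proof (rule Bochner_Integration.integral_cong[OF refl])
  fix z
  show "b * f (v + (- b) * z) = k z * lam0 (v - b * z)"
  proof (cases "z \<in> {-1..1}")
   case True
   have "b * z <= b * 1" "b * (-1) <= b * z" using True b by (intro mult_left_mono; simp)+
   then have "v - b * z \<in> {0..tauH}" using v by auto
   then show ?thesis using b by (simp add: f_def)
  qed (use k_supp b in \<open>simp add: f_def\<close>)
 qed
 finally show ?thesis .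
qed

lemma window_cont:
 assumes b: "0 < b" and v: "0 <= v - b" "v + b <= tauH"
 shows "continuous_on {-1..1} (%z. lam0 (v - b * z))"
proof (rule continuous_on_compose2[OF obs.lam0_cont])
 show "(%z. v - b * z) ` {-1..1} \<subseteq> {0..tauH}"
 proof (intro image_subsetI)
  fix z :: real assume "z \<in> {-1..1}"
  then have "b * z <= b * 1" "b * (-1) <= b * z" using b by (intro mult_left_mono; simp)+
  then show "v - b * z \<in> {0..tauH}" using v by auto
 qed
qed (auto intro!: continuous_intros)

end

locale cox_isotonic = cox_smoothing M Y P lam0 beta0 tauH k k' kB tau2
 for M :: "'w measure" and Y :: "nat => 'w => ('p::finite) obs" and P :: "('p::finite) obs measure"
  and lam0 beta0 tauH k k' kB tau2 +
 fixes betahat :: "nat => 'w => real ^ 'p" and b :: "nat => real" and m :: nat and c a taustar :: real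
  and D :: "nat => real => real"
 assumes D0: "D 0 = lam0"
  and D_deriv: "\<And>j t. j < m ==> t \<in> {0..tauH} ==> (D j has_real_derivative D (Suc j) t) (at t within {0..tauH})"
  and D_cont: "continuous_on {0..tauH} (D m)"
  and m2: "2 <= m"
  and a_pos: "0 < a"
  and slope: "\<And>s t. 0 <= s ==> s <= t ==> t <= tauH ==> a * (t - s) <= lam0 t - lam0 s"
  and taustar: "0 < taustar" "taustar < tau2"
  and k_orth: "\<And>j. 1 <= j ==> j < m ==> (\<integral>u. k u * u ^ j \<partial>lborel) = 0"
  and b_pos: "\<And>n. 0 < b n" and b_lim: "b \<longlonglongrightarrow> 0" and c_pos: "0 < c"
  and b_rate: "(%n. real n powr (1 / (2 * real m + 1)) * b n) \<longlonglongrightarrow> c"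
  and betahat_meas: "\<And>n. betahat n \<in> borel_measurable M"
  and root_n: "Op (%n w. norm (betahat n w - beta0)) (%n. 1 / sqrt n)"
begin

lemma D_cont_all: "j <= m ==> continuous_on {0..tauH} (D j)"
 using D_cont DERIV_continuous_on[OF D_deriv, of j] by (cases "j = m") auto

lemma D_bounded: "j <= m ==> \<exists>B\<ge>0. \<forall>t\<in>{0..tauH}. \<bar>D j t\<bar> <= B"
 using continuous_on_interval_bounded[OF D_cont_all, of j] obs.tauH_pos
 by (metis abs_ge_zero atLeastAtMost_iff less_imp_le order_refl order_trans)

lemma D_lipschitz:
 assumes "j < m"
 shows "\<exists>L\<ge>0. \<forall>s\<in>{0..tauH}. \<forall>t\<in>{0..tauH}. \<bar>D j t - D j s\<bar> <= L * \<bar>t - s\<bar>"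
proof -
 obtain L where L: "0 <= L" "\<forall>t\<in>{0..tauH}. \<bar>D (Suc j) t\<bar> <= L" using D_bounded[of "Suc j"] assms by auto
 have "\<bar>D j t - D j s\<bar> <= L * \<bar>t - s\<bar>" if "s \<in> {0..tauH}" "t \<in> {0..tauH}" for s t
  using field_differentiable_bound[of "{0..tauH}" "D j" "D (Suc j)" L t s] D_deriv[OF assms] L that by auto
 then show ?thesis using L by blast
qed

definition Lip :: real where
 "Lip = (SOME L. 0 <= L \<and> (\<forall>s\<in>{0..tauH}. \<forall>t\<in>{0..tauH}. \<bar>lam0 t - lam0 s\<bar> <= L * \<bar>t - s\<bar>))"

lemma Lip: "0 <= Lip" "\<And>s t. s \<in> {0..tauH} ==> t \<in> {0..tauH} ==> \<bar>lam0 t - lam0 s\<bar> <= Lip * \<bar>t - s\<bar>"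
proof -
 have "\<exists>L. 0 <= L \<and> (\<forall>s\<in>{0..tauH}. \<forall>t\<in>{0..tauH}. \<bar>lam0 t - lam0 s\<bar> <= L * \<bar>t - s\<bar>)"
  using D_lipschitz[of 0] m2 D0 by auto
 from someI_ex[OF this]
 show "0 <= Lip" "\<And>s t. s \<in> {0..tauH} ==> t \<in> {0..tauH} ==> \<bar>lam0 t - lam0 s\<bar> <= Lip * \<bar>t - s\<bar>"
  unfolding Lip_def[symmetric] by blast+
qed

lemma lam0_pos: "t \<in> {0<..tauH} ==> 0 < lam0 t"
 using slope[of 0 t] obs.lam0_nonneg[of 0] obs.tauH_pos mult_pos_pos[OF a_pos, of t] by force

text \<open>The derivative of \<open>lam0 (t - h * z) - lam0 t\<close> in \<open>t\<close> is an
  increment of the first derivative of \<open>lam0\<close>, which is Lipschitz because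
  \<open>m\<close> is at least 2. The factor \<open>\<bar>v - y\<bar>\<close> is the point: for
  small \<open>h\<close> this error is dominated by the linear growth of \<open>lam0\<close>,
  whereas a plain bias bound would not vanish as \<open>v\<close> approaches
  \<open>y\<close>.\<close>

lemma mean_increment:
 shows "\<exists>C\<ge>0. \<forall>h y v. 0 < h --> 0 <= y - h --> y + h <= tauH --> 0 <= v - h --> v + h <= tauH -->
  \<bar>mean h v - mean h y - (lam0 v - lam0 y)\<bar> <= C * h * \<bar>v - y\<bar>"
proof -
 obtain L where L: "0 <= L" "\<forall>s\<in>{0..tauH}. \<forall>t\<in>{0..tauH}. \<bar>D 1 t - D 1 s\<bar> <= L * \<bar>t - s\<bar>"
  using D_lipschitz[of 1] m2 by auto
 have "\<bar>mean h v - mean h y - (lam0 v - lam0 y)\<bar> <= 2 * (kB * L) * h * \<bar>v - y\<bar>"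
  if h: "0 < h" "0 <= y - h" "y + h <= tauH" "0 <= v - h" "v + h <= tauH" for h y v
 proof -
  have w: "t - h * z \<in> {0..tauH}" if "z \<in> {-1..1}" "0 <= t - h" "t + h <= tauH" for t z
  proof -
   have "h * z <= h * 1" "h * (-1) <= h * z" using h that by (intro mult_left_mono; simp)+
   then show ?thesis using that by auto
  qed
  have i: "integrable lborel (%z. k z * lam0 (t - h * z))" if "0 <= t - h" "t + h <= tauH" for t
   by (intro k_mult_integrable window_cont h that)
  have ic: "integrable lborel (%z. k z * q)" for q using k_integrable by simp
  have kq: "(\<integral>z. k z * q \<partial>lborel) = q" for q using k_int by simp
  have "mean h v - mean h y - (lam0 v - lam0 y) =
   (\<integral>z. k z * lam0 (v - h * z) \<partial>lborel) - (\<integral>z. k z * lam0 (y - h * z) \<partial>lborel) - (\<integral>z. k z * (lam0 v - lam0 y) \<partial>lborel)"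
   unfolding mean_eq[OF h(1,2,3)] mean_eq[OF h(1,4,5)] kq ..
  also have "... = (\<integral>z. k z * lam0 (v - h * z) - k z * lam0 (y - h * z) - k z * (lam0 v - lam0 y) \<partial>lborel)"
   using i[OF h(2,3)] i[OF h(4,5)] ic[of "lam0 v - lam0 y"] by (simp only: Bochner_Integration.integral_diff Bochner_Integration.integrable_diff)
  also have "... = (\<integral>z. k z * ((lam0 (v - h * z) - lam0 v) - (lam0 (y - h * z) - lam0 y)) \<partial>lborel)"
   by (intro Bochner_Integration.integral_cong refl) (simp add: algebra_simps)
  also have "\<bar>...\<bar> <= 2 * (kB * (L * h * \<bar>v - y\<bar>))"
  proof (rule k_mult_integral_bound)
   fix z :: real assume z: "z \<in> {-1..1}"
   define S where "S = {h..tauH - h}"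
   have "norm ((%t. lam0 (t - h * z) - lam0 t) v - (%t. lam0 (t - h * z) - lam0 t) y) <= L * h * norm (v - y)"
   proof (rule field_differentiable_bound[where S = S and f' = "%t. D 1 (t - h * z) - D 1 t"])
    show "convex S" by (simp add: S_def)
    show "v \<in> S" "y \<in> S" using h by (auto simp: S_def)
    fix t assume t: "t \<in> S"
    then have wt: "t - h * z \<in> {0..tauH}" using w[OF z, of t] by (auto simp: S_def)
    have S: "S \<subseteq> {0..tauH}" using h by (auto simp: S_def)
    have "(lam0 has_real_derivative D 1 t) (at t within S)"
     using D_deriv[of 0 t] m2 D0 t S DERIV_subset[OF _ S] by auto
    moreover have "((%t. lam0 (t - h * z)) has_real_derivative D 1 (t - h * z) * 1) (at t within S)"
    proof (rule DERIV_image_chain[where f = lam0 and g = "%t. t - h * z", unfolded o_def])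
     show "((%t. t - h * z) has_real_derivative 1) (at t within S)" by (auto intro!: derivative_eq_intros)
     have "(%t. t - h * z) ` S \<subseteq> {0..tauH}"
      by (intro image_subsetI w[OF z]) (simp_all add: S_def)
     then show "(lam0 has_real_derivative D 1 (t - h * z)) (at (t - h * z) within (%t. t - h * z) ` S)"
      using D_deriv[of 0 "t - h * z"] m2 D0 wt DERIV_subset by auto
    qed
    ultimately show "((%t. lam0 (t - h * z) - lam0 t) has_real_derivative D 1 (t - h * z) - D 1 t) (at t within S)"
     by (auto intro: DERIV_diff)
    have "\<bar>D 1 (t - h * z) - D 1 t\<bar> <= L * \<bar>t - h * z - t\<bar>" using L(2) wt t S by blast
    also have "... <= L * (h * 1)" using L(1) h z by (intro mult_left_mono) (auto simp: abs_mult)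
    finally show "norm (D 1 (t - h * z) - D 1 t) <= L * h" by simp
   qed
   then show "\<bar>lam0 (v - h * z) - lam0 v - (lam0 (y - h * z) - lam0 y)\<bar> <= L * h * \<bar>v - y\<bar>" by simp
  qed (use L h in simp)
  finally show ?thesis by (simp add: mult_ac)
 qed
 moreover have "0 <= 2 * (kB * L)" using L kB_nonneg by simp
 ultimately show ?thesis by blast
qed

text \<open>Taylor expansion with Lagrange remainder; orthogonality removes the terms of orders 1 to
  \<open>m - 1\<close>. Moving the intermediate point of the \<open>m\<close>-th derivative to
  \<open>v\<close> isolates the leading term and costs \<open>e\<close>, the oscillation of
  \<open>D m\<close> on the window. A constant \<open>e\<close> gives the uniform bound, a small one
  the limit.\<close>

lemma bias:
 assumes h: "0 < h" "0 < v - h" "v + h < tauH" and e: "\<And>t. \<bar>t - v\<bar> <= h ==> \<bar>D m t - D m v\<bar> <= e"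
 shows "\<bar>mean h v - lam0 v - (- h) ^ m / fact m * D m v * (\<integral>z. k z * z ^ m \<partial>lborel)\<bar> <= 2 * kB * e / fact m * h ^ m"
proof -
 define T where "T z = (\<Sum>j<m. D j v / fact j * (- h * z) ^ j)" for z
 define T' where "T' z = T z + D m v / fact m * (- h * z) ^ m" for z
 have e0: "0 <= e" using e[of v] h by simp
 have kp: "integrable lborel (%z. k z * z ^ j)" for j by (intro k_mult_integrable continuous_intros)
 have "(\<integral>z. k z * T' z \<partial>lborel) = (\<integral>z. (\<Sum>j<m. D j v / fact j * (- h) ^ j * (k z * z ^ j)) + D m v / fact m * (- h) ^ m * (k z * z ^ m) \<partial>lborel)"
  unfolding T'_def T_def power_mult_distrib distrib_left sum_distrib_left
  by (intro Bochner_Integration.integral_cong refl arg_cong2[of _ _ _ _ "(+)"] sum.cong) (simp_all only: mult_ac)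
 also have "... = (\<Sum>j<m. D j v / fact j * (- h) ^ j * (\<integral>z. k z * z ^ j \<partial>lborel)) + D m v / fact m * (- h) ^ m * (\<integral>z. k z * z ^ m \<partial>lborel)"
  using kp by (subst Bochner_Integration.integral_add) (auto intro!: Bochner_Integration.integrable_sum)
 also have "(\<Sum>j<m. D j v / fact j * (- h) ^ j * (\<integral>z. k z * z ^ j \<partial>lborel)) = (\<Sum>j\<in>{0}. D j v / fact j * (- h) ^ j * (\<integral>z. k z * z ^ j \<partial>lborel))"
  using m2 by (intro sum.mono_neutral_right) (auto simp: k_orth)
 also have "... = lam0 v" using k_int D0 by simp
 finally have T'_int: "(\<integral>z. k z * T' z \<partial>lborel) = lam0 v + D m v / fact m * (- h) ^ m * (\<integral>z. k z * z ^ m \<partial>lborel)" .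
 have T'_integrable: "integrable lborel (%z. k z * T' z)"
  unfolding T'_def T_def by (intro k_mult_integrable continuous_intros)
 have m_eq: "mean h v = (\<integral>z. k z * lam0 (v - h * z) \<partial>lborel)" using h by (intro mean_eq) auto
 have lam_integrable: "integrable lborel (%z. k z * lam0 (v - h * z))"
  using h by (intro k_mult_integrable window_cont) auto
 have "mean h v - lam0 v - (- h) ^ m / fact m * D m v * (\<integral>z. k z * z ^ m \<partial>lborel) =
   (\<integral>z. k z * lam0 (v - h * z) \<partial>lborel) - (\<integral>z. k z * T' z \<partial>lborel)"
  unfolding m_eq T'_int by (simp add: mult_ac)
 also have "... = (\<integral>z. k z * lam0 (v - h * z) - k z * T' z \<partial>lborel)"
  by (rule Bochner_Integration.integral_diff[OF lam_integrable T'_integrable, symmetric])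
 also have "... = (\<integral>z. k z * (lam0 (v - h * z) - T' z) \<partial>lborel)"
  by (intro Bochner_Integration.integral_cong refl) (simp add: right_diff_distrib)
 also have "\<bar>...\<bar> <= 2 * (kB * (e / fact m * h ^ m))"
 proof (rule k_mult_integral_bound)
  fix z :: real assume z: "z \<in> {-1..1}"
  have hz: "\<bar>h * z\<bar> <= h" using z h by (auto simp: abs_mult)
  \<comment> \<open>At \<open>z = 0\<close> the two points coincide and Taylor's theorem does not
    apply; the identity is then trivial because \<open>m\<close> is positive.\<close>
  have "\<exists>t. \<bar>t - v\<bar> <= h \<and> lam0 (v - h * z) = T z + D m t / fact m * (- h * z) ^ m"
  proof (cases "z = 0")
   case True
   have "T z = lam0 v"
    unfolding T_def using m2 True by (subst sum.mono_neutral_right[of "{..<m}" "{0}"]) (auto simp: D0 power_0_left)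
   then show ?thesis using True m2 h by (intro exI[of _ v]) auto
  next
   case False
   have der: "\<forall>j t. j < m \<and> v - h <= t \<and> t <= v + h --> DERIV (D j) t :> D (Suc j) t"
   proof (intro allI impI, elim conjE)
    fix j t assume "j < m" "v - h <= t" "t <= v + h"
    then have "0 < t" "t < tauH" using h by auto
    then show "DERIV (D j) t :> D (Suc j) t" using D_deriv[of j t] \<open>j < m\<close> by (simp add: at_within_Icc_at)
   qed
   obtain t where t: "if v - h * z < v then v - h * z < t \<and> t < v else v < t \<and> t < v - h * z"
    "lam0 (v - h * z) = (\<Sum>j<m. D j v / fact j * (v - h * z - v) ^ j) + D m t / fact m * (v - h * z - v) ^ m"
   proof -
    have c: "v - h <= v - h * z" "v - h * z <= v + h" "v - h * z \<noteq> v" "v - h <= v" "v <= v + h" "0 < m"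
     using hz h False m2 by (simp_all only: abs_le_iff) auto
    show ?thesis using Taylor[OF c(6) D0 der c(4,5,1,2,3)] that by blast
   qed
   have "\<bar>t - v\<bar> <= h" using t(1) hz by (auto split: if_splits)
   then show ?thesis using t(2) by (intro exI[of _ t]) (simp add: T_def)
  qed
  then obtain t where t: "\<bar>t - v\<bar> <= h" "lam0 (v - h * z) = T z + D m t / fact m * (- h * z) ^ m" by blast
  have "\<bar>lam0 (v - h * z) - T' z\<bar> = \<bar>D m t - D m v\<bar> / fact m * \<bar>h * z\<bar> ^ m"
   unfolding t(2) T'_def by (simp add: abs_mult power_abs flip: left_diff_distrib diff_divide_distrib)
  also have "... <= e / fact m * h ^ m"
   using e[OF t(1)] hz by (intro mult_mono divide_right_mono power_mono) (auto simp: e0)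
  finally show "\<bar>lam0 (v - h * z) - T' z\<bar> <= e / fact m * h ^ m" .
 qed (use e0 h in simp)
 also have "2 * (kB * (e / fact m * h ^ m)) = 2 * kB * e / fact m * h ^ m" by simp
 finally show ?thesis .
qed

lemma bias_uniform:
 "\<exists>C\<ge>0. \<forall>h v. 0 < h --> 0 < v - h --> v + h < tauH --> \<bar>mean h v - lam0 v\<bar> <= C * h ^ m"
proof -
 obtain B where B: "0 <= B" "\<forall>t\<in>{0..tauH}. \<bar>D m t\<bar> <= B" using D_bounded[of m] by auto
 define J where "J = \<bar>\<integral>z. k z * z ^ m \<partial>lborel\<bar>"
 define C where "C = 2 * kB * (2 * B) / fact m + B / fact m * J"
 have C: "0 <= C" using B kB_nonneg by (simp add: C_def J_def)
 have "\<bar>mean h v - lam0 v\<bar> <= C * h ^ m" if h: "0 < h" "0 < v - h" "v + h < tauH" for h v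
 proof -
  have "\<bar>D m t - D m v\<bar> <= 2 * B" if "\<bar>t - v\<bar> <= h" for t
  proof -
   have "t \<in> {0..tauH}" "v \<in> {0..tauH}" using that h by auto
   then have "\<bar>D m t\<bar> <= B" "\<bar>D m v\<bar> <= B" using B by blast+
   then show ?thesis by linarith
  qed
  note bb = bias[OF h this]
  have v: "v \<in> {0..tauH}" using h by auto
  have "\<bar>(- h) ^ m / fact m * D m v * (\<integral>z. k z * z ^ m \<partial>lborel)\<bar> = h ^ m * (\<bar>D m v\<bar> / fact m * J)"
   using h by (simp add: abs_mult power_abs J_def)
  also have "... <= h ^ m * (B / fact m * J)"
   using B v h by (intro mult_left_mono mult_right_mono divide_right_mono) (auto simp: J_def)
  finally have "\<bar>(- h) ^ m / fact m * D m v * (\<integral>z. k z * z ^ m \<partial>lborel)\<bar> <= B / fact m * J * h ^ m" by (simp add: mult_ac)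
  then show ?thesis using bb unfolding C_def distrib_right by linarith
 qed
 then show ?thesis using C by blast
qed

lemma bias_limit:
 assumes x: "0 < x" "x < tauH"
 shows "(%n. (mean (b n) x - lam0 x) / b n ^ m) \<longlonglongrightarrow> (- 1) ^ m / fact m * D m x * (\<integral>z. k z * z ^ m \<partial>lborel)"
  (is "?f \<longlonglongrightarrow> ?l")
proof (rule LIMSEQ_I)
 fix r :: real assume r: "0 < r"
 \<comment> \<open>Chosen so that the error term of \<open>bias\<close> becomes
   \<open>r * (kB / (2 * kB + 1))\<close>, which is below \<open>r\<close>.\<close>
 define e where "e = r * fact m / (2 * (2 * kB + 1))"
 have e: "0 < e" using r kB_nonneg by (simp add: e_def)
 have Dc: "isCont (D m) x" using D_cont x by (intro continuous_on_interior) (auto simp: interior_atLeastAtMost_real)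
 then obtain d where d: "0 < d" "\<And>t. \<bar>t - x\<bar> < d ==> \<bar>D m t - D m x\<bar> < e"
  using continuous_at_real_range[THEN iffD1, rule_format, OF Dc e] by auto
 have "LARGE n. b n < min d (min x (tauH - x))"
  using d x by (intro order_tendstoD(2)[OF b_lim]) auto
 then have "LARGE n. norm (?f n - ?l) < r"
 proof eventually_elim
  case (elim n)
  have bn: "0 < b n ^ m" using b_pos[of n] by simp
  have "\<bar>mean (b n) x - lam0 x - (- b n) ^ m / fact m * D m x * (\<integral>z. k z * z ^ m \<partial>lborel)\<bar> <= 2 * kB * e / fact m * b n ^ m"
  proof (rule bias)
   show "\<bar>D m t - D m x\<bar> <= e" if "\<bar>t - x\<bar> <= b n" for t using d(2)[of t] that elim by simp
  qed (use elim b_pos in auto)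
  moreover have "(- b n) ^ m = (- 1) ^ m * b n ^ m" by (rule power_minus)
  moreover have "mean (b n) x - lam0 x - (- 1) ^ m * b n ^ m / fact m * D m x * (\<integral>z. k z * z ^ m \<partial>lborel) = (?f n - ?l) * b n ^ m"
  proof -
   have g: "A - s * B / f * d * J = (A / B - s / f * d * J) * B" if "B \<noteq> 0" for A s B f d J :: real
    using that by (simp add: left_diff_distrib)
   show ?thesis by (rule g) (rule less_imp_neq[OF bn, symmetric])
  qed
  ultimately have "\<bar>(?f n - ?l) * b n ^ m\<bar> <= 2 * kB * e / fact m * b n ^ m" by simp
  then have "\<bar>?f n - ?l\<bar> * b n ^ m <= 2 * kB * e / fact m * b n ^ m" using bn by (simp add: abs_mult)
  then have "\<bar>?f n - ?l\<bar> <= 2 * kB * e / fact m" using bn by (rule mult_right_le_imp_le)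
  also have "... = r * (kB / (2 * kB + 1))"
  proof -
   have g: "2 * kB * (r * f / (2 * q)) / f = r * (kB / q)" if "f \<noteq> 0" "q \<noteq> 0" for f q :: real
    using that by simp
   show ?thesis unfolding e_def by (rule g) (use kB_nonneg in auto)
  qed
  also have "... < r * 1" using r kB_nonneg by (intro mult_strict_left_mono) auto
  finally show ?case by simp
 qed
 then show "\<exists>no. \<forall>n\<ge>no. norm (?f n - ?l) < r" by (simp add: eventually_sequentially)
qed

section \<open>Rates\<close>

definition rate :: "nat => real" where "rate n = real n powr (real m / (2 * real m + 1))"

text \<open>It tends to infinity because \<open>real n * b n ^ (2 * m + 1)\<close> has a positive
  limit and the exponent exceeds 4.\<close>

definition q :: "nat => real" where "q n = real n * b n ^ 4"

text \<open>For positive \<open>n\<close> this is \<open>n\<close> to the power -1/4, written so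
  that \<open>rho n / b n\<close> visibly tends to 0.\<close>

definition rho :: "nat => real" where "rho n = b n / sqrt (sqrt (q n))"

definition cn :: "nat => real" where "cn n = real n powr (1 / (2 * real m + 1)) * b n"

lemma cn_lim: "cn \<longlonglongrightarrow> c" using b_rate by (simp add: cn_def[abs_def])

lemma cn_pos: "0 < n ==> 0 < cn n" using b_pos[of n] by (simp add: cn_def)

lemma rate_pos: "0 < n ==> 0 < rate n" by (simp add: rate_def)

text \<open>The origin of the factor 1/c in the limiting variance.\<close>

lemma rate_sq: assumes "0 < n" shows "(rate n)\<^sup>2 / (n * b n) = 1 / cn n"
proof -
 define t where "t = 1 / (2 * real m + 1)"
 have "(rate n)\<^sup>2 = real n powr (2 * (real m / (2 * real m + 1)))"
  using assms by (simp add: rate_def powr_powr flip: powr_numeral) (simp add: mult.commute)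
 also have "2 * (real m / (2 * real m + 1)) = 1 - t" by (simp add: t_def field_simps)
 also have "real n powr (1 - t) = real n / real n powr t" using assms by (simp add: powr_diff)
 finally show ?thesis using assms b_pos[of n] by (simp add: cn_def t_def)
qed

lemma n_b_pow: assumes "0 < n" shows "real n * b n ^ (2 * m + 1) = cn n ^ (2 * m + 1)"
proof -
 have "(real n powr (1 / (2 * real m + 1))) ^ (2 * m + 1) = real n powr (real (2 * m + 1) * (1 / (2 * real m + 1)))"
  using assms by (intro powr_power) simp
 also have "real (2 * m + 1) * (1 / (2 * real m + 1)) = 1" by (simp add: field_simps)
 finally show ?thesis using assms by (simp only: cn_def power_mult_distrib powr_one)
qed

text \<open>The origin of the factor \<open>c ^ m\<close> in the limiting mean.\<close>

lemma rate_b_pow: assumes "0 < n" shows "rate n * b n ^ m = cn n ^ m"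
proof -
 have "(real n powr (1 / (2 * real m + 1))) ^ m = real n powr (real m * (1 / (2 * real m + 1)))"
  using assms by (intro powr_power) simp
 then show ?thesis by (simp add: cn_def rate_def power_mult_distrib)
qed

lemma rate_b_pow_lim: "(%n. rate n * b n ^ m) \<longlonglongrightarrow> c ^ m"
proof (rule Lim_transform_eventually[OF tendsto_power[OF cn_lim]])
 show "LARGE n. cn n ^ m = rate n * b n ^ m"
  using eventually_gt_at_top[of 0] by eventually_elim (simp add: rate_b_pow)
qed

lemma rate_sq_lim: "(%n. (rate n)\<^sup>2 / (n * b n)) \<longlonglongrightarrow> 1 / c"
proof (rule Lim_transform_eventually)
 show "(%n. 1 / cn n) \<longlonglongrightarrow> 1 / c" using c_pos by (intro tendsto_intros cn_lim) auto
 show "LARGE n. 1 / cn n = (rate n)\<^sup>2 / (n * b n)"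
  using eventually_gt_at_top[of 0] by eventually_elim (simp add: rate_sq)
qed

lemma b_pow_top: "0 < j ==> filterlim (%n. 1 / b n ^ j) at_top sequentially"
proof -
 assume "0 < j"
 have "filterlim (%n. inverse (b n ^ j)) at_top sequentially"
 proof (rule filterlim_inverse_at_top)
  show "(%n. b n ^ j) \<longlonglongrightarrow> 0" using tendsto_power[OF b_lim, of j] \<open>0 < j\<close> by (simp add: power_0_left)
 qed (simp add: b_pos)
 then show ?thesis by (simp add: divide_inverse)
qed

lemma q_pos: "0 < n ==> 0 < q n" using b_pos[of n] by (simp add: q_def)

lemma q_top: "filterlim q at_top sequentially"
proof -
 have "filterlim (%n. cn n ^ (2 * m + 1) * (1 / b n ^ (2 * m - 3))) at_top sequentially"
  using c_pos m2 by (intro filterlim_tendsto_pos_mult_at_top[OF tendsto_power[OF cn_lim]] b_pow_top) auto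
 then show ?thesis
 proof (rule filterlim_mono_eventually[OF _ order_refl order_refl])
  show "LARGE n. cn n ^ (2 * m + 1) * (1 / b n ^ (2 * m - 3)) = q n"
   using eventually_gt_at_top[of 0]
  proof eventually_elim
   case (elim n)
   \<comment> \<open>The subtraction of naturals is exact, and its result positive, because
     \<open>m\<close> is at least 2.\<close>
   have "2 * m + 1 = 4 + (2 * m - 3)" using m2 by simp
   then have "b n ^ (2 * m + 1) = b n ^ 4 * b n ^ (2 * m - 3)" by (simp only: power_add)
   then have e: "cn n ^ (2 * m + 1) = real n * (b n ^ 4 * b n ^ (2 * m - 3))" using n_b_pow[OF elim] by (simp only:)
   have g: "N * (u * v) * (1 / v) = N * u" if "0 < v" for N u v :: real using that by simp
   show ?case unfolding e q_def by (rule g) (simp add: b_pos)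
  qed
 qed
qed

lemma b_le_1: "LARGE n. b n <= 1"
 using order_tendstoD(2)[OF b_lim, of 1] by (auto elim: eventually_mono)

lemma sqrt_at_top_of: "filterlim f at_top sequentially ==> filterlim (%n. sqrt (f n)) at_top sequentially"
 by (rule filterlim_compose[OF sqrt_at_top])

lemma inverse_lim_0: "filterlim f at_top sequentially ==> (%n. 1 / f n) \<longlonglongrightarrow> (0 :: real)"
 using tendsto_inverse_0_at_top[of f sequentially] by (simp add: divide_inverse)

lemma small_of_lim_0:
 assumes "f \<longlonglongrightarrow> (0 :: real)" "0 < e" shows "LARGE n. C * f n <= e"
proof -
 have "(%n. C * f n) \<longlonglongrightarrow> C * 0" by (intro tendsto_intros assms)
 then have "LARGE n. C * f n < e" using assms(2) by (intro order_tendstoD(2)) auto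
 then show ?thesis by eventually_elim simp
qed

lemma sqrt_n_b_sq: "b n ^ 2 * sqrt n = sqrt (q n)"
 using b_pos[of n] by (simp add: q_def real_sqrt_mult mult.commute) (metis real_sqrt_abs2 abs_of_pos less_imp_le power2_eq_square power4_eq_xxxx mult.assoc real_sqrt_abs zero_le_power2 abs_of_nonneg)

text \<open>The second limit says that the uniform error is negligible relative to the window, which
  lets the slope of \<open>lam0\<close> absorb it outside the window.\<close>

lemma dev_rate: "(%n. 1 / (b n * sqrt n)) \<longlonglongrightarrow> 0" "(%n. 1 / (b n * sqrt n) / rho n) \<longlonglongrightarrow> 0"
proof -
 have "(%n. 1 / sqrt (sqrt (q n))) \<longlonglongrightarrow> 0" by (intro inverse_lim_0 sqrt_at_top_of q_top)
 moreover have "LARGE n. 1 / sqrt (sqrt (q n)) = 1 / (b n * sqrt n) / rho n"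
  using eventually_gt_at_top[of 0]
 proof eventually_elim
  case (elim n)
  define r where "r = sqrt (sqrt (q n))"
  have r: "0 < r" using q_pos[OF elim] by (simp add: r_def)
  have "r * r = sqrt (q n)" using q_pos[OF elim] by (simp add: r_def)
  then have "b n * sqrt n * b n = r * r" using sqrt_n_b_sq[of n] by (simp add: power2_eq_square mult_ac)
  then have "1 / r = r / (b n * sqrt n * b n)" using r by simp
  then show ?case using r by (simp add: rho_def flip: r_def)
 qed
 ultimately show "(%n. 1 / (b n * sqrt n) / rho n) \<longlonglongrightarrow> 0" by (rule Lim_transform_eventually)
 have "(%n. b n * (1 / sqrt (q n))) \<longlonglongrightarrow> 0 * 0" by (intro tendsto_mult b_lim inverse_lim_0 sqrt_at_top_of q_top)
 then have "(%n. b n * (1 / sqrt (q n))) \<longlonglongrightarrow> 0" by simp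
 moreover have "LARGE n. b n * (1 / sqrt (q n)) = 1 / (b n * sqrt n)"
  using eventually_gt_at_top[of 0]
 proof eventually_elim
  case (elim n)
  show ?case unfolding sqrt_n_b_sq[symmetric] using b_pos[of n] by (simp add: power2_eq_square)
 qed
 ultimately show "(%n. 1 / (b n * sqrt n)) \<longlonglongrightarrow> 0" by (rule Lim_transform_eventually)
qed

text \<open>The square of the quotient of the two sides is \<open>cn n ^ (2 * m + 1) * b n\<close>,
  which tends to 0. The bias is thereby absorbed in the stochastic order.\<close>

lemma bias_rate: "LARGE n. b n ^ m <= 1 * (1 / (b n * sqrt n))"
proof -
 have "(%n. cn n ^ (2 * m + 1) * b n) \<longlonglongrightarrow> c ^ (2 * m + 1) * 0"
  by (intro tendsto_intros cn_lim b_lim)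
 then have "LARGE n. cn n ^ (2 * m + 1) * b n < 1" by (intro order_tendstoD(2)) auto
 then show ?thesis using eventually_gt_at_top[of 0]
 proof eventually_elim
  case (elim n)
  have "(b n ^ m * (b n * sqrt n))\<^sup>2 = (b n ^ m)\<^sup>2 * b n * n * b n"
   by (simp add: power_mult_distrib power2_eq_square mult_ac)
  also have "(b n ^ m)\<^sup>2 * b n * n = n * b n ^ (2 * m + 1)"
   by (simp add: power_add mult_ac flip: power_mult)
  also have "... * b n <= 1\<^sup>2" using n_b_pow[OF elim(2)] elim by simp
  finally have "b n ^ m * (b n * sqrt n) <= 1" by (rule power2_le_imp_le) simp
  then show ?case using b_pos[of n] elim by (simp add: pos_le_divide_eq)
 qed
qed

lemma rho_pos: "0 < n ==> 0 < rho n" using b_pos[of n] q_pos[of n] by (simp add: rho_def)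

lemma rho_le_b: "LARGE n. rho n <= b n"
proof -
 have "LARGE n. 1 <= sqrt (sqrt (q n))"
  using sqrt_at_top_of[OF sqrt_at_top_of[OF q_top]] unfolding filterlim_at_top by (rule spec)
 then show ?thesis
 proof eventually_elim
  case (elim n)
  then have "b n * 1 <= b n * sqrt (sqrt (q n))" using b_pos[of n] by (intro mult_left_mono) auto
  then show ?case using elim by (simp add: rho_def pos_divide_le_eq)
 qed
qed

lemma rate_top: "filterlim rate at_top sequentially"
proof -
 define t where "t = real m / (2 * real m + 1)"
 have t: "0 < t" using m2 by (simp add: t_def)
 have "filterlim (%n. exp (t * ln (real n))) at_top sequentially"
  by (intro filterlim_compose[OF exp_at_top] filterlim_tendsto_pos_mult_at_top[OF tendsto_const t]
   filterlim_compose[OF ln_at_top] filterlim_real_sequentially)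
 then show ?thesis
 proof (rule filterlim_mono_eventually[OF _ order_refl order_refl])
  show "LARGE n. exp (t * ln (real n)) = rate n"
   using eventually_gt_at_top[of 0] by eventually_elim (simp add: rate_def t_def powr_def)
 qed
qed

lemma rate_sqrt_lim: "(%n. rate n * (1 / sqrt n)) \<longlonglongrightarrow> 0"
proof -
 have "(%n. sqrt ((rate n)\<^sup>2 / (n * b n) * b n)) \<longlonglongrightarrow> sqrt (1 / c * 0)"
  by (intro tendsto_intros rate_sq_lim b_lim)
 then have "(%n. sqrt ((rate n)\<^sup>2 / (n * b n) * b n)) \<longlonglongrightarrow> 0" by simp
 moreover have "LARGE n. sqrt ((rate n)\<^sup>2 / (n * b n) * b n) = rate n * (1 / sqrt n)"
  using eventually_gt_at_top[of 0]
 proof eventually_elim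
  case (elim n)
  have "(rate n)\<^sup>2 / (n * b n) * b n = (rate n)\<^sup>2 / n" using b_pos[of n] by simp
  then show ?case using rate_pos[OF elim] by (simp add: real_sqrt_divide)
 qed
 ultimately show ?thesis by (rule Lim_transform_eventually)
qed

text \<open>Up to the convergent factor \<open>rate n / sqrt (n * b n)\<close> the product is
  \<open>1 / sqrt (sqrt (q n))\<close>.\<close>

lemma increment_rate: "(%n. rate n * (rho n / sqrt (n * b n ^ 3))) \<longlonglongrightarrow> 0"
proof -
 have "(%n. sqrt ((rate n)\<^sup>2 / (n * b n)) * (1 / sqrt (sqrt (q n)))) \<longlonglongrightarrow> sqrt (1 / c) * 0"
  by (intro tendsto_mult tendsto_real_sqrt rate_sq_lim inverse_lim_0 sqrt_at_top_of q_top)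
 then have "(%n. sqrt ((rate n)\<^sup>2 / (n * b n)) * (1 / sqrt (sqrt (q n)))) \<longlonglongrightarrow> 0" by simp
 moreover have "LARGE n. sqrt ((rate n)\<^sup>2 / (n * b n)) * (1 / sqrt (sqrt (q n))) = rate n * (rho n / sqrt (n * b n ^ 3))"
  using eventually_gt_at_top[of 0]
 proof eventually_elim
  case (elim n)
  have "n * b n ^ 3 = (n * b n) * (b n)\<^sup>2" by (simp add: power2_eq_square power3_eq_cube)
  then have "sqrt (n * b n ^ 3) = sqrt (n * b n) * b n"
   using b_pos[of n] by (simp only: real_sqrt_mult[of "n * b n"] real_sqrt_abs abs_of_pos)
  moreover have "sqrt ((rate n)\<^sup>2 / (n * b n)) = rate n / sqrt (n * b n)"
   using rate_pos[OF elim] by (simp add: real_sqrt_divide)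
  ultimately show ?case using b_pos[of n] by (simp only: rho_def) simp
 qed
 ultimately show ?thesis by (rule Lim_transform_eventually)
qed

text \<open>Ensures that a tolerance of order \<open>1 / rate n\<close> eventually fits into the
  window \<open>rho n\<close>.\<close>

lemma rate_rho: "(%n. 1 / (rate n * rho n)) \<longlonglongrightarrow> 0"
proof -
 have "(%n. sqrt (cn n) * (1 / (b n * sqrt n) / rho n) * sqrt (b n)) \<longlonglongrightarrow> sqrt c * 0 * sqrt 0"
  by (intro tendsto_intros cn_lim dev_rate b_lim)
 then have "(%n. sqrt (cn n) * (1 / (b n * sqrt n) / rho n) * sqrt (b n)) \<longlonglongrightarrow> 0" by simp
 moreover have "LARGE n. norm (1 / (rate n * rho n)) <= sqrt (cn n) * (1 / (b n * sqrt n) / rho n) * sqrt (b n)"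
  using eventually_gt_at_top[of 0] b_le_1
 proof eventually_elim
  case (elim n)
  have p: "0 < rate n" "0 < cn n" "0 < b n" "0 < real n" "0 < rho n" using elim rate_pos cn_pos b_pos rho_pos by auto
  have "cn n * (rate n)\<^sup>2 = n * b n" using rate_sq[OF elim(1)] p by (simp add: field_simps)
  then have "sqrt (cn n) * rate n = sqrt n * sqrt (b n)"
   using p by (metis abs_of_pos real_sqrt_abs real_sqrt_mult)
  then have e: "1 / rate n = sqrt (cn n) / (sqrt n * sqrt (b n))" using p by (simp add: field_simps)
  have "1 / sqrt (b n) <= 1 / b n * sqrt (b n)"
  proof -
   have g: "1 / s\<^sup>2 * s = 1 / s" for s :: real by (simp add: power2_eq_square)
   have "1 / b n * sqrt (b n) = 1 / sqrt (b n)" using g[of "sqrt (b n)"] p by simp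
   then show ?thesis by simp
  qed
  then have "sqrt (cn n) / sqrt n / rho n * (1 / sqrt (b n)) <= sqrt (cn n) / sqrt n / rho n * (1 / b n * sqrt (b n))"
   using p by (intro mult_left_mono) auto
  moreover have "norm (1 / (rate n * rho n)) = 1 / rate n / rho n" using p by simp
  ultimately show ?case unfolding e by (simp add: mult_ac)
 qed
 ultimately show ?thesis by (rule Lim_null_comparison[rotated])
qed

text \<open>Up to a constant this bounds the entries of the triangular array in the central limit
  theorem.\<close>

lemma rate_nb: "(%n. rate n / (n * b n)) \<longlonglongrightarrow> 0"
proof -
 have "(%n. (rate n)\<^sup>2 / (n * b n) * (1 / rate n)) \<longlonglongrightarrow> 1 / c * 0"
  by (intro tendsto_mult rate_sq_lim inverse_lim_0 rate_top)
 then have "(%n. (rate n)\<^sup>2 / (n * b n) * (1 / rate n)) \<longlonglongrightarrow> 0" by simp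
 moreover have "LARGE n. (rate n)\<^sup>2 / (n * b n) * (1 / rate n) = rate n / (n * b n)"
  using eventually_gt_at_top[of 0] by eventually_elim (use rate_pos in \<open>simp add: power2_eq_square\<close>)
 ultimately show ?thesis by (rule Lim_transform_eventually)
qed

end

section \<open>The isotonized estimator\<close>

text \<open>Left of \<open>l\<close> the derivative of \<open>h\<close> is unknown, but
  \<open>h\<close> is within \<open>\<eta>\<close> of 0 and the chord has slope
  \<open>p >= 0\<close>, so going further left only lowers it. The quadratic gap built up between
  \<open>l\<close> and \<open>y\<close> exceeds the oscillation \<open>2 * \<eta>\<close>.\<close>

lemma chord_below_far_left:
 fixes h h' :: "real => real"
 assumes deriv: "\<And>v. (h has_real_derivative h' v) (at v)"
  and left: "\<And>v. l <= v ==> v <= y ==> \<alpha> * (y - v) - \<omega> <= p - h' v"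
  and small: "\<And>v. 0 <= v ==> v <= l ==> \<bar>h v\<bar> <= \<eta>"
  and p: "0 <= p" and l: "0 <= l" "l <= y" and gap: "2 * \<eta> + \<omega> * (y - l) <= \<alpha> / 2 * (y - l)\<^sup>2"
  and v: "0 <= v" "v <= l"
 shows "h y + p * (v - y) <= h v"
proof -
 define g where "g t = h t - (p + \<omega>) * t - \<alpha> / 2 * (y - t)\<^sup>2" for t
 have "g y <= g l"
 proof (rule DERIV_nonpos_imp_nonincreasing[OF l(2)])
  fix t assume t: "l <= t" "t <= y"
  have "(g has_real_derivative h' t - (p + \<omega>) + \<alpha> * (y - t)) (at t)"
   unfolding g_def[abs_def] by (auto intro!: derivative_eq_intros deriv simp: power2_eq_square field_simps)
  moreover have "h' t - (p + \<omega>) + \<alpha> * (y - t) <= 0" using left[OF t] by simp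
  ultimately show "\<exists>D. (g has_real_derivative D) (at t) \<and> D <= 0" by blast
 qed
 then have 1: "h y <= h l + p * (y - l) + \<omega> * (y - l) - \<alpha> / 2 * (y - l)\<^sup>2" by (simp add: g_def algebra_simps)
 have 2: "p * (v - l) <= 0" using p v by (intro mult_nonneg_nonpos) auto
 have 3: "p * (v - y) = p * (v - l) - p * (y - l)" by (simp add: algebra_simps)
 have "\<bar>h l\<bar> <= \<eta>" "\<bar>h v\<bar> <= \<eta>" using small[of l] small[OF v] l by auto
 then show ?thesis using 1 2 3 gap by linarith
qed

context cox_isotonic
begin

definition H :: "nat => 'w => real => real" where "H n w = smoothed (b n) n (ys w) (betahat n w)"

definition H' :: "nat => 'w => real => real" where "H' n w = smoothed' (b n) n (ys w) (betahat n w)"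

lemma H_deriv: "(H n w has_real_derivative H' n w v) (at v)"
 unfolding H_def H'_def by (rule smoothed_deriv[OF b_pos])

lemma H_cont: "continuous_on S (H n w)"
 unfolding H_def by (rule smoothed_continuous[OF b_pos])

lemma H_bounded_below: "\<exists>B. \<forall>u\<in>{0..taustar}. B <= H n w u"
proof -
 obtain B where "\<forall>u\<in>{0..taustar}. \<bar>H n w u\<bar> <= B" using continuous_on_interval_bounded[OF H_cont] by blast
 then have "\<forall>u\<in>{0..taustar}. - B <= H n w u" by (auto simp: abs_le_iff)
 then show ?thesis ..
qed

lemma rate_of_lim:
 assumes S: "Op S r" and "r \<longlonglongrightarrow> 0" "0 < e"
 shows "wpo (%n w. S n w <= e)"
 by (rule wpo_of_bdd_in_prob[OF S small_of_lim_0[OF assms(2,3)]])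

lemma uniform_deviation:
 assumes l: "0 < l" "l <= taustar"
 shows "\<exists>S. Op S (%n. 1 / (b n * sqrt n)) \<and>
  wpo (%n w. \<forall>v\<in>{l..taustar}. \<bar>H' n w v - lam0 v\<bar> <= S n w)"
proof -
 obtain SQ where SQ: "Op SQ (%n. 1 / (b n * sqrt n))" "\<And>n w v. v \<in> {l..taustar} ==> \<bar>Q (b n) n w v\<bar> <= SQ n w"
  using Q_sup[OF b_pos b_lim l(2) taustar(2)] by blast
 obtain SR where SR: "Op SR (%n. 1 / (b n * sqrt n))"
  "wpo (%n w. \<forall>v\<in>{l..taustar}. \<bar>resid (b n) n w (betahat n w) v\<bar> <= SR n w)"
  using R_sup[OF root_n b_pos b_lim l(1) taustar(2)] by blast
 obtain C where C: "0 <= C" "\<And>h v. 0 < h ==> 0 < v - h ==> v + h < tauH ==> \<bar>mean h v - lam0 v\<bar> <= C * h ^ m"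
  using bias_uniform by blast
 have "Op (%n w. b n ^ m) (%n. b n ^ m)"
  by (rule bdd_in_prob_const) (simp add: b_pos less_imp_le)
 then have "Op (%n w. b n ^ m) (%n. 1 / (b n * sqrt n))"
  by (rule bdd_in_prob_rate[OF _ _ bias_rate]) (simp add: b_pos less_imp_le)
 then have Sb: "Op (%n w. SQ n w + SR n w + C * b n ^ m) (%n. 1 / (b n * sqrt n))"
  using C by (intro bdd_in_prob_add bdd_in_prob_cmult SQ SR)
 have "LARGE n. b n < min l (tauH - taustar)"
  using l taustar tau2 by (intro order_tendstoD(2)[OF b_lim]) auto
 then have "LARGE n. \<forall>w\<in>space M.
  (\<forall>v\<in>{l..taustar}. \<bar>resid (b n) n w (betahat n w) v\<bar> <= SR n w) -->
  (\<forall>v\<in>{l..taustar}. \<bar>H' n w v - lam0 v\<bar> <= SQ n w + SR n w + C * b n ^ m)"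
 proof eventually_elim
  case (elim n)
  show ?case
  proof (intro ballI impI)
   fix w v assume R: "\<forall>v\<in>{l..taustar}. \<bar>resid (b n) n w (betahat n w) v\<bar> <= SR n w"
    and v: "v \<in> {l..taustar}"
   have "\<bar>mean (b n) v - lam0 v\<bar> <= C * b n ^ m" using v elim b_pos by (intro C) auto
   moreover have "\<bar>Q (b n) n w v\<bar> <= SQ n w" using v by (rule SQ)
   moreover have "\<bar>resid (b n) n w (betahat n w) v\<bar> <= SR n w" using R v by blast
   ultimately show "\<bar>H' n w v - lam0 v\<bar> <= SQ n w + SR n w + C * b n ^ m"
    unfolding H'_def Q_def by linarith
  qed
 qed
 from wpo_eventually_mp[OF SR(2) this] Sb show ?thesis by blast
qed

definition small_const :: real where "small_const = 4 * kB / \<kappa> * (2 * lamB * Env + 1)"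

lemma small_interval:
 assumes "0 < y" "0 < \<gamma>" shows "\<exists>l. 0 < l \<and> l <= y / 2 \<and> small_const * l <= \<gamma>"
proof -
 have s: "0 <= small_const"
  using kB_nonneg \<kappa>_pos lamB_nonneg Env_nonneg by (simp add: small_const_def)
 define l where "l = min (y / 2) (\<gamma> / (small_const + 1))"
 have "small_const * l <= (small_const + 1) * (\<gamma> / (small_const + 1))"
  using s assms by (intro mult_mono) (auto simp: l_def)
 also have "... = \<gamma>" using s by simp
 finally have "small_const * l <= \<gamma>" .
 moreover have "0 < l" using s assms by (simp add: l_def)
 moreover have "l <= y / 2" unfolding l_def by (rule min.cobounded1)
 ultimately show ?thesis by blast
qed

lemma H_small:
 assumes "0 < l" "2 * l <= tau2"
 shows "wpo (%n w. \<forall>v\<in>{0..l}. \<bar>H n w v\<bar> <= small_const * l)"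
 using smoothed_small_near_0[OF root_n b_pos b_lim assms] by (simp add: H_def small_const_def)

text \<open>At every \<open>y\<close> the minorant is compared with the slope \<open>lam0 y\<close>,
  with growth rate \<open>a\<close> and error \<open>\<omega>\<close>. All requirements on the
  sample are uniform in \<open>y\<close>, so one event serves the whole interval.\<close>

lemma uniform_rate:
 assumes lu: "0 < l" "l < u" "u < taustar"
 shows "\<exists>S. Op S (%n. 1 / (b n * sqrt n)) \<and>
  wpo (%n w. \<forall>y\<in>{l..u}. \<bar>left_deriv (gcm taustar (H n w)) y - lam0 y\<bar> <= S n w)"
proof -
 \<comment> \<open>Left of \<open>l0\<close> only smallness is known. The bound
   \<open>a * l\<^sup>2 / 32\<close> makes \<open>2 * small_const * l0\<close> at most half of
   \<open>a / 2 * (y - l0)\<^sup>2\<close>, since \<open>y - l0\<close> is at least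
   \<open>l / 2\<close>; the condition that \<open>\<omega>\<close> is at most
   \<open>a * l / 8\<close> spends the other half.\<close>
 obtain l0 where l0: "0 < l0" "l0 <= l / 2" "small_const * l0 <= a * l\<^sup>2 / 32"
  using small_interval[of l "a * l\<^sup>2 / 32"] lu a_pos by auto
 obtain S where S: "Op S (%n. 1 / (b n * sqrt n))"
  "wpo (%n w. \<forall>v\<in>{l0..taustar}. \<bar>H' n w v - lam0 v\<bar> <= S n w)"
  using uniform_deviation[of l0] l0 lu by auto
 \<comment> \<open>The deterministic term makes \<open>\<omega>\<close> strictly positive, as it
   serves as a step length.\<close>
 define \<omega> where "\<omega> n w = S n w + 1 / (b n * sqrt n)" for n w
 have "Op (%n w. 1 / (b n * sqrt n)) (%n. 1 / (b n * sqrt n))"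
  by (rule bdd_in_prob_const) (simp add: b_pos less_imp_le)
 then have \<omega>b: "Op \<omega> (%n. 1 / (b n * sqrt n))"
  unfolding \<omega>_def by (intro bdd_in_prob_add S)
 define e where "e = min (a * l / 8) (min (l / 2) (taustar - u))"
 have e: "0 < e" using a_pos lu by (simp add: e_def)
 define c1 where "c1 = Lip + 1 + 1 / (2 * a)"
 have "LARGE n. \<forall>w\<in>space M.
  (\<forall>v\<in>{l0..taustar}. \<bar>H' n w v - lam0 v\<bar> <= S n w) \<and> (\<forall>v\<in>{0..l0}. \<bar>H n w v\<bar> <= small_const * l0) \<and> \<omega> n w <= e -->
  (\<forall>y\<in>{l..u}. \<bar>left_deriv (gcm taustar (H n w)) y - lam0 y\<bar> <= c1 * \<omega> n w)"
  using eventually_gt_at_top[of 0]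
 proof eventually_elim
  case (elim n)
  show ?case
  proof (intro ballI impI, elim conjE)
   fix w y
   assume dev: "\<forall>v\<in>{l0..taustar}. \<bar>H' n w v - lam0 v\<bar> <= S n w"
    and sm: "\<forall>v\<in>{0..l0}. \<bar>H n w v\<bar> <= small_const * l0" and we: "\<omega> n w <= e" and y: "y \<in> {l..u}"
   have an: "0 < 1 / (b n * sqrt n)" using b_pos[of n] elim by simp
   have S0: "0 <= S n w" using dev[rule_format, of taustar] l0 lu by auto
   then have \<omega>: "0 < \<omega> n w" using an unfolding \<omega>_def by linarith
   have dev': "\<bar>H' n w v - lam0 v\<bar> <= \<omega> n w" if "l0 <= v" "v <= taustar" for v
   proof -
    have "\<bar>H' n w v - lam0 v\<bar> <= S n w" using dev that by auto
    then show ?thesis using an unfolding \<omega>_def by linarith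
   qed
   have we': "\<omega> n w <= a * l / 8" "\<omega> n w <= l / 2" "\<omega> n w <= taustar - u" using we by (auto simp: e_def)
   have yb: "l <= y" "y <= u" using y by auto
   have left: "a * (y - v) - \<omega> n w <= lam0 y - H' n w v" if "l0 <= v" "v <= y" for v
    using slope[of v y] dev'[of v] that l0 lu yb taustar tau2 by auto
   obtain B where B: "\<forall>u\<in>{0..taustar}. B <= H n w u" using H_bounded_below by blast
   have "\<bar>left_deriv (gcm taustar (H n w)) y - lam0 y\<bar> <= (Lip + 1 + 1 / (2 * a)) * \<omega> n w"
   proof (rule gcm_left_deriv_approx[OF B, where \<delta> = "y - l0" and h' = "H' n w"])
    show "0 <= y - (y - l0)" "y + \<omega> n w <= taustar" "0 < \<omega> n w" "\<omega> n w <= y - l0" "0 < a"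
     using l0 yb \<omega> we' a_pos by auto
    show "(H n w has_real_derivative H' n w v) (at v)" for v by (rule H_deriv)
    show "a * (v - y) - \<omega> n w <= H' n w v - lam0 y" if "y <= v" "v <= taustar" for v
     using slope[of y v] dev'[of v] that l0 lu yb taustar tau2 by auto
    show "a * (y - v) - \<omega> n w <= lam0 y - H' n w v" if "y - (y - l0) <= v" "v <= y" for v
     using left[of v] that by simp
    show "\<bar>H' n w v - lam0 y\<bar> <= (Lip + 1) * \<omega> n w" if "\<bar>v - y\<bar> <= \<omega> n w" for v
    proof -
     have v: "l0 <= v" "v <= taustar" using that we' yb l0 by linarith+
     have "\<bar>lam0 v - lam0 y\<bar> <= Lip * \<bar>v - y\<bar>" using v yb l0 lu taustar tau2 by (intro Lip) auto
     also have "... <= Lip * \<omega> n w" using that Lip(1) by (intro mult_left_mono)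
     finally show ?thesis using dev'[OF v] by (simp add: distrib_right)
    qed
    show "H n w y + lam0 y * (v - y) <= H n w v" if "0 <= v" "v <= y - (y - l0)" for v
    proof (rule chord_below_far_left[OF H_deriv left])
     show "\<bar>H n w v\<bar> <= small_const * l0" if "0 <= v" "v <= l0" for v using sm that by auto
     show "0 <= lam0 y" using lam0_pos[of y] yb lu taustar tau2 by (auto intro: less_imp_le)
     define \<delta> where "\<delta> = y - l0"
     have d: "l / 2 <= \<delta>" "0 < l" using yb l0 lu by (auto simp: \<delta>_def)
     have "(l / 2)\<^sup>2 <= \<delta>\<^sup>2" using d by (intro power_mono) auto
     then have "a / 4 * (l / 2)\<^sup>2 <= a / 4 * \<delta>\<^sup>2" using a_pos by (intro mult_left_mono) auto
     then have 1: "2 * (small_const * l0) <= a / 4 * \<delta>\<^sup>2" using l0(3) by (simp add: power2_eq_square)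
     have "\<omega> n w <= a / 4 * \<delta>"
     proof -
      have "a / 4 * (l / 2) <= a / 4 * \<delta>" using a_pos d by (intro mult_left_mono) auto
      then show ?thesis using we'(1) by simp
     qed
     then have "\<omega> n w * \<delta> <= a / 4 * \<delta> * \<delta>" using d by (intro mult_right_mono) auto
     then show "2 * (small_const * l0) + \<omega> n w * (y - l0) <= a / 2 * (y - l0)\<^sup>2"
      using 1 by (simp add: power2_eq_square flip: \<delta>_def)
    qed (use that l0 yb lu in auto)
   qed
   then show "\<bar>left_deriv (gcm taustar (H n w)) y - lam0 y\<bar> <= c1 * \<omega> n w" by (simp add: c1_def)
  qed
 qed
 from wpo_eventually_mp[OF wpo_conj[OF S(2) wpo_conj[OF H_small rate_of_lim[OF \<omega>b dev_rate(1) e]]] this]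
 have "wpo (%n w. \<forall>y\<in>{l..u}. \<bar>left_deriv (gcm taustar (H n w)) y - lam0 y\<bar> <= c1 * \<omega> n w)"
  using l0 lu taustar by simp
 moreover have "Op (%n w. c1 * \<omega> n w) (%n. 1 / (b n * sqrt n))"
  using Lip(1) a_pos by (intro bdd_in_prob_cmult \<omega>b) (simp add: c1_def)
 ultimately show ?thesis by blast
qed

text \<open>The reference slope is \<open>H' n w x\<close> and not \<open>lam0 x\<close>, so only
  increments of the error matter. Within \<open>rho n\<close> of \<open>x\<close> they are
  controlled by \<open>Q_increment\<close>, \<open>R_local\<close> and
  \<open>mean_increment\<close>; further away three quarters of the slope \<open>a\<close> absorb
  the uniform deviation, and the growth rate \<open>a / 4\<close> remains.\<close>

lemma local_approx:
 assumes x: "0 < x" "x < taustar" and \<epsilon>: "0 < \<epsilon>"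
 shows "wpo (%n w. \<bar>left_deriv (gcm taustar (H n w)) x - H' n w x\<bar> <= (Lip + 2 + 2 / a) * (\<epsilon> / rate n))"
proof -
 \<comment> \<open>With growth rate \<open>a / 4\<close> the available gap is
   \<open>a / 8 * (x - l0)\<^sup>2\<close>. The 128 assigns half of it to the values near 0; the 32
   in the definition of \<open>e\<close> assigns the other half to the tolerance.\<close>
 obtain l0 where l0: "0 < l0" "l0 <= x / 2" "small_const * l0 <= a * x\<^sup>2 / 128"
  using small_interval[of x "a * x\<^sup>2 / 128"] x a_pos by auto
 obtain S where S: "Op S (%n. 1 / (b n * sqrt n))"
  "wpo (%n w. \<forall>v\<in>{l0..taustar}. \<bar>H' n w v - lam0 v\<bar> <= S n w)"
  using uniform_deviation[of l0] l0 x by auto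
 have xt: "x < tau2" using x taustar by simp
 have "LARGE n. b n < (tau2 - x) / 2" using xt by (intro order_tendstoD(2)[OF b_lim]) auto
 then have "LARGE n. x + rho n + b n <= tau2" using rho_le_b by eventually_elim simp
 from Q_increment[OF b_pos rho_pos this]
 obtain SI where SI: "Op SI (%n. rho n / sqrt (n * b n ^ 3))"
  "\<And>n w v. 0 < n ==> \<bar>v - x\<bar> <= rho n ==> \<bar>Q (b n) n w v - Q (b n) n w x\<bar> <= SI n w" by blast
 obtain SR where SR: "Op SR (%n. 1 / sqrt n)"
  "wpo (%n w. \<forall>v. \<bar>v - x\<bar> <= b n --> \<bar>resid (b n) n w (betahat n w) v\<bar> <= SR n w)"
  using R_local[OF root_n b_pos b_lim xt] by blast
 obtain C where C: "0 <= C" "\<And>h y v. 0 < h ==> 0 <= y - h ==> y + h <= tauH ==> 0 <= v - h ==> v + h <= tauH ==>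
   \<bar>mean h v - mean h y - (lam0 v - lam0 y)\<bar> <= C * h * \<bar>v - y\<bar>" using mean_increment by blast
 have scale: "LARGE n. K * r n <= e / rate n" if "(%n. rate n * r n) \<longlonglongrightarrow> 0" "0 < e" for r :: "nat => real" and K e
  using small_of_lim_0[OF that, of K] eventually_gt_at_top[of 0]
  by eventually_elim (simp add: pos_le_divide_eq rate_pos mult_ac)
 have w1: "wpo (%n w. SI n w <= (\<epsilon> / 2) / rate n)"
  by (rule wpo_of_bdd_in_prob[OF SI(1) scale[OF increment_rate]]) (use \<epsilon> in simp)
 have w2: "wpo (%n w. SR n w <= (\<epsilon> / 4) / rate n)"
  by (rule wpo_of_bdd_in_prob[OF SR(1) scale[OF rate_sqrt_lim]]) (use \<epsilon> in simp)
 \<comment> \<open>The deviations at \<open>v\<close> and at \<open>x\<close> add up to at most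
   \<open>3 * a / 4 * rho n\<close>, hence to \<open>3 * a / 4 * \<bar>v - x\<bar>\<close> outside
   the window.\<close>
 have w3: "wpo (%n w. S n w <= 3 * a / 8 * rho n)"
 proof (rule wpo_of_bdd_in_prob[OF S(1)])
  fix K :: real
  have "0 < 3 * a / 8" using a_pos by simp
  from small_of_lim_0[OF dev_rate(2) this, of K]
  show "LARGE n. K * (1 / (b n * sqrt n)) <= 3 * a / 8 * rho n"
   using eventually_gt_at_top[of 0]
  proof eventually_elim
   case (elim n)
   have "K * (1 / (b n * sqrt n)) = K * (1 / (b n * sqrt n) / rho n) * rho n" using rho_pos[OF elim(2)] by simp
   also have "... <= 3 * a / 8 * rho n" using elim rho_pos[OF elim(2)] by (intro mult_right_mono) auto
   finally show ?case .
  qed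
 qed
 have lx: "0 < lam0 x" using lam0_pos[of x] x taustar tau2 by auto
 \<comment> \<open>Makes the reference slope \<open>H' n w x\<close> nonnegative, as
   \<open>chord_below_far_left\<close> demands.\<close>
 have w4: "wpo (%n w. S n w <= lam0 x)" by (rule rate_of_lim[OF S(1) dev_rate(1) lx])
 have w5: "wpo (%n w. \<forall>v\<in>{0..l0}. \<bar>H n w v\<bar> <= small_const * l0)"
  using x l0 taustar by (intro H_small) auto
 define e where "e = min (a * x / 32) (min (x / 2) (taustar - x))"
 have e: "0 < e" using a_pos x by (simp add: e_def)
 \<comment> \<open>Keeps the kernel windows inside \<open>{0..taustar}\<close> and makes
   \<open>C * b n\<close> at most 1 and at most \<open>a / 2\<close>.\<close>
 define d where "d = min (min (x / 2) ((taustar - x) / 2)) (min 1 (a / 2) / (C + 1))"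
 have d: "0 < d" using a_pos x C by (simp add: d_def)
 have ev1: "LARGE n. b n < d" by (rule order_tendstoD(2)[OF b_lim d])
 have ev2: "LARGE n. \<epsilon> * (1 / (rate n * rho n)) <= 1" by (rule small_of_lim_0[OF rate_rho]) simp
 have ev3: "LARGE n. \<epsilon> * (1 / rate n) <= e" by (rule small_of_lim_0[OF inverse_lim_0[OF rate_top] e])
 have "LARGE n. \<forall>w\<in>space M.
  (\<forall>v\<in>{l0..taustar}. \<bar>H' n w v - lam0 v\<bar> <= S n w) \<and>
  (\<forall>v. \<bar>v - x\<bar> <= b n --> \<bar>resid (b n) n w (betahat n w) v\<bar> <= SR n w) \<and>
  SI n w <= (\<epsilon> / 2) / rate n \<and> SR n w <= (\<epsilon> / 4) / rate n \<and> S n w <= 3 * a / 8 * rho n \<and> S n w <= lam0 x \<and>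
  (\<forall>v\<in>{0..l0}. \<bar>H n w v\<bar> <= small_const * l0) -->
  \<bar>left_deriv (gcm taustar (H n w)) x - H' n w x\<bar> <= (Lip + 2 + 2 / a) * (\<epsilon> / rate n)"
  using ev1 ev2 ev3 rho_le_b eventually_gt_at_top[of 0]
 proof eventually_elim
  case (elim n)
  show ?case
  proof (intro ballI impI, elim conjE)
   fix w
   assume dev: "\<forall>v\<in>{l0..taustar}. \<bar>H' n w v - lam0 v\<bar> <= S n w"
    and R: "\<forall>v. \<bar>v - x\<bar> <= b n --> \<bar>resid (b n) n w (betahat n w) v\<bar> <= SR n w"
    and SIw: "SI n w <= (\<epsilon> / 2) / rate n" and SRw: "SR n w <= (\<epsilon> / 4) / rate n"
    and S1: "S n w <= 3 * a / 8 * rho n" and S2: "S n w <= lam0 x"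
    and sm: "\<forall>v\<in>{0..l0}. \<bar>H n w v\<bar> <= small_const * l0"
   define \<omega> where "\<omega> = \<epsilon> / rate n"
   have \<omega>: "0 < \<omega>" using \<epsilon> rate_pos[OF elim(5)] by (simp add: \<omega>_def)
   have \<omega>\<rho>: "\<omega> <= rho n"
    using elim(2) rate_pos[OF elim(5)] rho_pos[OF elim(5)] by (simp add: \<omega>_def field_simps)
   have \<omega>e: "\<omega> <= a * x / 32" "\<omega> <= x / 2" "\<omega> <= taustar - x" using elim(3) by (auto simp: \<omega>_def e_def)
   have bd: "b n <= x / 2" "b n <= (taustar - x) / 2" using elim(1) by (auto simp: d_def)
   have "C * b n <= (C + 1) * (min 1 (a / 2) / (C + 1))"
    using elim(1) C(1) b_pos[of n] a_pos by (intro mult_mono) (auto simp: d_def)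
   also have "... = min 1 (a / 2)" using C(1) by simp
   finally have Cb: "C * b n <= 1" "C * b n <= a / 2" by auto
   have dx: "\<bar>H' n w x - lam0 x\<bar> <= S n w" using dev l0 x by auto
   have local: "\<bar>H' n w v - H' n w x - (lam0 v - lam0 x)\<bar> <= C * b n * \<bar>v - x\<bar> + \<omega>" if v: "\<bar>v - x\<bar> <= rho n" for v
   proof -
    have vb: "\<bar>v - x\<bar> <= b n" using v elim(4) by simp
    have "\<bar>mean (b n) v - mean (b n) x - (lam0 v - lam0 x)\<bar> <= C * b n * \<bar>v - x\<bar>"
     by (rule C(2)[OF b_pos]) (use bd vb b_pos[of n] x taustar tau2 in auto)
    moreover have "\<bar>Q (b n) n w v - Q (b n) n w x\<bar> <= \<omega> / 2" using SI(2)[OF elim(5) v, of w] SIw by (simp add: \<omega>_def)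
    moreover have "\<bar>H' n w v - emp n (psi (b n) v) (ys w)\<bar> <= \<omega> / 4"
     using R vb SRw unfolding H'_def \<omega>_def by fastforce
    moreover have "\<bar>H' n w x - emp n (psi (b n) x) (ys w)\<bar> <= \<omega> / 4"
     using R[rule_format, of x] b_pos[of n] SRw by (simp add: H'_def \<omega>_def)
    ultimately show ?thesis unfolding Q_def by linarith
   qed
   have global: "\<bar>H' n w v - H' n w x - (lam0 v - lam0 x)\<bar> <= 3 * a / 4 * \<bar>v - x\<bar> + \<omega>" if v: "l0 <= v" "v <= taustar" for v
   proof (cases "\<bar>v - x\<bar> <= rho n")
    case True
    have "C * b n * \<bar>v - x\<bar> <= 3 * a / 4 * \<bar>v - x\<bar>" using Cb a_pos by (intro mult_right_mono) auto
    then show ?thesis using local[OF True] by linarith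
   next
    case False
    then have "3 * a / 4 * rho n <= 3 * a / 4 * \<bar>v - x\<bar>" using a_pos by (intro mult_left_mono) auto
    moreover have "\<bar>H' n w v - lam0 v\<bar> <= S n w" using dev v by auto
    ultimately show ?thesis using dx S1 \<omega> by linarith
   qed
   have left: "a / 4 * (x - v) - \<omega> <= H' n w x - H' n w v" if "l0 <= v" "v <= x" for v
   proof -
    have "a * (x - v) <= lam0 x - lam0 v" using that l0 x taustar tau2 by (intro slope) auto
    moreover have "\<bar>H' n w v - H' n w x - (lam0 v - lam0 x)\<bar> <= 3 * a / 4 * (x - v) + \<omega>" using global[of v] that x by simp
    moreover have "3 * a / 4 * (x - v) = a * (x - v) - a / 4 * (x - v)" by (simp add: field_simps)
    ultimately show ?thesis by linarith
   qed
   obtain B where B: "\<forall>u\<in>{0..taustar}. B <= H n w u" using H_bounded_below by blast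
   have "\<bar>left_deriv (gcm taustar (H n w)) x - H' n w x\<bar> <= (Lip + 2 + 1 / (2 * (a / 4))) * \<omega>"
   proof (rule gcm_left_deriv_approx[OF B, where \<delta> = "x - l0" and h' = "H' n w"])
    show "0 <= x - (x - l0)" "x + \<omega> <= taustar" "0 < \<omega>" "\<omega> <= x - l0" "0 < a / 4"
     using l0 \<omega> \<omega>e a_pos by auto
    show "(H n w has_real_derivative H' n w v) (at v)" for v by (rule H_deriv)
    show "a / 4 * (v - x) - \<omega> <= H' n w v - H' n w x" if "x <= v" "v <= taustar" for v
    proof -
     have "a * (v - x) <= lam0 v - lam0 x" using that x taustar tau2 by (intro slope) auto
     moreover have "\<bar>H' n w v - H' n w x - (lam0 v - lam0 x)\<bar> <= 3 * a / 4 * (v - x) + \<omega>" using global[of v] that x l0 by simp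
     moreover have "3 * a / 4 * (v - x) = a * (v - x) - a / 4 * (v - x)" by (simp add: field_simps)
     ultimately show ?thesis by linarith
    qed
    show "a / 4 * (x - v) - \<omega> <= H' n w x - H' n w v" if "x - (x - l0) <= v" "v <= x" for v
     using left[of v] that by simp
    show "\<bar>H' n w v - H' n w x\<bar> <= (Lip + 2) * \<omega>" if "\<bar>v - x\<bar> <= \<omega>" for v
    proof -
     have "\<bar>lam0 v - lam0 x\<bar> <= Lip * \<bar>v - x\<bar>" using that \<omega>e x taustar tau2 by (intro Lip) auto
     also have "... <= Lip * \<omega>" using that Lip(1) by (intro mult_left_mono)
     finally have 1: "\<bar>lam0 v - lam0 x\<bar> <= Lip * \<omega>" .
     have "C * b n * \<bar>v - x\<bar> <= 1 * \<omega>" using that Cb C(1) b_pos[of n] by (intro mult_mono) auto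
     then show ?thesis using 1 local[of v] that \<omega>\<rho> by (simp add: distrib_right)
    qed
    show "H n w x + H' n w x * (v - x) <= H n w v" if "0 <= v" "v <= x - (x - l0)" for v
    proof (rule chord_below_far_left[OF H_deriv left])
     show "\<bar>H n w v\<bar> <= small_const * l0" if "0 <= v" "v <= l0" for v using sm that by auto
     show "0 <= H' n w x" using dx S2 by linarith
     define \<delta> where "\<delta> = x - l0"
     have dd: "x / 2 <= \<delta>" "0 < x" using l0 x by (auto simp: \<delta>_def)
     have "(x / 2)\<^sup>2 <= \<delta>\<^sup>2" using dd by (intro power_mono) auto
     then have "a / 16 * (x / 2)\<^sup>2 <= a / 16 * \<delta>\<^sup>2" using a_pos by (intro mult_left_mono) auto
     then have 1: "2 * (small_const * l0) <= a / 16 * \<delta>\<^sup>2" using l0(3) by (simp add: power2_eq_square)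
     have "\<omega> <= a / 16 * \<delta>"
     proof -
      have "a / 16 * (x / 2) <= a / 16 * \<delta>" using a_pos dd by (intro mult_left_mono) auto
      then show ?thesis using \<omega>e(1) by simp
     qed
     then have "\<omega> * \<delta> <= a / 16 * \<delta> * \<delta>" using dd by (intro mult_right_mono) auto
     then show "2 * (small_const * l0) + \<omega> * (x - l0) <= a / 4 / 2 * (x - l0)\<^sup>2"
      using 1 by (simp add: power2_eq_square flip: \<delta>_def)
    qed (use that l0 x in auto)
   qed
   then show "\<bar>left_deriv (gcm taustar (H n w)) x - H' n w x\<bar> <= (Lip + 2 + 2 / a) * (\<epsilon> / rate n)"
    by (simp add: \<omega>_def)
  qed
 qed
 from wpo_eventually_mp[OF wpo_conj[OF S(2) wpo_conj[OF SR(2) wpo_conj[OF w1 wpo_conj[OF w2 wpo_conj[OF w3 wpo_conj[OF w4 w5]]]]]] this]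
 show ?thesis .
qed

section \<open>Asymptotic normality and uniform consistency\<close>

lemma psi_bounds:
 assumes h: "0 < h" "v + h <= tau2"
 shows "\<bar>psi h v y\<bar> <= kB / (h * \<kappa>)" "integrable P (psi h v)" "\<bar>mean h v\<bar> <= kB / (h * \<kappa>)"
proof -
 have c0: "0 <= kB / (h * \<kappa>)" using kB_nonneg \<kappa>_pos h by simp
 show 1: "\<bar>psi h v y\<bar> <= kB / (h * \<kappa>)" for y
 proof -
  have "\<bar>psi h v y\<bar> = event y * \<bar>k ((v - fst y) / h) / h / phi (fst y)\<bar>"
   by (simp only: psi_def abs_mult abs_of_nonneg[OF event_nonneg])
  also have "... <= 1 * (kB / (h * \<kappa>) * indicator {v-h..v+h} (fst y))"
   by (intro mult_mono event_le_1 kernel_div(1)[OF h k_supp k_bound h(1)]) simp_all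
  also have "... <= kB / (h * \<kappa>)" using c0 by (simp add: indicator_def)
  finally show ?thesis .
 qed
 show i: "integrable P (psi h v)"
  by (rule obs.integrable_const_bound[of _ "kB / (h * \<kappa>)"]) (use 1 in \<open>simp_all add: measurable_P\<close>)
 have "\<bar>mean h v\<bar> = \<bar>\<integral>y. psi h v y \<partial>P\<bar>" unfolding psi_mean(1)[OF h] ..
 also have "... <= (\<integral>y. \<bar>psi h v y\<bar> \<partial>P)" by (rule integral_abs_bound)
 also have "... <= (\<integral>y. kB / (h * \<kappa>) \<partial>P)"
  using i 1 by (intro integral_mono) auto
 finally show "\<bar>mean h v\<bar> <= kB / (h * \<kappa>)" by (simp add: obs.prob_space)
qed

text \<open>Squaring divides by \<open>phi\<close> twice while the event intensity supplies it once;
  the remaining quotient of \<open>lam0\<close> and \<open>phi\<close> passes into the limiting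
  variance.\<close>

lemma psi_sq_integral:
 assumes h: "0 < h" "0 <= v - h" "v + h <= tau2"
 shows "h * (\<integral>y. (psi h v y)\<^sup>2 \<partial>P) = (\<integral>z. (k z)\<^sup>2 * (lam0 (v - h * z) / phi (v - h * z)) \<partial>lborel)"
proof -
 define g where "g s = (k ((v - s) / h) / h / phi s)\<^sup>2" for s
 have [measurable]: "k \<in> borel_measurable borel" using k_cont by (rule borel_measurable_continuous_onI)
 have gm: "g \<in> borel_measurable borel" unfolding g_def by measurable
 have c0: "0 <= kB / (h * \<kappa>)" using kB_nonneg \<kappa>_pos h by simp
 have gb: "\<bar>g s\<bar> <= (kB / (h * \<kappa>))\<^sup>2" for s
 proof -
  have "\<bar>k ((v - s) / h) / h / phi s\<bar> <= kB / (h * \<kappa>) * indicator {v-h..v+h} s"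
   by (rule kernel_div(1)[OF h(1,3) k_supp k_bound h(1)])
  also have "... <= kB / (h * \<kappa>)" using c0 by (simp add: indicator_def)
  finally have "\<bar>k ((v - s) / h) / h / phi s\<bar>\<^sup>2 <= (kB / (h * \<kappa>))\<^sup>2" by (intro power_mono) auto
  then show ?thesis by (simp only: g_def power2_abs abs_power2)
 qed
 define f where "f s = indicator {0..tauH} s * (lam0 s * phi s * g s)" for s
 have "(\<integral>y. (psi h v y)\<^sup>2 \<partial>P) = (\<integral>y. event y * g (fst y) \<partial>P)"
  by (intro Bochner_Integration.integral_cong refl) (simp only: psi_def g_def power_mult_distrib[of "event _"] event_sq)
 also have "... = (\<integral>s. f s \<partial>lborel)"
  unfolding f_def by (rule integral_event(2)[OF gm gb])
 also have "... = \<bar>- h\<bar> * (\<integral>z. f (v + (- h) * z) \<partial>lborel)"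
  using lborel_integral_real_affine[of "- h" f v] h by simp
 finally have "h * (\<integral>y. (psi h v y)\<^sup>2 \<partial>P) = (\<integral>z. h\<^sup>2 * f (v + (- h) * z) \<partial>lborel)"
  using h by (simp add: power2_eq_square)
 also have "... = (\<integral>z. (k z)\<^sup>2 * (lam0 (v - h * z) / phi (v - h * z)) \<partial>lborel)"
 proof (rule Bochner_Integration.integral_cong[OF refl])
  fix z
  show "h\<^sup>2 * f (v + (- h) * z) = (k z)\<^sup>2 * (lam0 (v - h * z) / phi (v - h * z))"
  proof (cases "z \<in> {-1..1}")
   case True
   have "h * z <= h * 1" "h * (-1) <= h * z" using True h by (intro mult_left_mono; simp)+
   then have w: "v - h * z \<in> {0..tauH}" "v - h * z <= tau2"
    using h tau2 unfolding atLeastAtMost_iff by linarith+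
   have p: "0 < phi (v - h * z)" using \<kappa>_le[OF w(2)] \<kappa>_pos by linarith
   have e: "(v - (v - h * z)) / h = z" using h by simp
   have g: "h\<^sup>2 * (l * p * (kz / h / p)\<^sup>2) = kz\<^sup>2 * (l / p)" if "0 < p" for l p kz :: real
    using that h by (simp add: power2_eq_square field_simps)
   show ?thesis using w g[OF p] e by (simp add: f_def g_def)
  qed (use k_supp h in \<open>simp add: f_def g_def\<close>)
 qed
 finally show ?thesis .
qed

text \<open>The window shrinks to \<open>x\<close>, where the quotient \<open>G\<close> is
  continuous; continuity of the risk enters here.\<close>

lemma variance_limit:
 assumes x: "0 < x" "x < taustar" and cont: "isCont phi x"
 shows "(%n. b n * (\<integral>y. (psi (b n) x y)\<^sup>2 \<partial>P)) \<longlonglongrightarrow> lam0 x / phi x * (\<integral>z. (k z)\<^sup>2 \<partial>lborel)"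
  (is "?f \<longlonglongrightarrow> ?l")
proof (rule LIMSEQ_I)
 fix r :: real assume r: "0 < r"
 define e where "e = r / (2 * kB\<^sup>2 + 1)"
 have e: "0 < e" using r by (simp add: e_def add_nonneg_pos)
 define G where "G t = lam0 t / phi t" for t
 have "isCont lam0 x" using obs.lam0_cont x taustar tau2
  by (intro continuous_on_interior) (auto simp: interior_atLeastAtMost_real)
 moreover have px: "phi x \<noteq> 0" using \<kappa>_le[of x] \<kappa>_pos x taustar by auto
 ultimately have Gc: "isCont G x" unfolding G_def[abs_def] using cont by (intro continuous_intros)
 obtain d where d: "0 < d" "\<And>t. \<bar>t - x\<bar> < d ==> \<bar>G t - G x\<bar> < e"
  using continuous_at_real_range[THEN iffD1, rule_format, OF Gc e] by auto
 have [measurable]: "k \<in> borel_measurable borel" using k_cont by (rule borel_measurable_continuous_onI)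
 have lm: "(%s. indicator {0..tauH} s * lam0 s) \<in> borel_measurable borel"
  using borel_measurable_continuous_on_indicator[OF _ obs.lam0_cont] by simp
 have "LARGE n. b n < min d (min x (tau2 - x))"
  using d x taustar by (intro order_tendstoD(2)[OF b_lim]) auto
 then have "LARGE n. norm (?f n - ?l) < r"
 proof eventually_elim
  case (elim n)
  have w: "0 <= x - b n" "x + b n <= tau2" using elim by auto
  have z: "\<bar>b n * z\<bar> < d \<and> x - b n * z \<in> {0..tauH}" if "z \<in> {-1..1}" for z
  proof -
   have "b n * z <= b n * 1" "b n * (-1) <= b n * z" using b_pos[of n] that by (intro mult_left_mono; simp)+
   then show ?thesis using elim tau2 unfolding atLeastAtMost_iff abs_less_iff by linarith
  qed
  have close: "\<bar>(k z)\<^sup>2 * (G (x - b n * z) - G x)\<bar> <= kB\<^sup>2 * e * indicator {-1..1} z" for z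
  proof (cases "z \<in> {-1..1}")
   case True
   have "(k z)\<^sup>2 <= kB\<^sup>2" using k_bound[of z] by (metis abs_le_square_iff abs_of_nonneg kB_nonneg)
   moreover have "\<bar>G (x - b n * z) - G x\<bar> <= e" using d(2)[of "x - b n * z"] z[OF True] by simp
   ultimately show ?thesis using True by (simp add: abs_mult mult_mono)
  qed (simp add: k_supp)
  have int: "integrable lborel (%z. (k z)\<^sup>2 * (G (x - b n * z) - G x))"
  proof (rule Bochner_Integration.integrable_bound[of _ "%z. kB\<^sup>2 * e * indicator {-1..1} z"])
   have "(%z. (k z)\<^sup>2 * ((indicator {0..tauH} (x - b n * z) * lam0 (x - b n * z)) / phi (x - b n * z) - G x)) \<in> borel_measurable lborel"
    using measurable_compose[OF _ lm, of "%z. x - b n * z" lborel] by measurable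
   moreover have "(%z. (k z)\<^sup>2 * ((indicator {0..tauH} (x - b n * z) * lam0 (x - b n * z)) / phi (x - b n * z) - G x)) = (%z. (k z)\<^sup>2 * (G (x - b n * z) - G x))"
   proof
    fix u
    show "(k u)\<^sup>2 * ((indicator {0..tauH} (x - b n * u) * lam0 (x - b n * u)) / phi (x - b n * u) - G x) = (k u)\<^sup>2 * (G (x - b n * u) - G x)"
     using z[of u] k_supp[of u] by (cases "u \<in> {-1..1}") (auto simp: G_def)
   qed
   ultimately show "(%z. (k z)\<^sup>2 * (G (x - b n * z) - G x)) \<in> borel_measurable lborel" by simp
  qed (use close e in \<open>auto intro!: AE_I2 order_trans[OF _ abs_ge_self]\<close>)
  have "(\<integral>z. (k z)\<^sup>2 * G (x - b n * z) \<partial>lborel) = (\<integral>z. (k z)\<^sup>2 * (G (x - b n * z) - G x) + (k z)\<^sup>2 * G x \<partial>lborel)"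
   by (intro Bochner_Integration.integral_cong refl) (simp add: algebra_simps)
  also have "... = (\<integral>z. (k z)\<^sup>2 * (G (x - b n * z) - G x) \<partial>lborel) + (\<integral>z. (k z)\<^sup>2 * G x \<partial>lborel)"
   by (rule Bochner_Integration.integral_add[OF int]) (intro integrable_mult_left k_sq_integrable)
  finally have "?f n - ?l = (\<integral>z. (k z)\<^sup>2 * (G (x - b n * z) - G x) \<partial>lborel)"
   using psi_sq_integral[OF b_pos w] by (simp add: G_def)
  then have "\<bar>?f n - ?l\<bar> <= 2 * (kB\<^sup>2 * e)"
   using real_abs_integral_le_of_support[OF close] e by simp
  also have "... = r * (2 * kB\<^sup>2 / (2 * kB\<^sup>2 + 1))" by (simp add: e_def)
  also have "... < r * 1" using r by (intro mult_strict_left_mono) (simp_all add: pos_divide_less_eq add_nonneg_pos)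
  finally show ?case by simp
 qed
 then show "\<exists>no. \<forall>n\<ge>no. norm (?f n - ?l) < r" by (simp add: eventually_sequentially)
qed

text \<open>A kernel that vanishes almost everywhere could not integrate to 1. The central limit
  theorem needs a positive limiting variance.\<close>

lemma k_sq_integral_pos: "0 < (\<integral>z. (k z)\<^sup>2 \<partial>lborel)"
proof -
 have "(\<integral>z. (k z)\<^sup>2 \<partial>lborel) \<noteq> 0"
 proof
  assume "(\<integral>z. (k z)\<^sup>2 \<partial>lborel) = 0"
  then have "AE z in lborel. (k z)\<^sup>2 = 0"
   using integral_nonneg_eq_0_iff_AE[OF k_sq_integrable] by simp
  then have "(\<integral>z. k z \<partial>lborel) = (\<integral>z. 0 \<partial>(lborel :: real measure))"
   using k_integrable by (intro integral_cong_AE) auto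
  then show False using k_int by simp
 qed
 moreover have "0 <= (\<integral>z. (k z)\<^sup>2 \<partial>lborel)" by (intro Bochner_Integration.integral_nonneg) simp
 ultimately show ?thesis by linarith
qed

lemma H_meas: "(%w. H n w v) \<in> borel_measurable M"
 unfolding H_def by (rule smoothed_measurable[OF smooth_kernel_axioms Y_meas betahat_meas])

text \<open>The scaled error splits into the minorant error, the risk replacement, a centred i.i.d.
  sum and the bias. The first two vanish, the third obeys the triangular central limit theorem, and
  the last converges to the limiting mean.\<close>

theorem asymptotic_normality:
 assumes x: "0 < x" "x < taustar" and cont: "isCont phi x"
 shows "weak_conv_m (%n. distr M borel (%w. rate n * (left_deriv (gcm taustar (H n w)) x - lam0 x)))
  (density lborel (normal_density ((- c) ^ m / fact m * D m x * (\<integral>z. k z * z ^ m \<partial>lborel))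
   (sqrt (lam0 x / (c * phi x) * (\<integral>z. (k z)\<^sup>2 \<partial>lborel)))))"
  (is "weak_conv_m _ (density lborel (normal_density ?\<mu> (sqrt ?s)))")
proof -
 \<comment> \<open>The central limit theorem is stated for all rows, whereas the moments of
   \<open>psi\<close> are known only when the kernel window ends before \<open>tau2\<close>; the
   remaining rows are set to 0.\<close>
 define ok where "ok n \<longleftrightarrow> 0 < n \<and> x + b n <= tau2" for n
 have ok: "LARGE n. ok n"
 proof -
  have "LARGE n. b n < tau2 - x" using x taustar by (intro order_tendstoD(2)[OF b_lim]) auto
  then show ?thesis using eventually_gt_at_top[of 0] by eventually_elim (simp add: ok_def)
 qed
 define \<phi> where "\<phi> n y = (if ok n then rate n / n * (psi (b n) x y - mean (b n) x) else 0)" for n y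
 define B where "B n = rate n / (n * b n) * (2 * kB / \<kappa>)" for n
 have lx: "0 < lam0 x" using lam0_pos[of x] x taustar tau2 by auto
 have px: "0 < phi x" using \<kappa>_le[of x] \<kappa>_pos x taustar by auto
 have s_pos: "0 < ?s" using lx px c_pos k_sq_integral_pos by simp
 show ?thesis
 proof (rule triangular_CLT[where \<phi> = \<phi> and B = B])
  show "\<phi> n \<in> borel_measurable borel" for n unfolding \<phi>_def by measurable
  show "(\<integral>y. \<phi> n y \<partial>P) = 0" for n
  proof (cases "ok n")
   case True
   then have n: "x + b n <= tau2" by (simp add: ok_def)
   have "(\<integral>y. psi (b n) x y - mean (b n) x \<partial>P) = 0"
    using psi_bounds(2)[OF b_pos n] psi_mean(1)[OF b_pos n] by (simp add: obs.prob_space)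
   then show ?thesis using True by (simp add: \<phi>_def)
  qed (simp add: \<phi>_def)
  show "\<bar>\<phi> n y\<bar> <= B n" for n y
  proof (cases "ok n")
   case True
   then have n: "0 < n" "x + b n <= tau2" by (auto simp: ok_def)
   have "\<bar>psi (b n) x y - mean (b n) x\<bar> <= 2 * (kB / (b n * \<kappa>))"
    using psi_bounds(1)[OF b_pos n(2), of y] psi_bounds(3)[OF b_pos n(2)] by linarith
   then have "rate n / n * \<bar>psi (b n) x y - mean (b n) x\<bar> <= rate n / n * (2 * (kB / (b n * \<kappa>)))"
    using rate_pos[OF n(1)] by (intro mult_left_mono) auto
   then show ?thesis using True rate_pos[OF n(1)] by (simp add: \<phi>_def B_def abs_mult mult_ac)
  next
   case False
   have "0 <= rate n" by (simp add: rate_def)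
   then show ?thesis using False kB_nonneg \<kappa>_pos b_pos[of n] by (simp add: \<phi>_def B_def)
  qed
  have "B \<longlonglongrightarrow> 0 * (2 * kB / \<kappa>)" unfolding B_def by (intro tendsto_mult rate_nb tendsto_const)
  then show "B \<longlonglongrightarrow> 0" by simp
  have ml: "(%n. mean (b n) x) \<longlonglongrightarrow> lam0 x"
  proof -
   have "(%n. (mean (b n) x - lam0 x) / b n ^ m * b n ^ m + lam0 x) \<longlonglongrightarrow>
    (- 1) ^ m / fact m * D m x * (\<integral>z. k z * z ^ m \<partial>lborel) * 0 ^ m + lam0 x"
    using x taustar tau2 by (intro tendsto_intros bias_limit b_lim) auto
   then show ?thesis using b_pos m2 by (simp add: power_0_left less_imp_neq[symmetric])
  qed
  \<comment> \<open>The squared mean carries a factor \<open>b n\<close> and drops out, so centring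
    does not affect the limiting variance.\<close>
  have "(%n. (rate n)\<^sup>2 / (n * b n) * (b n * (\<integral>y. (psi (b n) x y)\<^sup>2 \<partial>P) - b n * (mean (b n) x)\<^sup>2)) \<longlonglongrightarrow>
   1 / c * (lam0 x / phi x * (\<integral>z. (k z)\<^sup>2 \<partial>lborel) - 0 * (lam0 x)\<^sup>2)"
   by (intro tendsto_intros rate_sq_lim variance_limit[OF x cont] b_lim ml)
  then have "(%n. (rate n)\<^sup>2 / (n * b n) * (b n * (\<integral>y. (psi (b n) x y)\<^sup>2 \<partial>P) - b n * (mean (b n) x)\<^sup>2)) \<longlonglongrightarrow> ?s"
   by (simp add: mult_ac)
  moreover have "LARGE n. (rate n)\<^sup>2 / (n * b n) * (b n * (\<integral>y. (psi (b n) x y)\<^sup>2 \<partial>P) - b n * (mean (b n) x)\<^sup>2) = n * (\<integral>y. (\<phi> n y)\<^sup>2 \<partial>P)"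
   using ok
  proof eventually_elim
   case (elim n)
   then have n: "0 < n" "x + b n <= tau2" by (auto simp: ok_def)
   define mu where "mu = mean (b n) x"
   define I where "I = (\<integral>y. (psi (b n) x y)\<^sup>2 \<partial>P)"
   have i: "integrable P (psi (b n) x)" "integrable P (%y. (psi (b n) x y)\<^sup>2)"
    using psi_bounds(2)[OF b_pos n(2)] psi_sq(1)[OF b_pos n(2)] by auto
   have e: "(\<phi> n y)\<^sup>2 = (rate n / n)\<^sup>2 * (((psi (b n) x y)\<^sup>2 - 2 * mu * psi (b n) x y) + mu\<^sup>2)" for y
    using elim by (simp only: \<phi>_def if_True power_mult_distrib mu_def) (simp add: power2_diff algebra_simps)
   have "(\<integral>y. (psi (b n) x y)\<^sup>2 - 2 * mu * psi (b n) x y + mu\<^sup>2 \<partial>P) = I - 2 * mu * mu + mu\<^sup>2"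
    using i psi_mean(1)[OF b_pos n(2)]
    by (simp add: Bochner_Integration.integral_add Bochner_Integration.integral_diff I_def mu_def obs.prob_space)
   then have "(\<integral>y. (\<phi> n y)\<^sup>2 \<partial>P) = (rate n / n)\<^sup>2 * (I - 2 * mu * mu + mu\<^sup>2)"
    unfolding e by simp
   then have "(\<integral>y. (\<phi> n y)\<^sup>2 \<partial>P) = (rate n / n)\<^sup>2 * (I - mu\<^sup>2)" by (simp add: power2_eq_square)
   then have "n * (\<integral>y. (\<phi> n y)\<^sup>2 \<partial>P) = (rate n)\<^sup>2 / n * (I - mu\<^sup>2)"
    using n by (simp add: power2_eq_square)
   also have "... = (rate n)\<^sup>2 / (n * b n) * (b n * I - b n * mu\<^sup>2)"
   proof -
    have g: "R / N * (I - J) = R / (N * h) * (h * I - h * J)" if "0 < h" for R N I J h :: real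
     using that by (simp flip: right_diff_distrib)
    show ?thesis by (rule g[OF b_pos])
   qed
   finally show ?case by (simp add: I_def mu_def)
  qed
  ultimately have "(%n. n * (\<integral>y. (\<phi> n y)\<^sup>2 \<partial>P)) \<longlonglongrightarrow> ?s" by (rule Lim_transform_eventually)
  moreover have "(sqrt ?s)\<^sup>2 = ?s" using s_pos by (intro real_sqrt_pow2) simp
  ultimately show "(%n. n * (\<integral>y. (\<phi> n y)\<^sup>2 \<partial>P)) \<longlonglongrightarrow> (sqrt ?s)\<^sup>2" by (simp only:)
  show "0 < sqrt ?s" using s_pos by (simp only: real_sqrt_gt_zero)
  have "(%w. left_deriv (gcm taustar (H n w)) x) \<in> borel_measurable M" for n
   by (rule borel_measurable_left_deriv_gcm) (use H_meas H_cont x in auto)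
  then show "(%w. rate n * (left_deriv (gcm taustar (H n w)) x - lam0 x)) \<in> borel_measurable M" for n by measurable
  fix \<epsilon> :: real assume \<epsilon>: "0 < \<epsilon>"
  define L where "L = Lip + 2 + 2 / a"
  have L: "0 < L" using Lip(1) a_pos by (simp add: L_def add_nonneg_pos)
  have "0 < \<epsilon> / (3 * L)" using \<epsilon> L by simp
  from local_approx[OF x this]
  have w1: "wpo (%n w. \<bar>left_deriv (gcm taustar (H n w)) x - H' n w x\<bar> <= L * (\<epsilon> / (3 * L) / rate n))"
   unfolding L_def .
  have xt: "x < tau2" using x taustar by simp
  obtain SR where SR: "Op SR (%n. 1 / sqrt n)"
   "wpo (%n w. \<forall>v. \<bar>v - x\<bar> <= b n --> \<bar>resid (b n) n w (betahat n w) v\<bar> <= SR n w)"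
   using R_local[OF root_n b_pos b_lim xt] by blast
  have "0 < \<epsilon> / 3" using \<epsilon> by simp
  have w2: "wpo (%n w. SR n w <= (\<epsilon> / 3) / rate n)"
  proof (rule wpo_of_bdd_in_prob[OF SR(1)])
   fix C :: real
   show "LARGE n. C * (1 / sqrt (real n)) <= \<epsilon> / 3 / rate n"
    using small_of_lim_0[OF rate_sqrt_lim \<open>0 < \<epsilon> / 3\<close>, of C] eventually_gt_at_top[of 0]
    by eventually_elim (simp add: pos_le_divide_eq rate_pos mult_ac)
  qed
  have "(%n. rate n * b n ^ m * ((mean (b n) x - lam0 x) / b n ^ m)) \<longlonglongrightarrow> c ^ m * ((- 1) ^ m / fact m * D m x * (\<integral>z. k z * z ^ m \<partial>lborel))"
   using x taustar tau2 by (intro tendsto_mult rate_b_pow_lim bias_limit) auto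
  moreover have "c ^ m * ((- 1) ^ m / fact m * D m x * (\<integral>z. k z * z ^ m \<partial>lborel)) = ?\<mu>"
   by (simp add: power_minus[of c])
  moreover have "rate n * b n ^ m * ((mean (b n) x - lam0 x) / b n ^ m) = rate n * (mean (b n) x - lam0 x)" for n
   using b_pos[of n] by simp
  ultimately have "(%n. rate n * (mean (b n) x - lam0 x)) \<longlonglongrightarrow> ?\<mu>" by (simp only:)
  from tendstoD[OF this \<open>0 < \<epsilon> / 3\<close>]
  have ev: "LARGE n. \<bar>rate n * (mean (b n) x - lam0 x) - ?\<mu>\<bar> < \<epsilon> / 3" by (simp only: dist_real_def)
  have "LARGE n. \<forall>w\<in>space M.
   \<bar>left_deriv (gcm taustar (H n w)) x - H' n w x\<bar> <= L * (\<epsilon> / (3 * L) / rate n) \<and>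
   (\<forall>v. \<bar>v - x\<bar> <= b n --> \<bar>resid (b n) n w (betahat n w) v\<bar> <= SR n w) \<and>
   SR n w <= (\<epsilon> / 3) / rate n -->
   \<bar>rate n * (left_deriv (gcm taustar (H n w)) x - lam0 x) - (?\<mu> + (\<Sum>i<n. \<phi> n (Y i w)))\<bar> <= \<epsilon>"
   using ev ok
  proof eventually_elim
   case (elim n)
   then have n: "0 < n" by (simp add: ok_def)
   have rp: "0 < rate n" by (rule rate_pos[OF n])
   show ?case
   proof (intro ballI impI, elim conjE)
    fix w
    assume 1: "\<bar>left_deriv (gcm taustar (H n w)) x - H' n w x\<bar> <= L * (\<epsilon> / (3 * L) / rate n)"
     and R: "\<forall>v. \<bar>v - x\<bar> <= b n --> \<bar>resid (b n) n w (betahat n w) v\<bar> <= SR n w"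
     and S: "SR n w <= (\<epsilon> / 3) / rate n"
    define G where "G = left_deriv (gcm taustar (H n w)) x"
    have "L * (\<epsilon> / (3 * L) / rate n) = (\<epsilon> / 3) / rate n" using L by simp
    then have "\<bar>G - H' n w x\<bar> * rate n <= \<epsilon> / 3" using 1 rp by (simp add: G_def pos_le_divide_eq)
    then have g1: "\<bar>rate n * (G - H' n w x)\<bar> <= \<epsilon> / 3" using rp by (simp add: abs_mult mult.commute)
    have "\<bar>H' n w x - emp n (psi (b n) x) (ys w)\<bar> <= (\<epsilon> / 3) / rate n"
     using R[rule_format, of x] b_pos[of n] S by (simp add: H'_def)
    then have "\<bar>H' n w x - emp n (psi (b n) x) (ys w)\<bar> * rate n <= \<epsilon> / 3" using rp by (simp add: pos_le_divide_eq)
    then have g2: "\<bar>rate n * (H' n w x - emp n (psi (b n) x) (ys w))\<bar> <= \<epsilon> / 3" using rp by (simp add: abs_mult mult.commute)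
    have "(\<Sum>i<n. \<phi> n (Y i w)) = rate n / n * (\<Sum>i<n. psi (b n) x (Y i w) - mean (b n) x)"
     using elim(2) by (simp only: \<phi>_def if_True sum_distrib_left)
    also have "... = rate n * (emp n (psi (b n) x) (ys w) - mean (b n) x)"
     using n by (simp add: sum_subtractf emp_def field_simps)
    finally have g3: "(\<Sum>i<n. \<phi> n (Y i w)) = rate n * (emp n (psi (b n) x) (ys w) - mean (b n) x)" .
    have "rate n * (G - lam0 x) - (?\<mu> + (\<Sum>i<n. \<phi> n (Y i w))) =
     rate n * (G - H' n w x) + rate n * (H' n w x - emp n (psi (b n) x) (ys w)) + (rate n * (mean (b n) x - lam0 x) - ?\<mu>)"
     unfolding g3 by (simp add: algebra_simps)
    then show "\<bar>rate n * (left_deriv (gcm taustar (H n w)) x - lam0 x) - (?\<mu> + (\<Sum>i<n. \<phi> n (Y i w)))\<bar> <= \<epsilon>"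
     using g1 g2 elim(1) unfolding G_def[symmetric] by linarith
   qed
  qed
  from wpo_eventually_mp[OF wpo_conj[OF w1 wpo_conj[OF SR(2) w2]] this]
  show "wpo (%n w. \<bar>rate n * (left_deriv (gcm taustar (H n w)) x - lam0 x) - (?\<mu> + (\<Sum>i<n. \<phi> n (Y i w)))\<bar> <= \<epsilon>)" .
 qed
qed

theorem uniform_consistency:
 assumes lu: "0 < l" "l < u" "u < taustar"
 shows "\<forall>n. (%w. SUP y\<in>{l..u}. \<bar>left_deriv (gcm taustar (H n w)) y - lam0 y\<bar>) \<in> borel_measurable M"
  and "big_Op M (%n w. SUP y\<in>{l..u}. \<bar>left_deriv (gcm taustar (H n w)) y - lam0 y\<bar>) (%n. 1 / (b n * sqrt n))"
proof -
 let ?R = "%n w. SUP y\<in>{l..u}. \<bar>left_deriv (gcm taustar (H n w)) y - lam0 y\<bar>"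
 have fc: "continuous_on {l..u} lam0"
  by (rule continuous_on_subset[OF obs.lam0_cont]) (use lu taustar tau2 in auto)
 show meas: "\<forall>n. ?R n \<in> borel_measurable M"
  using borel_measurable_SUP_left_deriv_gcm(1)[OF H_meas H_cont lu fc] by simp
 have bdd: "bdd_above ((%y. \<bar>left_deriv (gcm taustar (H n w)) y - lam0 y\<bar>) ` {l..u})" if "w \<in> space M" for n w
  using borel_measurable_SUP_left_deriv_gcm(2)[OF H_meas H_cont lu fc that] .
 obtain S where S: "Op S (%n. 1 / (b n * sqrt n))"
  "wpo (%n w. \<forall>y\<in>{l..u}. \<bar>left_deriv (gcm taustar (H n w)) y - lam0 y\<bar> <= S n w)"
  using uniform_rate[OF lu] by blast
 have "wpo (%n w. ?R n w <= S n w)"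
  by (rule wpo_mono[OF S(2)]) (use lu in \<open>auto intro!: cSUP_least\<close>)
 from bdd_in_prob_mono[OF S(1) this] have Rb: "Op ?R (%n. 1 / (b n * sqrt n))" .
 show "big_Op M ?R (%n. 1 / (b n * sqrt n))"
  unfolding big_Op_def
 proof (intro conjI meas allI impI)
  fix \<epsilon> :: real assume \<epsilon>: "0 < \<epsilon>"
  then have "0 < \<epsilon> / 2" by simp
  then obtain C where C: "LARGE n. \<exists>A\<in>sets M. prob A >= 1 - \<epsilon> / 2 \<and> (\<forall>w\<in>A. ?R n w <= C * (1 / (b n * sqrt n)))"
   using Rb unfolding bdd_in_prob_def by blast
  have "LARGE n. measure M {w \<in> space M. \<bar>?R n w\<bar> > C * \<bar>1 / (b n * sqrt n)\<bar>} < \<epsilon>"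
   using C
  proof eventually_elim
   case (elim n)
   then obtain A where A: "A \<in> sets M" "prob A >= 1 - \<epsilon> / 2" "\<forall>w\<in>A. ?R n w <= C * (1 / (b n * sqrt n))" by blast
   have R0: "0 <= ?R n w" if "w \<in> space M" for w
    using cSUP_upper2[OF bdd[OF that, of n], of l 0] lu by auto
   have an: "\<bar>1 / (b n * sqrt n)\<bar> = 1 / (b n * sqrt n)" using b_pos[of n] by simp
   have "{w \<in> space M. \<bar>?R n w\<bar> > C * \<bar>1 / (b n * sqrt n)\<bar>} \<subseteq> space M - A"
   proof
    fix w assume "w \<in> {w \<in> space M. \<bar>?R n w\<bar> > C * \<bar>1 / (b n * sqrt n)\<bar>}"
    then have w: "w \<in> space M" "C * (1 / (b n * sqrt n)) < ?R n w" unfolding an using R0[of w] by simp_all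
    then have "w \<notin> A" using A(3) by fastforce
    then show "w \<in> space M - A" using w by simp
   qed
   then have "measure M {w \<in> space M. \<bar>?R n w\<bar> > C * \<bar>1 / (b n * sqrt n)\<bar>} <= prob (space M - A)"
    using A(1) by (intro finite_measure_mono) auto
   also have "... = 1 - prob A" by (rule prob_compl[OF A(1)])
   also have "... < \<epsilon>" using A(2) \<epsilon> by linarith
   finally show ?case .
  qed
  then show "\<exists>K. LARGE n. measure M {w \<in> space M. \<bar>?R n w\<bar> > K * \<bar>1 / (b n * sqrt n)\<bar>} < \<epsilon>" ..
 qed
qed

end

section \<open>Iterated derivatives, slopes, and the passage from the Cox model to the abstract
  setting\<close>

lemma deriv_funpow_eq:
  fixes D :: "nat \<Rightarrow> real \<Rightarrow> real"
  assumes "D 0 = f" "\<And>j t. j < m \<Longrightarrow> t \<in> {0..\<tau>} \<Longrightarrow> (D j has_real_derivative D (Suc j) t) (at t within {0..\<tau>})"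
    and "j \<le> m" "t \<in> {0<..<\<tau>}"
  shows "(deriv ^^ j) f t = D j t"
  using assms(3,4)
proof (induction j arbitrary: t)
  case (Suc j)
  have "(D j has_real_derivative D (Suc j) t) (at t)"
    using assms(2)[of j t] Suc.prems by (simp add: at_within_Icc_at)
  \<comment> \<open>The induction hypothesis holds on an open interval and can therefore be
    differentiated once more.\<close>
  then have "((deriv ^^ j) f has_real_derivative D (Suc j) t) (at t)"
    by (rule has_field_derivative_transform_within_open[of _ _ _ "{0<..<\<tau>}"]) (use Suc in auto)
  then show ?case by (simp add: DERIV_imp_deriv)
qed (simp add: assms(1))

lemma slope_of_derivative_bound:
  fixes f :: "real \<Rightarrow> real"
  assumes cont: "continuous_on {0..\<tau>} f"
    and deriv: "\<And>t. t \<in> {0..\<tau>} \<Longrightarrow> \<exists>D\<ge>a. (f has_real_derivative D) (at t within {0..\<tau>})"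
    and st: "0 \<le> s" "s \<le> t" "t \<le> \<tau>"
  shows "a * (t - s) \<le> f t - f s"
proof (cases "s = t")
  case False
  then have lt: "s < t" using st by simp
  have d: "\<exists>D\<ge>a. (f has_real_derivative D) (at z)" if "s < z" "z < t" for z
    using deriv[of z] that st by (simp add: at_within_Icc_at)
  have "continuous_on {s..t} f" by (rule continuous_on_subset[OF cont]) (use st in auto)
  moreover have "f differentiable (at z)" if "s < z" "z < t" for z
    using d[OF that] by (auto simp: real_differentiable_def)
  ultimately obtain l z where z: "s < z" "z < t" "(f has_real_derivative l) (at z)" "f t - f s = (t - s) * l"
    using MVT[OF lt] by blast
  have "a \<le> l" using d[OF z(1,2)] DERIV_unique[OF z(3)] by blast
  then show ?thesis using z(4) lt by (simp add: mult.commute)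
qed simp

theorem theorem4p3:
  fixes N :: "'a measure" and X C :: "'a \<Rightarrow> real" and Z :: "'a \<Rightarrow> real ^ 'p"
    and f g :: "real ^ 'p \<Rightarrow> real \<Rightarrow> real" and lam0 :: "real \<Rightarrow> real" and beta0 :: "real ^ 'p"
    and M :: "'w measure" and Y :: "nat \<Rightarrow> 'w \<Rightarrow> ('p::finite) obs" and betahat :: "nat \<Rightarrow> 'w \<Rightarrow> real ^ 'p"
    and k :: "real \<Rightarrow> real" and b :: "nat \<Rightarrow> real" and m :: nat
    and c x tauH taustar \<mu> \<sigma>2 :: real
    and lamGS :: "nat \<Rightarrow> 'w \<Rightarrow> real \<Rightarrow> real"
  defines "P \<equiv> obs_law N X C Z"
    and "Pn \<equiv> \<lambda>n w. empirical n (\<lambda>i. Y i w)"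
  assumes model: "cox_model N X C Z f g lam0 beta0"
    and sample_space: "prob_space M"
    and sample_indep: "prob_space.indep_vars M (\<lambda>_. borel) Y UNIV"
    and sample_law: "\<And>i. distr M borel (Y i) = P"
    and betahat_rv: "\<And>n. betahat n \<in> borel_measurable M"
    and betahat_mple: "with_prob_to_one M (\<lambda>n w. is_mple n (\<lambda>i. Y i w) (betahat n w))"
    and tauH: "right_endpoint (distr N borel (\<lambda>w. min (X w) (C w))) = ereal tauH"
    and tauG: "right_endpoint (distr N borel C) = ereal tauH"
    and tauF: "ereal tauH < right_endpoint (distr N borel X)"
    and moment: "\<exists>\<epsilon>>0. (SUP \<beta>\<in>cball beta0 \<epsilon>.
          \<integral>\<^sup>+ w. ennreal ((norm (Z w))\<^sup>2 * exp (2 * (\<beta> \<bullet> Z w))) \<partial>N) < \<infinity>"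
    and x: "x \<in> {0<..<tauH}"
    and taustar: "taustar \<in> {x<..<tauH}"
    and m: "m \<ge> 2"
    and lam0_smooth: "cont_diff_on m {0..tauH} lam0"
    and lam0_deriv: "\<exists>a>0. \<forall>t\<in>{0..tauH}. \<exists>D\<ge>a. (lam0 has_real_derivative D) (at t within {0..tauH})"
    and Phi_cont: "\<exists>e>0. continuous_on (ball x e) (\<lambda>t. Phi P t beta0)"
    and k_orth: "orthogonal_kernel m k"
    and k_supp: "\<And>u. u \<notin> {-1..1} \<Longrightarrow> k u = 0"
    and k_int: "(\<integral>y\<in>{-1..1}. k y \<partial>lborel) = 1"
    and k_diff: "\<And>u. k differentiable at u"
    and k_diff2: "\<And>u. deriv k differentiable at u"
    and k_deriv_bdd: "bounded (range (deriv k))"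
    and b_pos: "\<And>n. b n > 0"
    and b_lim: "b \<longlonglongrightarrow> 0"
    and nb_lim: "filterlim (\<lambda>n. real n * b n) at_top sequentially"
    and c_pos: "c > 0"
    and b_rate: "(\<lambda>n. real n powr (1 / (2 * real m + 1)) * b n) \<longlonglongrightarrow> c"
  defines "lamGS \<equiv> \<lambda>n w. iso_smoothed_breslow k (b n) taustar (Pn n w) (betahat n w)"
    and "\<mu> \<equiv> (- c) ^ m / fact m * (deriv ^^ m) lam0 x * (\<integral>y\<in>{-1..1}. k y * y ^ m \<partial>lborel)"
    and "\<sigma>2 \<equiv> lam0 x / (c * Phi P x beta0) * (\<integral>y\<in>{-1..1}. (k y)\<^sup>2 \<partial>lborel)"
  shows "(\<forall>l u. 0 < l \<and> l < u \<and> u < taustar \<longrightarrow>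
            (\<exists>r R. r \<in> O(\<lambda>n. b n ^ m) \<and>
               big_Op M R (\<lambda>n. 1 / (b n * sqrt (real n))) \<and>
               (\<forall>n. \<forall>w\<in>space M. (SUP y\<in>{l..u}. \<bar>lamGS n w y - lam0 y\<bar>) = r n + R n w))) \<and>
         conv_in_distribution M
           (\<lambda>n w. real n powr (real m / (2 * real m + 1)) * (lamGS n w x - lam0 x))
           (density lborel (normal_density \<mu> (sqrt \<sigma>2)))"
proof -
  interpret model: cox_model N X C Z f g lam0 beta0 by (rule model)
  have x': "0 < x" "x < tauH" "x < taustar" "taustar < tauH" using x taustar by auto
  obtain D where D: "D 0 = lam0" "\<And>j t. j < m \<Longrightarrow> t \<in> {0..tauH} \<Longrightarrow> (D j has_real_derivative D (Suc j) t) (at t within {0..tauH})"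
    "continuous_on {0..tauH} (D m)"
    using lam0_smooth unfolding cont_diff_on_def by blast
  have lam0_cont: "continuous_on {0..tauH} lam0"
    using DERIV_continuous_on[OF D(2)[of 0]] D(1) m by auto
  have obs: "cox_observation P lam0 beta0 tauH"
    unfolding P_def using x' by (intro model.cox_observation_obs_law[OF tauH tauF moment lam0_cont]) simp
  obtain a where a: "0 < a" "\<And>t. t \<in> {0..tauH} \<Longrightarrow> \<exists>D\<ge>a. (lam0 has_real_derivative D) (at t within {0..tauH})"
    using lam0_deriv by blast
  have slope: "a * (t - s) \<le> lam0 t - lam0 s" if "0 \<le> s" "s \<le> t" "t \<le> tauH" for s t
    by (rule slope_of_derivative_bound[OF lam0_cont a(2) that])
  have k_deriv: "(k has_real_derivative deriv k u) (at u)" for u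
    using k_diff by (simp add: DERIV_deriv_iff_real_differentiable)
  have k'_cont: "continuous_on UNIV (deriv k)"
    using k_diff2 by (intro continuous_at_imp_continuous_on ballI differentiable_imp_continuous_within)
  obtain B1 where B1: "\<And>u. \<bar>deriv k u\<bar> \<le> B1" using k_deriv_bdd unfolding bounded_iff by auto
  have k_cont: "continuous_on S k" for S
    by (rule DERIV_continuous_on) (rule has_field_derivative_at_within[OF k_deriv])
  \<comment> \<open>Boundedness of the kernel follows from continuity on its compact
    support.\<close>
  obtain B2 where B2: "\<forall>u\<in>{-1..1}. \<bar>k u\<bar> \<le> B2" using continuous_on_interval_bounded[OF k_cont] by blast
  have B2': "\<bar>k u\<bar> \<le> max 0 B2" for u
    using B2 k_supp[of u] by (cases "u \<in> {-1..1}") (auto intro: order_trans[OF _ max.cobounded2])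
  have on_support: "(\<integral>y\<in>{-1..1}. k y * h y \<partial>lborel) = (\<integral>y. k y * h y \<partial>lborel)" for h
    unfolding set_lebesgue_integral_def
  proof (rule Bochner_Integration.integral_cong[OF refl])
    show "indicator {-1..1} y *\<^sub>R (k y * h y) = k y * h y" for y
      using k_supp[of y] by (cases "y \<in> {-1..1}") simp_all
  qed
  interpret smooth_kernel k "deriv k" "max B1 (max 0 B2)"
  proof
    show "\<bar>k u\<bar> \<le> max B1 (max 0 B2)" for u using B2'[of u] by (rule order_trans) simp
    show "\<bar>deriv k u\<bar> \<le> max B1 (max 0 B2)" for u using B1[of u] by (rule order_trans) simp
    show "(\<integral>u. k u \<partial>lborel) = 1" using k_int on_support[of "\<lambda>_. 1"] by simp
  qed (use k_supp k_deriv k'_cont in auto)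
  interpret sample: iid_sample M Y P
    using sample_space sample_indep sample_law by (simp add: iid_sample_def iid_sample_axioms_def)
  interpret obs: cox_observation P lam0 beta0 tauH by (rule obs)
  interpret cox_sample M Y P lam0 beta0 tauH ..
  \<comment> \<open>The maximizing property of \<open>betahat\<close> enters here; afterwards only
    its rate and its measurability matter.\<close>
  have "bdd_in_prob M (\<lambda>n w. norm (betahat n w - beta0)) (\<lambda>n. 1 / sqrt n)"
  proof (rule mple_root_n)
    show "0 < lam0 s" if "s \<in> {0<..tauH}" for s
      using slope[of 0 s] obs.lam0_nonneg[of 0] obs.tauH_pos mult_pos_pos[OF a(1), of s] that by force
  qed (rule betahat_mple)
  \<comment> \<open>The midpoint plays the role of \<open>tau2\<close>: above
    \<open>taustar\<close>, so that kernel windows eventually fit, and below \<open>tauH\<close>,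
    where the risk is still positive.\<close>
  then interpret cox_isotonic M Y P lam0 beta0 tauH k "deriv k" "max B1 (max 0 B2)" "(taustar + tauH) / 2" betahat b m c a taustar D
  proof unfold_locales
    fix j assume "1 \<le> j" "j < m"
    then have "has_bochner_integral lborel (\<lambda>u. k u * u ^ j) 0" using k_orth by (auto simp: orthogonal_kernel_def)
    then show "(\<integral>u. k u * u ^ j \<partial>lborel) = 0" by (rule has_bochner_integral_integral_eq)
  qed (use D m a slope x' b_pos b_lim c_pos b_rate betahat_rv in auto)
  have lamGS: "lamGS n w = left_deriv (gcm taustar (H n w))" for n w
    unfolding lamGS_def Pn_def H_def by (rule iso_smoothed_breslow_eq[OF b_pos])
  have cont: "isCont phi x"
  proof -
    obtain e where "0 < e" "continuous_on (ball x e) phi" using Phi_cont by (auto simp: phi_def[abs_def])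
    then show ?thesis by (simp add: continuous_on_eq_continuous_at)
  qed
  have Dx: "(deriv ^^ m) lam0 x = D m x"
    using x' by (intro deriv_funpow_eq[where D = D and m = m, OF D(1,2)]) auto
  have \<mu>: "\<mu> = (- c) ^ m / fact m * D m x * (\<integral>z. k z * z ^ m \<partial>lborel)"
    unfolding \<mu>_def Dx on_support ..
  have \<sigma>2: "\<sigma>2 = lam0 x / (c * phi x) * (\<integral>z. (k z)\<^sup>2 \<partial>lborel)"
    unfolding \<sigma>2_def phi_def power2_eq_square on_support ..
  show ?thesis
  proof (intro conjI allI impI, elim conjE)
    fix l u assume lu: "0 < l" "l < u" "u < taustar"
    \<comment> \<open>The deterministic part is taken to be 0: for this bandwidth the bias is
      dominated by 1/(b sqrt n) and already contained in the stochastic part.\<close>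
    show "\<exists>r R. r \<in> O(\<lambda>n. b n ^ m) \<and> big_Op M R (\<lambda>n. 1 / (b n * sqrt (real n))) \<and>
      (\<forall>n. \<forall>w\<in>space M. (SUP y\<in>{l..u}. \<bar>lamGS n w y - lam0 y\<bar>) = r n + R n w)"
      using uniform_consistency(2)[OF lu] unfolding lamGS
      by (intro exI[of _ "\<lambda>_. 0"] exI[of _ "\<lambda>n w. SUP y\<in>{l..u}. \<bar>left_deriv (gcm taustar (H n w)) y - lam0 y\<bar>"]) simp
  next
    have "(\<lambda>w. left_deriv (gcm taustar (H n w)) x) \<in> borel_measurable M" for n
      by (rule borel_measurable_left_deriv_gcm) (use H_meas H_cont x' in auto)
    then show "conv_in_distribution M
           (\<lambda>n w. real n powr (real m / (2 * real m + 1)) * (lamGS n w x - lam0 x))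
           (density lborel (normal_density \<mu> (sqrt \<sigma>2)))"
      using asymptotic_normality[OF x'(1,3) cont]
      unfolding conv_in_distribution_def lamGS \<mu> \<sigma>2 rate_def by simp
  qed
qed

end
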